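(* For each $k=1,2,3,4$: (1) the category of sober étale topological categories and their morphisms of type $k$ is dually equivalent to the category of spatial complete restriction monoids and their morphisms of type $k$; (2) the category of spectral (resp. strongly spectral) étale topological categories and their coherent morphisms of type $k$ is dually equivalent to the category of coherent (resp. strongly coherent) complete restriction monoids and their coherent morphisms of type $k$.
   Context: **Complete restriction monoids.** An Ehresmann semigroup is a semigroup $S$ with a non-empty set $E$ of idempotents (the projections) and maps $\lambda,\rho:S\to E$ such that: $E$ is a commutative subsemigroup; $\lambda(a)=\rho(a)=a$ for $a\in E$; $a\lambda(a)=a$ and $\rho(a)a=a$; $\lambda(\lambda(a)b)=\lambda(ab)$ and $\rho(a\rho(b))=\rho(ab)$. It is a restriction semigroup if moreover $fa=a\lambda(fa)$ and $af=\rho(af)a$ for all $a\in S$, $f\in E$. Natural partial order: $a\le b$ iff $a=gb=bf$ for some $f,g\in E$. If $S$ is a monoid with identity $e$, then $E=e^{\downarrow}=\{x:x\le e\}$. Elements $a,b$ are compatible if $a\lambda(b)=b\lambda(a)$ and $\rho(b)a=\rho(a)b$; a non-empty subset is compatible if any two of its elements are compatible. A complete restriction monoid is a restriction semigroup that is a monoid, such that $E$ is a frame and $S$ has joins of all non-empty compatible subsets. Let $\mathcal L^{\vee}(S)$ be the set of order ideals $A\subseteq S$ such that $\bigvee X\in A$ for every (non-empty) compatible $X\subseteq A$, ordered by inclusion; it is a frame. A morphism $\varphi:S\to T$ is a semigroup homomorphism commuting with $\lambda,\rho$ whose restriction to projections is a frame morphism $E_S\to E_T$. It is proper if every $t\in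 T$ is $t=\bigvee X$ for some $X\subseteq T$ such that for each $x\in X$ there is $s\in S$ with $\varphi(s)\ge x$; a $\wedge$-morphism if it preserves binary meets. Types: 1 morphisms; 2 proper morphisms; 3 $\wedge$-morphisms; 4 proper $\wedge$-morphisms. An element $a$ of a frame is finite if $a=\bigvee M$ implies $a=\bigvee F$ for some finite $F\subseteq M$. A frame (locale) is coherent if every element is a join of finite elements and the meet of any two finite elements is finite (the top need not be finite). A frame $L$ is spatial if $a\mapsto\{p:p(a)=1\}$, with $p$ ranging over frame maps $L\to\{0,1\}$, is injective. $S$ is spatial if the frames $e^{\downarrow}$ and $\mathcal L^{\vee}(S)$ are spatial; coherent if $e^{\downarrow}$ is coherent; strongly coherent if $\mathcal L^{\vee}(S)$ is coherent. A morphism is coherent if it maps finite projections (finite elements of $e^{\downarrow}$) to finite projections. **Étale topological categories.** A topological category $C=(C_1,C_0,u,d,r,m)$ is an internal category in topological spaces ($u$ unit, $d$ domain, $r$ codomain, $m$ defined on $C_1\times_{C_0}C_1=\{(a,b):d(a)=r(b)\}$). It is étale if $d,r$ are local homeomorphisms and $u,m$ are open. A relational covering morphism $f=(f_1,f_0):C\to D$ consists of a continuous $f_0:C_0\to D_0$ and a function $f_1:C_1\to\mathcal P(D_1)$ (power set) such that: (RM1) $b\in f_1(a)$ implies $d(b)=f_0d(a)$ and $r(b)=f_0r(a)$; (RM2) if $(a,b)\in C_1\times_{C_0}C_1$, $(s,t)\in D_1\times_{D_0}D_1$, $s\in f_1(a)$, $t\in f_1(b)$, then $st\in f_1(ab)$;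 (RM3) if $d(a)=d(b)$ or $r(a)=r(b)$, and $f_1(a)\cap f_1(b)\ne\varnothing$, then $a=b$; (RM4) if $p=f_0(q)$ and $d(s)=p$ (resp. $r(s)=p$) with $q\in C_0$, $s\in D_1$, there is $t\in C_1$ with $d(t)=q$ (resp. $r(t)=q$) and $s\in f_1(t)$; (RM5) $\{x\in C_1:f_1(x)\cap A\ne\varnothing\}$ is open for every open $A\subseteq D_1$; (RM6) $uf_0(t)\in f_1u(t)$ for $t\in C_0$. Composition: $(gf)_1(a)=\bigcup_{b\in f_1(a)}g_1(b)$, $(gf)_0=g_0f_0$. Types: 1 all relational covering morphisms; 2 those with $|f_1(c)|\ge1$ for all $c$; 3 those with $|f_1(c)|\le1$; 4 those with $|f_1(c)|=1$. $C$ is sober if $C_0$ and $C_1$ are sober spaces. A space is spectral if it is sober and has a basis of compact-open sets closed under finite non-empty intersections (it need not be compact). $C$ is spectral if $C_0$ is spectral and strongly spectral if $C_1$ is spectral (strongly spectral implies spectral). A relational covering morphism $f$ is coherent if $f_0^{-1}$ maps compact-open sets to compact-open sets.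
   Formalization: Complete restriction monoids are also required to have a join of the empty set, i.e. a least element (zero); with joins of non-empty compatible subsets only, every monoid with E = {1} would qualify and the duality would fail. *)

theory Defs
  imports "HOL-Analysis.Analysis" "HOL-Algebra.Complete_Lattice" "HOL-Algebra.Group"
begin

section \<open>Frames\<close>

definition frame :: "('a, 'm) gorder_scheme \<Rightarrow> bool" where
  "frame L \<longleftrightarrow> complete_lattice L \<and>
     (\<forall>x\<in>carrier L. \<forall>A\<subseteq>carrier L.
        x \<sqinter>\<^bsub>L\<^esub> (\<Squnion>\<^bsub>L\<^esub>A) = \<Squnion>\<^bsub>L\<^esub>((\<lambda>a. x \<sqinter>\<^bsub>L\<^esub> a) ` A))"

definition frame_hom :: "('a, 'm) gorder_scheme \<Rightarrow> ('b, 'n) gorder_scheme \<Rightarrow> ('a \<Rightarrow> 'b) \<Rightarrow> bool" where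
  "frame_hom L M h \<longleftrightarrow> h \<in> carrier L \<rightarrow> carrier M \<and>
     h \<top>\<^bsub>L\<^esub> = \<top>\<^bsub>M\<^esub> \<and>
     (\<forall>x\<in>carrier L. \<forall>y\<in>carrier L. h (x \<sqinter>\<^bsub>L\<^esub> y) = h x \<sqinter>\<^bsub>M\<^esub> h y) \<and>
     (\<forall>A\<subseteq>carrier L. h (\<Squnion>\<^bsub>L\<^esub>A) = \<Squnion>\<^bsub>M\<^esub>(h ` A))"

text \<open>The two-element frame; its top is \<^term>\<open>True\<close>.\<close>

definition two_frame :: "bool gorder" where
  "two_frame = \<lparr>carrier = UNIV, eq = (=), le = (\<le>)\<rparr>"

definition spatial_frame :: "('a, 'm) gorder_scheme \<Rightarrow> bool" where
  "spatial_frame L \<longleftrightarrow> inj_on (\<lambda>a. {p. frame_hom L two_frame p \<and> p a}) (carrier L)"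

definition finite_elem :: "('a, 'm) gorder_scheme \<Rightarrow> 'a \<Rightarrow> bool" where
  "finite_elem L a \<longleftrightarrow> a \<in> carrier L \<and>
     (\<forall>M\<subseteq>carrier L. a = \<Squnion>\<^bsub>L\<^esub>M \<longrightarrow> (\<exists>F\<subseteq>M. finite F \<and> a = \<Squnion>\<^bsub>L\<^esub>F))"

definition coherent_frame :: "('a, 'm) gorder_scheme \<Rightarrow> bool" where
  "coherent_frame L \<longleftrightarrow>
     (\<forall>a\<in>carrier L. \<exists>M. (\<forall>x\<in>M. finite_elem L x) \<and> a = \<Squnion>\<^bsub>L\<^esub>M) \<and>
     (\<forall>a b. finite_elem L a \<and> finite_elem L b \<longrightarrow> finite_elem L (a \<sqinter>\<^bsub>L\<^esub> b))"

section \<open>Complete restriction monoids\<close>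

record 'a rmonoid = "'a monoid" +
  proj :: "'a set"
  lam :: "'a \<Rightarrow> 'a"
  rho :: "'a \<Rightarrow> 'a"

definition ehresmann_monoid :: "'a rmonoid \<Rightarrow> bool" where
  "ehresmann_monoid S \<longleftrightarrow> monoid S \<and>
     proj S \<subseteq> carrier S \<and> proj S \<noteq> {} \<and>
     (\<forall>f\<in>proj S. f \<otimes>\<^bsub>S\<^esub> f = f) \<and>
     (\<forall>f\<in>proj S. \<forall>g\<in>proj S. f \<otimes>\<^bsub>S\<^esub> g \<in> proj S \<and> f \<otimes>\<^bsub>S\<^esub> g = g \<otimes>\<^bsub>S\<^esub> f) \<and>
     lam S \<in> carrier S \<rightarrow> proj S \<and> rho S \<in> carrier S \<rightarrow> proj S \<and>
     (\<forall>f\<in>proj S. lam S f = f \<and> rho S f = f) \<and>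
     (\<forall>a\<in>carrier S. a \<otimes>\<^bsub>S\<^esub> lam S a = a \<and> rho S a \<otimes>\<^bsub>S\<^esub> a = a) \<and>
     (\<forall>a\<in>carrier S. \<forall>b\<in>carrier S.
        lam S (lam S a \<otimes>\<^bsub>S\<^esub> b) = lam S (a \<otimes>\<^bsub>S\<^esub> b) \<and>
        rho S (a \<otimes>\<^bsub>S\<^esub> rho S b) = rho S (a \<otimes>\<^bsub>S\<^esub> b))"

definition restriction_monoid :: "'a rmonoid \<Rightarrow> bool" where
  "restriction_monoid S \<longleftrightarrow> ehresmann_monoid S \<and>
     (\<forall>a\<in>carrier S. \<forall>f\<in>proj S.
        f \<otimes>\<^bsub>S\<^esub> a = a \<otimes>\<^bsub>S\<^esub> lam S (f \<otimes>\<^bsub>S\<^esub> a) \<and>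
        a \<otimes>\<^bsub>S\<^esub> f = rho S (a \<otimes>\<^bsub>S\<^esub> f) \<otimes>\<^bsub>S\<^esub> a)"

definition nat_le :: "'a rmonoid \<Rightarrow> 'a \<Rightarrow> 'a \<Rightarrow> bool" where
  "nat_le S a b \<longleftrightarrow> (\<exists>f\<in>proj S. \<exists>g\<in>proj S. a = g \<otimes>\<^bsub>S\<^esub> b \<and> a = b \<otimes>\<^bsub>S\<^esub> f)"

definition nat_order :: "'a rmonoid \<Rightarrow> 'a gorder" where
  "nat_order S = \<lparr>carrier = carrier S, eq = (=), le = nat_le S\<rparr>"

text \<open>In a monoid the projections are exactly the elements below the identity.\<close>

definition proj_order :: "'a rmonoid \<Rightarrow> 'a gorder" where
  "proj_order S = \<lparr>carrier = proj S, eq = (=), le = nat_le S\<rparr>"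

definition compatible :: "'a rmonoid \<Rightarrow> 'a set \<Rightarrow> bool" where
  "compatible S X \<longleftrightarrow> (\<forall>a\<in>X. \<forall>b\<in>X.
     a \<otimes>\<^bsub>S\<^esub> lam S b = b \<otimes>\<^bsub>S\<^esub> lam S a \<and> rho S b \<otimes>\<^bsub>S\<^esub> a = rho S a \<otimes>\<^bsub>S\<^esub> b)"

text \<open>
  The empty set counts as compatible here, so that \<open>S\<close> has a least element. It is then the bottom
  projection, and it is a zero of \<open>S\<close>. If only non-empty compatible sets had joins, every monoid
  whose only projection is the identity would be complete, and the duality would fail.
\<close>

definition complete_rmonoid :: "'a rmonoid \<Rightarrow> bool" where
  "complete_rmonoid S \<longleftrightarrow> restriction_monoid S \<and> frame (proj_order S) \<and>
     (\<forall>X\<subseteq>carrier S. compatible S X \<longrightarrow> (\<exists>x. is_lub (nat_order S) x X))"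

text \<open>The frame \<open>\<L>\<^sup>\<or>(S)\<close>. Order ideals are non-empty, so the bottom element is the zero ideal.\<close>

definition closed_ideals :: "'a rmonoid \<Rightarrow> 'a set gorder" where
  "closed_ideals S =
     \<lparr>carrier = {A. A \<subseteq> carrier S \<and> A \<noteq> {} \<and>
        (\<forall>a\<in>A. \<forall>b\<in>carrier S. nat_le S b a \<longrightarrow> b \<in> A) \<and>
        (\<forall>X x. X \<subseteq> A \<and> X \<noteq> {} \<and> compatible S X \<and> is_lub (nat_order S) x X \<longrightarrow> x \<in> A)},
      eq = (=), le = (\<subseteq>)\<rparr>"

definition spatial_rmonoid :: "'a rmonoid \<Rightarrow> bool" where
  "spatial_rmonoid S \<longleftrightarrow> spatial_frame (proj_order S) \<and> spatial_frame (closed_ideals S)"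

definition coherent_rmonoid :: "'a rmonoid \<Rightarrow> bool" where
  "coherent_rmonoid S \<longleftrightarrow> coherent_frame (proj_order S)"

definition strongly_coherent_rmonoid :: "'a rmonoid \<Rightarrow> bool" where
  "strongly_coherent_rmonoid S \<longleftrightarrow> coherent_frame (closed_ideals S)"

text \<open>Morphisms are extensional, so that HOL equality is equality of morphisms.\<close>

definition rmonoid_hom :: "'a rmonoid \<Rightarrow> 'b rmonoid \<Rightarrow> ('a \<Rightarrow> 'b) \<Rightarrow> bool" where
  "rmonoid_hom S T h \<longleftrightarrow> h \<in> hom S T \<and> h \<in> extensional (carrier S) \<and>
     (\<forall>a\<in>carrier S. h (lam S a) = lam T (h a) \<and> h (rho S a) = rho T (h a)) \<and>
     frame_hom (proj_order S) (proj_order T) h"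

definition proper_hom :: "'a rmonoid \<Rightarrow> 'b rmonoid \<Rightarrow> ('a \<Rightarrow> 'b) \<Rightarrow> bool" where
  "proper_hom S T h \<longleftrightarrow> (\<forall>t\<in>carrier T. \<exists>X\<subseteq>carrier T. is_lub (nat_order T) t X \<and>
     (\<forall>x\<in>X. \<exists>s\<in>carrier S. nat_le T x (h s)))"

definition meet_hom :: "'a rmonoid \<Rightarrow> 'b rmonoid \<Rightarrow> ('a \<Rightarrow> 'b) \<Rightarrow> bool" where
  "meet_hom S T h \<longleftrightarrow> (\<forall>a\<in>carrier S. \<forall>b\<in>carrier S. \<forall>c.
     is_glb (nat_order S) c {a, b} \<longrightarrow> is_glb (nat_order T) (h c) {h a, h b})"

definition coherent_hom :: "'a rmonoid \<Rightarrow> 'b rmonoid \<Rightarrow> ('a \<Rightarrow> 'b) \<Rightarrow> bool" where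
  "coherent_hom S T h \<longleftrightarrow>
     (\<forall>f. finite_elem (proj_order S) f \<longrightarrow> finite_elem (proj_order T) (h f))"

section \<open>Etale topological categories\<close>

text \<open>
  \<open>cmp C a b\<close> is the product \<open>ab\<close>, defined when \<open>dm C a = cd C b\<close>. The structure maps are
  relevant only on \<open>topspace (Arr C)\<close>, \<open>topspace (Ob C)\<close> and the composable pairs.
\<close>

record ('a, 'o) topcat =
  Arr :: "'a topology"
  Ob :: "'o topology"
  un :: "'o \<Rightarrow> 'a"
  dm :: "'a \<Rightarrow> 'o"
  cd :: "'a \<Rightarrow> 'o"
  cmp :: "'a \<Rightarrow> 'a \<Rightarrow> 'a"

definition composable :: "('a, 'o) topcat \<Rightarrow> ('a \<times> 'a) topology" where
  "composable C = subtopology (prod_topology (Arr C) (Arr C)) {(a, b). dm C a = cd C b}"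

definition topological_category :: "('a, 'o) topcat \<Rightarrow> bool" where
  "topological_category C \<longleftrightarrow>
     continuous_map (Ob C) (Arr C) (un C) \<and>
     continuous_map (Arr C) (Ob C) (dm C) \<and>
     continuous_map (Arr C) (Ob C) (cd C) \<and>
     continuous_map (composable C) (Arr C) (\<lambda>(a, b). cmp C a b) \<and>
     (\<forall>x\<in>topspace (Ob C). dm C (un C x) = x \<and> cd C (un C x) = x) \<and>
     (\<forall>(a, b)\<in>topspace (composable C).
        dm C (cmp C a b) = dm C b \<and> cd C (cmp C a b) = cd C a) \<and>
     (\<forall>a\<in>topspace (Arr C). cmp C a (un C (dm C a)) = a \<and> cmp C (un C (cd C a)) a = a) \<and>
     (\<forall>a b c. (a, b) \<in> topspace (composable C) \<and> (b, c) \<in> topspace (composable C) \<longrightarrow>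
        cmp C (cmp C a b) c = cmp C a (cmp C b c))"

definition local_homeo :: "'a topology \<Rightarrow> 'b topology \<Rightarrow> ('a \<Rightarrow> 'b) \<Rightarrow> bool" where
  "local_homeo X Y f \<longleftrightarrow> continuous_map X Y f \<and>
     (\<forall>x\<in>topspace X. \<exists>U. openin X U \<and> x \<in> U \<and> openin Y (f ` U) \<and>
        homeomorphic_map (subtopology X U) (subtopology Y (f ` U)) f)"

definition etale_category :: "('a, 'o) topcat \<Rightarrow> bool" where
  "etale_category C \<longleftrightarrow> topological_category C \<and>
     local_homeo (Arr C) (Ob C) (dm C) \<and> local_homeo (Arr C) (Ob C) (cd C) \<and>
     open_map (Ob C) (Arr C) (un C) \<and>
     open_map (composable C) (Arr C) (\<lambda>(a, b). cmp C a b)"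

definition irreducible_closed :: "'a topology \<Rightarrow> 'a set \<Rightarrow> bool" where
  "irreducible_closed X Z \<longleftrightarrow> closedin X Z \<and> Z \<noteq> {} \<and>
     (\<forall>A B. closedin X A \<and> closedin X B \<and> Z = A \<union> B \<longrightarrow> Z = A \<or> Z = B)"

definition sober_space :: "'a topology \<Rightarrow> bool" where
  "sober_space X \<longleftrightarrow>
     (\<forall>Z. irreducible_closed X Z \<longrightarrow> (\<exists>!x. x \<in> topspace X \<and> X closure_of {x} = Z))"

definition compact_open :: "'a topology \<Rightarrow> 'a set \<Rightarrow> bool" where
  "compact_open X K \<longleftrightarrow> compactin X K \<and> openin X K"

definition spectral_space :: "'a topology \<Rightarrow> bool" where
  "spectral_space X \<longleftrightarrow> sober_space X \<and>
     (\<exists>\<B>. (\<forall>K\<in>\<B>. compact_open X K) \<and>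
          openin X = arbitrary union_of (\<lambda>U. U \<in> \<B>) \<and>
          (\<forall>\<F>\<subseteq>\<B>. finite \<F> \<and> \<F> \<noteq> {} \<longrightarrow> \<Inter>\<F> \<in> \<B>))"

text \<open>Relational covering morphisms; again both components are extensional.\<close>

record ('a, 'o, 'b, 'p) relmap =
  on_arr :: "'a \<Rightarrow> 'b set"
  on_ob :: "'o \<Rightarrow> 'p"

definition rel_covering ::
    "('a, 'o) topcat \<Rightarrow> ('b, 'p) topcat \<Rightarrow> ('a, 'o, 'b, 'p) relmap \<Rightarrow> bool" where
  "rel_covering C D f \<longleftrightarrow>
     on_arr f \<in> topspace (Arr C) \<rightarrow>\<^sub>E Pow (topspace (Arr D)) \<and>
     on_ob f \<in> extensional (topspace (Ob C)) \<and> continuous_map (Ob C) (Ob D) (on_ob f) \<and>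
     (\<forall>a\<in>topspace (Arr C). \<forall>b\<in>on_arr f a.
        dm D b = on_ob f (dm C a) \<and> cd D b = on_ob f (cd C a)) \<and>
     (\<forall>(a, b)\<in>topspace (composable C). \<forall>(s, t)\<in>topspace (composable D).
        s \<in> on_arr f a \<and> t \<in> on_arr f b \<longrightarrow> cmp D s t \<in> on_arr f (cmp C a b)) \<and>
     (\<forall>a\<in>topspace (Arr C). \<forall>b\<in>topspace (Arr C).
        (dm C a = dm C b \<or> cd C a = cd C b) \<and> on_arr f a \<inter> on_arr f b \<noteq> {} \<longrightarrow> a = b) \<and>
     (\<forall>q\<in>topspace (Ob C). \<forall>s\<in>topspace (Arr D).
        (dm D s = on_ob f q \<longrightarrow> (\<exists>t\<in>topspace (Arr C). dm C t = q \<and> s \<in> on_arr f t)) \<and>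
        (cd D s = on_ob f q \<longrightarrow> (\<exists>t\<in>topspace (Arr C). cd C t = q \<and> s \<in> on_arr f t))) \<and>
     (\<forall>A. openin (Arr D) A \<longrightarrow> openin (Arr C) {x \<in> topspace (Arr C). on_arr f x \<inter> A \<noteq> {}}) \<and>
     (\<forall>t\<in>topspace (Ob C). un D (on_ob f t) \<in> on_arr f (un C t))"

definition coherent_relmap ::
    "('a, 'o) topcat \<Rightarrow> ('b, 'p) topcat \<Rightarrow> ('a, 'o, 'b, 'p) relmap \<Rightarrow> bool" where
  "coherent_relmap C D f \<longleftrightarrow> (\<forall>K. compact_open (Ob D) K \<longrightarrow>
     compact_open (Ob C) {x \<in> topspace (Ob C). on_ob f x \<in> K})"

definition rel_id :: "('a, 'o) topcat \<Rightarrow> ('a, 'o, 'a, 'o) relmap" where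
  "rel_id C = \<lparr>on_arr = (\<lambda>a\<in>topspace (Arr C). {a}), on_ob = (\<lambda>x\<in>topspace (Ob C). x)\<rparr>"

definition rel_comp :: "('a, 'o) topcat \<Rightarrow> ('b, 'p, 'c, 'q) relmap \<Rightarrow>
    ('a, 'o, 'b, 'p) relmap \<Rightarrow> ('a, 'o, 'c, 'q) relmap" where
  "rel_comp C g f =
     \<lparr>on_arr = (\<lambda>a\<in>topspace (Arr C). \<Union>b\<in>on_arr f a. on_arr g b),
      on_ob = compose (topspace (Ob C)) (on_ob g) (on_ob f)\<rparr>"

section \<open>The categories\<close>

text \<open>
  The index \<open>k\<close> is the type of the morphisms. A value of type \<open>flavour\<close> selects the pair of
  categories: sober/spatial with all morphisms of type \<open>k\<close>, or spectral/coherent or strongly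
  spectral/strongly coherent with the coherent morphisms of type \<open>k\<close>.
\<close>

datatype flavour = Sober_Spatial | Spectral_Coherent | Strongly_Spectral_Coherent

fun etale_ob :: "flavour \<Rightarrow> ('a, 'o) topcat \<Rightarrow> bool" where
  "etale_ob Sober_Spatial C \<longleftrightarrow>
     etale_category C \<and> sober_space (Ob C) \<and> sober_space (Arr C)"
| "etale_ob Spectral_Coherent C \<longleftrightarrow> etale_category C \<and> spectral_space (Ob C)"
| "etale_ob Strongly_Spectral_Coherent C \<longleftrightarrow> etale_category C \<and> spectral_space (Arr C)"

fun rmonoid_ob :: "flavour \<Rightarrow> 'a rmonoid \<Rightarrow> bool" where
  "rmonoid_ob Sober_Spatial S \<longleftrightarrow> complete_rmonoid S \<and> spatial_rmonoid S"
| "rmonoid_ob Spectral_Coherent S \<longleftrightarrow> complete_rmonoid S \<and> coherent_rmonoid S"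
| "rmonoid_ob Strongly_Spectral_Coherent S \<longleftrightarrow> complete_rmonoid S \<and> strongly_coherent_rmonoid S"

definition etale_mor :: "flavour \<Rightarrow> nat \<Rightarrow> ('a, 'o) topcat \<Rightarrow> ('b, 'p) topcat \<Rightarrow>
    ('a, 'o, 'b, 'p) relmap \<Rightarrow> bool" where
  "etale_mor v k C D f \<longleftrightarrow> rel_covering C D f \<and>
     (k = 2 \<longrightarrow> (\<forall>c\<in>topspace (Arr C). on_arr f c \<noteq> {})) \<and>
     (k = 3 \<longrightarrow> (\<forall>c\<in>topspace (Arr C). \<forall>s\<in>on_arr f c. \<forall>t\<in>on_arr f c. s = t)) \<and>
     (k = 4 \<longrightarrow> (\<forall>c\<in>topspace (Arr C). \<exists>!s. s \<in> on_arr f c)) \<and>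
     (v \<noteq> Sober_Spatial \<longrightarrow> coherent_relmap C D f)"

definition rmonoid_mor :: "flavour \<Rightarrow> nat \<Rightarrow> 'a rmonoid \<Rightarrow> 'b rmonoid \<Rightarrow> ('a \<Rightarrow> 'b) \<Rightarrow> bool" where
  "rmonoid_mor v k S T h \<longleftrightarrow> rmonoid_hom S T h \<and>
     (k = 2 \<longrightarrow> proper_hom S T h) \<and>
     (k = 3 \<longrightarrow> meet_hom S T h) \<and>
     (k = 4 \<longrightarrow> proper_hom S T h \<and> meet_hom S T h) \<and>
     (v \<noteq> Sober_Spatial \<longrightarrow> coherent_hom S T h)"

abbreviation rmonoid_id :: "'a rmonoid \<Rightarrow> 'a \<Rightarrow> 'a" where
  "rmonoid_id S \<equiv> (\<lambda>a\<in>carrier S. a)"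

abbreviation rmonoid_comp :: "'a rmonoid \<Rightarrow> ('b \<Rightarrow> 'c) \<Rightarrow> ('a \<Rightarrow> 'b) \<Rightarrow> 'a \<Rightarrow> 'c" where
  "rmonoid_comp S h g \<equiv> compose (carrier S) h g"

definition etale_iso :: "flavour \<Rightarrow> nat \<Rightarrow> ('a, 'o) topcat \<Rightarrow> ('b, 'p) topcat \<Rightarrow>
    ('a, 'o, 'b, 'p) relmap \<Rightarrow> bool" where
  "etale_iso v k C D f \<longleftrightarrow> etale_mor v k C D f \<and>
     (\<exists>g. etale_mor v k D C g \<and> rel_comp C g f = rel_id C \<and> rel_comp D f g = rel_id D)"

definition rmonoid_iso :: "flavour \<Rightarrow> nat \<Rightarrow> 'a rmonoid \<Rightarrow> 'b rmonoid \<Rightarrow> ('a \<Rightarrow> 'b) \<Rightarrow> bool" where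
  "rmonoid_iso v k S T h \<longleftrightarrow> rmonoid_mor v k S T h \<and>
     (\<exists>g. rmonoid_mor v k T S g \<and> rmonoid_comp S g h = rmonoid_id S \<and>
          rmonoid_comp T h g = rmonoid_id T)"

section \<open>The functors\<close>

text \<open>
  The two functors raise the underlying types: an etale category with arrows in \<open>'a\<close> yields a
  monoid of subsets of \<open>'a\<close>, a monoid on \<open>'s\<close> yields a category of filters, that is of subsets
  of \<open>'s\<close>. HOL cannot quantify over a functor acting at all types, so the functors and the natural
  isomorphisms of the duality are polymorphic constants.
\<close>

definition bisections :: "('a, 'o) topcat \<Rightarrow> 'a set set" where
  "bisections C = {A. openin (Arr C) A \<and> inj_on (dm C) A \<and> inj_on (cd C) A}"

definition section_monoid :: "('a, 'o) topcat \<Rightarrow> 'a set rmonoid" where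
  "section_monoid C =
     \<lparr>carrier = bisections C,
      monoid.mult = (\<lambda>A B. {cmp C a b | a b. a \<in> A \<and> b \<in> B \<and> dm C a = cd C b}),
      one = un C ` topspace (Ob C),
      proj = {A. openin (Arr C) A \<and> A \<subseteq> un C ` topspace (Ob C)},
      lam = (\<lambda>A. un C ` dm C ` A),
      rho = (\<lambda>A. un C ` cd C ` A)\<rparr>"

definition section_pullback :: "('a, 'o) topcat \<Rightarrow> ('b, 'p) topcat \<Rightarrow> ('a, 'o, 'b, 'p) relmap \<Rightarrow>
    'b set \<Rightarrow> 'a set" where
  "section_pullback C D f =
     (\<lambda>A\<in>bisections D. {c \<in> topspace (Arr C). on_arr f c \<inter> A \<noteq> {}})"

text \<open>
  Points are given as completely prime filters. The case of the empty join says that a filter does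
  not contain the bottom element.
\<close>

definition cp_filter :: "('a, 'm) gorder_scheme \<Rightarrow> 'a set \<Rightarrow> bool" where
  "cp_filter L P \<longleftrightarrow> P \<subseteq> carrier L \<and> P \<noteq> {} \<and>
     (\<forall>a\<in>P. \<forall>b\<in>carrier L. a \<sqsubseteq>\<^bsub>L\<^esub> b \<longrightarrow> b \<in> P) \<and>
     (\<forall>a\<in>P. \<forall>b\<in>P. \<exists>c\<in>P. c \<sqsubseteq>\<^bsub>L\<^esub> a \<and> c \<sqsubseteq>\<^bsub>L\<^esub> b) \<and>
     (\<forall>X\<subseteq>carrier L. \<forall>x\<in>P. is_lub L x X \<longrightarrow> X \<inter> P \<noteq> {})"

definition point_space :: "('a, 'm) gorder_scheme \<Rightarrow> 'a set topology" where
  "point_space L = topology_generated_by ((\<lambda>a. {P. cp_filter L P \<and> a \<in> P}) ` carrier L)"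

definition up_closure :: "('a, 'm) gorder_scheme \<Rightarrow> 'a set \<Rightarrow> 'a set" where
  "up_closure L A = {b \<in> carrier L. \<exists>a\<in>A. a \<sqsubseteq>\<^bsub>L\<^esub> b}"

definition filter_category :: "'s rmonoid \<Rightarrow> ('s set, 's set) topcat" where
  "filter_category S =
     \<lparr>Arr = point_space (nat_order S),
      Ob = point_space (proj_order S),
      un = up_closure (nat_order S),
      dm = (\<lambda>P. up_closure (proj_order S) (lam S ` P)),
      cd = (\<lambda>P. up_closure (proj_order S) (rho S ` P)),
      cmp = (\<lambda>P Q. up_closure (nat_order S) {a \<otimes>\<^bsub>S\<^esub> b | a b. a \<in> P \<and> b \<in> Q})\<rparr>"

text \<open>
  A morphism \<open>h : S \<rightarrow> T\<close> induces a relational morphism from the filter category of \<open>T\<close> to that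
  of \<open>S\<close>. The preimage of a completely prime filter \<open>P\<close> of \<open>T\<close> need not be a filter; \<open>P\<close> is sent to
  the filters in the preimage that have the domain and codomain that a relational covering morphism must preserve.
\<close>

definition filter_map :: "'s rmonoid \<Rightarrow> 't rmonoid \<Rightarrow> ('s \<Rightarrow> 't) \<Rightarrow>
    ('t set, 't set, 's set, 's set) relmap" where
  "filter_map S T h =
     (let h0 = (\<lambda>p. {f \<in> proj S. h f \<in> p}) in
     \<lparr>on_arr = (\<lambda>P\<in>topspace (Arr (filter_category T)).
        {Q \<in> topspace (Arr (filter_category S)). h ` Q \<subseteq> P \<and>
           dm (filter_category S) Q = h0 (dm (filter_category T) P) \<and>
           cd (filter_category S) Q = h0 (cd (filter_category T) P)}),
      on_ob = (\<lambda>p\<in>topspace (Ob (filter_category T)). h0 p)\<rparr>)"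

definition etale_unit :: "('a, 'o) topcat \<Rightarrow> ('a, 'o, 'a set set, 'a set set) relmap" where
  "etale_unit C =
     \<lparr>on_arr = (\<lambda>c\<in>topspace (Arr C). {{A \<in> bisections C. c \<in> A}}),
      on_ob = (\<lambda>x\<in>topspace (Ob C). {A \<in> proj (section_monoid C). un C x \<in> A})\<rparr>"

definition rmonoid_unit :: "'s rmonoid \<Rightarrow> 's \<Rightarrow> 's set set" where
  "rmonoid_unit S = (\<lambda>s\<in>carrier S. {P. cp_filter (nat_order S) P \<and> s \<in> P})"

end

theory Submission
  imports Defs
begin

text \<open>
  Two ideas carry the duality.

  The first is that a completely prime filter of a complete restriction monoid is a germ: it is
  determined by one of its members \<open>s\<close> and by its domain, a point of the frame of projections, and
  any point that contains \<open>\<lambda>(s)\<close> occurs (\<open>filter_eq_germ\<close>, \<open>germ_filter\<close>). Hence the domain map from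
  filters to points is injective and open on the set of filters through \<open>s\<close>, and reversing the
  multiplication gives the same for codomains. So the filters form an etale category
  (\<open>etale_filter_category\<close>), and two filters are equal once they have the same domain and a common
  member (\<open>filter_eqI\<close>). A homomorphism \<open>h\<close> relates a filter \<open>P\<close> to the filters that \<open>h\<close> maps into \<open>P\<close>
  and that lie over the domain and codomain of \<open>P\<close>. Germs lift along points (\<open>lift_dom\<close>), which is
  the covering condition, and every \<open>s\<close> with \<open>h s \<in> P\<close> is in a filter related to \<open>P\<close>
  (\<open>ex_map_filter\<close>). Consequently a proper \<open>h\<close> relates every filter to at least one, and an \<open>h\<close> that
  preserves meets relates it to at most one.

  The second idea is to represent an ordered set by open sets of a space (locale
  \<open>representation\<close>). The bisections of an etale category and its open sets of units are of this kind, and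
  a representation of a monoid yields a representation of its frame of closed ideals
  (\<open>representation_closed_ideals\<close>). Joins become unions and binary meets intersections. When all open sets of a sober space are
  represented, the finite elements are the compact open sets, and coherence of the frame is
  spectrality of the space (\<open>coherent_frame_iff_spectral\<close>). A monoid is represented by the basic
  open sets of its space of filters as soon as its frame of projections has enough points. Spatiality provides
  these by definition. For the two coherent kinds of monoid they come from Zorn's lemma, since
  every projection is a join of finite ones (\<open>algebraic_frame_enough_points\<close>,
  \<open>coherent_closed_ideals_enough_points\<close>). This settles which objects correspond.

  It remains to see that the two units are isomorphisms. An arrow of an etale category is sent to
  the filter of bisections around it. Conversely the domain of a filter of bisections is given by
  an object \<open>x\<close>, by sobriety, and a bisection in the filter contains exactly one arrow with domain
  \<open>x\<close> (\<open>nat_filter_is_nhds\<close>). An element \<open>s\<close> of a monoid is sent to the set of filters through \<open>s\<close>.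
  A bisection of the filter category is the union of the sets of this form inside it; these are
  compatible, because they are restrictions of one bisection, so their join in the monoid
  represents it (\<open>rmon_iso_unit\<close>). Isomorphisms are morphisms of all four types, and both
  naturality squares commute because an arrow is determined by its domain and a bisection through
  it, and a filter by its domain and one of its members.
\<close>

section \<open>Joins, meets and completely prime filters in a partial order\<close>

lemma is_lub_iff:
  assumes "X \<subseteq> carrier L"
  shows "is_lub L x X \<longleftrightarrow> x \<in> carrier L \<and> (\<forall>y\<in>X. y \<sqsubseteq>\<^bsub>L\<^esub> x) \<and>
    (\<forall>z\<in>carrier L. (\<forall>y\<in>X. y \<sqsubseteq>\<^bsub>L\<^esub> z) \<longrightarrow> x \<sqsubseteq>\<^bsub>L\<^esub> z)"
proof -
  have "X \<inter> carrier L = X" using assms by blast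
  then show ?thesis unfolding least_def Upper_def by (auto simp del: Int_iff)
qed

lemma is_glb_iff:
  assumes "a \<in> carrier L" "b \<in> carrier L"
  shows "is_glb L c {a, b} \<longleftrightarrow> c \<in> carrier L \<and> c \<sqsubseteq>\<^bsub>L\<^esub> a \<and> c \<sqsubseteq>\<^bsub>L\<^esub> b \<and>
    (\<forall>z\<in>carrier L. z \<sqsubseteq>\<^bsub>L\<^esub> a \<and> z \<sqsubseteq>\<^bsub>L\<^esub> b \<longrightarrow> z \<sqsubseteq>\<^bsub>L\<^esub> c)"
  using assms by (auto simp: greatest_def Lower_def)

context partial_order
begin

lemma sup_eqI: "is_lub L x A \<Longrightarrow> \<Squnion>A = x"
  unfolding sup_def by (metis least_unique someI)

lemma meet_eqI: "is_glb L x {a, b} \<Longrightarrow> a \<sqinter> b = x"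
  unfolding meet_def inf_def by (metis greatest_unique someI)

lemma top_eqI:
  assumes "x \<in> carrier L" "\<And>y. y \<in> carrier L \<Longrightarrow> y \<sqsubseteq> x"
  shows "\<top> = x"
proof -
  have "greatest L x (carrier L)" using assms by (auto simp: greatest_def)
  then show ?thesis unfolding top_def by (metis greatest_unique someI)
qed

end

definition pts :: "('a, 'm) gorder_scheme \<Rightarrow> 'a \<Rightarrow> 'a set set" where
  "pts L a = {P. cp_filter L P \<and> a \<in> P}"

lemma cp_filterD:
  assumes "cp_filter L P"
  shows cp_filter_carrier: "P \<subseteq> carrier L"
    and cp_filter_nonempty: "\<exists>a\<in>carrier L. a \<in> P"
    and cp_filter_up: "a \<in> P \<Longrightarrow> a \<sqsubseteq>\<^bsub>L\<^esub> b \<Longrightarrow> b \<in> carrier L \<Longrightarrow> b \<in> P"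
    and cp_filter_down: "a \<in> P \<Longrightarrow> b \<in> P \<Longrightarrow> \<exists>c\<in>P. c \<sqsubseteq>\<^bsub>L\<^esub> a \<and> c \<sqsubseteq>\<^bsub>L\<^esub> b"
    and cp_filter_lub: "X \<subseteq> carrier L \<Longrightarrow> is_lub L x X \<Longrightarrow> x \<in> P \<Longrightarrow> \<exists>y\<in>X. y \<in> P"
  using assms unfolding cp_filter_def by blast+

lemma topspace_point_space: "topspace (point_space L) = {P. cp_filter L P}"
  using cp_filter_nonempty unfolding point_space_def topology_generated_by_topspace by auto

text \<open>A filter contains a common lower bound of any two of its members, so the sets \<open>pts L a\<close>
  are a basis and not only a subbasis of the space of points.\<close>

lemma openin_point_space:
  "openin (point_space L) U \<longleftrightarrow>
     (\<forall>P\<in>U. cp_filter L P \<and> (\<exists>a\<in>P. pts L a \<subseteq> U))" (is "_ \<longleftrightarrow> ?R U")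
proof
  assume "openin (point_space L) U"
  then have "generate_topology_on ((\<lambda>a. {P. cp_filter L P \<and> a \<in> P}) ` carrier L) U"
    by (simp add: point_space_def openin_topology_generated_by_iff)
  then show "?R U"
  proof induction
    case (Int U V)
    show ?case
    proof
      fix P assume P: "P \<in> U \<inter> V"
      then obtain a b where ab: "a \<in> P" "pts L a \<subseteq> U" "b \<in> P" "pts L b \<subseteq> V" "cp_filter L P"
        using Int.IH(1)[rule_format, of P] Int.IH(2)[rule_format, of P] by blast
      then obtain c where c: "c \<in> P" "c \<sqsubseteq>\<^bsub>L\<^esub> a" "c \<sqsubseteq>\<^bsub>L\<^esub> b"
        using cp_filter_down[OF ab(5,1,3)] by blast
      have "a \<in> carrier L" "b \<in> carrier L" using ab cp_filter_carrier[OF ab(5)] by blast+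
      then have "pts L c \<subseteq> pts L a" "pts L c \<subseteq> pts L b"
        using c cp_filter_up unfolding pts_def by fast+
      then have "pts L c \<subseteq> U \<inter> V" using ab by blast
      then show "cp_filter L P \<and> (\<exists>a\<in>P. pts L a \<subseteq> U \<inter> V)" using c ab by blast
    qed
  next
    case (UN K)
    then show ?case by (meson Union_iff Union_upper order_trans)
  next
    case (Basis U)
    then show ?case by (auto simp: pts_def)
  qed auto
next
  assume R: "?R U"
  have "U = (\<Union>a\<in>{a\<in>carrier L. pts L a \<subseteq> U}. pts L a)"
  proof
    show "U \<subseteq> (\<Union>a\<in>{a\<in>carrier L. pts L a \<subseteq> U}. pts L a)"
    proof
      fix P assume "P \<in> U"
      with R obtain a where "cp_filter L P" "a \<in> P" "pts L a \<subseteq> U" by blast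
      then show "P \<in> (\<Union>a\<in>{a\<in>carrier L. pts L a \<subseteq> U}. pts L a)"
        using cp_filter_carrier by (fastforce simp: pts_def)
    qed
  qed auto
  moreover have "openin (point_space L) (\<Union>a\<in>{a\<in>carrier L. pts L a \<subseteq> U}. pts L a)"
    by (rule openin_Union) (auto simp: point_space_def pts_def intro: topology_generated_by_Basis)
  ultimately show "openin (point_space L) U" by simp
qed

lemma openin_pts: "openin (point_space L) (pts L a)"
  unfolding openin_point_space by (auto simp: pts_def)

text \<open>An irreducible closed set \<open>Z\<close> of points has as its generic point the filter of all elements
  whose basic open set meets \<open>Z\<close>: irreducibility makes it a filter, and complete primality
  is inherited from the members of \<open>Z\<close>.\<close>

lemma sober_point_space: "sober_space (point_space L)"
  unfolding sober_space_def
proof (intro allI impI)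
  fix Z assume irr: "irreducible_closed (point_space L) Z"
  let ?X = "point_space L"
  have cl: "closedin ?X Z" and ne: "Z \<noteq> {}" using irr by (auto simp: irreducible_closed_def)
  have ZX: "Z \<subseteq> {P. cp_filter L P}" using closedin_subset[OF cl] by (simp add: topspace_point_space)
  have meet: "U \<inter> V \<inter> Z \<noteq> {}" if U: "openin ?X U" "U \<inter> Z \<noteq> {}" and V: "openin ?X V" "V \<inter> Z \<noteq> {}" for U V
  proof
    assume e: "U \<inter> V \<inter> Z = {}"
    have "closedin ?X (Z - U)" "closedin ?X (Z - V)" using cl U V by (auto intro: closedin_diff)
    moreover have "Z = (Z - U) \<union> (Z - V)" using e by blast
    ultimately have "Z = Z - U \<or> Z = Z - V" using irr unfolding irreducible_closed_def by blast
    then show False using U V by blast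
  qed
  define G where "G = {a \<in> carrier L. pts L a \<inter> Z \<noteq> {}}"
  have G: "cp_filter L G"
    unfolding cp_filter_def
  proof (intro conjI ballI allI impI)
    show "G \<subseteq> carrier L" by (auto simp: G_def)
    obtain P where "P \<in> Z" using ne by blast
    with ZX obtain a where "a \<in> carrier L" "a \<in> P" "cp_filter L P" using cp_filter_nonempty by blast
    then show "G \<noteq> {}" using \<open>P \<in> Z\<close> by (auto simp: G_def pts_def)
  next
    fix a b assume "a \<in> G" "b \<in> carrier L" "a \<sqsubseteq>\<^bsub>L\<^esub> b"
    then show "b \<in> G" using cp_filter_up by (fastforce simp: G_def pts_def)
  next
    fix a b assume "a \<in> G" "b \<in> G"
    then obtain P where P: "P \<in> Z" "cp_filter L P" "a \<in> P" "b \<in> P"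
      using meet[OF openin_pts _ openin_pts, of a b] by (auto simp: G_def pts_def)
    then obtain c where "c \<in> P" "c \<sqsubseteq>\<^bsub>L\<^esub> a" "c \<sqsubseteq>\<^bsub>L\<^esub> b" using cp_filter_down[OF P(2-4)] by blast
    then show "\<exists>c\<in>G. c \<sqsubseteq>\<^bsub>L\<^esub> a \<and> c \<sqsubseteq>\<^bsub>L\<^esub> b"
      using P cp_filter_carrier by (fastforce simp: G_def pts_def)
  next
    fix M x assume M: "M \<subseteq> carrier L" "x \<in> G" "is_lub L x M"
    then obtain P where "P \<in> Z" "cp_filter L P" "x \<in> P" by (auto simp: G_def pts_def)
    then show "M \<inter> G \<noteq> {}" using cp_filter_lub[of L P M x] M by (fastforce simp: G_def pts_def)
  qed
  have closure: "P \<in> ?X closure_of {Q} \<longleftrightarrow> cp_filter L P \<and> P \<subseteq> Q"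
    if "cp_filter L Q" for P Q
  proof
    assume P: "P \<in> ?X closure_of {Q}"
    then have "cp_filter L P" by (auto simp: in_closure_of topspace_point_space)
    moreover have "a \<in> Q" if "a \<in> P" for a
    proof -
      have "P \<in> pts L a" using that \<open>cp_filter L P\<close> by (simp add: pts_def)
      then have "Q \<in> pts L a" using P openin_pts[of L a] by (auto simp: in_closure_of)
      then show ?thesis by (simp add: pts_def)
    qed
    ultimately show "cp_filter L P \<and> P \<subseteq> Q" by blast
  next
    assume P: "cp_filter L P \<and> P \<subseteq> Q"
    have "\<exists>y. y \<in> {Q} \<and> y \<in> T" if "P \<in> T \<and> openin ?X T" for T
    proof -
      obtain a where "a \<in> P" "pts L a \<subseteq> T" using \<open>P \<in> T \<and> openin ?X T\<close> openin_point_space by metis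
      then show ?thesis using P \<open>cp_filter L Q\<close> by (auto simp: pts_def)
    qed
    then show "P \<in> ?X closure_of {Q}" using P by (auto simp: in_closure_of topspace_point_space)
  qed
  have "?X closure_of {G} = Z"
  proof
    show "?X closure_of {G} \<subseteq> Z"
    proof
      fix P assume "P \<in> ?X closure_of {G}"
      then have P: "cp_filter L P" "P \<subseteq> G" using closure[OF G] by auto
      show "P \<in> Z"
      proof (rule ccontr)
        assume "P \<notin> Z"
        then have "P \<in> topspace ?X - Z" using P by (simp add: topspace_point_space)
        moreover have "openin ?X (topspace ?X - Z)" using cl by blast
        ultimately obtain a where "a \<in> P" "pts L a \<subseteq> topspace ?X - Z" using openin_point_space by metis
        then show False using P by (auto simp: G_def)
      qed
    qed
    show "Z \<subseteq> ?X closure_of {G}"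
    proof
      fix P assume "P \<in> Z"
      then have "cp_filter L P" "P \<subseteq> G" using ZX cp_filter_carrier[of L P] by (auto simp: G_def pts_def)
      then show "P \<in> ?X closure_of {G}" using closure[OF G] by blast
    qed
  qed
  moreover have "Q = G" if Q: "cp_filter L Q" "?X closure_of {Q} = Z" for Q
  proof
    show "Q \<subseteq> G" using closure[OF G, of Q] closure[OF Q(1), of Q] Q \<open>?X closure_of {G} = Z\<close> by simp
    show "G \<subseteq> Q" using closure[OF G, of G] closure[OF Q(1), of G] Q G \<open>?X closure_of {G} = Z\<close> by simp
  qed
  ultimately show "\<exists>!x. x \<in> topspace ?X \<and> ?X closure_of {x} = Z"
    using G by (auto simp: topspace_point_space)
qed

section \<open>Representing an order by open sets\<close>

text \<open>The orders of interest are bases of open sets: the bisections and the open sets of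
  units of an etale category, the closed ideals of a monoid. The image of \<open>\<phi>\<close> is a
  basis that contains every open subset of each of its members, so joins that exist in \<open>L\<close> are
  unions and meets are intersections.\<close>

locale representation = partial_order L for L :: "('a, 'm) gorder_scheme" (structure) +
  fixes X :: "'x topology" and \<phi> :: "'a \<Rightarrow> 'x set"
  assumes open_rep: "a \<in> carrier L \<Longrightarrow> openin X (\<phi> a)"
    and le_iff: "a \<in> carrier L \<Longrightarrow> b \<in> carrier L \<Longrightarrow> a \<sqsubseteq> b \<longleftrightarrow> \<phi> a \<subseteq> \<phi> b"
    and basis: "openin X U \<Longrightarrow> x \<in> U \<Longrightarrow> \<exists>a\<in>carrier L. x \<in> \<phi> a \<and> \<phi> a \<subseteq> U"
    and down: "a \<in> carrier L \<Longrightarrow> openin X U \<Longrightarrow> U \<subseteq> \<phi> a \<Longrightarrow> \<exists>b\<in>carrier L. \<phi> b = U"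
begin

lemma rep_inj: "a \<in> carrier L \<Longrightarrow> b \<in> carrier L \<Longrightarrow> \<phi> a = \<phi> b \<Longrightarrow> a = b"
  using le_iff[of a b] le_iff[of b a] le_antisym by blast

lemma is_lub_iff_Union:
  assumes "M \<subseteq> carrier L" "a \<in> carrier L"
  shows "is_lub L a M \<longleftrightarrow> \<phi> a = \<Union>(\<phi> ` M)"
proof
  assume lub: "is_lub L a M"
  then have le: "\<phi> y \<subseteq> \<phi> a" if "y \<in> M" for y
  proof -
    have "y \<in> carrier L" "y \<sqsubseteq> a" using that assms lub is_lub_iff[OF assms(1)] by blast+
    then show ?thesis using le_iff assms by blast
  qed
  have "openin X (\<Union>(\<phi> ` M))" using assms open_rep by blast
  moreover have "\<Union>(\<phi> ` M) \<subseteq> \<phi> a" using le by auto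
  ultimately obtain b where b: "b \<in> carrier L" "\<phi> b = \<Union>(\<phi> ` M)"
    using down[OF assms(2)] by blast
  have ub: "y \<sqsubseteq> b" if "y \<in> M" for y
  proof -
    have "y \<in> carrier L" "\<phi> y \<subseteq> \<phi> b" using that assms b by auto
    then show ?thesis using le_iff b by blast
  qed
  moreover have "\<forall>z\<in>carrier L. (\<forall>y\<in>M. y \<sqsubseteq> z) \<longrightarrow> a \<sqsubseteq> z"
    using lub unfolding is_lub_iff[OF assms(1)] by blast
  ultimately have "a \<sqsubseteq> b" using b by simp
  then show "\<phi> a = \<Union>(\<phi> ` M)" using \<open>\<Union>(\<phi> ` M) \<subseteq> \<phi> a\<close> b le_iff assms by auto
next
  assume a: "\<phi> a = \<Union>(\<phi> ` M)"
  have le: "y \<sqsubseteq> z \<longleftrightarrow> \<phi> y \<subseteq> \<phi> z" if "y \<in> M" "z \<in> carrier L" for y z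
    using that assms le_iff by blast
  show "is_lub L a M"
    unfolding is_lub_iff[OF assms(1)] using a assms le le_iff[OF assms(2)] by auto
qed

lemma ex_glb:
  assumes "a \<in> carrier L" "b \<in> carrier L"
  shows "\<exists>c\<in>carrier L. \<phi> c = \<phi> a \<inter> \<phi> b"
  by (rule down[OF assms(1)]) (use open_rep[OF assms(1)] open_rep[OF assms(2)] in auto)

lemma is_glb_iff_Int:
  assumes "a \<in> carrier L" "b \<in> carrier L" "c \<in> carrier L"
  shows "is_glb L c {a, b} \<longleftrightarrow> \<phi> c = \<phi> a \<inter> \<phi> b"
proof
  assume c: "is_glb L c {a, b}"
  obtain d where d: "d \<in> carrier L" "\<phi> d = \<phi> a \<inter> \<phi> b" using ex_glb[OF assms(1,2)] by blast
  then have "d \<sqsubseteq> a" "d \<sqsubseteq> b" using assms le_iff by auto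
  then have "d \<sqsubseteq> c" "c \<sqsubseteq> a" "c \<sqsubseteq> b" using c d unfolding is_glb_iff[OF assms(1,2)] by blast+
  then have "\<phi> d \<subseteq> \<phi> c" "\<phi> c \<subseteq> \<phi> a" "\<phi> c \<subseteq> \<phi> b" using d assms le_iff by auto
  then show "\<phi> c = \<phi> a \<inter> \<phi> b" using d by blast
next
  assume "\<phi> c = \<phi> a \<inter> \<phi> b"
  then show "is_glb L c {a, b}" using assms le_iff unfolding is_glb_iff[OF assms(1,2)] by auto
qed

lemma meet_rep:
  assumes "a \<in> carrier L" "b \<in> carrier L"
  shows "a \<sqinter> b \<in> carrier L" "\<phi> (a \<sqinter> b) = \<phi> a \<inter> \<phi> b"
proof -
  obtain c where c: "c \<in> carrier L" "\<phi> c = \<phi> a \<inter> \<phi> b" using ex_glb[OF assms] by blast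
  then have "is_glb L c {a, b}" using is_glb_iff_Int assms by blast
  then have "a \<sqinter> b = c" by (rule meet_eqI)
  with c show "a \<sqinter> b \<in> carrier L" "\<phi> (a \<sqinter> b) = \<phi> a \<inter> \<phi> b" by auto
qed

lemma cp_filter_nhds:
  assumes "x \<in> topspace X"
  shows "cp_filter L {a \<in> carrier L. x \<in> \<phi> a}"
  unfolding cp_filter_def
proof (intro conjI ballI allI impI)
  show "{a \<in> carrier L. x \<in> \<phi> a} \<noteq> {}" using basis[OF openin_topspace assms] by blast
next
  fix a b assume "a \<in> {a \<in> carrier L. x \<in> \<phi> a}" "b \<in> {a \<in> carrier L. x \<in> \<phi> a}"
  then show "\<exists>c\<in>{a \<in> carrier L. x \<in> \<phi> a}. c \<sqsubseteq> a \<and> c \<sqsubseteq> b"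
    using ex_glb[of a b] le_iff by auto
next
  fix M y assume "M \<subseteq> carrier L" "y \<in> {a \<in> carrier L. x \<in> \<phi> a}" "is_lub L y M"
  then show "M \<inter> {a \<in> carrier L. x \<in> \<phi> a} \<noteq> {}"
    using is_lub_iff_Union[of M y] by blast
qed (use le_iff in auto)

text \<open>A completely prime filter \<open>P\<close> is the neighbourhood filter of the generic point of the
  irreducible closed set of all points that lie in no \<open>\<phi> a\<close> with \<open>a \<notin> P\<close>.\<close>

lemma cp_filter_is_nhds:
  assumes sob: "sober_space X" and P: "cp_filter L P"
  shows "\<exists>!x. x \<in> topspace X \<and> P = {a \<in> carrier L. x \<in> \<phi> a}"
proof -
  define W where "W = \<Union>(\<phi> ` (carrier L - P))"
  define Z where "Z = topspace X - W"
  have opW: "openin X W" unfolding W_def using open_rep by blast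
  then have clZ: "closedin X Z" unfolding Z_def by blast
  have PL: "P \<subseteq> carrier L" using cp_filter_carrier[OF P] .
  have mem: "a \<in> P \<longleftrightarrow> \<phi> a \<inter> Z \<noteq> {}" if a: "a \<in> carrier L" for a
  proof
    assume aP: "a \<in> P"
    show "\<phi> a \<inter> Z \<noteq> {}"
    proof
      assume e: "\<phi> a \<inter> Z = {}"
      then have "\<phi> a \<subseteq> W" using openin_subset[OF open_rep[OF a]] unfolding Z_def by blast
      define M where "M = {c \<in> carrier L. c \<sqsubseteq> a \<and> c \<notin> P}"
      have "\<phi> a = \<Union>(\<phi> ` M)"
      proof
        show "\<phi> a \<subseteq> \<Union>(\<phi> ` M)"
        proof
          fix x assume x: "x \<in> \<phi> a"
          then obtain b where b: "b \<in> carrier L" "b \<notin> P" "x \<in> \<phi> b"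
            using \<open>\<phi> a \<subseteq> W\<close> unfolding W_def by blast
          then obtain c where c: "c \<in> carrier L" "\<phi> c = \<phi> a \<inter> \<phi> b" using ex_glb a by blast
          then have "c \<sqsubseteq> a" "c \<sqsubseteq> b" using le_iff a b by auto
          then have "c \<in> M" using c b cp_filter_up[OF P, of c b] unfolding M_def by blast
          then show "x \<in> \<Union>(\<phi> ` M)" using c x b by blast
        qed
        show "\<Union>(\<phi> ` M) \<subseteq> \<phi> a" using le_iff a unfolding M_def by blast
      qed
      moreover have M: "M \<subseteq> carrier L" by (auto simp: M_def)
      ultimately have "is_lub L a M" using is_lub_iff_Union[OF M a] by simp
      then have "\<exists>c\<in>M. c \<in> P" using cp_filter_lub[OF P M _ aP] by simp
      then show False unfolding M_def by blast
    qed
  next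
    assume "\<phi> a \<inter> Z \<noteq> {}"
    then show "a \<in> P" using a unfolding Z_def W_def by blast
  qed
  have irr: "irreducible_closed X Z"
    unfolding irreducible_closed_def
  proof (intro conjI allI impI)
    show "closedin X Z" by fact
    show "Z \<noteq> {}" using cp_filter_nonempty[OF P] mem by blast
    fix A B assume AB: "closedin X A \<and> closedin X B \<and> Z = A \<union> B"
    show "Z = A \<or> Z = B"
    proof (rule ccontr)
      assume "\<not> (Z = A \<or> Z = B)"
      then obtain x y where x: "x \<in> Z" "x \<notin> A" and y: "y \<in> Z" "y \<notin> B" using AB by blast
      have tops: "x \<in> topspace X" "y \<in> topspace X" using x y unfolding Z_def by auto
      obtain a where a: "a \<in> carrier L" "x \<in> \<phi> a" "\<phi> a \<subseteq> topspace X - A"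
        using basis[of "topspace X - A" x] AB x tops by blast
      obtain b where b: "b \<in> carrier L" "y \<in> \<phi> b" "\<phi> b \<subseteq> topspace X - B"
        using basis[of "topspace X - B" y] AB y tops by blast
      have "a \<in> P" "b \<in> P" using mem a b x y by blast+
      then obtain c where c: "c \<in> P" "c \<sqsubseteq> a" "c \<sqsubseteq> b" using cp_filter_down[OF P] by blast
      moreover have "c \<in> carrier L" using c PL by blast
      ultimately have "\<phi> c \<inter> Z \<noteq> {}" "\<phi> c \<subseteq> \<phi> a" "\<phi> c \<subseteq> \<phi> b"
        using mem[of c] le_iff a b by auto
      then show False using a b AB by blast
    qed
  qed
  have char: "P = {a \<in> carrier L. x \<in> \<phi> a} \<longleftrightarrow> X closure_of {x} = Z" if x: "x \<in> topspace X" for x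
  proof
    assume Px: "P = {a \<in> carrier L. x \<in> \<phi> a}"
    show "X closure_of {x} = Z"
    proof
      have "x \<in> Z" using x Px unfolding Z_def W_def by blast
      then show "X closure_of {x} \<subseteq> Z" using clZ by (simp add: closure_of_minimal)
      show "Z \<subseteq> X closure_of {x}"
      proof
        fix y assume y: "y \<in> Z"
        have "x \<in> T" if T: "y \<in> T" "openin X T" for T
        proof -
          obtain a where "a \<in> carrier L" "y \<in> \<phi> a" "\<phi> a \<subseteq> T" using basis T by blast
          then show ?thesis using Px mem y by blast
        qed
        then show "y \<in> X closure_of {x}" using y unfolding Z_def by (auto simp: in_closure_of)
      qed
    qed
  next
    assume cl: "X closure_of {x} = Z"
    have "\<phi> a \<inter> Z \<noteq> {} \<longleftrightarrow> x \<in> \<phi> a" if a: "a \<in> carrier L" for a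
      using cl[symmetric] open_rep[OF a] x by (auto simp: in_closure_of)
    then show "P = {a \<in> carrier L. x \<in> \<phi> a}" using mem PL by blast
  qed
  have "\<exists>!x. x \<in> topspace X \<and> X closure_of {x} = Z" using sob irr unfolding sober_space_def by simp
  moreover have "x \<in> topspace X \<and> P = {a \<in> carrier L. x \<in> \<phi> a} \<longleftrightarrow>
      x \<in> topspace X \<and> X closure_of {x} = Z" for x
    using char[of x] by (rule conj_cong[OF HOL.refl])
  ultimately show ?thesis by simp
qed

text \<open>That every point of the order is a neighbourhood filter is taken as the hypothesis, instead of
  sobriety of \<open>X\<close>: for an etale category it will follow, for objects and arrows alike, from
  sobriety of only one of the two spaces.\<close>

lemma homeomorphic_point_space:
  assumes nhds: "\<And>P. cp_filter L P \<Longrightarrow> \<exists>!x. x \<in> topspace X \<and> P = {a \<in> carrier L. x \<in> \<phi> a}"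
  shows "homeomorphic_map X (point_space L) (\<lambda>x. {a \<in> carrier L. x \<in> \<phi> a})" (is "homeomorphic_map _ _ ?N")
proof (rule bijective_open_imp_homeomorphic_map)
  have pre: "{x \<in> topspace X. ?N x \<in> pts L a} = \<phi> a" if "a \<in> carrier L" for a
    using that cp_filter_nhds openin_subset[OF open_rep[OF that]] by (auto simp: pts_def)
  have img: "?N ` topspace X = topspace (point_space L)"
    unfolding topspace_point_space using nhds cp_filter_nhds by (auto simp: image_iff) metis
  then show "?N ` topspace X = topspace (point_space L)" .
  show "inj_on ?N (topspace X)"
    using nhds[OF cp_filter_nhds] by (intro inj_onI) blast
  show "continuous_map X (point_space L) ?N"
    unfolding continuous_map_def
  proof (intro conjI allI impI)
    show "?N \<in> topspace X \<rightarrow> topspace (point_space L)" using img by blast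
    fix U assume U: "openin (point_space L) U"
    show "openin X {x \<in> topspace X. ?N x \<in> U}"
    proof (subst openin_subopen, intro ballI)
      fix x assume x: "x \<in> {x \<in> topspace X. ?N x \<in> U}"
      then obtain a where a: "a \<in> ?N x" "pts L a \<subseteq> U" using U unfolding openin_point_space by blast
      then have "\<phi> a \<subseteq> {x \<in> topspace X. ?N x \<in> U}" using pre[of a] by blast
      then show "\<exists>T. openin X T \<and> x \<in> T \<and> T \<subseteq> {x \<in> topspace X. ?N x \<in> U}"
        using a open_rep by blast
    qed
  qed
  show "open_map X (point_space L) ?N"
    unfolding open_map_def
  proof (intro allI impI)
    fix U assume U: "openin X U"
    show "openin (point_space L) (?N ` U)"
      unfolding openin_point_space
    proof
      fix P assume "P \<in> ?N ` U"
      then obtain x where x: "x \<in> U" "P = ?N x" by blast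
      obtain a where a: "a \<in> carrier L" "x \<in> \<phi> a" "\<phi> a \<subseteq> U" using basis U x by blast
      have "pts L a \<subseteq> ?N ` U"
      proof
        fix Q assume Q: "Q \<in> pts L a"
        then obtain y where "y \<in> topspace X" "Q = ?N y" using nhds[of Q] by (auto simp: pts_def)
        then show "Q \<in> ?N ` U" using Q a by (auto simp: pts_def)
      qed
      moreover have "x \<in> topspace X" using U x openin_subset by blast
      ultimately show "cp_filter L P \<and> (\<exists>a\<in>P. pts L a \<subseteq> ?N ` U)" using a x cp_filter_nhds by blast
    qed
  qed
qed

end

locale full_representation = representation +
  assumes full: "openin X U \<Longrightarrow> \<exists>a\<in>carrier L. \<phi> a = U"
begin

lemma sup_rep:
  assumes "M \<subseteq> carrier L"
  shows "is_lub L (\<Squnion>M) M" "\<Squnion>M \<in> carrier L" "\<phi> (\<Squnion>M) = \<Union>(\<phi> ` M)"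
proof -
  have "openin X (\<Union>(\<phi> ` M))" using assms open_rep by blast
  then obtain a where a: "a \<in> carrier L" "\<phi> a = \<Union>(\<phi> ` M)" using full by blast
  then have "is_lub L a M" using assms is_lub_iff_Union by blast
  moreover from this have "\<Squnion>M = a" by (rule sup_eqI)
  ultimately show "is_lub L (\<Squnion>M) M" "\<Squnion>M \<in> carrier L" "\<phi> (\<Squnion>M) = \<Union>(\<phi> ` M)" using a by auto
qed

lemma top_rep: "\<top> \<in> carrier L" "\<phi> \<top> = topspace X"
proof -
  obtain a where a: "a \<in> carrier L" "\<phi> a = topspace X" using full[OF openin_topspace] by blast
  then have "\<top> = a" using le_iff open_rep openin_subset by (intro top_eqI) blast+
  then show "\<top> \<in> carrier L" "\<phi> \<top> = topspace X" using a by auto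
qed

lemma frame_rep: "frame L"
  unfolding frame_def
proof (intro conjI ballI allI impI)
  show "complete_lattice L"
  proof (rule complete_latticeI)
    fix A assume A: "A \<subseteq> carrier L"
    then show "\<exists>s. is_lub L s A" using sup_rep by blast
    \<comment> \<open>the meet is the interior of the intersection, that is the join of all lower bounds\<close>
    define B where "B = {b \<in> carrier L. \<forall>a\<in>A. b \<sqsubseteq> a}"
    have B: "B \<subseteq> carrier L" by (auto simp: B_def)
    have "\<Squnion>B \<sqsubseteq> a" if "a \<in> A" for a
      using that A sup_rep[OF B] by (subst le_iff) (auto simp: B_def le_iff subset_iff)
    moreover have "y \<sqsubseteq> \<Squnion>B" if "y \<in> Lower L A" for y
    proof -
      have "y \<in> B" using that A unfolding Lower_def B_def by blast
      then show ?thesis using sup_rep(1)[OF B] is_lub_iff[OF B] by blast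
    qed
    ultimately show "\<exists>i. is_glb L i A"
      using sup_rep(2)[OF B] A by (intro exI[of _ "\<Squnion>B"] greatest_LowerI) auto
  qed
  fix x A assume x: "x \<in> carrier L" and A: "A \<subseteq> carrier L"
  have A': "(\<sqinter>) x ` A \<subseteq> carrier L" using meet_rep(1) x A by blast
  show "x \<sqinter> \<Squnion>A = \<Squnion>((\<sqinter>) x ` A)"
  proof (rule rep_inj)
    have "\<phi> (x \<sqinter> a) = \<phi> x \<inter> \<phi> a" if "a \<in> A" for a using that x A meet_rep(2) by blast
    then have "\<Union>(\<phi> ` (\<sqinter>) x ` A) = \<phi> x \<inter> \<Union>(\<phi> ` A)" by auto
    then show "\<phi> (x \<sqinter> \<Squnion>A) = \<phi> (\<Squnion>((\<sqinter>) x ` A))"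
      using x sup_rep[OF A] sup_rep[OF A'] meet_rep(2)[of x "\<Squnion>A"] by simp
  qed (use x sup_rep[OF A] sup_rep[OF A'] meet_rep(1) in auto)
qed

text \<open>Joins are unions, so finiteness of an element is the finite subcover property for covers by
  represented sets, and these form a basis.\<close>

lemma finite_elem_iff: "finite_elem L a \<longleftrightarrow> a \<in> carrier L \<and> compact_open X (\<phi> a)"
proof (cases "a \<in> carrier L")
  case True
  have "finite_elem L a \<longleftrightarrow> (\<forall>M\<subseteq>carrier L. \<phi> a = \<Union>(\<phi> ` M) \<longrightarrow> (\<exists>F\<subseteq>M. finite F \<and> \<phi> a = \<Union>(\<phi> ` F)))"
  proof -
    have eq: "a = \<Squnion>M \<longleftrightarrow> \<phi> a = \<Union>(\<phi> ` M)" if "M \<subseteq> carrier L" for M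
      using sup_rep[OF that] True rep_inj[of a "\<Squnion>M"] by auto
    have "F \<subseteq> M \<and> finite F \<and> a = \<Squnion>F \<longleftrightarrow> F \<subseteq> M \<and> finite F \<and> \<phi> a = \<Union>(\<phi> ` F)"
      if "M \<subseteq> carrier L" for F M using eq[of F] that by auto
    then show ?thesis unfolding finite_elem_def using True eq by simp
  qed
  also have "\<dots> \<longleftrightarrow> compactin X (\<phi> a)"
  proof
    assume fin: "\<forall>M\<subseteq>carrier L. \<phi> a = \<Union>(\<phi> ` M) \<longrightarrow> (\<exists>F\<subseteq>M. finite F \<and> \<phi> a = \<Union>(\<phi> ` F))"
    show "compactin X (\<phi> a)"
      unfolding compactin_def
    proof (intro conjI allI impI)
      show "\<phi> a \<subseteq> topspace X" using openin_subset[OF open_rep[OF True]] .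
      fix \<U> assume \<U>: "Ball \<U> (openin X) \<and> \<phi> a \<subseteq> \<Union>\<U>"
      \<comment> \<open>the open cover refined to represented sets\<close>
      define M where "M = {b \<in> carrier L. \<phi> b \<subseteq> \<phi> a \<and> (\<exists>U\<in>\<U>. \<phi> b \<subseteq> U)}"
      have "\<phi> a = \<Union>(\<phi> ` M)"
      proof
        show "\<phi> a \<subseteq> \<Union>(\<phi> ` M)"
        proof
          fix x assume x: "x \<in> \<phi> a"
          then obtain U where U: "U \<in> \<U>" "x \<in> U" using \<U> by blast
          have "openin X (\<phi> a \<inter> U)" using U \<U> open_rep[OF True] by blast
          then obtain b where "b \<in> carrier L" "x \<in> \<phi> b" "\<phi> b \<subseteq> \<phi> a \<inter> U" using basis x U by blast
          then show "x \<in> \<Union>(\<phi> ` M)" using U unfolding M_def by blast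
        qed
      qed (auto simp: M_def)
      moreover have "M \<subseteq> carrier L" by (auto simp: M_def)
      ultimately have "\<exists>F\<subseteq>M. finite F \<and> \<phi> a = \<Union>(\<phi> ` F)" using fin by simp
      then obtain F where F: "F \<subseteq> M" "finite F" "\<phi> a = \<Union>(\<phi> ` F)" by blast
      then have "\<forall>b\<in>F. \<exists>U. U \<in> \<U> \<and> \<phi> b \<subseteq> U" unfolding M_def by blast
      then obtain g where "\<forall>b\<in>F. g b \<in> \<U> \<and> \<phi> b \<subseteq> g b" by metis
      then show "\<exists>\<F>. finite \<F> \<and> \<F> \<subseteq> \<U> \<and> \<phi> a \<subseteq> \<Union>\<F>"
        using F by (intro exI[of _ "g ` F"]) auto
    qed
  next
    assume comp: "compactin X (\<phi> a)"
    show "\<forall>M\<subseteq>carrier L. \<phi> a = \<Union>(\<phi> ` M) \<longrightarrow> (\<exists>F\<subseteq>M. finite F \<and> \<phi> a = \<Union>(\<phi> ` F))"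
    proof (intro allI impI)
      fix M assume M: "M \<subseteq> carrier L" "\<phi> a = \<Union>(\<phi> ` M)"
      then have "Ball (\<phi> ` M) (openin X) \<and> \<phi> a \<subseteq> \<Union>(\<phi> ` M)" using open_rep by auto
      then have "\<exists>\<F>. finite \<F> \<and> \<F> \<subseteq> \<phi> ` M \<and> \<phi> a \<subseteq> \<Union>\<F>"
        using comp unfolding compactin_def by simp
      then obtain \<F> where \<F>: "finite \<F>" "\<F> \<subseteq> \<phi> ` M" "\<phi> a \<subseteq> \<Union>\<F>"
        by blast
      then obtain F where F: "F \<subseteq> M" "finite F" "\<F> = \<phi> ` F" by (meson finite_subset_image)
      then have "\<Union>(\<phi> ` F) \<subseteq> \<Union>(\<phi> ` M)" "\<phi> a \<subseteq> \<Union>(\<phi> ` F)" using \<F> by auto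
      then have "\<phi> a = \<Union>(\<phi> ` F)" using M by simp
      with F show "\<exists>F\<subseteq>M. finite F \<and> \<phi> a = \<Union>(\<phi> ` F)" by blast
    qed
  qed
  finally show ?thesis using True open_rep by (simp add: compact_open_def)
qed (simp add: finite_elem_def)

text \<open>Finite elements are the compact open sets, so coherence of the frame and spectrality of a
  sober space are the same condition.\<close>

lemma coherent_frame_iff_spectral:
  assumes "sober_space X"
  shows "coherent_frame L \<longleftrightarrow> spectral_space X"
proof
  assume coh: "coherent_frame L"
  have fin_Int: "compact_open X (U \<inter> V)" if U: "compact_open X U" and V: "compact_open X V" for U V
  proof -
    obtain a b where ab: "a \<in> carrier L" "\<phi> a = U" "b \<in> carrier L" "\<phi> b = V"
      using full U V unfolding compact_open_def by metis
    then have "finite_elem L a" "finite_elem L b" using U V finite_elem_iff by auto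
    then have "finite_elem L (a \<sqinter> b)" using coh unfolding coherent_frame_def by blast
    then show ?thesis using ab meet_rep(2)[of a b] unfolding finite_elem_iff by auto
  qed
  show "spectral_space X"
    unfolding spectral_space_def
  proof (intro conjI exI[of _ "Collect (compact_open X)"])
    show "openin X = arbitrary union_of (\<lambda>U. U \<in> Collect (compact_open X))"
    proof (intro ext iffI)
      fix U assume "openin X U"
      then obtain a where a: "a \<in> carrier L" "\<phi> a = U" using full by blast
      then obtain M where M: "\<forall>x\<in>M. finite_elem L x" "a = \<Squnion>M" using coh unfolding coherent_frame_def by blast
      then have "M \<subseteq> carrier L" by (auto simp: finite_elem_def)
      then have "U = \<Union>(\<phi> ` M)" using sup_rep M a by blast
      then show "(arbitrary union_of (\<lambda>U. U \<in> Collect (compact_open X))) U"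
        using M unfolding finite_elem_iff by (auto simp: union_of_def arbitrary_def intro!: exI[of _ "\<phi> ` M"])
    next
      fix U assume "(arbitrary union_of (\<lambda>U. U \<in> Collect (compact_open X))) U"
      then show "openin X U" by (auto simp: union_of_def arbitrary_def compact_open_def)
    qed
    show "\<forall>\<F>\<subseteq>Collect (compact_open X). finite \<F> \<and> \<F> \<noteq> {} \<longrightarrow> \<Inter>\<F> \<in> Collect (compact_open X)"
    proof (intro allI impI)
      fix \<F> assume "\<F> \<subseteq> Collect (compact_open X)" "finite \<F> \<and> \<F> \<noteq> {}"
      then have "finite \<F>" "\<F> \<noteq> {}" "\<F> \<subseteq> Collect (compact_open X)" by auto
      then show "\<Inter>\<F> \<in> Collect (compact_open X)"
        by (induction \<F> rule: finite_ne_induct) (auto intro: fin_Int)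
    qed
  qed (use assms in auto)
next
  assume "spectral_space X"
  then obtain \<B> where \<B>': "\<forall>K\<in>\<B>. compact_open X K"
      "openin X = arbitrary union_of (\<lambda>U. U \<in> \<B>)"
      "\<forall>\<F>\<subseteq>\<B>. finite \<F> \<and> \<F> \<noteq> {} \<longrightarrow> \<Inter>\<F> \<in> \<B>"
    unfolding spectral_space_def by (elim conjE exE)
  have \<B>: "\<And>K. K \<in> \<B> \<Longrightarrow> compact_open X K"
      "openin X = arbitrary union_of (\<lambda>U. U \<in> \<B>)"
      "\<And>\<F>. \<F> \<subseteq> \<B> \<Longrightarrow> finite \<F> \<Longrightarrow> \<F> \<noteq> {} \<Longrightarrow> \<Inter>\<F> \<in> \<B>"
    using \<B>' by simp_all
  have cover: "\<exists>\<U>\<subseteq>\<B>. U = \<Union>\<U>" if "openin X U" for U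
    using that unfolding \<B>(2) by (auto simp: union_of_def arbitrary_def)
  have cover_fin: "\<exists>\<U>\<subseteq>\<B>. finite \<U> \<and> U = \<Union>\<U>" if U: "compact_open X U" for U
  proof -
    obtain \<U> where \<U>: "\<U> \<subseteq> \<B>" "U = \<Union>\<U>" using cover U unfolding compact_open_def by blast
    then have "Ball \<U> (openin X) \<and> U \<subseteq> \<Union>\<U>" using \<B>(1) unfolding compact_open_def by blast
    then obtain \<F> where "finite \<F>" "\<F> \<subseteq> \<U>" "U \<subseteq> \<Union>\<F>"
      using U unfolding compact_open_def compactin_def by meson
    then show ?thesis using \<U> by (intro exI[of _ \<F>]) blast
  qed
  have fin_Int: "compact_open X (U \<inter> V)" if U: "compact_open X U" and V: "compact_open X V" for U V
  proof -
    obtain \<U> \<V> where UV: "\<U> \<subseteq> \<B>" "finite \<U>" "U = \<Union>\<U>" "\<V> \<subseteq> \<B>" "finite \<V>" "V = \<Union>\<V>"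
      using cover_fin U V by meson
    have "U \<inter> V = \<Union>((\<lambda>(A, B). A \<inter> B) ` (\<U> \<times> \<V>))" using UV by auto
    moreover have "compactin X (A \<inter> B)" if "A \<in> \<U>" "B \<in> \<V>" for A B
      using \<B>(3)[of "{A, B}"] \<B>(1) that UV unfolding compact_open_def by auto
    then have "compactin X (\<Union>((\<lambda>(A, B). A \<inter> B) ` (\<U> \<times> \<V>)))"
      using UV by (intro compactin_Union) auto
    moreover have "openin X (U \<inter> V)" using U V by (simp add: compact_open_def openin_Int)
    ultimately show ?thesis unfolding compact_open_def by simp
  qed
  show "coherent_frame L"
    unfolding coherent_frame_def
  proof (intro conjI ballI allI impI)
    fix a assume a: "a \<in> carrier L"
    obtain \<U> where \<U>: "\<U> \<subseteq> \<B>" "\<phi> a = \<Union>\<U>" using cover[OF open_rep[OF a]] by metis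
    define M where "M = {b \<in> carrier L. \<phi> b \<in> \<U>}"
    have "M \<subseteq> carrier L" by (auto simp: M_def)
    have "\<exists>b\<in>carrier L. \<phi> b = U" if "U \<in> \<U>" for U
      using that \<U>(1) \<B>(1)[of U] full[of U] by (auto simp: compact_open_def)
    then have "\<phi> ` M = \<U>" by (force simp: M_def)
    then have "is_lub L a M" using \<U> a is_lub_iff_Union \<open>M \<subseteq> carrier L\<close> by simp
    then have "a = \<Squnion>M" using sup_eqI by blast
    moreover have "\<forall>b\<in>M. finite_elem L b" using \<U>(1) \<B>(1) unfolding M_def finite_elem_iff by auto
    ultimately show "\<exists>M. (\<forall>x\<in>M. finite_elem L x) \<and> a = \<Squnion>M" by blast
  next
    fix a b assume "finite_elem L a \<and> finite_elem L b"
    then show "finite_elem L (a \<sqinter> b)" unfolding finite_elem_iff using fin_Int meet_rep by simp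
  qed
qed

end

interpretation two: partial_order two_frame
  by unfold_locales (auto simp: two_frame_def)

lemma two_frame_simps [simp]: "carrier two_frame = UNIV" "x \<sqsubseteq>\<^bsub>two_frame\<^esub> y \<longleftrightarrow> x \<le> y"
  by (auto simp: two_frame_def)

lemma two_frame_ops:
  "\<Squnion>\<^bsub>two_frame\<^esub>A \<longleftrightarrow> True \<in> A" "x \<sqinter>\<^bsub>two_frame\<^esub> y \<longleftrightarrow> x \<and> y" "\<top>\<^bsub>two_frame\<^esub>"
proof -
  show "\<Squnion>\<^bsub>two_frame\<^esub>A \<longleftrightarrow> True \<in> A"
    by (rule two.sup_eqI) (subst is_lub_iff, auto simp: le_bool_def)
  show "x \<sqinter>\<^bsub>two_frame\<^esub> y \<longleftrightarrow> x \<and> y"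
    by (rule two.meet_eqI) (subst is_glb_iff, auto simp: le_bool_def)
  have "\<top>\<^bsub>two_frame\<^esub> = True" by (rule two.top_eqI) auto
  then show "\<top>\<^bsub>two_frame\<^esub>" by simp
qed

text \<open>Every point \<open>x\<close> of the space gives the frame map that sends \<open>a\<close> to \<open>x \<in> \<phi> a\<close>.\<close>

lemma (in full_representation) spatial_frame_rep: "spatial_frame L"
  unfolding spatial_frame_def
proof (rule inj_onI)
  fix a b assume ab: "a \<in> carrier L" "b \<in> carrier L"
    and eq: "{p. frame_hom L two_frame p \<and> p a} = {p. frame_hom L two_frame p \<and> p b}"
  have "frame_hom L two_frame (\<lambda>a. x \<in> \<phi> a)" if "x \<in> topspace X" for x
    unfolding frame_hom_def two_frame_ops
  proof (intro conjI ballI allI impI)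
    fix A assume "A \<subseteq> carrier L"
    then show "(x \<in> \<phi> (\<Squnion>A)) = (True \<in> (\<lambda>a. x \<in> \<phi> a) ` A)" using sup_rep(3) by auto
  qed (use that top_rep meet_rep two_frame_ops in auto)
  then have "x \<in> \<phi> a \<longleftrightarrow> x \<in> \<phi> b" if "x \<in> topspace X" for x
    using eq[THEN eqset_imp_iff, of "\<lambda>a. x \<in> \<phi> a"] that by simp
  then have "\<phi> a = \<phi> b" using openin_subset[OF open_rep] ab by (meson subset_antisym subset_iff)
  then show "a = b" using rep_inj ab by blast
qed

section \<open>Orders with enough points\<close>

definition enough_points :: "('a, 'm) gorder_scheme \<Rightarrow> bool" where
  "enough_points L \<longleftrightarrow>
     (\<forall>a\<in>carrier L. \<forall>b\<in>carrier L. \<not> a \<sqsubseteq>\<^bsub>L\<^esub> b \<longrightarrow> (\<exists>P. cp_filter L P \<and> a \<in> P \<and> b \<notin> P))"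

text \<open>Order is reflected because there are enough points. An open set \<open>U\<close> inside a basic one is
  represented by the join of all elements whose basic open set lies in \<open>U\<close>; by complete primality
  this join has no points outside \<open>U\<close>.\<close>

lemma (in partial_order) representation_point_space:
  assumes sep: "enough_points L"
    and lubs: "\<And>M z. M \<subseteq> carrier L \<Longrightarrow> z \<in> carrier L \<Longrightarrow> \<forall>y\<in>M. y \<sqsubseteq> z \<Longrightarrow> \<exists>x. is_lub L x M"
  shows "representation L (point_space L) (pts L)"
proof
  fix a b assume "a \<in> carrier L" "b \<in> carrier L"
  then show "a \<sqsubseteq> b \<longleftrightarrow> pts L a \<subseteq> pts L b"
    using sep cp_filter_up unfolding enough_points_def pts_def by (auto 4 3)
next
  fix U x assume U: "openin (point_space L) U" "x \<in> U"
  then obtain a where "cp_filter L x" "a \<in> x" "pts L a \<subseteq> U" using openin_point_space by blast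
  then show "\<exists>a\<in>carrier L. x \<in> pts L a \<and> pts L a \<subseteq> U"
    using cp_filter_carrier[of L x] by (intro bexI[of _ a]) (auto simp: pts_def)
next
  fix a U assume a: "a \<in> carrier L" and U: "openin (point_space L) U" "U \<subseteq> pts L a"
  define M where "M = {b \<in> carrier L. b \<sqsubseteq> a \<and> pts L b \<subseteq> U}"
  have M: "M \<subseteq> carrier L" by (auto simp: M_def)
  obtain b where b: "is_lub L b M" using lubs[OF M a] by (auto simp: M_def)
  then have bc: "b \<in> carrier L" and ub: "\<forall>y\<in>M. y \<sqsubseteq> b" using is_lub_iff[OF M] by blast+
  have "pts L b = U"
  proof
    show "pts L b \<subseteq> U"
    proof
      fix P assume "P \<in> pts L b"
      then have P: "cp_filter L P" "b \<in> P" by (auto simp: pts_def)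
      then obtain c where "c \<in> M" "c \<in> P" using cp_filter_lub[OF P(1) M b P(2)] by blast
      then show "P \<in> U" using P by (auto simp: M_def pts_def)
    qed
    show "U \<subseteq> pts L b"
    proof
      fix P assume PU: "P \<in> U"
      then obtain c where P: "cp_filter L P" "c \<in> P" "pts L c \<subseteq> U" using U openin_point_space by blast
      have "a \<in> P" using PU U by (auto simp: pts_def)
      then obtain d where d: "d \<in> P" "d \<sqsubseteq> a" "d \<sqsubseteq> c"
        using cp_filter_down[OF P(1) _ P(2)] by blast
      have cd: "c \<in> carrier L" "d \<in> carrier L" using P d cp_filter_carrier[OF P(1)] by blast+
      then have "pts L d \<subseteq> pts L c" using d cp_filter_up unfolding pts_def by fast
      then have "d \<in> M" using d cd P by (auto simp: M_def)
      then have "b \<in> P" using ub cp_filter_up[OF P(1) d(1) _ bc] by blast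
      then show "P \<in> pts L b" using P by (simp add: pts_def)
    qed
  qed
  then show "\<exists>b\<in>carrier L. pts L b = U" using bc by blast
qed (rule openin_pts)

lemma (in representation) full_representationI:
  assumes "t \<in> carrier L" "topspace X \<subseteq> \<phi> t"
  shows "full_representation L X \<phi>"
  by unfold_locales (use down[OF assms(1)] assms openin_subset in blast)

lemma frame_is_complete_lattice: "frame L \<Longrightarrow> complete_lattice L"
  by (simp add: frame_def)

text \<open>If \<open>a \<sqsubseteq> b\<close> fails, then \<open>a\<close> differs from \<open>a \<sqinter> b\<close>, and a frame map that tells these two apart is true
  at \<open>a\<close> and false at \<open>b\<close>.\<close>

lemma spatial_frame_enough_points:
  assumes fr: "frame L" and sp: "spatial_frame L"
  shows "enough_points L"
  unfolding enough_points_def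
proof (intro ballI impI)
  interpret complete_lattice L using frame_is_complete_lattice[OF fr] .
  fix a b assume ab: "a \<in> carrier L" "b \<in> carrier L" and nle: "\<not> a \<sqsubseteq>\<^bsub>L\<^esub> b"
  have m: "a \<sqinter>\<^bsub>L\<^esub> b \<in> carrier L" using ab by simp
  have "a \<sqinter>\<^bsub>L\<^esub> b \<noteq> a" using nle ab meet_right by metis
  then have "{p. frame_hom L two_frame p \<and> p a} \<noteq> {p. frame_hom L two_frame p \<and> p (a \<sqinter>\<^bsub>L\<^esub> b)}"
    using inj_onD[OF sp[unfolded spatial_frame_def] _ ab(1) m] by auto
  then obtain p where p: "frame_hom L two_frame p" "p a \<noteq> p (a \<sqinter>\<^bsub>L\<^esub> b)" by blast
  have pm: "p (x \<sqinter>\<^bsub>L\<^esub> y) \<longleftrightarrow> p x \<and> p y" if "x \<in> carrier L" "y \<in> carrier L" for x y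
    using p(1) that unfolding frame_hom_def two_frame_ops by blast
  define P where "P = {x \<in> carrier L. p x}"
  have le: "p y" if "p x" "x \<sqsubseteq>\<^bsub>L\<^esub> y" "x \<in> carrier L" "y \<in> carrier L" for x y
  proof -
    have "x \<sqinter>\<^bsub>L\<^esub> y = x" using that le_iff_join[of x y] by simp
    then show ?thesis using pm that by metis
  qed
  have "cp_filter L P"
    unfolding cp_filter_def
  proof (intro conjI ballI allI impI)
    show "P \<noteq> {}" using p pm ab by (auto simp: P_def)
    fix x y assume xy: "x \<in> P" "y \<in> P"
    then show "\<exists>c\<in>P. c \<sqsubseteq>\<^bsub>L\<^esub> x \<and> c \<sqsubseteq>\<^bsub>L\<^esub> y"
      using pm meet_left meet_right by (intro bexI[of _ "x \<sqinter>\<^bsub>L\<^esub> y"]) (auto simp: P_def)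
  next
    fix M x assume M: "M \<subseteq> carrier L" "x \<in> P" "is_lub L x M"
    then have "p (\<Squnion>\<^bsub>L\<^esub>M)" using sup_eqI by (auto simp: P_def)
    then have "True \<in> p ` M" using p(1) M unfolding frame_hom_def two_frame_ops by blast
    then show "M \<inter> P \<noteq> {}" using M by (auto simp: P_def)
  qed (auto simp: P_def intro: le)
  moreover have "a \<in> P" "b \<notin> P" using p pm ab by (auto simp: P_def)
  ultimately show "\<exists>P. cp_filter L P \<and> a \<in> P \<and> b \<notin> P" by blast
qed

text \<open>If \<open>a \<sqsubseteq> b\<close> fails at a finite element \<open>k\<close>, the elements above \<open>b\<close> but not above \<open>k\<close> have a maximal
  member \<open>m\<close>, because \<open>k\<close> is not below the join of a chain unless it is below a member. By
  distributivity \<open>m\<close> is prime, and the elements not below it are the required filter.\<close>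

lemma algebraic_frame_enough_points:
  assumes fr: "frame L"
    and alg: "\<And>a b. a \<in> carrier L \<Longrightarrow> b \<in> carrier L \<Longrightarrow> \<not> a \<sqsubseteq>\<^bsub>L\<^esub> b \<Longrightarrow>
      \<exists>k. finite_elem L k \<and> k \<sqsubseteq>\<^bsub>L\<^esub> a \<and> \<not> k \<sqsubseteq>\<^bsub>L\<^esub> b"
  shows "enough_points L"
  unfolding enough_points_def
proof (intro ballI impI)
  interpret complete_lattice L using frame_is_complete_lattice[OF fr] .
  have distrib: "x \<sqinter>\<^bsub>L\<^esub> \<Squnion>\<^bsub>L\<^esub>A = \<Squnion>\<^bsub>L\<^esub>((\<lambda>a. x \<sqinter>\<^bsub>L\<^esub> a) ` A)" if "x \<in> carrier L" "A \<subseteq> carrier L" for x A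
    using fr that unfolding frame_def by blast
  have sup_le: "\<Squnion>\<^bsub>L\<^esub>A \<sqsubseteq>\<^bsub>L\<^esub> z" if "A \<subseteq> carrier L" "z \<in> carrier L" "\<And>y. y \<in> A \<Longrightarrow> y \<sqsubseteq>\<^bsub>L\<^esub> z" for A z
    using that by (intro sup_least) (auto simp: Upper_def)
  fix a b assume ab: "a \<in> carrier L" "b \<in> carrier L" "\<not> a \<sqsubseteq>\<^bsub>L\<^esub> b"
  then obtain k where k: "finite_elem L k" "k \<sqsubseteq>\<^bsub>L\<^esub> a" "\<not> k \<sqsubseteq>\<^bsub>L\<^esub> b" using alg by blast
  then have kc: "k \<in> carrier L" by (simp add: finite_elem_def)
  define A where "A = {x \<in> carrier L. b \<sqsubseteq>\<^bsub>L\<^esub> x \<and> \<not> k \<sqsubseteq>\<^bsub>L\<^esub> x}"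
  have "\<exists>m\<in>A. \<forall>x\<in>A. m \<sqsubseteq>\<^bsub>L\<^esub> x \<longrightarrow> x = m"
  proof (rule predicate_Zorn)
    show "partial_order_on A (relation_of (\<sqsubseteq>\<^bsub>L\<^esub>) A)"
      by (rule partial_order_on_relation_ofI) (auto simp: A_def intro: le_trans)
    fix C assume C: "C \<in> Chains (relation_of (\<sqsubseteq>\<^bsub>L\<^esub>) A)"
    then have CA: "C \<subseteq> A" using Chains_relation_of by blast
    have chain: "x \<sqsubseteq>\<^bsub>L\<^esub> y \<or> y \<sqsubseteq>\<^bsub>L\<^esub> x" if "x \<in> C" "y \<in> C" for x y
      using C that unfolding Chains_def relation_of_def by blast
    \<comment> \<open>adjoining \<open>b\<close> makes the chain non-empty\<close>
    let ?C = "insert b C"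
    have Cc: "?C \<subseteq> carrier L" using CA ab unfolding A_def by blast
    have bC: "b \<sqsubseteq>\<^bsub>L\<^esub> x" if "x \<in> ?C" for x using that CA ab unfolding A_def by auto
    have top_of_fin: "\<exists>g\<in>?C. \<forall>x\<in>G. x \<sqsubseteq>\<^bsub>L\<^esub> g" if "finite G" "G \<subseteq> ?C" for G
      using that
    proof (induction G rule: finite_induct)
      case (insert y G)
      then obtain g where g: "g \<in> ?C" "\<forall>x\<in>G. x \<sqsubseteq>\<^bsub>L\<^esub> g" by auto
      have y: "y \<in> ?C" using insert by auto
      have "y \<sqsubseteq>\<^bsub>L\<^esub> g \<or> g \<sqsubseteq>\<^bsub>L\<^esub> y" using chain bC y g by blast
      then show ?case
      proof
        assume "g \<sqsubseteq>\<^bsub>L\<^esub> y"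
        then have "x \<sqsubseteq>\<^bsub>L\<^esub> y" if "x \<in> insert y G" for x
        proof (cases "x = y")
          case False
          then have "x \<sqsubseteq>\<^bsub>L\<^esub> g" "x \<in> carrier L" "y \<in> carrier L" "g \<in> carrier L"
            using that g y insert.prems Cc by auto
          then show ?thesis using le_trans[of x g y] \<open>g \<sqsubseteq>\<^bsub>L\<^esub> y\<close> by blast
        qed (use y Cc in auto)
        then show ?case using y by blast
      qed (use g in auto)
    qed auto
    have "\<not> k \<sqsubseteq>\<^bsub>L\<^esub> \<Squnion>\<^bsub>L\<^esub>?C"
    proof
      assume "k \<sqsubseteq>\<^bsub>L\<^esub> \<Squnion>\<^bsub>L\<^esub>?C"
      then have "k = k \<sqinter>\<^bsub>L\<^esub> \<Squnion>\<^bsub>L\<^esub>?C" using le_iff_join kc Cc by simp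
      then have "k = \<Squnion>\<^bsub>L\<^esub>((\<lambda>c. k \<sqinter>\<^bsub>L\<^esub> c) ` ?C)" using distrib[OF kc Cc] by simp
      moreover have "(\<lambda>c. k \<sqinter>\<^bsub>L\<^esub> c) ` ?C \<subseteq> carrier L" using kc Cc by auto
      ultimately have "\<exists>F\<subseteq>(\<lambda>c. k \<sqinter>\<^bsub>L\<^esub> c) ` ?C. finite F \<and> k = \<Squnion>\<^bsub>L\<^esub>F"
        using k(1) unfolding finite_elem_def by blast
      then obtain F where F: "F \<subseteq> (\<lambda>c. k \<sqinter>\<^bsub>L\<^esub> c) ` ?C" "finite F" "k = \<Squnion>\<^bsub>L\<^esub>F" by blast
      then obtain G where G: "G \<subseteq> ?C" "finite G" "F = (\<lambda>c. k \<sqinter>\<^bsub>L\<^esub> c) ` G" by (meson finite_subset_image)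
      then obtain g where g: "g \<in> ?C" "\<forall>x\<in>G. x \<sqsubseteq>\<^bsub>L\<^esub> g" using top_of_fin by blast
      have gc: "g \<in> carrier L" using g Cc by blast
      have "k \<sqinter>\<^bsub>L\<^esub> x \<sqsubseteq>\<^bsub>L\<^esub> g" if "x \<in> G" for x
      proof -
        have "x \<in> carrier L" "x \<sqsubseteq>\<^bsub>L\<^esub> g" using that G g Cc by auto
        then show ?thesis using meet_right[OF kc, of x] kc gc by (meson le_trans meet_closed)
      qed
      then have "y \<sqsubseteq>\<^bsub>L\<^esub> g" if "y \<in> F" for y using that G(3) by auto
      moreover have "F \<subseteq> carrier L"
        unfolding G(3) using G(1) Cc kc by (intro image_subsetI meet_closed) auto
      ultimately have "\<Squnion>\<^bsub>L\<^esub>F \<sqsubseteq>\<^bsub>L\<^esub> g" using sup_le gc by simp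
      then have "k \<sqsubseteq>\<^bsub>L\<^esub> g" using F(3) by simp
      then show False using g CA k unfolding A_def by auto
    qed
    moreover have le: "c \<sqsubseteq>\<^bsub>L\<^esub> \<Squnion>\<^bsub>L\<^esub>?C" if "c \<in> ?C" for c using that Cc by (rule_tac sup_upper) auto
    ultimately have "\<Squnion>\<^bsub>L\<^esub>?C \<in> A" using Cc unfolding A_def by auto
    then show "\<exists>u\<in>A. \<forall>a\<in>C. a \<sqsubseteq>\<^bsub>L\<^esub> u" using le by blast
  qed
  then obtain m where m: "m \<in> carrier L" "b \<sqsubseteq>\<^bsub>L\<^esub> m" "\<not> k \<sqsubseteq>\<^bsub>L\<^esub> m"
      and max: "\<forall>x\<in>A. m \<sqsubseteq>\<^bsub>L\<^esub> x \<longrightarrow> x = m" unfolding A_def by blast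
  have above: "k \<sqsubseteq>\<^bsub>L\<^esub> m \<squnion>\<^bsub>L\<^esub> x" if x: "x \<in> carrier L" "\<not> x \<sqsubseteq>\<^bsub>L\<^esub> m" for x
  proof (rule ccontr)
    assume "\<not> k \<sqsubseteq>\<^bsub>L\<^esub> m \<squnion>\<^bsub>L\<^esub> x"
    moreover have "b \<sqsubseteq>\<^bsub>L\<^esub> m \<squnion>\<^bsub>L\<^esub> x" using m ab x join_left by (meson join_closed le_trans)
    ultimately have "m \<squnion>\<^bsub>L\<^esub> x \<in> A" using m x by (simp add: A_def)
    then have "m \<squnion>\<^bsub>L\<^esub> x = m" using max m x join_left by blast
    then show False using x m join_right by metis
  qed
  have split: "y \<sqsubseteq>\<^bsub>L\<^esub> m" if y: "y \<in> carrier L" "x \<in> carrier L" "y \<sqsubseteq>\<^bsub>L\<^esub> m \<squnion>\<^bsub>L\<^esub> x" "y \<sqinter>\<^bsub>L\<^esub> x \<sqsubseteq>\<^bsub>L\<^esub> m" for x y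
  proof -
    have "y = y \<sqinter>\<^bsub>L\<^esub> \<Squnion>\<^bsub>L\<^esub>{m, x}" using le_iff_join[of y "m \<squnion>\<^bsub>L\<^esub> x"] y m by (simp add: join_def)
    also have "\<dots> = \<Squnion>\<^bsub>L\<^esub>{y \<sqinter>\<^bsub>L\<^esub> m, y \<sqinter>\<^bsub>L\<^esub> x}" using distrib[of y "{m, x}"] y m by simp
    also have "\<dots> \<sqsubseteq>\<^bsub>L\<^esub> m" using y m meet_right by (intro sup_le) auto
    finally show ?thesis .
  qed
  define P where "P = {x \<in> carrier L. \<not> x \<sqsubseteq>\<^bsub>L\<^esub> m}"
  have "cp_filter L P"
    unfolding cp_filter_def
  proof (intro conjI ballI allI impI)
    show "P \<noteq> {}" using kc m by (auto simp: P_def)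
    fix x y assume "x \<in> P" "y \<in> P"
    then have x: "x \<in> carrier L" "\<not> x \<sqsubseteq>\<^bsub>L\<^esub> m" and y: "y \<in> carrier L" "\<not> y \<sqsubseteq>\<^bsub>L\<^esub> m" by (auto simp: P_def)
    have "\<not> x \<sqinter>\<^bsub>L\<^esub> y \<sqsubseteq>\<^bsub>L\<^esub> m"
    proof
      assume xy: "x \<sqinter>\<^bsub>L\<^esub> y \<sqsubseteq>\<^bsub>L\<^esub> m"
      have kx: "k \<sqinter>\<^bsub>L\<^esub> x \<in> carrier L" using kc x by simp
      have "k \<sqinter>\<^bsub>L\<^esub> x \<sqsubseteq>\<^bsub>L\<^esub> m \<squnion>\<^bsub>L\<^esub> y" 
        by (rule le_trans[OF meet_left[OF kc x(1)] above[OF y]]) (use kx kc m y in auto)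
      moreover have "(k \<sqinter>\<^bsub>L\<^esub> x) \<sqinter>\<^bsub>L\<^esub> y \<sqsubseteq>\<^bsub>L\<^esub> m"
      proof (rule le_trans[OF _ xy])
        have kxy: "(k \<sqinter>\<^bsub>L\<^esub> x) \<sqinter>\<^bsub>L\<^esub> y \<in> carrier L" using meet_closed[OF kx y(1)] .
        have "(k \<sqinter>\<^bsub>L\<^esub> x) \<sqinter>\<^bsub>L\<^esub> y \<sqsubseteq>\<^bsub>L\<^esub> x"
          using le_trans[OF meet_left[OF kx y(1)] meet_right[OF kc x(1)] kxy kx x(1)] .
        from meet_le[OF this meet_right[OF kx y(1)] x(1) y(1) kxy]
        show "(k \<sqinter>\<^bsub>L\<^esub> x) \<sqinter>\<^bsub>L\<^esub> y \<sqsubseteq>\<^bsub>L\<^esub> x \<sqinter>\<^bsub>L\<^esub> y" .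
        show "(k \<sqinter>\<^bsub>L\<^esub> x) \<sqinter>\<^bsub>L\<^esub> y \<in> carrier L" by (rule kxy)
        show "x \<sqinter>\<^bsub>L\<^esub> y \<in> carrier L" using meet_closed[OF x(1) y(1)] .
      qed (rule m(1))
      ultimately have "k \<sqinter>\<^bsub>L\<^esub> x \<sqsubseteq>\<^bsub>L\<^esub> m" using split[OF kx y(1)] by blast
      then have "k \<sqsubseteq>\<^bsub>L\<^esub> m" using split[OF kc x(1) above[OF x]] by blast
      then show False using m by blast
    qed
    then show "\<exists>c\<in>P. c \<sqsubseteq>\<^bsub>L\<^esub> x \<and> c \<sqsubseteq>\<^bsub>L\<^esub> y"
      using x y meet_left meet_right by (intro bexI[of _ "x \<sqinter>\<^bsub>L\<^esub> y"]) (auto simp: P_def)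
  next
    fix M x assume M: "M \<subseteq> carrier L" "x \<in> P" "is_lub L x M"
    show "M \<inter> P \<noteq> {}"
    proof
      assume "M \<inter> P = {}"
      then have "\<forall>y\<in>M. y \<sqsubseteq>\<^bsub>L\<^esub> m" using M(1) by (auto simp: P_def)
      then have "x \<sqsubseteq>\<^bsub>L\<^esub> m" using M(3) m(1) by (simp add: is_lub_iff[OF M(1)])
      then show False using M(2) by (simp add: P_def)
    qed
  next
    fix x y assume "x \<in> P" "y \<in> carrier L" "x \<sqsubseteq>\<^bsub>L\<^esub> y"
    then show "y \<in> P" using m(1) le_trans[of x y m] by (auto simp: P_def)
  qed (auto simp: P_def)
  moreover have "a \<in> P" using ab k kc m le_trans[of k a m] by (auto simp: P_def)
  moreover have "b \<notin> P" using m by (simp add: P_def)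
  ultimately show "\<exists>P. cp_filter L P \<and> a \<in> P \<and> b \<notin> P" by blast
qed

section \<open>Restriction monoids\<close>

lemma nat_order_simps [simp]:
  "carrier (nat_order S) = carrier S" "x \<sqsubseteq>\<^bsub>nat_order S\<^esub> y \<longleftrightarrow> nat_le S x y" "x .=\<^bsub>nat_order S\<^esub> y \<longleftrightarrow> x = y"
  by (simp_all add: nat_order_def)

lemma proj_order_simps [simp]:
  "carrier (proj_order S) = proj S" "x \<sqsubseteq>\<^bsub>proj_order S\<^esub> y \<longleftrightarrow> nat_le S x y" "x .=\<^bsub>proj_order S\<^esub> y \<longleftrightarrow> x = y"
  by (simp_all add: proj_order_def)

locale rmon = monoid S for S :: "'a rmonoid" (structure) +
  assumes restriction: "restriction_monoid S"
begin

abbreviation nat_le_S (infix "\<preceq>" 50) where "a \<preceq> b \<equiv> nat_le S a b"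

lemma proj_carrier [simp, intro]: "f \<in> proj S \<Longrightarrow> f \<in> carrier S"
  and proj_idem [simp]: "f \<in> proj S \<Longrightarrow> f \<otimes> f = f"
  and proj_mult [simp, intro]: "f \<in> proj S \<Longrightarrow> g \<in> proj S \<Longrightarrow> f \<otimes> g \<in> proj S"
  and proj_comm: "f \<in> proj S \<Longrightarrow> g \<in> proj S \<Longrightarrow> f \<otimes> g = g \<otimes> f"
  and lam_in_proj [simp, intro]: "a \<in> carrier S \<Longrightarrow> lam S a \<in> proj S"
  and rho_in_proj [simp, intro]: "a \<in> carrier S \<Longrightarrow> rho S a \<in> proj S"
  and lam_proj [simp]: "f \<in> proj S \<Longrightarrow> lam S f = f"
  and rho_proj [simp]: "f \<in> proj S \<Longrightarrow> rho S f = f"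
  and mult_lam [simp]: "a \<in> carrier S \<Longrightarrow> a \<otimes> lam S a = a"
  and rho_mult [simp]: "a \<in> carrier S \<Longrightarrow> rho S a \<otimes> a = a"
  and lam_lam_mult: "a \<in> carrier S \<Longrightarrow> b \<in> carrier S \<Longrightarrow> lam S (lam S a \<otimes> b) = lam S (a \<otimes> b)"
  and rho_mult_rho: "a \<in> carrier S \<Longrightarrow> b \<in> carrier S \<Longrightarrow> rho S (a \<otimes> rho S b) = rho S (a \<otimes> b)"
  and proj_swap: "a \<in> carrier S \<Longrightarrow> f \<in> proj S \<Longrightarrow> a \<otimes> lam S (f \<otimes> a) = f \<otimes> a"
  and swap_proj: "a \<in> carrier S \<Longrightarrow> f \<in> proj S \<Longrightarrow> rho S (a \<otimes> f) \<otimes> a = a \<otimes> f"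
  using restriction unfolding restriction_monoid_def ehresmann_monoid_def by (auto simp: Pi_iff)

lemma lam_mult_proj: "a \<in> carrier S \<Longrightarrow> f \<in> proj S \<Longrightarrow> lam S (a \<otimes> f) = lam S a \<otimes> f"
  using lam_lam_mult[of a f] by simp

lemma one_in_proj [simp, intro]: "\<one> \<in> proj S"
  using mult_lam[OF one_closed] lam_in_proj[OF one_closed] l_one[of "lam S \<one>"] by (metis proj_carrier)

text \<open>If \<open>a\<close> is any restriction of \<open>b\<close> at all, it is the restriction to \<open>\<lambda>(a)\<close>, so the existential
  quantifiers in the natural order can be replaced by one equation.\<close>

lemma nat_le_iff_lam:
  assumes "a \<in> carrier S" "b \<in> carrier S"
  shows "a \<preceq> b \<longleftrightarrow> b \<otimes> lam S a = a"
proof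
  assume "a \<preceq> b"
  then obtain f where f: "f \<in> proj S" "a = b \<otimes> f" unfolding nat_le_def by blast
  then have "b \<otimes> lam S a = b \<otimes> (lam S b \<otimes> f)" using assms lam_mult_proj by simp
  also have "\<dots> = (b \<otimes> lam S b) \<otimes> f" using f assms m_assoc[of b "lam S b" f] by simp
  finally show "b \<otimes> lam S a = a" using f assms by simp
next
  assume "b \<otimes> lam S a = a"
  then have "a = rho S (b \<otimes> lam S a) \<otimes> b" "a = b \<otimes> lam S a"
    using swap_proj[of b "lam S a"] assms by auto
  then show "a \<preceq> b" unfolding nat_le_def using assms by (metis lam_in_proj rho_in_proj)
qed

lemma nat_leD: "a \<preceq> b \<Longrightarrow> a \<in> carrier S \<Longrightarrow> b \<in> carrier S \<Longrightarrow> b \<otimes> lam S a = a"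
  by (simp add: nat_le_iff_lam)

lemma mult_proj_le: "a \<in> carrier S \<Longrightarrow> f \<in> proj S \<Longrightarrow> a \<otimes> f \<preceq> a"
  unfolding nat_le_def using swap_proj by (metis proj_carrier m_closed rho_in_proj)

lemma proj_mult_le: "a \<in> carrier S \<Longrightarrow> f \<in> proj S \<Longrightarrow> f \<otimes> a \<preceq> a"
  unfolding nat_le_def using proj_swap by (metis proj_carrier m_closed lam_in_proj)

lemma nat_le_refl [simp]: "a \<in> carrier S \<Longrightarrow> a \<preceq> a"
  by (simp add: nat_le_iff_lam)

lemma nat_le_trans:
  assumes "a \<preceq> b" "b \<preceq> c" "a \<in> carrier S" "b \<in> carrier S" "c \<in> carrier S"
  shows "a \<preceq> c"
proof -
  have "a = c \<otimes> (lam S b \<otimes> lam S a)" using assms nat_leD[of a b] nat_leD[of b c] by (simp flip: m_assoc)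
  then show ?thesis using assms mult_proj_le[of c "lam S b \<otimes> lam S a"] by simp
qed

lemma nat_le_antisym:
  assumes "a \<preceq> b" "b \<preceq> a" "a \<in> carrier S" "b \<in> carrier S"
  shows "a = b"
proof -
  have "a = a \<otimes> (lam S b \<otimes> lam S a)" using assms nat_leD[of a b] nat_leD[of b a] by (simp flip: m_assoc)
  also have "\<dots> = (a \<otimes> lam S a) \<otimes> lam S b"
    using assms proj_comm[of "lam S b" "lam S a"] m_assoc[of a "lam S a" "lam S b"] by simp
  also have "\<dots> = b" using assms nat_leD[of b a] by simp
  finally show ?thesis .
qed

lemma mult_mono:
  assumes "a \<preceq> b" "c \<preceq> d" "a \<in> carrier S" "b \<in> carrier S" "c \<in> carrier S" "d \<in> carrier S"
  shows "a \<otimes> c \<preceq> b \<otimes> d"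
proof -
  have "a \<otimes> c = b \<otimes> lam S a \<otimes> (d \<otimes> lam S c)" using assms nat_leD by simp
  also have "\<dots> = b \<otimes> (lam S a \<otimes> d) \<otimes> lam S c" using assms by (simp add: m_assoc)
  also have "\<dots> = b \<otimes> (d \<otimes> lam S (lam S a \<otimes> d)) \<otimes> lam S c" using assms proj_swap by simp
  also have "\<dots> = (b \<otimes> d) \<otimes> (lam S (lam S a \<otimes> d) \<otimes> lam S c)" using assms by (simp add: m_assoc)
  finally show ?thesis using assms mult_proj_le by simp
qed

lemma lam_mono:
  assumes "a \<preceq> b" "a \<in> carrier S" "b \<in> carrier S"
  shows "lam S a \<preceq> lam S b"
proof -
  have "lam S a = lam S b \<otimes> lam S a"
    using arg_cong[OF nat_leD[OF assms], of "lam S"] assms lam_mult_proj[of b "lam S a"] by simp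
  then show ?thesis using assms mult_proj_le[of "lam S b" "lam S a"] by simp
qed

lemma proj_le_iff: "e \<in> proj S \<Longrightarrow> f \<in> proj S \<Longrightarrow> e \<preceq> f \<longleftrightarrow> f \<otimes> e = e"
  by (simp add: nat_le_iff_lam)

lemma le_proj_in_proj: "a \<preceq> f \<Longrightarrow> a \<in> carrier S \<Longrightarrow> f \<in> proj S \<Longrightarrow> a \<in> proj S"
  using nat_leD[of a f] by (metis proj_carrier proj_mult lam_in_proj)

lemma mult_proj_mono:
  "e \<preceq> f \<Longrightarrow> a \<in> carrier S \<Longrightarrow> e \<in> proj S \<Longrightarrow> f \<in> proj S \<Longrightarrow> a \<otimes> e \<preceq> a \<otimes> f"
  by (rule mult_mono) auto

text \<open>Below a common bound the order is determined by the projections \<open>\<lambda>\<close>.\<close>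

lemma bounded_leI_lam:
  assumes "a \<preceq> c" "b \<preceq> c" "lam S a \<preceq> lam S b" "a \<in> carrier S" "b \<in> carrier S" "c \<in> carrier S"
  shows "a \<preceq> b"
proof -
  have "a = c \<otimes> (lam S b \<otimes> lam S a)" using assms nat_leD[of a c] proj_le_iff by simp
  also have "\<dots> = b \<otimes> lam S a" using assms nat_leD[of b c] by (simp flip: m_assoc)
  finally show ?thesis using assms mult_proj_le[of b "lam S a"] by simp
qed

lemma partial_order_nat_order: "partial_order (nat_order S)"
  by unfold_locales (auto simp: nat_order_def intro: nat_le_antisym nat_le_trans)

lemma partial_order_proj_order: "partial_order (proj_order S)"
  by unfold_locales (auto simp: proj_order_def intro: nat_le_antisym nat_le_trans)

end

lemma monoid_of_restriction: "restriction_monoid S \<Longrightarrow> monoid S"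
  by (simp add: restriction_monoid_def ehresmann_monoid_def)

lemma rmonI: "restriction_monoid S \<Longrightarrow> rmon S"
  by (simp add: rmon_def rmon_axioms_def monoid_of_restriction)

text \<open>Reversing the multiplication exchanges \<open>\<lambda>\<close> and \<open>\<rho>\<close> and keeps the natural order, so every
  fact about domains yields one about codomains.\<close>

definition opp :: "'a rmonoid \<Rightarrow> 'a rmonoid" where
  "opp S = \<lparr>carrier = carrier S, monoid.mult = (\<lambda>a b. b \<otimes>\<^bsub>S\<^esub> a), one = \<one>\<^bsub>S\<^esub>,
     proj = proj S, lam = rho S, rho = lam S\<rparr>"

lemma opp_simps [simp]:
  "carrier (opp S) = carrier S" "a \<otimes>\<^bsub>opp S\<^esub> b = b \<otimes>\<^bsub>S\<^esub> a" "\<one>\<^bsub>opp S\<^esub> = \<one>\<^bsub>S\<^esub>"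
  "proj (opp S) = proj S" "lam (opp S) = rho S" "rho (opp S) = lam S"
  by (simp_all add: opp_def)

lemma nat_le_opp [simp]: "nat_le (opp S) = nat_le S"
  unfolding nat_le_def by (intro ext) auto

lemma orders_opp [simp]: "nat_order (opp S) = nat_order S" "proj_order (opp S) = proj_order S"
  by (simp_all add: nat_order_def proj_order_def)

lemma compatible_opp [simp]: "compatible (opp S) X = compatible S X"
  unfolding compatible_def by auto

lemma restriction_monoid_opp:
  assumes "restriction_monoid S"
  shows "restriction_monoid (opp S)"
proof -
  interpret rmon S using assms by (rule rmonI)
  have "monoid (opp S)" by unfold_locales (auto simp: m_assoc)
  then show ?thesis
    unfolding restriction_monoid_def ehresmann_monoid_def
    by (auto simp: lam_lam_mult rho_mult_rho proj_swap swap_proj intro: proj_comm)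
qed

lemma complete_rmonoid_opp: "complete_rmonoid S \<Longrightarrow> complete_rmonoid (opp S)"
  unfolding complete_rmonoid_def by (simp add: restriction_monoid_opp)

section \<open>Joins in complete restriction monoids\<close>

locale complete_rmon = rmon S for S :: "'a rmonoid" (structure) +
  assumes complete: "complete_rmonoid S"

lemma complete_rmonI: "complete_rmonoid S \<Longrightarrow> complete_rmon S"
  by (simp add: complete_rmon_def complete_rmon_axioms_def rmonI complete_rmonoid_def)

context complete_rmon
begin

sublocale nord: partial_order "nat_order S" by (rule partial_order_nat_order)

lemma proj_frame: "frame (proj_order S)"
  using complete by (simp add: complete_rmonoid_def)

sublocale pord: complete_lattice "proj_order S"
  using proj_frame by (rule frame_is_complete_lattice)

lemma complete_rmon_opp: "complete_rmon (opp S)" by (rule complete_rmonI) (rule complete_rmonoid_opp[OF complete])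

lemma nat_lub_iff:
  "X \<subseteq> carrier S \<Longrightarrow> is_lub (nat_order S) x X \<longleftrightarrow> x \<in> carrier S \<and> (\<forall>y\<in>X. y \<preceq> x) \<and>
    (\<forall>z\<in>carrier S. (\<forall>y\<in>X. y \<preceq> z) \<longrightarrow> x \<preceq> z)"
  using is_lub_iff[of X "nat_order S"] by simp

lemma proj_lub_iff:
  "X \<subseteq> proj S \<Longrightarrow> is_lub (proj_order S) x X \<longleftrightarrow> x \<in> proj S \<and> (\<forall>y\<in>X. y \<preceq> x) \<and>
    (\<forall>z\<in>proj S. (\<forall>y\<in>X. y \<preceq> z) \<longrightarrow> x \<preceq> z)"
  using is_lub_iff[of X "proj_order S"] by simp

text \<open>Two elements below \<open>s\<close> are restrictions of \<open>s\<close> on either side, and projections commute.\<close>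

lemma compatible_bounded:
  assumes "X \<subseteq> carrier S" "s \<in> carrier S" "\<And>x. x \<in> X \<Longrightarrow> x \<preceq> s"
  shows "compatible S X"
  unfolding compatible_def
proof (intro ballI conjI)
  fix a b assume ab: "a \<in> X" "b \<in> X"
  interpret op: rmon "opp S" by (rule rmonI) (rule restriction_monoid_opp[OF restriction])
  have c: "a \<in> carrier S" "b \<in> carrier S" using ab assms by auto
  have a: "s \<otimes> lam S a = a" "rho S a \<otimes> s = a"
    using nat_leD[of a s] op.nat_leD[of a s] ab c assms by auto
  have b: "s \<otimes> lam S b = b" "rho S b \<otimes> s = b"
    using nat_leD[of b s] op.nat_leD[of b s] ab c assms by auto
  have "s \<otimes> lam S a \<otimes> lam S b = s \<otimes> lam S b \<otimes> lam S a"
    using c assms by (simp add: m_assoc proj_comm)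
  then show "a \<otimes> lam S b = b \<otimes> lam S a" using a b by simp
  have "rho S b \<otimes> (rho S a \<otimes> s) = rho S a \<otimes> (rho S b \<otimes> s)"
    using c assms by (simp flip: m_assoc add: proj_comm[of "rho S b" "rho S a"])
  then show "rho S b \<otimes> a = rho S a \<otimes> b" using a b by simp
qed

lemma ex_lub: "X \<subseteq> carrier S \<Longrightarrow> compatible S X \<Longrightarrow> \<exists>x. is_lub (nat_order S) x X"
  using complete by (simp add: complete_rmonoid_def)

lemma ex_bounded_lub:
  "X \<subseteq> carrier S \<Longrightarrow> s \<in> carrier S \<Longrightarrow> (\<And>x. x \<in> X \<Longrightarrow> x \<preceq> s) \<Longrightarrow> \<exists>x. is_lub (nat_order S) x X"
  by (rule ex_lub) (auto intro: compatible_bounded)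

lemma ex_zero: "\<exists>z\<in>carrier S. \<forall>x\<in>carrier S. z \<preceq> x"
  using ex_lub[of "{}"] nat_lub_iff[of "{}"] by (auto simp: compatible_def)

text \<open>The common lower bounds of two elements are bounded, hence compatible, and their join is the meet.\<close>

lemma ex_nat_glb:
  assumes "a \<in> carrier S" "b \<in> carrier S"
  shows "\<exists>c. is_glb (nat_order S) c {a, b}"
proof -
  let ?X = "{x \<in> carrier S. x \<preceq> a \<and> x \<preceq> b}"
  have "\<exists>c. is_lub (nat_order S) c ?X" by (rule ex_bounded_lub[of _ a]) (use assms in auto)
  then obtain c where "is_lub (nat_order S) c ?X" by blast
  then show ?thesis using assms nat_lub_iff[of ?X c] by (subst is_glb_iff) auto
qed

text \<open>For an upper bound \<open>g\<close> of the projections \<open>\<lambda>(y)\<close> the restriction \<open>x g\<close> is still an upper bound of \<open>X\<close>,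
  so \<open>x = x g\<close> and \<open>\<lambda>(x)\<close> lies below \<open>g\<close>.\<close>

lemma lam_lub:
  assumes X: "X \<subseteq> carrier S" and x: "is_lub (nat_order S) x X"
  shows "is_lub (proj_order S) (lam S x) (lam S ` X)"
proof -
  have xc: "x \<in> carrier S" and ub: "\<And>y. y \<in> X \<Longrightarrow> y \<preceq> x"
    and least: "\<And>z. z \<in> carrier S \<Longrightarrow> \<forall>y\<in>X. y \<preceq> z \<Longrightarrow> x \<preceq> z"
    using x unfolding nat_lub_iff[OF X] by auto
  have "lam S x \<preceq> g" if g: "g \<in> proj S" "\<forall>y\<in>X. lam S y \<preceq> g" for g
  proof -
    have "y \<preceq> x \<otimes> g" if y: "y \<in> X" for y
    proof -
      have yc: "y \<in> carrier S" using y X by blast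
      have "y \<otimes> g = y \<otimes> (lam S y \<otimes> g)" using yc g by (simp flip: m_assoc)
      also have "\<dots> = y" using yc g y proj_le_iff[of "lam S y" g] proj_comm[of "lam S y" g] by simp
      finally show ?thesis using mult_mono[OF ub[OF y], of g g] yc xc g by auto
    qed
    then have "x \<preceq> x \<otimes> g" using least xc g by auto
    then have "lam S x \<preceq> lam S x \<otimes> g" using lam_mono[of x "x \<otimes> g"] lam_mult_proj xc g by auto
    moreover have "lam S x \<otimes> g \<preceq> g" using proj_mult_le xc g by auto
    ultimately show ?thesis using nat_le_trans xc g by (meson proj_carrier proj_mult lam_in_proj)
  qed
  moreover have "lam S ` X \<subseteq> proj S" using X by auto
  ultimately show ?thesis using X xc ub by (subst proj_lub_iff) (auto intro!: lam_mono)
qed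

lemma proj_meet: "e \<in> proj S \<Longrightarrow> f \<in> proj S \<Longrightarrow> e \<sqinter>\<^bsub>proj_order S\<^esub> f = e \<otimes> f"
proof (rule pord.meet_eqI)
  assume ef: "e \<in> proj S" "f \<in> proj S"
  have "z \<preceq> e \<otimes> f" if "z \<in> proj S" "z \<preceq> e" "z \<preceq> f" for z
    using that ef mult_mono[of z e z f] by simp
  then show "is_glb (proj_order S) (e \<otimes> f) {e, f}"
    using ef mult_proj_le[of e f] proj_mult_le[of f e] by (subst is_glb_iff) auto
qed

lemma proj_lub_distrib:
  assumes X: "X \<subseteq> proj S" and e: "is_lub (proj_order S) e X" and f: "f \<in> proj S"
  shows "is_lub (proj_order S) (f \<otimes> e) ((\<otimes>) f ` X)"
proof -
  have fX: "(\<otimes>) f ` X \<subseteq> proj S" using f X by auto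
  have ec: "e \<in> proj S" using e proj_lub_iff[OF X] by blast
  have "f \<sqinter>\<^bsub>proj_order S\<^esub> \<Squnion>\<^bsub>proj_order S\<^esub>X = \<Squnion>\<^bsub>proj_order S\<^esub>((\<lambda>a. f \<sqinter>\<^bsub>proj_order S\<^esub> a) ` X)"
    using proj_frame X f unfolding frame_def by simp
  also have "(\<lambda>a. f \<sqinter>\<^bsub>proj_order S\<^esub> a) ` X = (\<otimes>) f ` X" using proj_meet f X by (intro image_cong) auto
  finally have "f \<otimes> e = \<Squnion>\<^bsub>proj_order S\<^esub>((\<otimes>) f ` X)"
    using pord.sup_eqI[OF e] proj_meet f ec by simp
  moreover obtain s where "is_lub (proj_order S) s ((\<otimes>) f ` X)" using pord.sup_exists[of "(\<otimes>) f ` X"] fX by auto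
  ultimately show ?thesis using pord.sup_eqI by metis
qed

text \<open>The join \<open>t\<close> of the products lies below \<open>s e\<close>, and distributivity in the frame of projections
  gives it the same \<open>\<lambda>\<close> as \<open>s e\<close>. Below a common bound this forces equality.\<close>

lemma mult_proj_lub:
  assumes X: "X \<subseteq> proj S" and e: "is_lub (proj_order S) e X" and s: "s \<in> carrier S"
  shows "is_lub (nat_order S) (s \<otimes> e) ((\<otimes>) s ` X)"
proof -
  have sX: "(\<otimes>) s ` X \<subseteq> carrier S" using s X by auto
  have ec: "e \<in> proj S" and eub: "\<And>f. f \<in> X \<Longrightarrow> f \<preceq> e" using e proj_lub_iff[OF X] by auto
  have ub: "y \<preceq> s \<otimes> e" if "y \<in> (\<otimes>) s ` X" for y
    using that eub ec s X by (auto intro!: mult_proj_mono)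
  \<comment> \<open>comparing \<open>\<lambda>(t)\<close> with \<open>\<lambda>(s e)\<close> needs some join \<open>t\<close> to start from\<close>
  obtain t where t: "is_lub (nat_order S) t ((\<otimes>) s ` X)"
    using ex_bounded_lub[OF sX, of "s \<otimes> e"] ub s ec by auto
  then have tc: "t \<in> carrier S" and tle: "t \<preceq> s \<otimes> e" using nat_lub_iff[OF sX] ub s ec by auto
  have "lam S ` (\<otimes>) s ` X = (\<otimes>) (lam S s) ` X"
    unfolding image_image using s X lam_mult_proj by (intro image_cong) auto
  then have "is_lub (proj_order S) (lam S t) ((\<otimes>) (lam S s) ` X)" using lam_lub[OF sX t] by simp
  moreover have "is_lub (proj_order S) (lam S s \<otimes> e) ((\<otimes>) (lam S s) ` X)"
    using proj_lub_distrib[OF X e] s by simp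
  ultimately have "lam S t = lam S s \<otimes> e" by (rule pord.least_unique)
  then have "lam S (s \<otimes> e) = lam S t" using lam_mult_proj s ec by simp
  then have "s \<otimes> e = t"
    using nat_leD[OF tle] mult_lam[of "s \<otimes> e"] tc s ec by simp
  then show ?thesis using t by simp
qed

end

section \<open>Completely prime filters as germs\<close>

text \<open>A completely prime filter \<open>P\<close> of the monoid is determined by one of its members \<open>s\<close> together
  with its domain, a point of the frame of projections: it consists of the elements above some
  restriction \<open>s f\<close> of \<open>s\<close> to a member \<open>f\<close> of the domain.\<close>

definition fdom :: "'a rmonoid \<Rightarrow> 'a set \<Rightarrow> 'a set" where
  "fdom S P = up_closure (proj_order S) (lam S ` P)"

definition fcod :: "'a rmonoid \<Rightarrow> 'a set \<Rightarrow> 'a set" where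
  "fcod S P = up_closure (proj_order S) (rho S ` P)"

definition germ :: "'a rmonoid \<Rightarrow> 'a \<Rightarrow> 'a set \<Rightarrow> 'a set" where
  "germ S s p = {x \<in> carrier S. \<exists>f\<in>p. nat_le S (s \<otimes>\<^bsub>S\<^esub> f) x}"

lemma fdom_opp [simp]: "fdom (opp S) = fcod S" "fcod (opp S) = fdom S"
  by (simp_all add: fun_eq_iff fdom_def fcod_def up_closure_def)

abbreviation nat_filter :: "'a rmonoid \<Rightarrow> 'a set \<Rightarrow> bool" where
  "nat_filter S \<equiv> cp_filter (nat_order S)"

abbreviation proj_filter :: "'a rmonoid \<Rightarrow> 'a set \<Rightarrow> bool" where
  "proj_filter S \<equiv> cp_filter (proj_order S)"

context complete_rmon
begin

lemma mem_fdom: "f \<in> fdom S P \<longleftrightarrow> f \<in> proj S \<and> (\<exists>s\<in>P. lam S s \<preceq> f)"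
  by (auto simp: fdom_def up_closure_def)

lemma nat_filterD:
  assumes "nat_filter S P"
  shows nat_filter_carrier: "a \<in> P \<Longrightarrow> a \<in> carrier S"
    and nat_filter_nonempty: "\<exists>a\<in>carrier S. a \<in> P"
    and nat_filter_up: "a \<in> P \<Longrightarrow> a \<preceq> b \<Longrightarrow> b \<in> carrier S \<Longrightarrow> b \<in> P"
    and nat_filter_down: "a \<in> P \<Longrightarrow> b \<in> P \<Longrightarrow> \<exists>c\<in>P. c \<in> carrier S \<and> c \<preceq> a \<and> c \<preceq> b"
    and nat_filter_lub: "X \<subseteq> carrier S \<Longrightarrow> is_lub (nat_order S) x X \<Longrightarrow> x \<in> P \<Longrightarrow> \<exists>y\<in>X. y \<in> P"
proof -
  note c = cp_filterD[OF assms, simplified]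
  show car: "a \<in> P \<Longrightarrow> a \<in> carrier S" for a using c(1) by blast
  show "\<exists>a\<in>carrier S. a \<in> P" by (rule c(2))
  show "a \<in> P \<Longrightarrow> a \<preceq> b \<Longrightarrow> b \<in> carrier S \<Longrightarrow> b \<in> P" by (rule c(3))
  show "a \<in> P \<Longrightarrow> b \<in> P \<Longrightarrow> \<exists>c\<in>P. c \<in> carrier S \<and> c \<preceq> a \<and> c \<preceq> b"
    using c(4)[of a b] car by auto
  show "X \<subseteq> carrier S \<Longrightarrow> is_lub (nat_order S) x X \<Longrightarrow> x \<in> P \<Longrightarrow> \<exists>y\<in>X. y \<in> P" by (rule c(5))
qed

lemma proj_filterD:
  assumes "proj_filter S p"
  shows proj_filter_proj: "f \<in> p \<Longrightarrow> f \<in> proj S"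
    and proj_filter_up: "f \<in> p \<Longrightarrow> f \<preceq> g \<Longrightarrow> g \<in> proj S \<Longrightarrow> g \<in> p"
    and proj_filter_mult: "f \<in> p \<Longrightarrow> g \<in> p \<Longrightarrow> f \<otimes> g \<in> p"
    and proj_filter_lub: "X \<subseteq> proj S \<Longrightarrow> is_lub (proj_order S) x X \<Longrightarrow> x \<in> p \<Longrightarrow> \<exists>y\<in>X. y \<in> p"
    and proj_filter_one: "\<one> \<in> p"
proof -
  note c = cp_filterD[OF assms, simplified]
  show car: "f \<in> p \<Longrightarrow> f \<in> proj S" for f using c(1) by blast
  have ne: "\<exists>f\<in>proj S. f \<in> p" by (rule c(2))
  show up: "f \<in> p \<Longrightarrow> f \<preceq> g \<Longrightarrow> g \<in> proj S \<Longrightarrow> g \<in> p" for f g by (rule c(3))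
  show "f \<otimes> g \<in> p" if fg: "f \<in> p" "g \<in> p"
  proof -
    obtain h where h: "h \<in> p" "h \<preceq> f" "h \<preceq> g" using c(4)[of f g] fg by auto
    then have "h \<otimes> h \<preceq> f \<otimes> g" using fg car by (intro mult_mono) auto
    then show ?thesis using up[of h] h fg car by simp
  qed
  show "X \<subseteq> proj S \<Longrightarrow> is_lub (proj_order S) x X \<Longrightarrow> x \<in> p \<Longrightarrow> \<exists>y\<in>X. y \<in> p" by (rule c(5))
  obtain f where f: "f \<in> proj S" "f \<in> p" using ne by blast
  then show "\<one> \<in> p" using up[of f \<one>] mult_proj_le[of \<one> f] by simp
qed

lemma lam_mem_fdom: "nat_filter S P \<Longrightarrow> s \<in> P \<Longrightarrow> lam S s \<in> fdom S P"
  using nat_filter_carrier unfolding mem_fdom by (metis lam_in_proj nat_le_refl proj_carrier)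

text \<open>Restriction to \<open>f\<close> keeps a member of \<open>P\<close> inside \<open>P\<close> exactly when \<open>f\<close> is in the domain: if
  \<open>\<lambda>(t) \<preceq> f\<close> with \<open>t \<in> P\<close>, a common lower bound of \<open>s\<close> and \<open>t\<close> in \<open>P\<close> lies below \<open>s f\<close>.\<close>

lemma mult_proj_mem_iff:
  assumes P: "nat_filter S P" "s \<in> P" and f: "f \<in> proj S"
  shows "s \<otimes> f \<in> P \<longleftrightarrow> f \<in> fdom S P"
proof
  have sc: "s \<in> carrier S" using P by (rule nat_filter_carrier)
  assume "s \<otimes> f \<in> P"
  moreover have "lam S (s \<otimes> f) \<preceq> f" using lam_mult_proj proj_mult_le sc f by simp
  ultimately show "f \<in> fdom S P" unfolding mem_fdom using f by blast
next
  have sc: "s \<in> carrier S" using P by (rule nat_filter_carrier)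
  assume "f \<in> fdom S P"
  then obtain t where t: "t \<in> P" "lam S t \<preceq> f" unfolding mem_fdom by blast
  then obtain c where c: "c \<in> P" "c \<in> carrier S" "c \<preceq> s" "c \<preceq> t" using nat_filter_down P by blast
  have tc: "t \<in> carrier S" using P t nat_filter_carrier by blast
  have "lam S c \<preceq> f" using nat_le_trans[OF lam_mono t(2)] c tc f by auto
  then have "s \<otimes> lam S c \<preceq> s \<otimes> f" using mult_proj_mono sc c f by auto
  then have "c \<preceq> s \<otimes> f" using nat_leD[of c s] c sc by simp
  then show "s \<otimes> f \<in> P" using nat_filter_up[OF P(1) c(1)] sc f by auto
qed

lemma below_mem_iff:
  assumes P: "nat_filter S P" "s \<in> P" and t: "t \<preceq> s" "t \<in> carrier S"
  shows "t \<in> P \<longleftrightarrow> lam S t \<in> fdom S P"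
  using mult_proj_mem_iff[OF P, of "lam S t"] nat_leD[OF t] nat_filter_carrier[OF P] t by auto

lemma filter_eq_germ:
  assumes P: "nat_filter S P" "s \<in> P"
  shows "P = germ S s (fdom S P)"
proof
  have sc: "s \<in> carrier S" using P by (rule nat_filter_carrier)
  show "P \<subseteq> germ S s (fdom S P)"
  proof
    fix x assume x: "x \<in> P"
    then obtain c where c: "c \<in> P" "c \<in> carrier S" "c \<preceq> s" "c \<preceq> x" using nat_filter_down P by blast
    then have "s \<otimes> lam S c \<preceq> x" "lam S c \<in> fdom S P" using nat_leD[of c s] sc lam_mem_fdom P by auto
    then show "x \<in> germ S s (fdom S P)" unfolding germ_def using x P nat_filter_carrier by blast
  qed
  show "germ S s (fdom S P) \<subseteq> P"
  proof
    fix x assume "x \<in> germ S s (fdom S P)"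
    then obtain f where f: "x \<in> carrier S" "f \<in> fdom S P" "s \<otimes> f \<preceq> x" unfolding germ_def by blast
    then have "s \<otimes> f \<in> P" using mult_proj_mem_iff[OF P] mem_fdom by blast
    then show "x \<in> P" using nat_filter_up[OF P(1)] f by blast
  qed
qed

text \<open>This is the local injectivity of the domain map on filters, the source of most equalities
  between filters below.\<close>

lemma filter_eqI:
  assumes "nat_filter S P" "nat_filter S Q" "fdom S P = fdom S Q" "s \<in> P" "s \<in> Q"
  shows "P = Q"
  using filter_eq_germ[of P s] filter_eq_germ[of Q s] assms by simp

text \<open>For one fixed \<open>s \<in> P\<close>, membership of \<open>f\<close> in the domain means \<open>s f \<in> P\<close>. Multiplication by \<open>s\<close>
  preserves joins of projections, so the domain inherits complete primality from \<open>P\<close>.\<close>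

lemma proj_filter_fdom:
  assumes P: "nat_filter S P"
  shows "proj_filter S (fdom S P)"
  unfolding cp_filter_def
proof (intro conjI ballI allI impI)
  show "fdom S P \<subseteq> carrier (proj_order S)" by (auto simp: mem_fdom)
  obtain s where s: "s \<in> carrier S" "s \<in> P" using nat_filter_nonempty[OF P] by blast
  then show "fdom S P \<noteq> {}" using lam_mem_fdom P by blast
  fix f g assume "f \<in> fdom S P" "g \<in> carrier (proj_order S)" "f \<sqsubseteq>\<^bsub>proj_order S\<^esub> g"
  moreover from this obtain t where "t \<in> P" "lam S t \<preceq> f" "f \<in> proj S" by (auto simp: mem_fdom)
  moreover have "t \<in> carrier S" using \<open>t \<in> P\<close> P nat_filter_carrier by blast
  ultimately show "g \<in> fdom S P" using nat_le_trans[of "lam S t" f g] by (auto simp: mem_fdom)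
next
  obtain s where s: "s \<in> carrier S" "s \<in> P" using nat_filter_nonempty[OF P] by blast
  fix f g assume f: "f \<in> fdom S P" and g: "g \<in> fdom S P"
  then have fg: "f \<in> proj S" "g \<in> proj S" by (auto simp: mem_fdom)
  have "s \<otimes> f \<otimes> g \<in> P" using mult_proj_mem_iff[OF P] s f g fg by blast
  then have "s \<otimes> (f \<otimes> g) \<in> P" using s fg by (simp add: m_assoc)
  then have "f \<otimes> g \<in> fdom S P" using mult_proj_mem_iff[OF P s(2)] fg by auto
  then show "\<exists>c\<in>fdom S P. c \<sqsubseteq>\<^bsub>proj_order S\<^esub> f \<and> c \<sqsubseteq>\<^bsub>proj_order S\<^esub> g"
    using fg mult_proj_le[of f g] proj_mult_le[of g f] by auto
next
  obtain s where s: "s \<in> carrier S" "s \<in> P" using nat_filter_nonempty[OF P] by blast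
  fix X e assume X: "X \<subseteq> carrier (proj_order S)" and e: "e \<in> fdom S P" "is_lub (proj_order S) e X"
  then have X': "X \<subseteq> proj S" by simp
  have lub: "is_lub (nat_order S) (s \<otimes> e) ((\<otimes>) s ` X)" using mult_proj_lub[OF X' e(2)] s by blast
  have "s \<otimes> e \<in> P" using mult_proj_mem_iff[OF P s(2)] e mem_fdom by blast
  moreover have "(\<otimes>) s ` X \<subseteq> carrier S" using s X' by auto
  ultimately obtain f where f: "f \<in> X" "s \<otimes> f \<in> P" using nat_filter_lub[OF P _ lub] by blast
  then have "f \<in> fdom S P" using mult_proj_mem_iff[OF P s(2)] X' by blast
  then show "X \<inter> fdom S P \<noteq> {}" using f by blast
qed

text \<open>For complete primality, let the join \<open>x\<close> of \<open>X\<close> be in the germ. Then \<open>\<lambda>(x)\<close>, the join of the \<open>\<lambda>(y)\<close>,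
  is in the point \<open>p\<close>, hence so is some \<open>\<lambda>(y)\<close>, and \<open>y = x \<lambda>(y)\<close> is in the germ.\<close>

lemma germ_filter:
  assumes p: "proj_filter S p" and s: "s \<in> carrier S" "lam S s \<in> p"
  shows "nat_filter S (germ S s p)" "s \<in> germ S s p" "fdom S (germ S s p) = p"
proof -
  have pp: "f \<in> proj S" if "f \<in> p" for f using that p proj_filter_proj by blast
  have car: "x \<in> carrier S" if "x \<in> germ S s p" for x using that unfolding germ_def by blast
  have memI: "x \<in> germ S s p" if "x \<in> carrier S" "f \<in> p" "s \<otimes> f \<preceq> x" for x f
    using that unfolding germ_def by blast
  have sf: "s \<otimes> f \<in> germ S s p" if "f \<in> p" for f
    using that s pp[OF that] by (intro memI[of _ f]) auto
  show s_in: "s \<in> germ S s p" using s by (intro memI[of _ "lam S s"]) auto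
  have lam_in: "lam S x \<in> p" if x: "x \<in> germ S s p" for x
  proof -
    obtain f where f: "f \<in> p" "s \<otimes> f \<preceq> x" using x unfolding germ_def by blast
    then have "lam S (s \<otimes> f) \<preceq> lam S x" using lam_mono s pp[OF f(1)] car[OF x] by auto
    moreover have "lam S (s \<otimes> f) \<in> p"
      using proj_filter_mult[OF p s(2) f(1)] lam_mult_proj s pp f by simp
    ultimately show ?thesis using proj_filter_up[OF p] car[OF x] by blast
  qed
  show fdom: "fdom S (germ S s p) = p"
  proof
    show "fdom S (germ S s p) \<subseteq> p"
    proof
      fix f assume "f \<in> fdom S (germ S s p)"
      then obtain x where "f \<in> proj S" "x \<in> germ S s p" "lam S x \<preceq> f" unfolding mem_fdom by blast
      then show "f \<in> p" using proj_filter_up[OF p lam_in] by blast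
    qed
    show "p \<subseteq> fdom S (germ S s p)"
    proof
      fix f assume f: "f \<in> p"
      have "lam S (s \<otimes> f) \<preceq> f" using lam_mult_proj proj_mult_le s pp[OF f] by simp
      then show "f \<in> fdom S (germ S s p)" unfolding mem_fdom using sf[OF f] pp[OF f] by blast
    qed
  qed
  show "nat_filter S (germ S s p)"
    unfolding cp_filter_def
  proof (intro conjI ballI allI impI)
    show "germ S s p \<subseteq> carrier (nat_order S)" using car by auto
    show "germ S s p \<noteq> {}" using s_in by blast
    fix x y assume "x \<in> germ S s p" "y \<in> carrier (nat_order S)" "x \<sqsubseteq>\<^bsub>nat_order S\<^esub> y"
    moreover from this obtain f where "f \<in> p" "s \<otimes> f \<preceq> x" unfolding germ_def by blast
    ultimately show "y \<in> germ S s p"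
      using nat_le_trans[of "s \<otimes> f" x y] car s pp by (intro memI[of y f]) auto
  next
    fix x y assume x: "x \<in> germ S s p" and y: "y \<in> germ S s p"
    then obtain f g where fg: "f \<in> p" "s \<otimes> f \<preceq> x" "g \<in> p" "s \<otimes> g \<preceq> y" unfolding germ_def by blast
    have fgp: "f \<in> proj S" "g \<in> proj S" using fg pp by auto
    have "s \<otimes> (f \<otimes> g) \<preceq> s \<otimes> f" "s \<otimes> (f \<otimes> g) \<preceq> s \<otimes> g"
      using mult_proj_le[of f g] proj_mult_le[of g f] fgp s by (auto intro!: mult_proj_mono)
    then have "s \<otimes> (f \<otimes> g) \<preceq> x" "s \<otimes> (f \<otimes> g) \<preceq> y"
      using nat_le_trans fg fgp s car[OF x] car[OF y] by (meson m_closed proj_carrier proj_mult)+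
    then show "\<exists>c\<in>germ S s p. c \<sqsubseteq>\<^bsub>nat_order S\<^esub> x \<and> c \<sqsubseteq>\<^bsub>nat_order S\<^esub> y"
      using sf[OF proj_filter_mult[OF p fg(1,3)]] by auto
  next
    fix X x assume X: "X \<subseteq> carrier (nat_order S)" and x: "x \<in> germ S s p" "is_lub (nat_order S) x X"
    then have X': "X \<subseteq> carrier S" by simp
    have xc: "x \<in> carrier S" using car x by blast
    have lX: "lam S ` X \<subseteq> proj S" using X' by auto
    have "is_lub (proj_order S) (lam S x) (lam S ` X)" using lam_lub[OF X' x(2)] .
    then obtain y where y: "y \<in> X" "lam S y \<in> p" using proj_filter_lub[OF p lX _ lam_in[OF x(1)]] by blast
    obtain f where f: "f \<in> p" "s \<otimes> f \<preceq> x" using x unfolding germ_def by blast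
    have yc: "y \<in> carrier S" using y X' by blast
    have fp: "f \<in> proj S" using pp f by blast
    have "y \<preceq> x" using x(2) y unfolding nat_lub_iff[OF X'] by blast
    then have "y = x \<otimes> lam S y" using nat_leD yc xc by simp
    moreover have "(s \<otimes> f) \<otimes> lam S y \<preceq> x \<otimes> lam S y"
      using mult_mono[OF f(2), of "lam S y" "lam S y"] s fp xc yc by auto
    ultimately have "s \<otimes> (f \<otimes> lam S y) \<preceq> y" using s fp yc by (simp add: m_assoc)
    then have "y \<in> germ S s p" using memI[OF yc proj_filter_mult[OF p f(1) y(2)]] by blast
    then show "X \<inter> germ S s p \<noteq> {}" using y by blast
  qed
qed

text \<open>If \<open>s \<preceq> t\<close> fails, the meet \<open>c\<close> of the two has a strictly smaller \<open>\<lambda>\<close> than \<open>s\<close>. The germ of \<open>s\<close> at a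
  point that contains \<open>\<lambda>(s)\<close> but not \<open>\<lambda>(c)\<close> separates \<open>s\<close> from \<open>t\<close>.\<close>

lemma enough_points_nat_order:
  assumes ep: "enough_points (proj_order S)"
  shows "enough_points (nat_order S)"
  unfolding enough_points_def nat_order_simps
proof (intro ballI impI)
  fix s t assume st: "s \<in> carrier S" "t \<in> carrier S" "\<not> s \<preceq> t"
  obtain c where "is_glb (nat_order S) c {s, t}" using ex_nat_glb st by blast
  then have c: "c \<in> carrier S" "c \<preceq> s" "c \<preceq> t" "\<And>z. z \<in> carrier S \<Longrightarrow> z \<preceq> s \<Longrightarrow> z \<preceq> t \<Longrightarrow> z \<preceq> c"
    using is_glb_iff[of s "nat_order S" t c] st by auto
  have "\<not> lam S s \<preceq> lam S c"
  proof
    assume "lam S s \<preceq> lam S c"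
    then have "s \<preceq> c" using bounded_leI_lam[of s s c] st c by simp
    then show False using nat_le_trans[of s c t] st c by blast
  qed
  then obtain p where p: "proj_filter S p" "lam S s \<in> p" "lam S c \<notin> p"
    using ep st c unfolding enough_points_def proj_order_simps by (meson lam_in_proj)
  have "t \<notin> germ S s p"
  proof
    assume "t \<in> germ S s p"
    then obtain f where f: "f \<in> p" "s \<otimes> f \<preceq> t" unfolding germ_def by blast
    have fp: "f \<in> proj S" using f p proj_filter_proj by blast
    have "s \<otimes> f \<preceq> c" using c(4)[of "s \<otimes> f"] f st fp mult_proj_le by auto
    then have "lam S s \<otimes> f \<preceq> lam S c" using lam_mono[of "s \<otimes> f" c] lam_mult_proj st fp c by auto
    then show False using p proj_filter_up[OF p(1) proj_filter_mult[OF p(1,2) f(1)]] c by auto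
  qed
  then show "\<exists>P. nat_filter S P \<and> s \<in> P \<and> t \<notin> P" using germ_filter[OF p(1) st(1) p(2)] by blast
qed

end

section \<open>The frame of closed ideals\<close>

lemma closed_ideals_simps [simp]:
  "A \<sqsubseteq>\<^bsub>closed_ideals S\<^esub> B \<longleftrightarrow> A \<subseteq> B" "A .=\<^bsub>closed_ideals S\<^esub> B \<longleftrightarrow> A = B"
  by (simp_all add: closed_ideals_def)

lemma partial_order_closed_ideals: "partial_order (closed_ideals S)"
  by unfold_locales (auto simp: closed_ideals_def)

context complete_rmon
begin

lemma mem_closed_ideals:
  "A \<in> carrier (closed_ideals S) \<longleftrightarrow> A \<subseteq> carrier S \<and> A \<noteq> {} \<and>
    (\<forall>a\<in>A. \<forall>b\<in>carrier S. b \<preceq> a \<longrightarrow> b \<in> A) \<and>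
    (\<forall>X x. X \<subseteq> A \<and> X \<noteq> {} \<and> compatible S X \<and> is_lub (nat_order S) x X \<longrightarrow> x \<in> A)"
  by (simp add: closed_ideals_def)

lemma closed_idealI:
  assumes "A \<subseteq> carrier S" "a \<in> A"
    and "\<And>a b. a \<in> A \<Longrightarrow> b \<in> carrier S \<Longrightarrow> b \<preceq> a \<Longrightarrow> b \<in> A"
    and "\<And>X x. X \<subseteq> A \<Longrightarrow> is_lub (nat_order S) x X \<Longrightarrow> x \<in> A"
  shows "A \<in> carrier (closed_ideals S)"
  unfolding mem_closed_ideals using assms by auto

lemma closed_idealD:
  assumes "A \<in> carrier (closed_ideals S)"
  shows "a \<in> A \<Longrightarrow> a \<in> carrier S"
    and "a \<in> A \<Longrightarrow> b \<in> carrier S \<Longrightarrow> b \<preceq> a \<Longrightarrow> b \<in> A"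
    and "X \<subseteq> A \<Longrightarrow> X \<noteq> {} \<Longrightarrow> compatible S X \<Longrightarrow> is_lub (nat_order S) x X \<Longrightarrow> x \<in> A"
    and "\<exists>z\<in>A. z \<in> carrier S \<and> (\<forall>x\<in>carrier S. z \<preceq> x)"
proof -
  show 1: "a \<in> A \<Longrightarrow> a \<in> carrier S" for a using assms unfolding mem_closed_ideals by auto
  show 2: "a \<in> A \<Longrightarrow> b \<in> carrier S \<Longrightarrow> b \<preceq> a \<Longrightarrow> b \<in> A" for a b
    using assms unfolding mem_closed_ideals by simp
  show "X \<subseteq> A \<Longrightarrow> X \<noteq> {} \<Longrightarrow> compatible S X \<Longrightarrow> is_lub (nat_order S) x X \<Longrightarrow> x \<in> A"
    using assms unfolding mem_closed_ideals by simp
  obtain a where "a \<in> A" using assms unfolding mem_closed_ideals by auto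
  then show "\<exists>z\<in>A. z \<in> carrier S \<and> (\<forall>x\<in>carrier S. z \<preceq> x)" using ex_zero 1 2 by meson
qed

text \<open>A set with a join is bounded, hence compatible. The empty join is the least element of the
  monoid, which lies in every order ideal.\<close>

lemma closed_ideal_lub:
  assumes A: "A \<in> carrier (closed_ideals S)" and X: "X \<subseteq> A" and x: "is_lub (nat_order S) x X"
  shows "x \<in> A"
proof (cases "X = {}")
  case True
  obtain z where z: "z \<in> A" "z \<in> carrier S" using closed_idealD(4)[OF A] by blast
  have "x \<in> carrier S" "x \<preceq> z" using x z nat_lub_iff[of "{}"] True by auto
  then show ?thesis using closed_idealD(2)[OF A z(1)] by blast
next
  case False
  have XS: "X \<subseteq> carrier S" using X closed_idealD(1)[OF A] by blast
  then have "compatible S X" using x nat_lub_iff[OF XS] by (intro compatible_bounded) auto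
  then show ?thesis using closed_idealD(3)[OF A X False] x by blast
qed

text \<open>A closed ideal is sent to the union of the open sets of its members. It is recovered from this
  union \<open>U\<close>: if the open set of \<open>s\<close> lies in \<open>U\<close>, then \<open>s\<close> is the join of the members of the ideal
  below \<open>s\<close>.\<close>

lemma representation_closed_ideals:
  assumes "representation (nat_order S) X \<phi>"
  shows "full_representation (closed_ideals S) X (\<lambda>A. \<Union>(\<phi> ` A))"
proof -
  interpret rep: representation "nat_order S" X \<phi> by fact
  interpret ci: partial_order "closed_ideals S" by (rule partial_order_closed_ideals)
  define J where "J U = {s \<in> carrier S. \<phi> s \<subseteq> U}" for U
  have J: "J U \<in> carrier (closed_ideals S)" "\<Union>(\<phi> ` J U) = U" if U: "openin X U" for U
  proof -
    obtain z where z: "z \<in> carrier S" "\<forall>x\<in>carrier S. z \<preceq> x" using ex_zero by blast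
    have "\<phi> z = \<Union>(\<phi> ` {})" using rep.is_lub_iff_Union[of "{}" z] nat_lub_iff[of "{}" z] z by simp
    then have zJ: "z \<in> J U" using z by (simp add: J_def)
    have dn: "b \<in> J U" if "a \<in> J U" "b \<in> carrier S" "b \<preceq> a" for a b
      using that rep.le_iff[of b a] by (auto simp: J_def)
    have lb: "x \<in> J U" if "M \<subseteq> J U" "is_lub (nat_order S) x M" for M x
    proof -
      have M: "M \<subseteq> carrier S" using that by (auto simp: J_def)
      have x: "x \<in> carrier S" using that nat_lub_iff[OF M] by blast
      then have "\<phi> x = \<Union>(\<phi> ` M)" using rep.is_lub_iff_Union[of M x] M that by simp
      then show ?thesis using that x by (auto simp: J_def)
    qed
    have "J U \<subseteq> carrier S" by (auto simp: J_def)
    then show "J U \<in> carrier (closed_ideals S)" by (rule closed_idealI[OF _ zJ dn lb])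
    show "\<Union>(\<phi> ` J U) = U"
    proof
      show "U \<subseteq> \<Union>(\<phi> ` J U)" using rep.basis[OF U] by (fastforce simp: J_def)
    qed (auto simp: J_def)
  qed
  have op: "openin X (\<Union>(\<phi> ` A))" if "A \<in> carrier (closed_ideals S)" for A
    using rep.open_rep closed_idealD(1)[OF that] by (intro openin_Union) auto
  have emb: "A \<subseteq> B" if A: "A \<in> carrier (closed_ideals S)" and B: "B \<in> carrier (closed_ideals S)"
    and le: "\<Union>(\<phi> ` A) \<subseteq> \<Union>(\<phi> ` B)" for A B
  proof
    fix s assume s: "s \<in> A"
    have sc: "s \<in> carrier S" using closed_idealD(1)[OF A s] .
    define M where "M = {x \<in> B. x \<preceq> s}"
    have M: "M \<subseteq> carrier S" using closed_idealD(1)[OF B] by (auto simp: M_def)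
    have "\<phi> s = \<Union>(\<phi> ` M)"
    proof
      show "\<Union>(\<phi> ` M) \<subseteq> \<phi> s"
      proof (intro UN_least)
        fix x assume "x \<in> M"
        then show "\<phi> x \<subseteq> \<phi> s" using rep.le_iff[of x s] sc M by (auto simp: M_def)
      qed
      show "\<phi> s \<subseteq> \<Union>(\<phi> ` M)"
      proof
        fix y assume y: "y \<in> \<phi> s"
        then obtain b where b: "b \<in> B" "y \<in> \<phi> b" using le s by blast
        have bc: "b \<in> carrier S" using closed_idealD(1)[OF B b(1)] .
        obtain x where x: "x \<in> carrier S" "\<phi> x = \<phi> s \<inter> \<phi> b" using rep.ex_glb[of s b] sc bc by auto
        then have "x \<preceq> s" "x \<preceq> b" using rep.le_iff[of x s] rep.le_iff[of x b] sc bc by auto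
        then have "x \<in> M" using closed_idealD(2)[OF B b(1)] x by (simp add: M_def)
        moreover have "y \<in> \<phi> x" using x y b by simp
        ultimately show "y \<in> \<Union>(\<phi> ` M)" by (rule UN_I)
      qed
    qed
    then have "is_lub (nat_order S) s M" using rep.is_lub_iff_Union[of M s] M sc by simp
    moreover have "M \<subseteq> B" by (auto simp: M_def)
    ultimately show "s \<in> B" using closed_ideal_lub[OF B, of M] by simp
  qed
  have all: "\<exists>A\<in>carrier (closed_ideals S). \<Union>(\<phi> ` A) = U" if "openin X U" for U
    using that by (intro bexI[of _ "J U"] J)
  show ?thesis
  proof
    fix A B assume A: "A \<in> carrier (closed_ideals S)" and B: "B \<in> carrier (closed_ideals S)"
    show "A \<sqsubseteq>\<^bsub>closed_ideals S\<^esub> B \<longleftrightarrow> \<Union>(\<phi> ` A) \<subseteq> \<Union>(\<phi> ` B)"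
      using emb[OF A B] by auto
  next
    fix U x assume "openin X U" "x \<in> U"
    then show "\<exists>a\<in>carrier (closed_ideals S). x \<in> \<Union>(\<phi> ` a) \<and> \<Union>(\<phi> ` a) \<subseteq> U"
      using J[of U] by (intro bexI[of _ "J U"]) auto
  next
    fix A U assume "openin X U" "U \<subseteq> \<Union>(\<phi> ` A)"
    then show "\<exists>A\<in>carrier (closed_ideals S). \<Union>(\<phi> ` A) = U" by (intro all)
  next
    fix U assume "openin X U"
    then show "\<exists>A\<in>carrier (closed_ideals S). \<Union>(\<phi> ` A) = U" by (rule all)
  qed (rule op)
qed

lemma principal_ideal:
  assumes s: "s \<in> carrier S"
  shows "{x \<in> carrier S. x \<preceq> s} \<in> carrier (closed_ideals S)"
proof (rule closed_idealI[of _ s])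
  fix X y assume X: "X \<subseteq> {x \<in> carrier S. x \<preceq> s}" "is_lub (nat_order S) y X"
  then have "X \<subseteq> carrier S" by blast
  then show "y \<in> {x \<in> carrier S. x \<preceq> s}" using X s nat_lub_iff[of X y] by auto
qed (use s nat_le_trans[of _ _ s] in auto)

lemma proj_lub_imp_nat_lub:
  assumes X: "X \<subseteq> proj S" and e: "is_lub (proj_order S) e X"
  shows "is_lub (nat_order S) e X"
proof -
  have "(\<otimes>) \<one> ` X = X" using X by force
  moreover have "\<one> \<otimes> e = e" using e proj_lub_iff[OF X] by simp
  ultimately show ?thesis using mult_proj_lub[OF X e one_closed] by simp
qed

text \<open>A closed ideal that contains all of \<open>Y\<close> contains the join \<open>y\<close>, so principal ideals turn
  joins of elements into joins of ideals.\<close>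

lemma principal_ideal_lub:
  assumes Y: "Y \<subseteq> carrier S" and y: "is_lub (nat_order S) y Y"
  shows "is_lub (closed_ideals S) {x \<in> carrier S. x \<preceq> y} ((\<lambda>z. {x \<in> carrier S. x \<preceq> z}) ` Y)"
proof (subst is_lub_iff)
  have yc: "y \<in> carrier S" and ub: "\<forall>z\<in>Y. z \<preceq> y" using y nat_lub_iff[OF Y] by auto
  show "(\<lambda>z. {x \<in> carrier S. x \<preceq> z}) ` Y \<subseteq> carrier (closed_ideals S)" using principal_ideal Y by auto
  have "{x \<in> carrier S. x \<preceq> y} \<subseteq> B"
    if B: "B \<in> carrier (closed_ideals S)" and sub: "\<forall>z\<in>Y. {x \<in> carrier S. x \<preceq> z} \<subseteq> B" for B
  proof -
    have "Y \<subseteq> B" using sub Y nat_le_refl by blast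
    then have "y \<in> B" using closed_ideal_lub[OF B _ y] by blast
    then show ?thesis using closed_idealD(2)[OF B] by blast
  qed
  moreover have "{x \<in> carrier S. x \<preceq> z} \<subseteq> {x \<in> carrier S. x \<preceq> y}" if "z \<in> Y" for z
    using that ub Y yc nat_le_trans[of _ z y] by blast
  ultimately show "{x \<in> carrier S. x \<preceq> y} \<in> carrier (closed_ideals S) \<and>
    (\<forall>A\<in>(\<lambda>z. {x \<in> carrier S. x \<preceq> z}) ` Y. A \<sqsubseteq>\<^bsub>closed_ideals S\<^esub> {x \<in> carrier S. x \<preceq> y}) \<and>
    (\<forall>B\<in>carrier (closed_ideals S).
      (\<forall>A\<in>(\<lambda>z. {x \<in> carrier S. x \<preceq> z}) ` Y. A \<sqsubseteq>\<^bsub>closed_ideals S\<^esub> B) \<longrightarrow>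
      {x \<in> carrier S. x \<preceq> y} \<sqsubseteq>\<^bsub>closed_ideals S\<^esub> B)"
    using principal_ideal[OF yc] by simp
qed

text \<open>The principal ideal of a projection is a join of finite ideals. Each of these consists of
  projections and contains its own join, so it is principal, and its generator is a finite
  projection. So every projection is separated by finite ones from those it does not lie below.\<close>

lemma coherent_closed_ideals_enough_points:
  assumes coh: "coherent_frame (closed_ideals S)"
  shows "enough_points (proj_order S)"
proof (rule algebraic_frame_enough_points[OF proj_frame])
  interpret ci: partial_order "closed_ideals S" by (rule partial_order_closed_ideals)
  let ?D = "\<lambda>z. {x \<in> carrier S. x \<preceq> z}"
  fix a b assume ab: "a \<in> carrier (proj_order S)" "b \<in> carrier (proj_order S)" "\<not> a \<sqsubseteq>\<^bsub>proj_order S\<^esub> b"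
  then have a: "a \<in> proj S" and b: "b \<in> proj S" and nle: "\<not> a \<preceq> b" by auto
  have Da: "?D a \<in> carrier (closed_ideals S)" and Db: "?D b \<in> carrier (closed_ideals S)"
    using principal_ideal a b by auto
  obtain M where M: "\<forall>K\<in>M. finite_elem (closed_ideals S) K" "?D a = \<Squnion>\<^bsub>closed_ideals S\<^esub>M"
    using coh Da unfolding coherent_frame_def by blast
  have Mc: "M \<subseteq> carrier (closed_ideals S)" using M by (auto simp: finite_elem_def)
  have "is_lub (closed_ideals S) (\<Inter>{B \<in> carrier (closed_ideals S). \<forall>K\<in>M. K \<subseteq> B}) M"
  \<comment> \<open>closed ideals are stable under intersection, so the join of \<open>M\<close> is the least upper bound\<close>
  proof (subst is_lub_iff[OF Mc])
    let ?I = "\<Inter>{B \<in> carrier (closed_ideals S). \<forall>K\<in>M. K \<subseteq> B}"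
    have "x \<in> carrier S" if "is_lub (nat_order S) x X" for x X
      using that least_closed[of "nat_order S" x] by simp
    then have "carrier S \<in> carrier (closed_ideals S)" by (intro closed_idealI[of _ \<one>]) auto
    then have S: "carrier S \<in> {B \<in> carrier (closed_ideals S). \<forall>K\<in>M. K \<subseteq> B}"
      using Mc closed_idealD(1) by blast
    obtain z where z: "z \<in> carrier S" "\<forall>x\<in>carrier S. z \<preceq> x" using ex_zero by blast
    have "?I \<in> carrier (closed_ideals S)"
    proof (rule closed_idealI[of _ z])
      show "?I \<subseteq> carrier S" using S by blast
      have "z \<in> B" if B: "B \<in> carrier (closed_ideals S)" for B
      proof -
        obtain y where "y \<in> B" "y \<in> carrier S" using closed_idealD(4)[OF B] by blast
        then show ?thesis using closed_idealD(2)[OF B] z by blast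
      qed
      then show "z \<in> ?I" by blast
    next
      fix a b assume ab: "a \<in> ?I" "b \<in> carrier S" "b \<preceq> a"
      have "b \<in> B" if "B \<in> carrier (closed_ideals S)" "\<forall>K\<in>M. K \<subseteq> B" for B
        using closed_idealD(2)[OF that(1) _ ab(2,3)] ab(1) that by simp
      then show "b \<in> ?I" by simp
    next
      fix X x assume X: "X \<subseteq> ?I" "is_lub (nat_order S) x X"
      have "x \<in> B" if "B \<in> carrier (closed_ideals S)" "\<forall>K\<in>M. K \<subseteq> B" for B
        using closed_ideal_lub[OF that(1) _ X(2)] X(1) that by blast
      then show "x \<in> ?I" by simp
    qed
    note I1 = this
    have I2: "K \<subseteq> ?I" if "K \<in> M" for K using that by (intro Inter_greatest) simp
    have I3: "?I \<subseteq> B" if "B \<in> carrier (closed_ideals S)" "\<forall>K\<in>M. K \<subseteq> B" for B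
      using that by (intro Inter_lower) simp
    show "?I \<in> carrier (closed_ideals S) \<and> (\<forall>K\<in>M. K \<sqsubseteq>\<^bsub>closed_ideals S\<^esub> ?I) \<and>
      (\<forall>B\<in>carrier (closed_ideals S). (\<forall>K\<in>M. K \<sqsubseteq>\<^bsub>closed_ideals S\<^esub> B) \<longrightarrow> ?I \<sqsubseteq>\<^bsub>closed_ideals S\<^esub> B)"
      unfolding closed_ideals_simps
      by (intro conjI ballI impI) (rule I1, erule I2, erule I3, assumption)
  qed
  then obtain I where I: "is_lub (closed_ideals S) I M" by (rule that)
  have DI: "?D a = I" using M(2) unfolding ci.sup_eqI[OF I] .
  have lubM: "is_lub (closed_ideals S) (?D a) M" unfolding DI by (rule I)
  have "\<not> ?D a \<subseteq> ?D b" using nle a by auto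
  moreover have lubM': "\<forall>K\<in>M. K \<subseteq> ?D a"
      "\<forall>B\<in>carrier (closed_ideals S). (\<forall>K\<in>M. K \<subseteq> B) \<longrightarrow> ?D a \<subseteq> B"
    using lubM unfolding is_lub_iff[OF Mc] closed_ideals_simps by (rule conjunct1[OF conjunct2], rule conjunct2[OF conjunct2])
  ultimately have "\<not> (\<forall>K\<in>M. K \<subseteq> ?D b)" using Db by (metis (no_types, lifting))
  then obtain K where K: "K \<in> M" "\<not> K \<subseteq> ?D b" by blast
  then have Kc: "K \<in> carrier (closed_ideals S)" and Kfin: "finite_elem (closed_ideals S) K" using M Mc by auto
  have Ka: "K \<subseteq> ?D a" using lubM'(1) K(1) by (rule bspec)
  then have Kp: "K \<subseteq> proj S" using le_proj_in_proj a by blast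
  then obtain k where "is_lub (proj_order S) k K" using pord.sup_exists by auto
  then have lubk: "is_lub (nat_order S) k K" and kp: "k \<in> proj S"
    using proj_lub_imp_nat_lub[OF Kp] proj_lub_iff[OF Kp] by auto
  have kK: "k \<in> K" using closed_ideal_lub[OF Kc _ lubk] by blast
  have KD: "K = ?D k"
  proof
    show "K \<subseteq> ?D k" using lubk nat_lub_iff[of K k] Kp by blast
    show "?D k \<subseteq> K" using closed_idealD(2)[OF Kc kK] by blast
  qed
  have "finite_elem (proj_order S) k"
    unfolding finite_elem_def
  proof (intro conjI allI impI)
    show "k \<in> carrier (proj_order S)" using kp by simp
    fix Y assume Y: "Y \<subseteq> carrier (proj_order S)" "k = \<Squnion>\<^bsub>proj_order S\<^esub>Y"
    then have Yp: "Y \<subseteq> proj S" by simp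
    have Yc: "Y \<subseteq> carrier S" using Yp by auto
    have lubY: "is_lub (proj_order S) k Y" using pord.sup_exists[OF Y(1)] pord.sup_eqI Y(2) by metis
    have "K = \<Squnion>\<^bsub>closed_ideals S\<^esub>(?D ` Y)"
      using ci.sup_eqI[OF principal_ideal_lub[OF Yc proj_lub_imp_nat_lub[OF Yp lubY]]] KD by simp
    moreover have "?D ` Y \<subseteq> carrier (closed_ideals S)" using principal_ideal Yc by auto
    ultimately have "\<exists>F\<subseteq>?D ` Y. finite F \<and> K = \<Squnion>\<^bsub>closed_ideals S\<^esub>F"
      using Kfin unfolding finite_elem_def by blast
    then obtain F where F: "F \<subseteq> ?D ` Y" "finite F" "K = \<Squnion>\<^bsub>closed_ideals S\<^esub>F" by blast
    then obtain G where G: "G \<subseteq> Y" "finite G" "F = ?D ` G" by (meson finite_subset_image)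
    have Gp: "G \<subseteq> proj S" "G \<subseteq> carrier S" using G Yp Yc by auto
    obtain g where g: "is_lub (proj_order S) g G" using pord.sup_exists[of G] Gp by auto
    then have gp: "g \<in> proj S" using proj_lub_iff[OF Gp(1)] by blast
    have "K = ?D g"
      using ci.sup_eqI[OF principal_ideal_lub[OF Gp(2) proj_lub_imp_nat_lub[OF Gp(1) g]]] F(3) G(3) by simp
    then have "?D g = ?D k" using KD by simp
    moreover have "g \<in> ?D g" "k \<in> ?D k" using gp kp by auto
    ultimately have "g \<preceq> k" "k \<preceq> g" by blast+
    then have "k = g" using nat_le_antisym gp kp by auto
    then have "k = \<Squnion>\<^bsub>proj_order S\<^esub>G" using pord.sup_eqI[OF g] by simp
    then show "\<exists>F\<subseteq>Y. finite F \<and> k = \<Squnion>\<^bsub>proj_order S\<^esub>F" using G by blast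
  qed
  moreover have "k \<preceq> a" using kK Ka by blast
  moreover have "\<not> k \<preceq> b"
  proof
    assume "k \<preceq> b"
    then have "K \<subseteq> ?D b" using KD nat_le_trans[of _ k b] kp b by blast
    then show False using K by blast
  qed
  ultimately show "\<exists>k. finite_elem (proj_order S) k \<and> k \<sqsubseteq>\<^bsub>proj_order S\<^esub> a \<and> \<not> k \<sqsubseteq>\<^bsub>proj_order S\<^esub> b"
    by auto
qed

lemma coherent_proj_enough_points:
  assumes coh: "coherent_frame (proj_order S)"
  shows "enough_points (proj_order S)"
proof (rule algebraic_frame_enough_points[OF proj_frame])
  fix a b assume ab: "a \<in> carrier (proj_order S)" "b \<in> carrier (proj_order S)" "\<not> a \<sqsubseteq>\<^bsub>proj_order S\<^esub> b"
  obtain M where M: "\<forall>k\<in>M. finite_elem (proj_order S) k" "a = \<Squnion>\<^bsub>proj_order S\<^esub>M"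
    using coh ab unfolding coherent_frame_def by blast
  have Mp: "M \<subseteq> proj S" using M by (auto simp: finite_elem_def)
  have "is_lub (proj_order S) a M" using pord.sup_exists[of M] pord.sup_eqI M Mp by (metis proj_order_simps(1))
  then have lub: "\<forall>k\<in>M. k \<preceq> a" "\<forall>z\<in>proj S. (\<forall>k\<in>M. k \<preceq> z) \<longrightarrow> a \<preceq> z"
    using proj_lub_iff[OF Mp] by auto
  then obtain k where "k \<in> M" "\<not> k \<preceq> b" using ab by auto
  then show "\<exists>k. finite_elem (proj_order S) k \<and> k \<sqsubseteq>\<^bsub>proj_order S\<^esub> a \<and> \<not> k \<sqsubseteq>\<^bsub>proj_order S\<^esub> b"
    using M lub by auto
qed

end

lemma rmonoid_ob_enough_points:
  assumes "rmonoid_ob v S"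
  shows "complete_rmonoid S" "enough_points (proj_order S)"
proof -
  show c: "complete_rmonoid S" using assms by (cases v) auto
  interpret complete_rmon S using c by (rule complete_rmonI)
  show "enough_points (proj_order S)"
  proof (cases v)
    case Sober_Spatial
    then show ?thesis
      using assms spatial_frame_enough_points[OF proj_frame] by (simp add: spatial_rmonoid_def)
  next
    case Spectral_Coherent
    then show ?thesis using assms coherent_proj_enough_points by (simp add: coherent_rmonoid_def)
  next
    case Strongly_Spectral_Coherent
    then show ?thesis
      using assms coherent_closed_ideals_enough_points by (simp add: strongly_coherent_rmonoid_def)
  qed
qed

context complete_rmon
begin

lemma representation_nat_order:
  assumes "enough_points (proj_order S)"
  shows "representation (nat_order S) (point_space (nat_order S)) (pts (nat_order S))"
proof (rule nord.representation_point_space[OF enough_points_nat_order[OF assms]])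
  fix M z assume "M \<subseteq> carrier (nat_order S)" "z \<in> carrier (nat_order S)" "\<forall>y\<in>M. y \<sqsubseteq>\<^bsub>nat_order S\<^esub> z"
  then show "\<exists>x. is_lub (nat_order S) x M" by (intro ex_bounded_lub[of M z]) simp_all
qed

lemma full_representation_proj_order:
  assumes "enough_points (proj_order S)"
  shows "full_representation (proj_order S) (point_space (proj_order S)) (pts (proj_order S))"
proof -
  interpret representation "proj_order S" "point_space (proj_order S)" "pts (proj_order S)"
    by (rule pord.representation_point_space[OF assms]) (rule pord.sup_exists)
  show ?thesis
    by (rule full_representationI[of \<one>])
      (auto simp: topspace_point_space pts_def intro: proj_filter_one)
qed

end

section \<open>Continuous and open maps of spaces of points\<close>

lemma continuous_map_into_point_space:
  assumes "\<And>x. x \<in> topspace X \<Longrightarrow> cp_filter L (f x)"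
    and "\<And>a. a \<in> carrier L \<Longrightarrow> openin X {x \<in> topspace X. a \<in> f x}"
  shows "continuous_map X (point_space L) f"
  unfolding continuous_map_def
proof (intro conjI allI impI)
  show "f \<in> topspace X \<rightarrow> topspace (point_space L)" using assms(1) by (simp add: topspace_point_space)
  fix U assume U: "openin (point_space L) U"
  show "openin X {x \<in> topspace X. f x \<in> U}"
  proof (subst openin_subopen, intro ballI)
    fix x assume x: "x \<in> {x \<in> topspace X. f x \<in> U}"
    then obtain a where a: "a \<in> f x" "pts L a \<subseteq> U" using U unfolding openin_point_space by blast
    have "a \<in> carrier L" using cp_filter_carrier[OF assms(1)] x a by blast
    moreover have "{y \<in> topspace X. a \<in> f y} \<subseteq> {x \<in> topspace X. f x \<in> U}"
      using a assms(1) by (auto simp: pts_def)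
    ultimately show "\<exists>T. openin X T \<and> x \<in> T \<and> T \<subseteq> {x \<in> topspace X. f x \<in> U}"
      using assms(2)[of a] x a by (intro exI[of _ "{y \<in> topspace X. a \<in> f y}"]) simp
  qed
qed

lemma open_map_from_point_space:
  assumes "\<And>a. a \<in> carrier L \<Longrightarrow> openin Y (f ` pts L a)"
  shows "open_map (point_space L) Y f"
  unfolding open_map_def
proof (intro allI impI)
  fix U assume U: "openin (point_space L) U"
  show "openin Y (f ` U)"
  proof (subst openin_subopen, intro ballI)
    fix y assume "y \<in> f ` U"
    then obtain P where P: "P \<in> U" "y = f P" by blast
    then obtain a where a: "cp_filter L P" "a \<in> P" "pts L a \<subseteq> U" using U unfolding openin_point_space by blast
    have "a \<in> carrier L" using cp_filter_carrier[OF a(1)] a(2) by blast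
    then have "openin Y (f ` pts L a)" by (rule assms)
    moreover have "y \<in> f ` pts L a" using P a by (simp add: pts_def)
    ultimately show "\<exists>T. openin Y T \<and> y \<in> T \<and> T \<subseteq> f ` U"
      using a(3) by (intro exI[of _ "f ` pts L a"]) auto
  qed
qed

lemma local_homeoI:
  assumes cont: "continuous_map X Y f" and op: "open_map X Y f"
    and inj: "\<And>x. x \<in> topspace X \<Longrightarrow> \<exists>U. openin X U \<and> x \<in> U \<and> inj_on f U"
  shows "local_homeo X Y f"
  unfolding local_homeo_def
proof (intro conjI ballI)
  show "continuous_map X Y f" by fact
  fix x assume "x \<in> topspace X"
  then obtain U where U: "openin X U" "x \<in> U" "inj_on f U" using inj by blast
  have "homeomorphic_map (subtopology X U) (subtopology Y (f ` U)) f"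
  proof (rule bijective_open_imp_homeomorphic_map)
    have UX: "topspace (subtopology X U) = U" using openin_subset[OF U(1)] by auto
    have fU: "f ` U \<subseteq> topspace Y" using op U(1) openin_subset unfolding open_map_def by blast
    show "continuous_map (subtopology X U) (subtopology Y (f ` U)) f"
      using cont UX by (simp add: continuous_map_in_subtopology continuous_map_from_subtopology)
    show "f ` topspace (subtopology X U) = topspace (subtopology Y (f ` U))"
      using fU UX by auto
    show "inj_on f (topspace (subtopology X U))" using U UX by simp
    show "open_map (subtopology X U) (subtopology Y (f ` U)) f"
      unfolding open_map_def
    proof (intro allI impI)
      fix V assume "openin (subtopology X U) V"
      then have V: "openin X V" "V \<subseteq> U" using openin_open_subtopology[OF U(1)] by auto
      then have "openin Y (f ` V)" using op unfolding open_map_def by blast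
      moreover have "f ` V = f ` V \<inter> f ` U" using V by blast
      ultimately show "openin (subtopology Y (f ` U)) (f ` V)" unfolding openin_subtopology by blast
    qed
  qed
  then show "\<exists>U. openin X U \<and> x \<in> U \<and> openin Y (f ` U) \<and>
      homeomorphic_map (subtopology X U) (subtopology Y (f ` U)) f"
    using U op unfolding open_map_def by blast
qed

lemma openin_UN_pts: "openin (point_space L) (\<Union>a\<in>A. pts L a)"
  by (rule openin_Union) (auto simp: openin_pts)

section \<open>The category of completely prime filters\<close>

definition fmult :: "'a rmonoid \<Rightarrow> 'a set \<Rightarrow> 'a set \<Rightarrow> 'a set" where
  "fmult S P Q = up_closure (nat_order S) {a \<otimes>\<^bsub>S\<^esub> b | a b. a \<in> P \<and> b \<in> Q}"

lemma filter_category_simps [simp]: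
  "Arr (filter_category S) = point_space (nat_order S)"
  "Ob (filter_category S) = point_space (proj_order S)"
  "un (filter_category S) = up_closure (nat_order S)"
  "dm (filter_category S) = fdom S"
  "cd (filter_category S) = fcod S"
  "cmp (filter_category S) = fmult S"
  by (simp_all add: filter_category_def fun_eq_iff fdom_def fcod_def fmult_def)

lemma fmult_opp [simp]: "fmult (opp S) P Q = fmult S Q P"
proof -
  have "{a \<otimes>\<^bsub>opp S\<^esub> b | a b. a \<in> P \<and> b \<in> Q} = {a \<otimes>\<^bsub>S\<^esub> b | a b. a \<in> Q \<and> b \<in> P}" by auto
  then show ?thesis unfolding fmult_def by simp
qed

lemma topspace_composable:
  "topspace (composable C) = {(a, b). a \<in> topspace (Arr C) \<and> b \<in> topspace (Arr C) \<and> dm C a = cd C b}"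
  unfolding composable_def by auto

lemma topspace_composable_filters:
  "topspace (composable (filter_category S)) =
     {(P, Q). nat_filter S P \<and> nat_filter S Q \<and> fdom S P = fcod S Q}"
  by (simp add: topspace_composable topspace_point_space)

context complete_rmon
begin

lemmas mem_fcod = complete_rmon.mem_fdom[OF complete_rmon_opp, unfolded fdom_opp opp_simps nat_le_opp]
lemmas rho_mem_fcod = complete_rmon.lam_mem_fdom[OF complete_rmon_opp, unfolded fdom_opp opp_simps nat_le_opp orders_opp]
lemmas proj_mult_mem_iff = complete_rmon.mult_proj_mem_iff[OF complete_rmon_opp, unfolded fdom_opp opp_simps nat_le_opp orders_opp]
lemmas proj_filter_fcod = complete_rmon.proj_filter_fdom[OF complete_rmon_opp, unfolded fdom_opp opp_simps nat_le_opp orders_opp]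
lemmas filter_eqI_cod = complete_rmon.filter_eqI[OF complete_rmon_opp, unfolded fdom_opp opp_simps nat_le_opp orders_opp]

lemma mem_fmult: "x \<in> fmult S P Q \<longleftrightarrow> x \<in> carrier S \<and> (\<exists>a\<in>P. \<exists>b\<in>Q. a \<otimes> b \<preceq> x)"
  unfolding fmult_def up_closure_def by auto

lemma mult_mem_fmult: "nat_filter S P \<Longrightarrow> nat_filter S Q \<Longrightarrow> a \<in> P \<Longrightarrow> b \<in> Q \<Longrightarrow> a \<otimes> b \<in> fmult S P Q"
  unfolding mem_fmult using nat_filter_carrier nat_le_refl m_closed by metis

text \<open>A product of restrictions is a restriction of the product: \<open>(a g)(b f) = a b \<lambda>(g b f)\<close>, where
  \<open>g b f\<close> is again in \<open>Q\<close> because \<open>g\<close> is in the codomain of \<open>Q\<close>.\<close>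

lemma fmult_eq_germ:
  assumes P: "nat_filter S P" and Q: "nat_filter S Q" and c: "fdom S P = fcod S Q"
    and a: "a \<in> P" and b: "b \<in> Q"
  shows "lam S (a \<otimes> b) \<in> fdom S Q" "fmult S P Q = germ S (a \<otimes> b) (fdom S Q)"
proof -
  have ac: "a \<in> carrier S" and bc: "b \<in> carrier S" using nat_filter_carrier P Q a b by auto
  have "lam S a \<in> fcod S Q" using lam_mem_fdom[OF P a] c by simp
  then have "lam S a \<otimes> b \<in> Q" using proj_mult_mem_iff[OF Q b] ac by auto
  then show "lam S (a \<otimes> b) \<in> fdom S Q" using lam_mem_fdom[OF Q] lam_lam_mult[OF ac bc] by metis
  show "fmult S P Q = germ S (a \<otimes> b) (fdom S Q)"
  proof
    show "fmult S P Q \<subseteq> germ S (a \<otimes> b) (fdom S Q)"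
    proof
      fix x assume "x \<in> fmult S P Q"
      then obtain a' b' where x: "x \<in> carrier S" "a' \<in> P" "b' \<in> Q" "a' \<otimes> b' \<preceq> x" unfolding mem_fmult by blast
      have a'c: "a' \<in> carrier S" and b'c: "b' \<in> carrier S" using nat_filter_carrier P Q x by auto
      obtain g where g: "g \<in> fdom S P" "a \<otimes> g \<preceq> a'"
        using x(2) filter_eq_germ[OF P a] unfolding germ_def by blast
      obtain f where f: "f \<in> fdom S Q" "b \<otimes> f \<preceq> b'"
        using x(3) filter_eq_germ[OF Q b] unfolding germ_def by blast
      have gp: "g \<in> proj S" and fp: "f \<in> proj S" using f g mem_fdom by auto
      have "b \<otimes> f \<in> Q" using mult_proj_mem_iff[OF Q b fp] f by simp
      then have y: "g \<otimes> (b \<otimes> f) \<in> Q" using proj_mult_mem_iff[OF Q _ gp] g c by simp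
      let ?y = "g \<otimes> (b \<otimes> f)"
      have yc: "?y \<in> carrier S" using gp fp bc by simp
      have "?y \<preceq> b"
        using nat_le_trans[OF proj_mult_le[of "b \<otimes> f" g] mult_proj_le[of b f]] gp fp bc by simp
      then have "b \<otimes> lam S ?y = ?y" using nat_leD yc bc by simp
      then have "(a \<otimes> b) \<otimes> lam S ?y = a \<otimes> ?y" using ac bc yc by (simp add: m_assoc)
      also have "\<dots> = (a \<otimes> g) \<otimes> (b \<otimes> f)" using ac bc gp fp by (simp add: m_assoc)
      also have "\<dots> \<preceq> a' \<otimes> b'" using mult_mono[OF g(2) f(2)] ac bc gp fp a'c b'c by simp
      finally have "(a \<otimes> b) \<otimes> lam S ?y \<preceq> x"
        using nat_le_trans[OF _ x(4)] x(1) a'c b'c ac bc yc by simp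
      then show "x \<in> germ S (a \<otimes> b) (fdom S Q)"
        unfolding germ_def using x(1) lam_mem_fdom[OF Q y] by blast
    qed
    show "germ S (a \<otimes> b) (fdom S Q) \<subseteq> fmult S P Q"
    proof
      fix x assume "x \<in> germ S (a \<otimes> b) (fdom S Q)"
      then obtain f where f: "x \<in> carrier S" "f \<in> fdom S Q" "a \<otimes> b \<otimes> f \<preceq> x" unfolding germ_def by blast
      then have fp: "f \<in> proj S" using mem_fdom by blast
      have "b \<otimes> f \<in> Q" using mult_proj_mem_iff[OF Q b fp] f by simp
      moreover have "a \<otimes> (b \<otimes> f) \<preceq> x" using f ac bc fp by (simp add: m_assoc)
      ultimately show "x \<in> fmult S P Q" unfolding mem_fmult using f a by blast
    qed
  qed
qed

lemma fmult_filter: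
  assumes P: "nat_filter S P" and Q: "nat_filter S Q" and c: "fdom S P = fcod S Q"
  shows "nat_filter S (fmult S P Q)" "fdom S (fmult S P Q) = fdom S Q"
proof -
  obtain a b where ab: "a \<in> P" "b \<in> Q" using nat_filter_nonempty P Q by metis
  have "a \<otimes> b \<in> carrier S" using nat_filter_carrier P Q ab by auto
  note germ_filter[OF proj_filter_fdom[OF Q] this fmult_eq_germ(1)[OF P Q c ab]]
  then show "nat_filter S (fmult S P Q)" "fdom S (fmult S P Q) = fdom S Q"
    using fmult_eq_germ(2)[OF P Q c ab] by simp_all
qed

lemma fcod_fmult:
  assumes "nat_filter S P" "nat_filter S Q" "fdom S P = fcod S Q"
  shows "fcod S (fmult S P Q) = fcod S P"
  using complete_rmon.fmult_filter(2)[OF complete_rmon_opp, of Q P] assms by simp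

lemma unit_filter:
  assumes p: "proj_filter S p"
  shows "nat_filter S (up_closure (nat_order S) p)" "fdom S (up_closure (nat_order S) p) = p"
    and "p \<subseteq> up_closure (nat_order S) p"
proof -
  have "up_closure (nat_order S) p = germ S \<one> p"
    unfolding up_closure_def germ_def using proj_filter_proj[OF p] by auto
  then show "nat_filter S (up_closure (nat_order S) p)" "fdom S (up_closure (nat_order S) p) = p"
    using germ_filter[OF p, of \<one>] proj_filter_one[OF p] by simp_all
  show "p \<subseteq> up_closure (nat_order S) p"
    using proj_filter_proj[OF p] by (force simp: up_closure_def)
qed

lemma fcod_unit: "proj_filter S p \<Longrightarrow> fcod S (up_closure (nat_order S) p) = p"
  using complete_rmon.unit_filter(2)[OF complete_rmon_opp, of p] by simp

lemma image_fdom_pts: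
  assumes s: "s \<in> carrier S"
  shows "fdom S ` pts (nat_order S) s = pts (proj_order S) (lam S s)"
proof
  show "fdom S ` pts (nat_order S) s \<subseteq> pts (proj_order S) (lam S s)"
    using proj_filter_fdom lam_mem_fdom by (auto simp: pts_def)
  show "pts (proj_order S) (lam S s) \<subseteq> fdom S ` pts (nat_order S) s"
  proof
    fix p assume "p \<in> pts (proj_order S) (lam S s)"
    then have p: "proj_filter S p" "lam S s \<in> p" by (auto simp: pts_def)
    note g = germ_filter[OF p(1) s p(2)]
    then have "germ S s p \<in> pts (nat_order S) s" by (simp add: pts_def)
    then show "p \<in> fdom S ` pts (nat_order S) s" using g(3) by (metis image_eqI)
  qed
qed

lemma continuous_fdom: "continuous_map (point_space (nat_order S)) (point_space (proj_order S)) (fdom S)"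
proof (rule continuous_map_into_point_space)
  fix f assume "f \<in> carrier (proj_order S)"
  then have f: "f \<in> proj S" by simp
  have "{P \<in> topspace (point_space (nat_order S)). f \<in> fdom S P} =
      (\<Union>s\<in>{s \<in> carrier S. lam S s \<preceq> f}. pts (nat_order S) s)"
    unfolding topspace_point_space pts_def mem_fdom using f nat_filter_carrier by blast
  then show "openin (point_space (nat_order S)) {P \<in> topspace (point_space (nat_order S)). f \<in> fdom S P}"
    by (simp only: openin_UN_pts)
qed (simp add: topspace_point_space proj_filter_fdom)

lemma local_homeo_fdom: "local_homeo (point_space (nat_order S)) (point_space (proj_order S)) (fdom S)"
proof (rule local_homeoI[OF continuous_fdom])
  show "open_map (point_space (nat_order S)) (point_space (proj_order S)) (fdom S)"
    by (rule open_map_from_point_space) (simp add: image_fdom_pts openin_pts)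
  fix P assume "P \<in> topspace (point_space (nat_order S))"
  then have P: "nat_filter S P" by (simp add: topspace_point_space)
  then obtain s where s: "s \<in> P" using nat_filter_nonempty by blast
  have "inj_on (fdom S) (pts (nat_order S) s)"
    using filter_eqI by (auto simp: pts_def inj_on_def)
  then show "\<exists>U. openin (point_space (nat_order S)) U \<and> P \<in> U \<and> inj_on (fdom S) U"
    using s P openin_pts by (intro exI[of _ "pts (nat_order S) s"]) (simp add: pts_def)
qed

lemma local_homeo_fcod: "local_homeo (point_space (nat_order S)) (point_space (proj_order S)) (fcod S)"
  using complete_rmon.local_homeo_fdom[OF complete_rmon_opp] by simp

text \<open>A filter that contains a projection is the unit at its domain, since both have the same domain
  and share that projection.\<close>

lemma unit_image_pts:
  assumes f: "f \<in> proj S"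
  shows "up_closure (nat_order S) ` pts (proj_order S) f = pts (nat_order S) f"
proof
  show "up_closure (nat_order S) ` pts (proj_order S) f \<subseteq> pts (nat_order S) f"
    using unit_filter(1,3) by (fastforce simp: pts_def)
  show "pts (nat_order S) f \<subseteq> up_closure (nat_order S) ` pts (proj_order S) f"
  proof
    fix P assume "P \<in> pts (nat_order S) f"
    then have P: "nat_filter S P" "f \<in> P" by (auto simp: pts_def)
    have fd: "f \<in> fdom S P" using lam_mem_fdom[OF P] f by simp
    note d = proj_filter_fdom[OF P(1)]
    have "P = up_closure (nat_order S) (fdom S P)"
      using filter_eqI[OF P(1) unit_filter(1)[OF d] _ P(2)] unit_filter(2,3)[OF d] fd by auto
    then show "P \<in> up_closure (nat_order S) ` pts (proj_order S) f"
      using d fd by (auto simp: pts_def)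
  qed
qed

lemma continuous_unit:
  "continuous_map (point_space (proj_order S)) (point_space (nat_order S)) (up_closure (nat_order S))"
proof (rule continuous_map_into_point_space)
  fix s assume "s \<in> carrier (nat_order S)"
  then have s: "s \<in> carrier S" by simp
  have "{p \<in> topspace (point_space (proj_order S)). s \<in> up_closure (nat_order S) p} =
      (\<Union>f\<in>{f \<in> proj S. f \<preceq> s}. pts (proj_order S) f)"
    unfolding topspace_point_space pts_def up_closure_def using s proj_filter_proj by auto
  then show "openin (point_space (proj_order S)) {p \<in> topspace (point_space (proj_order S)). s \<in> up_closure (nat_order S) p}"
    by (simp only: openin_UN_pts)
qed (simp add: topspace_point_space unit_filter)

lemma continuous_fmult:
  "continuous_map (composable (filter_category S)) (point_space (nat_order S)) (\<lambda>(P, Q). fmult S P Q)"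
proof (rule continuous_map_into_point_space)
  let ?X = "composable (filter_category S)" and ?N = "point_space (nat_order S)"
  fix x assume "x \<in> topspace ?X"
  then show "nat_filter S (case x of (P, Q) \<Rightarrow> fmult S P Q)"
    using fmult_filter(1) by (auto simp: topspace_composable_filters)
next
  let ?X = "composable (filter_category S)" and ?N = "point_space (nat_order S)"
  fix s assume "s \<in> carrier (nat_order S)"
  then have s: "s \<in> carrier S" by simp
  \<comment> \<open>a product of filters contains \<open>s\<close> when members \<open>a\<close>, \<open>b\<close> of the factors have \<open>a b \<preceq> s\<close>\<close>
  let ?V = "\<Union>(a, b)\<in>{(a, b). a \<in> carrier S \<and> b \<in> carrier S \<and> a \<otimes> b \<preceq> s}. pts (nat_order S) a \<times> pts (nat_order S) b"
  have "openin (prod_topology ?N ?N) ?V"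
    by (rule openin_Union) (auto simp: openin_prod_Times_iff openin_pts)
  then have "openin ?X (?V \<inter> {(P, Q). fdom S P = fcod S Q})"
    unfolding composable_def openin_subtopology by auto
  moreover have "{x \<in> topspace ?X. s \<in> (case x of (P, Q) \<Rightarrow> fmult S P Q)} = ?V \<inter> {(P, Q). fdom S P = fcod S Q}"
    (is "?A = ?B")
  proof (rule Set.set_eqI)
    fix x
    show "x \<in> ?A \<longleftrightarrow> x \<in> ?B"
    proof (cases x)
      case (Pair P Q)
      show ?thesis
        unfolding Pair using s nat_filter_carrier[of P] nat_filter_carrier[of Q]
        by (simp add: topspace_composable_filters mem_fmult pts_def) blast
    qed
  qed
  ultimately show "openin ?X {x \<in> topspace ?X. s \<in> (case x of (P, Q) \<Rightarrow> fmult S P Q)}" by simp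
qed

text \<open>A filter that contains \<open>a b\<close> is a product of a filter that contains \<open>a\<close> and one that
  contains \<open>b\<close>, so multiplication of filters is open.\<close>

lemma fmult_factor:
  assumes R: "nat_filter S R" "a \<otimes> b \<in> R" and ab: "a \<in> carrier S" "b \<in> carrier S"
  shows "\<exists>P Q. nat_filter S P \<and> nat_filter S Q \<and> fdom S P = fcod S Q \<and> a \<in> P \<and> b \<in> Q \<and> fmult S P Q = R"
proof -
  note d = proj_filter_fdom[OF R(1)]
  have labd: "lam S (lam S a \<otimes> b) \<in> fdom S R" using lam_mem_fdom[OF R] lam_lam_mult ab by simp
  moreover have "lam S (lam S a \<otimes> b) \<preceq> lam S b" using lam_mono proj_mult_le ab by simp
  ultimately have "lam S b \<in> fdom S R" using proj_filter_up[OF d] ab by blast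
  then obtain Q where Q: "nat_filter S Q" "b \<in> Q" "fdom S Q = fdom S R" using germ_filter[OF d] ab by metis
  then have "lam S a \<otimes> b \<in> Q" using below_mem_iff[OF Q(1,2), of "lam S a \<otimes> b"] labd proj_mult_le ab by simp
  then have "lam S a \<in> fcod S Q" using proj_mult_mem_iff[OF Q(1,2)] ab by simp
  then obtain P where P: "nat_filter S P" "a \<in> P" "fdom S P = fcod S Q"
    using germ_filter[OF proj_filter_fcod[OF Q(1)]] ab by metis
  have "fmult S P Q = R"
    using filter_eqI[OF fmult_filter(1)[OF P(1) Q(1) P(3)] R(1) _ mult_mem_fmult[OF P(1) Q(1) P(2) Q(2)] R(2)]
      fmult_filter(2)[OF P(1) Q(1) P(3)] Q(3) by simp
  then show ?thesis using P Q by blast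
qed

lemma open_fmult:
  "open_map (composable (filter_category S)) (point_space (nat_order S)) (\<lambda>(P, Q). fmult S P Q)"
  unfolding open_map_def
proof (intro allI impI)
  let ?X = "composable (filter_category S)" and ?N = "point_space (nat_order S)"
  fix U assume "openin ?X U"
  then obtain V where V: "openin (prod_topology ?N ?N) V" "U = V \<inter> {(P, Q). fdom S P = fcod S Q}"
    unfolding composable_def openin_subtopology by auto
  show "openin ?N ((\<lambda>(P, Q). fmult S P Q) ` U)"
    unfolding openin_point_space
  proof
    fix R assume "R \<in> (\<lambda>(P, Q). fmult S P Q) ` U"
    then obtain P Q where PQ: "(P, Q) \<in> U" "R = fmult S P Q" by auto
    then have PQV: "(P, Q) \<in> V" and c: "fdom S P = fcod S Q" using V by auto
    obtain A B where AB: "openin ?N A" "openin ?N B" "P \<in> A" "Q \<in> B" "A \<times> B \<subseteq> V"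
      using V(1) PQV unfolding openin_prod_topology_alt by metis
    obtain a where a: "nat_filter S P" "a \<in> P" "pts (nat_order S) a \<subseteq> A" using AB unfolding openin_point_space by blast
    obtain b where b: "nat_filter S Q" "b \<in> Q" "pts (nat_order S) b \<subseteq> B" using AB unfolding openin_point_space by blast
    have ac: "a \<in> carrier S" and bc: "b \<in> carrier S" using nat_filter_carrier a b by auto
    have "pts (nat_order S) (a \<otimes> b) \<subseteq> (\<lambda>(P, Q). fmult S P Q) ` U"
    proof
      fix R' assume "R' \<in> pts (nat_order S) (a \<otimes> b)"
      then have "nat_filter S R'" "a \<otimes> b \<in> R'" by (auto simp: pts_def)
      then obtain P' Q' where P': "nat_filter S P'" "nat_filter S Q'" "fdom S P' = fcod S Q'"
          "a \<in> P'" "b \<in> Q'" "fmult S P' Q' = R'" using fmult_factor ac bc by blast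
      then have "P' \<in> A" "Q' \<in> B" using a b by (auto simp: pts_def)
      then have "(P', Q') \<in> U" using V AB(5) P'(3) by auto
      then show "R' \<in> (\<lambda>(P, Q). fmult S P Q) ` U" using P'(6) by force
    qed
    moreover have "a \<otimes> b \<in> R" using mult_mem_fmult a b PQ by simp
    ultimately show "nat_filter S R \<and> (\<exists>a\<in>R. pts (nat_order S) a \<subseteq> (\<lambda>(P, Q). fmult S P Q) ` U)"
      using fmult_filter(1)[OF a(1) b(1) c] PQ(2) by blast
  qed
qed

text \<open>The unit laws and associativity hold because both sides have the same domain and a common
  member.\<close>

lemma etale_filter_category: "etale_category (filter_category S)"
proof -
  have fc: "continuous_map (point_space (nat_order S)) (point_space (proj_order S)) (fcod S)"
    using local_homeo_fcod unfolding local_homeo_def by blast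
  have unit_r: "fmult S P (up_closure (nat_order S) (fdom S P)) = P" if P: "nat_filter S P" for P
  proof -
    note d = proj_filter_fdom[OF P]
    obtain s where s: "s \<in> P" "s \<in> carrier S" using nat_filter_nonempty[OF P] by blast
    have "lam S s \<in> up_closure (nat_order S) (fdom S P)" using unit_filter(3)[OF d] lam_mem_fdom[OF P s(1)] by blast
    then have "s \<in> fmult S P (up_closure (nat_order S) (fdom S P))"
      using mult_mem_fmult[OF P unit_filter(1)[OF d] s(1)] s(2) by force
    then show ?thesis
      using fmult_filter[OF P unit_filter(1)[OF d]] fcod_unit[OF d] unit_filter(2)[OF d]
      by (intro filter_eqI[OF _ P _ _ s(1)]) simp_all
  qed
  show ?thesis
    unfolding etale_category_def topological_category_def filter_category_simps
  proof (intro conjI)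
    show "\<forall>x\<in>topspace (point_space (proj_order S)).
       fdom S (up_closure (nat_order S) x) = x \<and> fcod S (up_closure (nat_order S) x) = x"
      by (simp add: topspace_point_space unit_filter(2) fcod_unit)
    show "\<forall>(a, b)\<in>topspace (composable (filter_category S)).
       fdom S (fmult S a b) = fdom S b \<and> fcod S (fmult S a b) = fcod S a"
      by (auto simp: topspace_composable_filters fmult_filter(2) fcod_fmult)
    show "\<forall>a\<in>topspace (point_space (nat_order S)).
       fmult S a (up_closure (nat_order S) (fdom S a)) = a \<and> fmult S (up_closure (nat_order S) (fcod S a)) a = a"
    proof (intro ballI conjI)
      fix P assume "P \<in> topspace (point_space (nat_order S))"
      then have P: "nat_filter S P" by (simp add: topspace_point_space)
      show "fmult S P (up_closure (nat_order S) (fdom S P)) = P" by (rule unit_r[OF P])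
      note d = proj_filter_fcod[OF P]
      obtain s where s: "s \<in> P" "s \<in> carrier S" using nat_filter_nonempty[OF P] by blast
      have "rho S s \<in> up_closure (nat_order S) (fcod S P)" using unit_filter(3)[OF d] rho_mem_fcod[OF P s(1)] by blast
      then have "s \<in> fmult S (up_closure (nat_order S) (fcod S P)) P"
        using mult_mem_fmult[OF unit_filter(1)[OF d] P _ s(1)] s(2) by force
      then show "fmult S (up_closure (nat_order S) (fcod S P)) P = P"
        using fmult_filter[OF unit_filter(1)[OF d] P] unit_filter(2)[OF d]
        by (intro filter_eqI[OF _ P _ _ s(1)]) simp_all
    qed
    show "\<forall>a b c. (a, b) \<in> topspace (composable (filter_category S)) \<and>
       (b, c) \<in> topspace (composable (filter_category S)) \<longrightarrow>
       fmult S (fmult S a b) c = fmult S a (fmult S b c)"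
    proof (intro allI impI)
      fix P Q R assume "(P, Q) \<in> topspace (composable (filter_category S)) \<and>
        (Q, R) \<in> topspace (composable (filter_category S))"
      then have P: "nat_filter S P" and Q: "nat_filter S Q" and R: "nat_filter S R"
        and PQ: "fdom S P = fcod S Q" and QR: "fdom S Q = fcod S R"
        by (auto simp: topspace_composable_filters)
      note PQf = fmult_filter[OF P Q PQ] and QRf = fmult_filter[OF Q R QR]
      have PQ_R: "fdom S (fmult S P Q) = fcod S R" using PQf QR by simp
      have P_QR: "fdom S P = fcod S (fmult S Q R)" using fcod_fmult[OF Q R QR] PQ by simp
      obtain a b c where abc: "a \<in> P" "b \<in> Q" "c \<in> R" using nat_filter_nonempty P Q R by metis
      have carr: "a \<in> carrier S" "b \<in> carrier S" "c \<in> carrier S" using abc nat_filter_carrier P Q R by auto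
      have "(a \<otimes> b) \<otimes> c \<in> fmult S (fmult S P Q) R" "a \<otimes> (b \<otimes> c) \<in> fmult S P (fmult S Q R)"
        using mult_mem_fmult PQf(1) QRf(1) P Q R abc by auto
      then have "a \<otimes> b \<otimes> c \<in> fmult S (fmult S P Q) R" "a \<otimes> b \<otimes> c \<in> fmult S P (fmult S Q R)"
        using m_assoc[OF carr] by simp_all
      moreover have "fdom S (fmult S (fmult S P Q) R) = fdom S (fmult S P (fmult S Q R))"
        unfolding fmult_filter(2)[OF PQf(1) R PQ_R] fmult_filter(2)[OF P QRf(1) P_QR] QRf(2) ..
      ultimately show "fmult S (fmult S P Q) R = fmult S P (fmult S Q R)"
        by (intro filter_eqI[OF fmult_filter(1)[OF PQf(1) R PQ_R] fmult_filter(1)[OF P QRf(1) P_QR]])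
    qed
    show "open_map (point_space (proj_order S)) (point_space (nat_order S)) (up_closure (nat_order S))"
      by (rule open_map_from_point_space) (simp add: unit_image_pts openin_pts)
  qed (rule continuous_unit continuous_fdom fc continuous_fmult local_homeo_fdom local_homeo_fcod open_fmult)+
qed

end

section \<open>Homomorphisms induce relational covering morphisms\<close>

locale restriction_hom = S: complete_rmon S + T: complete_rmon T for S :: "'s rmonoid" and T :: "'t rmonoid" +
  fixes h :: "'s \<Rightarrow> 't"
  assumes hom: "rmonoid_hom S T h"

lemma restriction_homI: "complete_rmonoid S \<Longrightarrow> complete_rmonoid T \<Longrightarrow> rmonoid_hom S T h \<Longrightarrow> restriction_hom S T h"
  by (simp add: restriction_hom_def restriction_hom_axioms_def complete_rmonI)

definition proj_pre :: "'s rmonoid \<Rightarrow> ('s \<Rightarrow> 't) \<Rightarrow> 't set \<Rightarrow> 's set" where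
  "proj_pre S h p = {f \<in> proj S. h f \<in> p}"

lemma proj_pre_opp [simp]: "proj_pre (opp S) h p = proj_pre S h p"
  by (simp add: proj_pre_def)

context restriction_hom
begin

lemma h_closed [simp, intro]: "a \<in> carrier S \<Longrightarrow> h a \<in> carrier T"
  and h_mult: "a \<in> carrier S \<Longrightarrow> b \<in> carrier S \<Longrightarrow> h (a \<otimes>\<^bsub>S\<^esub> b) = h a \<otimes>\<^bsub>T\<^esub> h b"
  and h_lam: "a \<in> carrier S \<Longrightarrow> h (lam S a) = lam T (h a)"
  and h_rho: "a \<in> carrier S \<Longrightarrow> h (rho S a) = rho T (h a)"
  and h_proj [simp, intro]: "f \<in> proj S \<Longrightarrow> h f \<in> proj T"
  using hom by (auto simp: rmonoid_hom_def hom_def frame_hom_def)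

lemma h_mono: "nat_le S a b \<Longrightarrow> a \<in> carrier S \<Longrightarrow> b \<in> carrier S \<Longrightarrow> nat_le T (h a) (h b)"
  using S.nat_leD[of a b] h_mult[of b "lam S a"] h_lam[of a] by (simp add: T.nat_le_iff_lam)

lemma h_one: "h \<one>\<^bsub>S\<^esub> = \<one>\<^bsub>T\<^esub>"
proof -
  have "\<top>\<^bsub>proj_order S\<^esub> = \<one>\<^bsub>S\<^esub>"
    using S.mult_proj_le[of "\<one>\<^bsub>S\<^esub>"] by (intro S.pord.top_eqI) auto
  moreover have "\<top>\<^bsub>proj_order T\<^esub> = \<one>\<^bsub>T\<^esub>"
    using T.mult_proj_le[of "\<one>\<^bsub>T\<^esub>"] by (intro T.pord.top_eqI) auto
  ultimately show ?thesis using hom by (simp add: rmonoid_hom_def frame_hom_def)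
qed

lemma h_lub:
  assumes X: "X \<subseteq> proj S" and x: "is_lub (proj_order S) x X"
  shows "is_lub (proj_order T) (h x) (h ` X)"
proof -
  have "h (\<Squnion>\<^bsub>proj_order S\<^esub>X) = \<Squnion>\<^bsub>proj_order T\<^esub>(h ` X)"
    using hom X by (simp add: rmonoid_hom_def frame_hom_def)
  then have eq: "h x = \<Squnion>\<^bsub>proj_order T\<^esub>(h ` X)" using S.pord.sup_eqI[OF x] by simp
  have "h ` X \<subseteq> carrier (proj_order T)" using X by auto
  then obtain y where y: "is_lub (proj_order T) y (h ` X)" using T.pord.sup_exists by blast
  then show ?thesis using eq T.pord.sup_eqI[OF y] by simp
qed

lemma restriction_hom_opp: "restriction_hom (opp S) (opp T) h"
proof (rule restriction_homI)
  show "rmonoid_hom (opp S) (opp T) h"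
    using hom by (auto simp: rmonoid_hom_def hom_def)
qed (use S.complete T.complete complete_rmonoid_opp in auto)

lemma proj_filter_pre:
  assumes p: "proj_filter T p"
  shows "proj_filter S (proj_pre S h p)"
  unfolding cp_filter_def
proof (intro conjI ballI allI impI)
  show "proj_pre S h p \<subseteq> carrier (proj_order S)" by (auto simp: proj_pre_def)
  show "proj_pre S h p \<noteq> {}" using T.proj_filter_one[OF p] h_one S.one_in_proj unfolding proj_pre_def by auto
next
  fix f g assume "f \<in> proj_pre S h p" "g \<in> carrier (proj_order S)" "f \<sqsubseteq>\<^bsub>proj_order S\<^esub> g"
  then show "g \<in> proj_pre S h p"
    using T.proj_filter_up[OF p, of "h f" "h g"] h_mono[of f g] by (simp add: proj_pre_def)
next
  fix f g assume "f \<in> proj_pre S h p" "g \<in> proj_pre S h p"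
  then have fg: "f \<in> proj S" "g \<in> proj S" "h f \<in> p" "h g \<in> p" by (auto simp: proj_pre_def)
  then have "f \<otimes>\<^bsub>S\<^esub> g \<in> proj_pre S h p"
    using T.proj_filter_mult[OF p] h_mult[of f g] by (simp add: proj_pre_def)
  then show "\<exists>c\<in>proj_pre S h p. c \<sqsubseteq>\<^bsub>proj_order S\<^esub> f \<and> c \<sqsubseteq>\<^bsub>proj_order S\<^esub> g"
    using S.mult_proj_le[of f g] S.proj_mult_le[of g f] fg by (intro bexI[of _ "f \<otimes>\<^bsub>S\<^esub> g"]) auto
next
  fix X x assume X: "X \<subseteq> carrier (proj_order S)" and x: "x \<in> proj_pre S h p" "is_lub (proj_order S) x X"
  have hX: "h ` X \<subseteq> proj T" using X by auto
  have "is_lub (proj_order T) (h x) (h ` X)" using h_lub x X by simp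
  then have "\<exists>y\<in>h ` X. y \<in> p" using T.proj_filter_lub[OF p hX] x by (simp add: proj_pre_def)
  then show "X \<inter> proj_pre S h p \<noteq> {}" using X by (auto simp: proj_pre_def)
qed

text \<open>The lift of a filter \<open>Q\<close> along a point \<open>p\<close> of the target that lies over the domain of \<open>Q\<close>
  is the germ at \<open>p\<close> of \<open>h q\<close>, for any \<open>q \<in> Q\<close>.\<close>

lemma lift_dom:
  assumes Q: "nat_filter S Q" and p: "proj_filter T p" and d: "fdom S Q = proj_pre S h p"
  shows "\<exists>P. nat_filter T P \<and> fdom T P = p \<and> h ` Q \<subseteq> P \<and> fcod S Q = proj_pre S h (fcod T P)"
proof -
  obtain q where q: "q \<in> carrier S" "q \<in> Q" using S.nat_filter_nonempty[OF Q] by blast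
  have in_p: "h f \<in> p" if "f \<in> fdom S Q" for f using that d by (simp add: proj_pre_def)
  have "lam T (h q) \<in> p" using in_p[OF S.lam_mem_fdom[OF Q q(2)]] h_lam q by simp
  note g = T.germ_filter[OF p h_closed[OF q(1)] this]
  define P where "P = germ T (h q) p"
  note P = g[folded P_def]
  have hQ: "h x \<in> P" if x: "x \<in> Q" for x
  proof -
    have xc: "x \<in> carrier S" using S.nat_filter_carrier[OF Q x] .
    obtain f where f: "f \<in> fdom S Q" "nat_le S (q \<otimes>\<^bsub>S\<^esub> f) x"
      using x S.filter_eq_germ[OF Q q(2)] unfolding germ_def by blast
    have fp: "f \<in> proj S" using f S.mem_fdom by blast
    have "nat_le T (h q \<otimes>\<^bsub>T\<^esub> h f) (h x)" using h_mono[OF f(2)] h_mult q fp xc by simp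
    then show ?thesis unfolding P_def germ_def using in_p[OF f(1)] xc by blast
  qed
  have "fcod S Q = proj_pre S h (fcod T P)"
  proof
    show "fcod S Q \<subseteq> proj_pre S h (fcod T P)"
    proof
      fix f assume f: "f \<in> fcod S Q"
      then have fp: "f \<in> proj S" using S.mem_fcod by blast
      have "f \<otimes>\<^bsub>S\<^esub> q \<in> Q" using S.proj_mult_mem_iff[OF Q q(2) fp] f by simp
      then have "h f \<otimes>\<^bsub>T\<^esub> h q \<in> P" using hQ h_mult[of f q] fp q by force
      then show "f \<in> proj_pre S h (fcod T P)"
        using T.proj_mult_mem_iff[OF P(1,2), of "h f"] fp by (simp add: proj_pre_def)
    qed
    show "proj_pre S h (fcod T P) \<subseteq> fcod S Q"
    proof
      fix f assume "f \<in> proj_pre S h (fcod T P)"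
      then have f: "f \<in> proj S" "h f \<in> fcod T P" by (auto simp: proj_pre_def)
      then have "h (f \<otimes>\<^bsub>S\<^esub> q) \<in> P" using T.proj_mult_mem_iff[OF P(1,2), of "h f"] h_mult[of f q] q by simp
      then have "h (lam S (f \<otimes>\<^bsub>S\<^esub> q)) \<in> p" using T.lam_mem_fdom[OF P(1)] P(3) h_lam f q by force
      then have "lam S (f \<otimes>\<^bsub>S\<^esub> q) \<in> fdom S Q" using d f q by (simp add: proj_pre_def)
      then have "f \<otimes>\<^bsub>S\<^esub> q \<in> Q" using S.below_mem_iff[OF Q q(2)] S.proj_mult_le f q by simp
      then show "f \<in> fcod S Q" using S.proj_mult_mem_iff[OF Q q(2)] f by simp
    qed
  qed
  then show ?thesis using P hQ by blast
qed

lemma lift_cod: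
  assumes "nat_filter S Q" "proj_filter T p" "fcod S Q = proj_pre S h p"
  shows "\<exists>P. nat_filter T P \<and> fcod T P = p \<and> h ` Q \<subseteq> P \<and> fdom S Q = proj_pre S h (fdom T P)"
  using restriction_hom.lift_dom[OF restriction_hom_opp, of Q p] assms by simp

definition map_filter :: "'t set \<Rightarrow> 's set set" where
  "map_filter P = {Q. nat_filter S Q \<and> h ` Q \<subseteq> P \<and> fdom S Q = proj_pre S h (fdom T P) \<and>
     fcod S Q = proj_pre S h (fcod T P)}"

lemma on_arr_filter_map: "nat_filter T P \<Longrightarrow> on_arr (filter_map S T h) P = map_filter P"
  by (simp add: filter_map_def Let_def topspace_point_space map_filter_def proj_pre_def)

lemma on_ob_filter_map: "proj_filter T p \<Longrightarrow> on_ob (filter_map S T h) p = proj_pre S h p"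
  by (simp add: filter_map_def Let_def topspace_point_space proj_pre_def)

text \<open>The germ of \<open>s\<close> at the preimage of the domain of \<open>P\<close> lifts to a filter that contains \<open>h s\<close> and has
  the domain of \<open>P\<close>, which therefore is \<open>P\<close>.\<close>

lemma ex_map_filter:
  assumes P: "nat_filter T P" and s: "s \<in> carrier S" "h s \<in> P"
  shows "\<exists>Q\<in>map_filter P. s \<in> Q"
proof -
  note d = T.proj_filter_fdom[OF P]
  have "lam S s \<in> proj_pre S h (fdom T P)"
    using T.lam_mem_fdom[OF P s(2)] h_lam s by (simp add: proj_pre_def)
  note Q = S.germ_filter[OF proj_filter_pre[OF d] s(1) this]
  let ?Q = "germ S s (proj_pre S h (fdom T P))"
  obtain P' where P': "nat_filter T P'" "fdom T P' = fdom T P" "h ` ?Q \<subseteq> P'"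
      "fcod S ?Q = proj_pre S h (fcod T P')"
    using lift_dom[OF Q(1) d Q(3)] by blast
  have "P' = P" using T.filter_eqI[OF P'(1) P P'(2)] P'(3) Q(2) s by blast
  then show ?thesis using P' Q unfolding map_filter_def by blast
qed

lemma map_filter_inj:
  assumes P: "nat_filter T P" "nat_filter T P'" and dc: "fdom T P = fdom T P' \<or> fcod T P = fcod T P'"
    and Q: "Q \<in> map_filter P" "Q \<in> map_filter P'"
  shows "P = P'"
proof -
  have "nat_filter S Q" using Q by (simp add: map_filter_def)
  then obtain q where "q \<in> Q" using S.nat_filter_nonempty by blast
  then have "h q \<in> P" "h q \<in> P'" using Q unfolding map_filter_def by auto
  then show "P = P'" using dc T.filter_eqI[OF P] T.filter_eqI_cod[OF P] by blast
qed

text \<open>The covering condition is the lifting of filters along points, and the condition on preimages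
  holds because the filters related to a member of the basic open set of \<open>s\<close> are those that contain
  \<open>h s\<close>.\<close>

lemma rel_covering_filter_map: "rel_covering (filter_category T) (filter_category S) (filter_map S T h)"
  unfolding rel_covering_def filter_category_simps topspace_point_space
proof (intro conjI)
  let ?f = "filter_map S T h"
  show "on_arr ?f \<in> {P. nat_filter T P} \<rightarrow>\<^sub>E Pow {P. nat_filter S P}"
  proof (rule PiE_I)
    fix P assume "P \<in> {P. nat_filter T P}"
    then show "on_arr ?f P \<in> Pow {P. nat_filter S P}" using on_arr_filter_map[of P] by (auto simp: map_filter_def)
  next
    fix P assume "P \<notin> {P. nat_filter T P}"
    then show "on_arr ?f P = undefined" by (simp add: filter_map_def Let_def topspace_point_space)
  qed
  show "on_ob ?f \<in> extensional {P. proj_filter T P}"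
    by (simp add: filter_map_def Let_def topspace_point_space)
  show "continuous_map (point_space (proj_order T)) (point_space (proj_order S)) (on_ob ?f)"
  proof (rule continuous_map_into_point_space)
    fix f assume "f \<in> carrier (proj_order S)"
    then have "{p \<in> topspace (point_space (proj_order T)). f \<in> on_ob ?f p} = pts (proj_order T) (h f)"
      by (auto simp: topspace_point_space on_ob_filter_map proj_pre_def pts_def)
    then show "openin (point_space (proj_order T)) {p \<in> topspace (point_space (proj_order T)). f \<in> on_ob ?f p}"
      by (simp add: openin_pts)
  qed (simp add: topspace_point_space on_ob_filter_map proj_filter_pre)
  show "\<forall>P\<in>{P. nat_filter T P}. \<forall>Q\<in>on_arr ?f P.
      fdom S Q = on_ob ?f (fdom T P) \<and> fcod S Q = on_ob ?f (fcod T P)"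
    by (simp add: on_arr_filter_map on_ob_filter_map T.proj_filter_fdom T.proj_filter_fcod map_filter_def)
  show "\<forall>(P, P')\<in>topspace (composable (filter_category T)). \<forall>(Q, Q')\<in>topspace (composable (filter_category S)).
      Q \<in> on_arr ?f P \<and> Q' \<in> on_arr ?f P' \<longrightarrow> fmult S Q Q' \<in> on_arr ?f (fmult T P P')"
  proof (clarsimp simp: topspace_composable_filters)
    fix P P' Q Q'
    assume P: "nat_filter T P" "nat_filter T P'" "fdom T P = fcod T P'"
      and Q: "nat_filter S Q" "nat_filter S Q'" "fdom S Q = fcod S Q'"
      and f: "Q \<in> on_arr ?f P" "Q' \<in> on_arr ?f P'"
    note F = S.fmult_filter[OF Q] S.fcod_fmult[OF Q] T.fmult_filter[OF P] T.fcod_fmult[OF P]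
    have f': "Q \<in> map_filter P" "Q' \<in> map_filter P'" using f P by (simp_all add: on_arr_filter_map)
    have "h x \<in> fmult T P P'" if x: "x \<in> fmult S Q Q'" for x
    proof -
      obtain a b where ab: "x \<in> carrier S" "a \<in> Q" "b \<in> Q'" "nat_le S (a \<otimes>\<^bsub>S\<^esub> b) x"
        using x S.mem_fmult by blast
      have abc: "a \<in> carrier S" "b \<in> carrier S" using ab Q S.nat_filter_carrier by auto
      have "nat_le T (h a \<otimes>\<^bsub>T\<^esub> h b) (h x)" using h_mono[OF ab(4)] h_mult[OF abc] abc ab(1) by simp
      moreover have "h a \<in> P" "h b \<in> P'" using f' ab unfolding map_filter_def by auto
      ultimately show ?thesis using T.mem_fmult ab(1) by blast
    qed
    then have "fmult S Q Q' \<in> map_filter (fmult T P P')" using F f' unfolding map_filter_def by auto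
    then show "fmult S Q Q' \<in> on_arr ?f (fmult T P P')" using F by (simp add: on_arr_filter_map)
  qed
  show "\<forall>a\<in>{P. nat_filter T P}. \<forall>b\<in>{P. nat_filter T P}.
      (fdom T a = fdom T b \<or> fcod T a = fcod T b) \<and> on_arr ?f a \<inter> on_arr ?f b \<noteq> {} \<longrightarrow> a = b"
  proof (intro ballI impI)
    fix a b assume ab: "a \<in> {P. nat_filter T P}" "b \<in> {P. nat_filter T P}"
      "(fdom T a = fdom T b \<or> fcod T a = fcod T b) \<and> on_arr ?f a \<inter> on_arr ?f b \<noteq> {}"
    then have "map_filter a \<inter> map_filter b \<noteq> {}" using on_arr_filter_map[of a] on_arr_filter_map[of b] by simp
    then obtain Q where "Q \<in> map_filter a" "Q \<in> map_filter b" by blast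
    then show "a = b" using ab map_filter_inj[of a b Q] by simp
  qed
  show "\<forall>q\<in>{p. proj_filter T p}. \<forall>s\<in>{P. nat_filter S P}.
      (fdom S s = on_ob ?f q \<longrightarrow> (\<exists>t\<in>{P. nat_filter T P}. fdom T t = q \<and> s \<in> on_arr ?f t)) \<and>
      (fcod S s = on_ob ?f q \<longrightarrow> (\<exists>t\<in>{P. nat_filter T P}. fcod T t = q \<and> s \<in> on_arr ?f t))"
  proof (intro ballI conjI impI)
    fix q s assume q: "q \<in> {p. proj_filter T p}" and s: "s \<in> {P. nat_filter S P}"
    then have qf: "proj_filter T q" and sf: "nat_filter S s" by auto
    {
      assume d: "fdom S s = on_ob ?f q"
      then obtain t where t: "nat_filter T t" "fdom T t = q" "h ` s \<subseteq> t" "fcod S s = proj_pre S h (fcod T t)"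
        using lift_dom[OF sf qf] on_ob_filter_map[OF qf] by auto
      then have "s \<in> on_arr ?f t" using on_arr_filter_map[OF t(1)] sf d on_ob_filter_map[OF qf] by (simp add: map_filter_def)
      then show "\<exists>t\<in>{P. nat_filter T P}. fdom T t = q \<and> s \<in> on_arr ?f t" using t by blast
    }
    {
      assume d: "fcod S s = on_ob ?f q"
      then obtain t where t: "nat_filter T t" "fcod T t = q" "h ` s \<subseteq> t" "fdom S s = proj_pre S h (fdom T t)"
        using lift_cod[OF sf qf] on_ob_filter_map[OF qf] by auto
      then have "s \<in> on_arr ?f t" using on_arr_filter_map[OF t(1)] sf d on_ob_filter_map[OF qf] by (simp add: map_filter_def)
      then show "\<exists>t\<in>{P. nat_filter T P}. fcod T t = q \<and> s \<in> on_arr ?f t" using t by blast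
    }
  qed
  show "\<forall>A. openin (point_space (nat_order S)) A \<longrightarrow>
      openin (point_space (nat_order T)) {x \<in> {P. nat_filter T P}. on_arr ?f x \<inter> A \<noteq> {}}"
  proof (intro allI impI)
    fix A assume A: "openin (point_space (nat_order S)) A"
    show "openin (point_space (nat_order T)) {x \<in> {P. nat_filter T P}. on_arr ?f x \<inter> A \<noteq> {}}"
      unfolding openin_point_space
    proof
      fix P assume P: "P \<in> {x \<in> {P. nat_filter T P}. on_arr ?f x \<inter> A \<noteq> {}}"
      then have Pf: "nat_filter T P" by simp
      obtain Q where Q: "Q \<in> map_filter P" "Q \<in> A" using P on_arr_filter_map[OF Pf] by auto
      then obtain s where s: "nat_filter S Q" "s \<in> Q" "pts (nat_order S) s \<subseteq> A"
        using A unfolding openin_point_space by blast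
      have sc: "s \<in> carrier S" using S.nat_filter_carrier s by blast
      have "P' \<in> {x \<in> {P. nat_filter T P}. on_arr ?f x \<inter> A \<noteq> {}}" if P': "P' \<in> pts (nat_order T) (h s)" for P'
      proof -
        have P'f: "nat_filter T P'" "h s \<in> P'" using P' by (auto simp: pts_def)
        then obtain Q' where "Q' \<in> map_filter P'" "s \<in> Q'" using ex_map_filter sc by blast
        moreover from this have "Q' \<in> pts (nat_order S) s" by (simp add: map_filter_def pts_def)
        ultimately show ?thesis using s(3) on_arr_filter_map[OF P'f(1)] P'f(1) by auto
      qed
      moreover have "h s \<in> P" using Q s unfolding map_filter_def by auto
      ultimately show "nat_filter T P \<and> (\<exists>a\<in>P. pts (nat_order T) a \<subseteq> {x \<in> {P. nat_filter T P}. on_arr ?f x \<inter> A \<noteq> {}})"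
        using Pf by blast
    qed
  qed
  show "\<forall>t\<in>{p. proj_filter T p}. up_closure (nat_order S) (on_ob ?f t) \<in> on_arr ?f (up_closure (nat_order T) t)"
  proof
    fix p assume "p \<in> {p. proj_filter T p}"
    then have p: "proj_filter T p" by simp
    note q = proj_filter_pre[OF p]
    have "h x \<in> up_closure (nat_order T) p" if x: "x \<in> up_closure (nat_order S) (proj_pre S h p)" for x
    proof -
      obtain f where f: "f \<in> proj S" "h f \<in> p" "nat_le S f x" "x \<in> carrier S"
        using x by (auto simp: up_closure_def proj_pre_def)
      then show ?thesis using h_mono[of f x] by (auto simp: up_closure_def)
    qed
    then have "up_closure (nat_order S) (proj_pre S h p) \<in> map_filter (up_closure (nat_order T) p)"
      unfolding map_filter_def using S.unit_filter[OF q] S.fcod_unit[OF q] T.unit_filter[OF p] T.fcod_unit[OF p] by auto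
    then show "up_closure (nat_order S) (on_ob ?f p) \<in> on_arr ?f (up_closure (nat_order T) p)"
      using on_arr_filter_map[OF T.unit_filter(1)[OF p]] on_ob_filter_map[OF p] by simp
  qed
qed

text \<open>If \<open>h s \<in> P\<close>, some filter through \<open>s\<close> is related to \<open>P\<close>; conversely \<open>h\<close> maps every filter related to
  \<open>P\<close> into \<open>P\<close>.\<close>

lemma filter_map_preimage:
  assumes "s \<in> carrier S"
  shows "{P. nat_filter T P \<and> on_arr (filter_map S T h) P \<inter> pts (nat_order S) s \<noteq> {}} = pts (nat_order T) (h s)"
proof -
  have "on_arr (filter_map S T h) P \<inter> pts (nat_order S) s \<noteq> {} \<longleftrightarrow> h s \<in> P" if P: "nat_filter T P" for P
    using on_arr_filter_map[OF P] ex_map_filter[OF P assms] unfolding map_filter_def pts_def by auto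
  then show ?thesis by (auto simp: pts_def)
qed

text \<open>Some \<open>h s\<close> lies above a member of \<open>P\<close>, because \<open>P\<close> is completely prime and its members are joins of
  elements below the image.\<close>

lemma filter_map_proper:
  assumes "proper_hom S T h" "nat_filter T P"
  shows "on_arr (filter_map S T h) P \<noteq> {}"
proof -
  obtain t where t: "t \<in> carrier T" "t \<in> P" using T.nat_filter_nonempty assms by blast
  then obtain X where X: "X \<subseteq> carrier T" "is_lub (nat_order T) t X" "\<forall>x\<in>X. \<exists>s\<in>carrier S. nat_le T x (h s)"
    using assms(1) unfolding proper_hom_def by blast
  then obtain x where "x \<in> X" "x \<in> P" using T.nat_filter_lub[OF assms(2) X(1,2) t(2)] by blast
  moreover from this obtain s where s: "s \<in> carrier S" "nat_le T x (h s)" using X by blast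
  ultimately have "h s \<in> P" using T.nat_filter_up[OF assms(2)] by blast
  then show ?thesis using ex_map_filter[OF assms(2) s(1)] on_arr_filter_map[OF assms(2)] by auto
qed

text \<open>Both filters have the same domain, so a common member makes them equal. The meet of a member of
  each is one, because \<open>h\<close> preserves it.\<close>

lemma filter_map_meet:
  assumes m: "meet_hom S T h" and P: "nat_filter T P"
    and Q: "Q \<in> on_arr (filter_map S T h) P" "Q' \<in> on_arr (filter_map S T h) P"
  shows "Q = Q'"
proof -
  have f: "Q \<in> map_filter P" "Q' \<in> map_filter P" using Q on_arr_filter_map[OF P] by auto
  then have nf: "nat_filter S Q" "nat_filter S Q'" unfolding map_filter_def by auto
  then obtain q q' where q: "q \<in> Q" "q' \<in> Q'" using S.nat_filter_nonempty by metis
  have qc: "q \<in> carrier S" "q' \<in> carrier S" using S.nat_filter_carrier nf q by auto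
  obtain c where c: "is_glb (nat_order S) c {q, q'}" using S.ex_nat_glb qc by blast
  then have cc: "c \<in> carrier S" "nat_le S c q" "nat_le S c q'" using is_glb_iff[of q "nat_order S" q' c] qc by auto
  have hc: "is_glb (nat_order T) (h c) {h q, h q'}" using m c qc unfolding meet_hom_def by blast
  have hq: "h q \<in> P" "h q' \<in> P" using f q unfolding map_filter_def by auto
  then obtain d where d: "d \<in> P" "d \<in> carrier T" "nat_le T d (h q)" "nat_le T d (h q')"
    using T.nat_filter_down[OF P] by blast
  then have "nat_le T d (h c)" using hc is_glb_iff[of "h q" "nat_order T" "h q'" "h c"] qc by auto
  then have "h c \<in> P" using T.nat_filter_up[OF P d(1)] cc by blast
  then have "lam S c \<in> proj_pre S h (fdom T P)" using T.lam_mem_fdom[OF P] h_lam cc by (force simp: proj_pre_def)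
  then have "lam S c \<in> fdom S Q" "lam S c \<in> fdom S Q'" "fdom S Q = fdom S Q'" using f unfolding map_filter_def by auto
  moreover from this have "c \<in> Q" "c \<in> Q'" using S.below_mem_iff nf q cc by blast+
  ultimately show ?thesis using S.filter_eqI nf by blast
qed

end

lemma filter_map_ext:
  "on_arr (filter_map S T h) \<in> extensional {P. nat_filter T P}"
  "on_ob (filter_map S T h) \<in> extensional {p. proj_filter T p}"
  by (simp_all add: filter_map_def Let_def topspace_point_space)

lemma relmap_eqI:
  fixes f g :: "('a, 'o, 'b, 'p) relmap"
  assumes "on_arr f \<in> extensional A" "on_arr g \<in> extensional A" "\<And>x. x \<in> A \<Longrightarrow> on_arr f x = on_arr g x"
    and "on_ob f \<in> extensional B" "on_ob g \<in> extensional B" "\<And>x. x \<in> B \<Longrightarrow> on_ob f x = on_ob g x"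
  shows "f = g"
proof -
  have "on_arr f = on_arr g" using assms(1-3) by (rule extensionalityI)
  moreover have "on_ob f = on_ob g" using assms(4-6) by (rule extensionalityI)
  ultimately show ?thesis by (cases f, cases g) simp
qed

lemma (in complete_rmon) filter_map_id:
  assumes "rmonoid_hom S S (rmonoid_id S)"
  shows "filter_map S S (rmonoid_id S) = rel_id (filter_category S)"
proof (rule relmap_eqI[of _ "{P. nat_filter S P}" _ "{p. proj_filter S p}"])
  interpret h: restriction_hom S S "rmonoid_id S" using complete assms by (intro restriction_homI)
  have pre: "proj_pre S (rmonoid_id S) p = p" if "proj_filter S p" for p
    using proj_filter_proj[OF that] by (auto simp: proj_pre_def)
  fix P assume "P \<in> {P. nat_filter S P}"
  then have P: "nat_filter S P" by simp
  have "Q \<in> h.map_filter P \<longleftrightarrow> Q = P" for Q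
  proof
    assume "Q \<in> h.map_filter P"
    then have Q: "nat_filter S Q" "rmonoid_id S ` Q \<subseteq> P" "fdom S Q = fdom S P"
      using pre[OF proj_filter_fdom[OF P]] by (auto simp: h.map_filter_def)
    obtain q where "q \<in> Q" "q \<in> carrier S" using nat_filter_nonempty[OF Q(1)] by blast
    then show "Q = P" using filter_eqI[OF Q(1) P Q(3)] Q(2) by force
  next
    assume "Q = P"
    then show "Q \<in> h.map_filter P"
      using P pre[OF proj_filter_fdom[OF P]] pre[OF proj_filter_fcod[OF P]] nat_filter_carrier[OF P]
      by (auto simp: h.map_filter_def)
  qed
  then show "on_arr (filter_map S S (rmonoid_id S)) P = on_arr (rel_id (filter_category S)) P"
    using h.on_arr_filter_map[OF P] P by (auto simp: rel_id_def topspace_point_space)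
next
  interpret h: restriction_hom S S "rmonoid_id S" using complete assms by (intro restriction_homI)
  fix p assume "p \<in> {p. proj_filter S p}"
  then show "on_ob (filter_map S S (rmonoid_id S)) p = on_ob (rel_id (filter_category S)) p"
    using proj_filter_proj[of p]
    by (auto simp: h.on_ob_filter_map proj_pre_def rel_id_def topspace_point_space)
qed (auto simp: filter_map_ext rel_id_def topspace_point_space)

text \<open>Let \<open>R\<close> be related to \<open>P\<close> by the composite homomorphism and let \<open>r \<in> R\<close>. A filter \<open>Q\<close> through \<open>f r\<close>
  related to \<open>P\<close>, and then a filter through \<open>r\<close> related to \<open>Q\<close>, exist; the latter has the domain of \<open>R\<close>
  and so equals \<open>R\<close>.\<close>

lemma filter_map_comp:
  assumes f: "restriction_hom S T f" and g: "restriction_hom T U g" and gf: "restriction_hom S U (rmonoid_comp S g f)"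
  shows "filter_map S U (rmonoid_comp S g f) =
    rel_comp (filter_category U) (filter_map S T f) (filter_map T U g)"
proof (rule relmap_eqI[of _ "{P. nat_filter U P}" _ "{p. proj_filter U p}"])
  interpret f: restriction_hom S T f by fact
  interpret g: restriction_hom T U g by fact
  interpret gf: restriction_hom S U "rmonoid_comp S g f" by fact
  have pre: "proj_pre S (rmonoid_comp S g f) p = proj_pre S f (proj_pre T g p)" for p
    by (auto simp: proj_pre_def compose_def)
  fix P assume "P \<in> {P. nat_filter U P}"
  then have P: "nat_filter U P" by simp
  have sub: "R \<in> gf.map_filter P" if Q: "Q \<in> g.map_filter P" "R \<in> f.map_filter Q" for Q R
  proof -
    have "rmonoid_comp S g f x \<in> P" if "x \<in> R" for x
    proof -
      have "x \<in> carrier S" "f x \<in> Q" using Q that f.S.nat_filter_carrier unfolding f.map_filter_def by auto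
      then show ?thesis using Q unfolding g.map_filter_def by (auto simp: compose_def)
    qed
    then show ?thesis using Q unfolding f.map_filter_def g.map_filter_def gf.map_filter_def by (auto simp: pre)
  qed
  have "R \<in> gf.map_filter P \<longleftrightarrow> (\<exists>Q\<in>g.map_filter P. R \<in> f.map_filter Q)" for R
  proof
    assume R: "R \<in> gf.map_filter P"
    then have Rf: "nat_filter S R" by (simp add: gf.map_filter_def)
    then obtain r where r: "r \<in> R" "r \<in> carrier S" using f.S.nat_filter_nonempty by blast
    then have "rmonoid_comp S g f r \<in> P" using R unfolding gf.map_filter_def by blast
    then have "g (f r) \<in> P" using r by (simp add: compose_def)
    then obtain Q where Q: "Q \<in> g.map_filter P" "f r \<in> Q" using g.ex_map_filter[OF P] r by blast
    then have "nat_filter T Q" by (simp add: g.map_filter_def)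
    then obtain R' where R': "R' \<in> f.map_filter Q" "r \<in> R'" using f.ex_map_filter r Q by blast
    then have "R' \<in> gf.map_filter P" using sub Q by blast
    then have "R' = R" using f.S.filter_eqI[of R' R r] R r R' by (simp add: gf.map_filter_def)
    then show "\<exists>Q\<in>g.map_filter P. R \<in> f.map_filter Q" using Q R' by blast
  qed (use sub in blast)
  moreover have "nat_filter T Q" if "Q \<in> g.map_filter P" for Q using that by (simp add: g.map_filter_def)
  ultimately show "on_arr (filter_map S U (rmonoid_comp S g f)) P =
      on_arr (rel_comp (filter_category U) (filter_map S T f) (filter_map T U g)) P"
    using P by (auto simp: rel_comp_def topspace_point_space gf.on_arr_filter_map g.on_arr_filter_map f.on_arr_filter_map)
next
  interpret f: restriction_hom S T f by fact
  interpret g: restriction_hom T U g by fact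
  interpret gf: restriction_hom S U "rmonoid_comp S g f" by fact
  fix p assume "p \<in> {p. proj_filter U p}"
  then have p: "proj_filter U p" by simp
  have "proj_pre S (rmonoid_comp S g f) p = proj_pre S f (proj_pre T g p)"
    by (auto simp: proj_pre_def compose_def)
  moreover have "on_ob (rel_comp (filter_category U) (filter_map S T f) (filter_map T U g)) p =
      proj_pre S f (proj_pre T g p)"
    using p g.on_ob_filter_map[OF p] f.on_ob_filter_map[OF g.proj_filter_pre[OF p]]
    by (simp add: rel_comp_def compose_def topspace_point_space)
  ultimately show "on_ob (filter_map S U (rmonoid_comp S g f)) p =
      on_ob (rel_comp (filter_category U) (filter_map S T f) (filter_map T U g)) p"
    using gf.on_ob_filter_map[OF p] by (simp only:)
qed (auto simp: filter_map_ext rel_comp_def topspace_point_space)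

section \<open>The monoid of bisections of an etale category\<close>

lemma local_homeo_open_map:
  assumes lh: "local_homeo X Y f"
  shows "open_map X Y f"
  unfolding open_map_def
proof (intro allI impI)
  fix U assume U: "openin X U"
  show "openin Y (f ` U)"
  proof (subst openin_subopen, intro ballI)
    fix y assume "y \<in> f ` U"
    then obtain x where x: "x \<in> U" "y = f x" by blast
    then have "x \<in> topspace X" using U openin_subset by blast
    then obtain V where V: "openin X V" "x \<in> V" "openin Y (f ` V)"
        "homeomorphic_map (subtopology X V) (subtopology Y (f ` V)) f"
      using lh unfolding local_homeo_def by blast
    have "openin (subtopology X V) (U \<inter> V)" using U by (auto simp: openin_subtopology)
    then have "openin (subtopology Y (f ` V)) (f ` (U \<inter> V))"
      using homeomorphic_imp_open_map[OF V(4)] unfolding open_map_def by blast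
    then have "openin Y (f ` (U \<inter> V))" using openin_trans_full V(3) by blast
    then show "\<exists>T. openin Y T \<and> y \<in> T \<and> T \<subseteq> f ` U"
      using x V(2) by (intro exI[of _ "f ` (U \<inter> V)"]) auto
  qed
qed

lemma local_homeo_inj:
  assumes "local_homeo X Y f" "x \<in> topspace X"
  shows "\<exists>U. openin X U \<and> x \<in> U \<and> inj_on f U"
proof -
  obtain V where V: "openin X V" "x \<in> V" "homeomorphic_map (subtopology X V) (subtopology Y (f ` V)) f"
    using assms unfolding local_homeo_def by blast
  have "topspace (subtopology X V) = V" using openin_subset[OF V(1)] by auto
  then have "inj_on f V" using homeomorphic_imp_injective_map[OF V(3)] by simp
  then show ?thesis using V by blast
qed

locale etale =
  fixes C :: "('a, 'o) topcat"
  assumes etale: "etale_category C"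
begin

abbreviation "arrs \<equiv> topspace (Arr C)"
abbreviation "obs \<equiv> topspace (Ob C)"
abbreviation "SM \<equiv> section_monoid C"

lemma topcat: "topological_category C"
  using etale by (simp add: etale_category_def)

lemma dm_in [simp, intro]: "a \<in> arrs \<Longrightarrow> dm C a \<in> obs"
  and cd_in [simp, intro]: "a \<in> arrs \<Longrightarrow> cd C a \<in> obs"
  and un_in [simp, intro]: "x \<in> obs \<Longrightarrow> un C x \<in> arrs"
  using topcat unfolding topological_category_def continuous_map_def by blast+

lemma dm_un [simp]: "x \<in> obs \<Longrightarrow> dm C (un C x) = x"
  and cd_un [simp]: "x \<in> obs \<Longrightarrow> cd C (un C x) = x"
  and cmp_unit [simp]: "a \<in> arrs \<Longrightarrow> cmp C a (un C (dm C a)) = a" "a \<in> arrs \<Longrightarrow> cmp C (un C (cd C a)) a = a"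
  using topcat unfolding topological_category_def by blast+

lemma cmp_in: "a \<in> arrs \<Longrightarrow> b \<in> arrs \<Longrightarrow> dm C a = cd C b \<Longrightarrow> cmp C a b \<in> arrs"
proof -
  assume "a \<in> arrs" "b \<in> arrs" "dm C a = cd C b"
  then have "(a, b) \<in> topspace (composable C)" by (simp add: topspace_composable)
  moreover have "(\<lambda>(a, b). cmp C a b) \<in> topspace (composable C) \<rightarrow> arrs"
    using topcat unfolding topological_category_def continuous_map_def by blast
  ultimately have "(\<lambda>(a, b). cmp C a b) (a, b) \<in> arrs" by (rule Pi_mem[rotated])
  then show ?thesis by simp
qed

lemma dm_cmp: "a \<in> arrs \<Longrightarrow> b \<in> arrs \<Longrightarrow> dm C a = cd C b \<Longrightarrow> dm C (cmp C a b) = dm C b"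
  and cd_cmp: "a \<in> arrs \<Longrightarrow> b \<in> arrs \<Longrightarrow> dm C a = cd C b \<Longrightarrow> cd C (cmp C a b) = cd C a"
proof -
  have "\<forall>(a, b)\<in>topspace (composable C). dm C (cmp C a b) = dm C b \<and> cd C (cmp C a b) = cd C a"
    using topcat unfolding topological_category_def by blast
  then show "a \<in> arrs \<Longrightarrow> b \<in> arrs \<Longrightarrow> dm C a = cd C b \<Longrightarrow> dm C (cmp C a b) = dm C b"
    and "a \<in> arrs \<Longrightarrow> b \<in> arrs \<Longrightarrow> dm C a = cd C b \<Longrightarrow> cd C (cmp C a b) = cd C a"
    by (auto simp: topspace_composable)
qed

lemma cmp_assoc:
  "a \<in> arrs \<Longrightarrow> b \<in> arrs \<Longrightarrow> c \<in> arrs \<Longrightarrow> dm C a = cd C b \<Longrightarrow> dm C b = cd C c \<Longrightarrow>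
    cmp C (cmp C a b) c = cmp C a (cmp C b c)"
proof -
  have "\<forall>a b c. (a, b) \<in> topspace (composable C) \<and> (b, c) \<in> topspace (composable C) \<longrightarrow>
        cmp C (cmp C a b) c = cmp C a (cmp C b c)"
    using topcat unfolding topological_category_def by blast
  then show "a \<in> arrs \<Longrightarrow> b \<in> arrs \<Longrightarrow> c \<in> arrs \<Longrightarrow> dm C a = cd C b \<Longrightarrow> dm C b = cd C c \<Longrightarrow>
    cmp C (cmp C a b) c = cmp C a (cmp C b c)" by (simp add: topspace_composable)
qed

lemma open_dm: "openin (Arr C) A \<Longrightarrow> openin (Ob C) (dm C ` A)"
  and open_cd: "openin (Arr C) A \<Longrightarrow> openin (Ob C) (cd C ` A)"
  and open_un: "openin (Ob C) U \<Longrightarrow> openin (Arr C) (un C ` U)"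
  using etale local_homeo_open_map unfolding etale_category_def open_map_def by blast+

lemma bisectionD:
  assumes "A \<in> bisections C"
  shows bisection_open: "openin (Arr C) A" and bisection_arrs: "a \<in> A \<Longrightarrow> a \<in> arrs"
    and bisection_dm: "a \<in> A \<Longrightarrow> b \<in> A \<Longrightarrow> dm C a = dm C b \<Longrightarrow> a = b"
    and bisection_cd: "a \<in> A \<Longrightarrow> b \<in> A \<Longrightarrow> cd C a = cd C b \<Longrightarrow> a = b"
  using assms openin_subset unfolding bisections_def inj_on_def by blast+

lemma bisection_subset: "A \<in> bisections C \<Longrightarrow> openin (Arr C) U \<Longrightarrow> U \<subseteq> A \<Longrightarrow> U \<in> bisections C"
  unfolding bisections_def using inj_on_subset by blast

lemma ex_bisection:
  assumes U: "openin (Arr C) U" and x: "x \<in> U"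
  shows "\<exists>A\<in>bisections C. x \<in> A \<and> A \<subseteq> U"
proof -
  have xa: "x \<in> arrs" using U x openin_subset by blast
  obtain V where V: "openin (Arr C) V" "x \<in> V" "inj_on (dm C) V"
    using local_homeo_inj[of "Arr C" "Ob C" "dm C", OF _ xa] etale by (auto simp: etale_category_def)
  obtain W where W: "openin (Arr C) W" "x \<in> W" "inj_on (cd C) W"
    using local_homeo_inj[of "Arr C" "Ob C" "cd C", OF _ xa] etale by (auto simp: etale_category_def)
  have "U \<inter> V \<inter> W \<in> bisections C"
    using U V W unfolding bisections_def by (auto intro: openin_Int inj_on_subset)
  then show ?thesis using V W x by (intro bexI[of _ "U \<inter> V \<inter> W"]) auto
qed

definition smult :: "'a set \<Rightarrow> 'a set \<Rightarrow> 'a set" where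
  "smult A B = {cmp C a b | a b. a \<in> A \<and> b \<in> B \<and> dm C a = cd C b}"

definition open_units :: "'a set set" where
  "open_units = {A. openin (Arr C) A \<and> A \<subseteq> un C ` obs}"

lemma section_monoid_simps [simp]:
  "carrier SM = bisections C" "A \<otimes>\<^bsub>SM\<^esub> B = smult A B" "\<one>\<^bsub>SM\<^esub> = un C ` obs" "proj SM = open_units"
  "lam SM A = un C ` dm C ` A" "rho SM A = un C ` cd C ` A"
  by (simp_all add: section_monoid_def smult_def open_units_def)

lemma open_smult:
  assumes "openin (Arr C) A" "openin (Arr C) B"
  shows "openin (Arr C) (smult A B)"
proof -
  have "openin (prod_topology (Arr C) (Arr C)) (A \<times> B)" using assms by (simp add: openin_prod_Times_iff)
  then have "openin (composable C) (A \<times> B \<inter> {(a, b). dm C a = cd C b})"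
    unfolding composable_def openin_subtopology by auto
  then have "openin (Arr C) ((\<lambda>(a, b). cmp C a b) ` (A \<times> B \<inter> {(a, b). dm C a = cd C b}))"
    using etale unfolding etale_category_def open_map_def by blast
  moreover have "(\<lambda>(a, b). cmp C a b) ` (A \<times> B \<inter> {(a, b). dm C a = cd C b}) = smult A B"
    unfolding smult_def by (auto simp: image_iff)
  ultimately show ?thesis by simp
qed

lemma mem_smult: "x \<in> smult A B \<longleftrightarrow> (\<exists>a\<in>A. \<exists>b\<in>B. dm C a = cd C b \<and> x = cmp C a b)"
  unfolding smult_def by auto

lemma smult_bisection:
  assumes A: "A \<in> bisections C" and B: "B \<in> bisections C"
  shows "smult A B \<in> bisections C"
proof -
  have "x = y" if x: "x \<in> smult A B" and y: "y \<in> smult A B"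
    and eq: "dm C x = dm C y \<or> cd C x = cd C y" for x y
  proof -
    obtain a b where ab: "a \<in> A" "b \<in> B" "dm C a = cd C b" "x = cmp C a b" using x mem_smult by blast
    obtain a' b' where ab': "a' \<in> A" "b' \<in> B" "dm C a' = cd C b'" "y = cmp C a' b'" using y mem_smult by blast
    have arr: "a \<in> arrs" "b \<in> arrs" "a' \<in> arrs" "b' \<in> arrs" using ab ab' bisection_arrs A B by auto
    from eq show ?thesis
    proof
      assume "dm C x = dm C y"
      then have "b = b'" using bisection_dm[OF B ab(2) ab'(2)] ab ab' arr by (simp add: dm_cmp)
      then show ?thesis using bisection_dm[OF A ab(1) ab'(1)] ab(3,4) ab'(3,4) by simp
    next
      assume "cd C x = cd C y"
      then have "a = a'" using bisection_cd[OF A ab(1) ab'(1)] ab ab' arr by (simp add: cd_cmp)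
      then show ?thesis using bisection_cd[OF B ab(2) ab'(2)] ab(3,4) ab'(3,4) by simp
    qed
  qed
  then show ?thesis
    using open_smult[OF bisection_open[OF A] bisection_open[OF B]]
    by (auto simp: bisections_def inj_on_def)
qed

lemma un_inj: "x \<in> obs \<Longrightarrow> y \<in> obs \<Longrightarrow> un C x = un C y \<Longrightarrow> x = y"
  using dm_un by metis

lemma mem_un_image: "x \<in> obs \<Longrightarrow> X \<subseteq> obs \<Longrightarrow> un C x \<in> un C ` X \<longleftrightarrow> x \<in> X"
  using un_inj by blast

lemma units_bisection: "un C ` obs \<in> bisections C"
  using open_un[OF openin_topspace] by (auto simp: bisections_def inj_on_def)

lemma open_units_bisection: "F \<in> open_units \<Longrightarrow> F \<in> bisections C"
  using bisection_subset[OF units_bisection] by (simp add: open_units_def)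

lemma open_units_mem: "F \<in> open_units \<Longrightarrow> f \<in> F \<Longrightarrow> \<exists>x\<in>obs. f = un C x"
  by (auto simp: open_units_def)

lemma un_image_open_units: "openin (Ob C) U \<Longrightarrow> un C ` U \<in> open_units"
  using open_un openin_subset by (fastforce simp: open_units_def)

text \<open>Multiplication by an open set of units restricts a bisection, on the right by domain and on the
  left by codomain.\<close>

lemma smult_open_units:
  assumes A: "A \<in> bisections C" and F: "F \<in> open_units"
  shows "smult A F = {a \<in> A. un C (dm C a) \<in> F}" "smult F A = {a \<in> A. un C (cd C a) \<in> F}"
proof -
  have 1: "cmp C a f = a \<and> un C (dm C a) = f" if "a \<in> A" "f \<in> F" "dm C a = cd C f" for a f
    using open_units_mem[OF F that(2)] bisection_arrs[OF A that(1)] that(3) by (metis cd_un cmp_unit(1))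
  have 2: "cmp C f a = a \<and> un C (cd C a) = f" if "a \<in> A" "f \<in> F" "dm C f = cd C a" for a f
    using open_units_mem[OF F that(2)] bisection_arrs[OF A that(1)] that(3) by (metis dm_un cmp_unit(2))
  show "smult A F = {a \<in> A. un C (dm C a) \<in> F}"
  proof (rule Set.set_eqI)
    fix x show "x \<in> smult A F \<longleftrightarrow> x \<in> {a \<in> A. un C (dm C a) \<in> F}"
    proof
      assume "x \<in> smult A F"
      then obtain a f where "a \<in> A" "f \<in> F" "dm C a = cd C f" "x = cmp C a f" using mem_smult by blast
      then show "x \<in> {a \<in> A. un C (dm C a) \<in> F}" using 1[of a f] by simp
    next
      assume x: "x \<in> {a \<in> A. un C (dm C a) \<in> F}"
      then have "x \<in> arrs" using bisection_arrs[OF A] by blast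
      then show "x \<in> smult A F" unfolding mem_smult using x by (intro bexI[of _ x] bexI[of _ "un C (dm C x)"]) auto
    qed
  qed
  show "smult F A = {a \<in> A. un C (cd C a) \<in> F}"
  proof (rule Set.set_eqI)
    fix x show "x \<in> smult F A \<longleftrightarrow> x \<in> {a \<in> A. un C (cd C a) \<in> F}"
    proof
      assume "x \<in> smult F A"
      then obtain f a where "a \<in> A" "f \<in> F" "dm C f = cd C a" "x = cmp C f a" using mem_smult by blast
      then show "x \<in> {a \<in> A. un C (cd C a) \<in> F}" using 2[of a f] by simp
    next
      assume x: "x \<in> {a \<in> A. un C (cd C a) \<in> F}"
      then have "x \<in> arrs" using bisection_arrs[OF A] by blast
      then show "x \<in> smult F A" unfolding mem_smult using x by (intro bexI[of _ "un C (cd C x)"] bexI[of _ x]) auto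
    qed
  qed
qed

lemma lam_open_units: "A \<in> bisections C \<Longrightarrow> un C ` dm C ` A \<in> open_units"
  and rho_open_units: "A \<in> bisections C \<Longrightarrow> un C ` cd C ` A \<in> open_units"
  by (auto intro: un_image_open_units open_dm open_cd dest: bisection_open)

lemma un_dm_mem: "A \<in> bisections C \<Longrightarrow> x \<in> obs \<Longrightarrow> un C x \<in> un C ` dm C ` A \<longleftrightarrow> x \<in> dm C ` A"
  and un_cd_mem: "A \<in> bisections C \<Longrightarrow> x \<in> obs \<Longrightarrow> un C x \<in> un C ` cd C ` A \<longleftrightarrow> x \<in> cd C ` A"
  using bisection_arrs by (auto intro!: mem_un_image)

lemma smult_lam:
  assumes "A \<in> bisections C" "B \<in> bisections C"
  shows "smult A (un C ` dm C ` B) = {a \<in> A. dm C a \<in> dm C ` B}"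
    and "smult (un C ` dm C ` B) A = {a \<in> A. cd C a \<in> dm C ` B}"
    and "smult A (un C ` cd C ` B) = {a \<in> A. dm C a \<in> cd C ` B}"
    and "smult (un C ` cd C ` B) A = {a \<in> A. cd C a \<in> cd C ` B}"
proof -
  note p = smult_open_units[OF assms(1) lam_open_units[OF assms(2)]] smult_open_units[OF assms(1) rho_open_units[OF assms(2)]]
  have ob: "dm C a \<in> obs" "cd C a \<in> obs" if "a \<in> A" for a
    using bisection_arrs[OF assms(1) that] by auto
  note m = un_dm_mem[OF assms(2) ob(1)] un_dm_mem[OF assms(2) ob(2)]
    un_cd_mem[OF assms(2) ob(1)] un_cd_mem[OF assms(2) ob(2)]
  show "smult A (un C ` dm C ` B) = {a \<in> A. dm C a \<in> dm C ` B}"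
    by (rule trans[OF p(1)], rule Collect_cong, rule conj_cong[OF HOL.refl], rule m(1))
  show "smult (un C ` dm C ` B) A = {a \<in> A. cd C a \<in> dm C ` B}"
    by (rule trans[OF p(2)], rule Collect_cong, rule conj_cong[OF HOL.refl], rule m(2))
  show "smult A (un C ` cd C ` B) = {a \<in> A. dm C a \<in> cd C ` B}"
    by (rule trans[OF p(3)], rule Collect_cong, rule conj_cong[OF HOL.refl], rule m(3))
  show "smult (un C ` cd C ` B) A = {a \<in> A. cd C a \<in> cd C ` B}"
    by (rule trans[OF p(4)], rule Collect_cong, rule conj_cong[OF HOL.refl], rule m(4))
qed

lemma smult_assoc:
  assumes A: "A \<in> bisections C" and B: "B \<in> bisections C" and D: "D \<in> bisections C"
  shows "smult (smult A B) D = smult A (smult B D)"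
proof (rule Set.set_eqI)
  note arr = bisection_arrs[OF A] bisection_arrs[OF B] bisection_arrs[OF D]
  fix x
  show "x \<in> smult (smult A B) D \<longleftrightarrow> x \<in> smult A (smult B D)"
  proof
    assume "x \<in> smult (smult A B) D"
    then obtain c d where c: "c \<in> smult A B" "d \<in> D" "dm C c = cd C d" "x = cmp C c d"
      using mem_smult by blast
    obtain a b where ab: "a \<in> A" "b \<in> B" "dm C a = cd C b" "c = cmp C a b"
      using c(1) mem_smult by blast
    have x: "a \<in> A" "b \<in> B" "d \<in> D" "dm C a = cd C b" "dm C (cmp C a b) = cd C d"
        "x = cmp C (cmp C a b) d" using c ab by simp_all
    then have bd: "dm C b = cd C d" using dm_cmp[of a b] arr by simp
    then have "cmp C b d \<in> smult B D" "dm C a = cd C (cmp C b d)" "x = cmp C a (cmp C b d)"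
      using x arr cd_cmp[of b d] cmp_assoc[of a b d] unfolding mem_smult by auto
    then show "x \<in> smult A (smult B D)" using x mem_smult[of x A] by blast
  next
    assume "x \<in> smult A (smult B D)"
    then obtain a c where c: "a \<in> A" "c \<in> smult B D" "dm C a = cd C c" "x = cmp C a c"
      using mem_smult by blast
    obtain b d where bd: "b \<in> B" "d \<in> D" "dm C b = cd C d" "c = cmp C b d"
      using c(2) mem_smult by blast
    have x: "a \<in> A" "b \<in> B" "d \<in> D" "dm C b = cd C d" "dm C a = cd C (cmp C b d)"
        "x = cmp C a (cmp C b d)" using c bd by simp_all
    then have ab: "dm C a = cd C b" using cd_cmp[of b d] arr by simp
    then have "cmp C a b \<in> smult A B" "dm C (cmp C a b) = cd C d" "x = cmp C (cmp C a b) d"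
      using x arr dm_cmp[of a b] cmp_assoc[of a b d] unfolding mem_smult by auto
    then show "x \<in> smult (smult A B) D" using x mem_smult[of x "smult A B"] by blast
  qed
qed

lemma one_open_units: "un C ` obs \<in> open_units"
  using un_image_open_units openin_topspace by blast

lemma restriction_section_monoid: "restriction_monoid SM"
proof -
  have one: "smult (un C ` obs) A = A" "smult A (un C ` obs) = A" if "A \<in> bisections C" for A
    using smult_open_units[OF that one_open_units] bisection_arrs[OF that] by auto
  have mon: "monoid SM"
    by unfold_locales (auto simp: smult_bisection smult_assoc units_bisection one)
  have idem: "un C (dm C f) = f" "un C (cd C f) = f" if "f \<in> F" "F \<in> open_units" for f F
    using open_units_mem[OF that(2,1)] by auto
  have prod: "smult F G = F \<inter> G" if "F \<in> open_units" "G \<in> open_units" for F G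
    using smult_open_units(1)[OF open_units_bisection[OF that(1)] that(2)] idem that by auto
  have un_id: "un C ` dm C ` F = F" "un C ` cd C ` F = F" if "F \<in> open_units" for F
    using idem[OF _ that] by (force simp: image_iff)+
  have lam_lam: "un C ` dm C ` smult (un C ` dm C ` A) B = un C ` dm C ` smult A B"
    if A: "A \<in> bisections C" and B: "B \<in> bisections C" for A B
  proof -
    have "dm C ` {b \<in> B. cd C b \<in> dm C ` A} = dm C ` smult A B"
    proof (rule Set.set_eqI, rule iffI)
      fix x assume "x \<in> dm C ` {b \<in> B. cd C b \<in> dm C ` A}"
      then obtain a b where ab: "a \<in> A" "b \<in> B" "dm C a = cd C b" "x = dm C b" by auto
      then have "cmp C a b \<in> smult A B" "dm C (cmp C a b) = x"
        using bisection_arrs[OF A] bisection_arrs[OF B] dm_cmp mem_smult by auto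
      then show "x \<in> dm C ` smult A B" by blast
    next
      fix x assume "x \<in> dm C ` smult A B"
      then obtain y where y: "y \<in> smult A B" "x = dm C y" by blast
      then obtain a b where ab: "a \<in> A" "b \<in> B" "dm C a = cd C b" "x = dm C (cmp C a b)"
        using mem_smult[THEN iffD1, OF y(1)] by blast
      then have "x = dm C b" using bisection_arrs[OF A] bisection_arrs[OF B] dm_cmp by simp
      moreover have "cd C b \<in> dm C ` A" using ab(1) unfolding ab(3)[symmetric] by (rule imageI)
      ultimately show "x \<in> dm C ` {b \<in> B. cd C b \<in> dm C ` A}" using ab(2) by blast
    qed
    then show ?thesis using smult_lam(2)[OF B A] by simp
  qed
  have rho_rho: "un C ` cd C ` smult A (un C ` cd C ` B) = un C ` cd C ` smult A B"
    if A: "A \<in> bisections C" and B: "B \<in> bisections C" for A B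
  proof -
    have "cd C ` {a \<in> A. dm C a \<in> cd C ` B} = cd C ` smult A B"
    proof (rule Set.set_eqI, rule iffI)
      fix x assume "x \<in> cd C ` {a \<in> A. dm C a \<in> cd C ` B}"
      then obtain a b where ab: "a \<in> A" "b \<in> B" "dm C a = cd C b" "x = cd C a" by auto
      then have "cmp C a b \<in> smult A B" "cd C (cmp C a b) = x"
        using bisection_arrs[OF A] bisection_arrs[OF B] cd_cmp mem_smult by auto
      then show "x \<in> cd C ` smult A B" by blast
    next
      fix x assume "x \<in> cd C ` smult A B"
      then obtain y where y: "y \<in> smult A B" "x = cd C y" by blast
      then obtain a b where ab: "a \<in> A" "b \<in> B" "dm C a = cd C b" "x = cd C (cmp C a b)"
        using mem_smult[THEN iffD1, OF y(1)] by blast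
      then have "x = cd C a" using bisection_arrs[OF A] bisection_arrs[OF B] cd_cmp by simp
      moreover have "dm C a \<in> cd C ` B" using ab(2) unfolding ab(3) by (rule imageI)
      ultimately show "x \<in> cd C ` {a \<in> A. dm C a \<in> cd C ` B}" using ab(1) by blast
    qed
    then show ?thesis using smult_lam(3)[OF A B] by simp
  qed
  have swap_l: "smult F A = smult A (un C ` dm C ` smult F A)" if A: "A \<in> bisections C" and F: "F \<in> open_units" for A F
  proof -
    have "smult A (un C ` dm C ` smult F A) = {a \<in> A. dm C a \<in> dm C ` smult F A}"
      using smult_lam(1)[OF A smult_bisection[OF open_units_bisection[OF F] A]] .
    also have "\<dots> = smult F A" unfolding smult_open_units(2)[OF A F] using bisection_dm[OF A] by auto
    finally show ?thesis by simp
  qed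
  have swap_r: "smult A F = smult (un C ` cd C ` smult A F) A" if A: "A \<in> bisections C" and F: "F \<in> open_units" for A F
  proof -
    have "smult (un C ` cd C ` smult A F) A = {a \<in> A. cd C a \<in> cd C ` smult A F}"
      using smult_lam(4)[OF A smult_bisection[OF A open_units_bisection[OF F]]] .
    also have "\<dots> = smult A F" unfolding smult_open_units(1)[OF A F] using bisection_cd[OF A] by auto
    finally show ?thesis by simp
  qed
  have "ehresmann_monoid SM"
    unfolding ehresmann_monoid_def section_monoid_simps
  proof (intro conjI ballI)
    show "open_units \<subseteq> bisections C" using open_units_bisection by blast
    show "open_units \<noteq> {}" using one_open_units by blast
    fix F assume F: "F \<in> open_units"
    show "smult F F = F" "un C ` dm C ` F = F" "un C ` cd C ` F = F" using prod[OF F F] un_id[OF F] by auto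
    fix G assume G: "G \<in> open_units"
    show "smult F G \<in> open_units" using F G by (auto simp: prod open_units_def)
    show "smult F G = smult G F" using F G by (auto simp: prod)
  next
    fix A assume A: "A \<in> bisections C"
    show "smult A (un C ` dm C ` A) = A" "smult (un C ` cd C ` A) A = A"
      using smult_lam(1,4)[OF A A] by auto
    fix B assume B: "B \<in> bisections C"
    show "un C ` dm C ` smult (un C ` dm C ` A) B = un C ` dm C ` smult A B" by (rule lam_lam[OF A B])
    show "un C ` cd C ` smult A (un C ` cd C ` B) = un C ` cd C ` smult A B" by (rule rho_rho[OF A B])
  qed (simp_all add: mon Pi_iff lam_open_units rho_open_units)
  then show ?thesis
    unfolding restriction_monoid_def section_monoid_simps using swap_l swap_r by blast
qed

sublocale SM: rmon SM by (rule rmonI) (rule restriction_section_monoid)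

lemma nat_le_section_monoid:
  assumes A: "A \<in> bisections C" and B: "B \<in> bisections C"
  shows "nat_le SM A B \<longleftrightarrow> A \<subseteq> B"
proof -
  have "smult B (un C ` dm C ` A) = A \<longleftrightarrow> A \<subseteq> B"
    unfolding smult_lam(1)[OF B A] using bisection_dm[OF B] by blast
  then show ?thesis using SM.nat_le_iff_lam[of A B] A B by simp
qed

lemma representation_sections: "representation (nat_order SM) (Arr C) (\<lambda>A. A)"
proof -
  interpret no: partial_order "nat_order SM" by (rule SM.partial_order_nat_order)
  show ?thesis
  proof
    fix A assume "A \<in> carrier (nat_order SM)"
    then show "openin (Arr C) A" using bisection_open by simp
  next
    fix A B assume "A \<in> carrier (nat_order SM)" "B \<in> carrier (nat_order SM)"
    then show "A \<sqsubseteq>\<^bsub>nat_order SM\<^esub> B \<longleftrightarrow> A \<subseteq> B" using nat_le_section_monoid by simp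
  next
    fix U x assume "openin (Arr C) U" "x \<in> U"
    then show "\<exists>A\<in>carrier (nat_order SM). x \<in> A \<and> A \<subseteq> U" using ex_bisection by simp
  next
    fix A U assume "A \<in> carrier (nat_order SM)" "openin (Arr C) U" "U \<subseteq> A"
    then show "\<exists>B\<in>carrier (nat_order SM). B = U" using bisection_subset[of A U] by simp
  qed
qed

definition units_in :: "'a set \<Rightarrow> 'o set" where
  "units_in F = {x \<in> obs. un C x \<in> F}"

lemma units_in_open: "openin (Arr C) F \<Longrightarrow> openin (Ob C) (units_in F)"
  using topcat unfolding topological_category_def units_in_def by (blast intro: openin_continuous_map_preimage)

lemma un_units_in: "F \<in> open_units \<Longrightarrow> un C ` units_in F = F"
  by (auto simp: units_in_def open_units_def)

lemma units_in_un: "U \<subseteq> obs \<Longrightarrow> units_in (un C ` U) = U"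
  using mem_un_image by (auto simp: units_in_def)

lemma full_representation_units: "full_representation (proj_order SM) (Ob C) units_in"
proof -
  interpret po: partial_order "proj_order SM" by (rule SM.partial_order_proj_order)
  have full: "\<exists>F\<in>open_units. units_in F = U" if "openin (Ob C) U" for U
    using un_image_open_units[OF that] units_in_un[OF openin_subset[OF that]] by blast
  have le: "nat_le SM F G \<longleftrightarrow> units_in F \<subseteq> units_in G" if "F \<in> open_units" "G \<in> open_units" for F G
  proof -
    have "F \<subseteq> G" if "units_in F \<subseteq> units_in G"
      using image_mono[OF that, of "un C"] un_units_in \<open>F \<in> open_units\<close> \<open>G \<in> open_units\<close> by simp
    moreover have "units_in F \<subseteq> units_in G" if "F \<subseteq> G" using that by (auto simp: units_in_def)
    ultimately show ?thesis using nat_le_section_monoid[of F G] that open_units_bisection by blast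
  qed
  show ?thesis
  proof
    fix a assume "a \<in> carrier (proj_order SM)"
    then show "openin (Ob C) (units_in a)" using units_in_open by (simp add: open_units_def)
  next
    fix a b assume "a \<in> carrier (proj_order SM)" "b \<in> carrier (proj_order SM)"
    then show "a \<sqsubseteq>\<^bsub>proj_order SM\<^esub> b \<longleftrightarrow> units_in a \<subseteq> units_in b" using le by simp
  next
    fix U x assume "openin (Ob C) U" "x \<in> U"
    then show "\<exists>a\<in>carrier (proj_order SM). x \<in> units_in a \<and> units_in a \<subseteq> U" using full[of U] by auto
  next
    fix a U assume "openin (Ob C) U" "U \<subseteq> units_in a"
    then show "\<exists>b\<in>carrier (proj_order SM). units_in b = U" using full[of U] by simp
  next
    fix U assume "openin (Ob C) U"
    then show "\<exists>a\<in>carrier (proj_order SM). units_in a = U" using full[of U] by simp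
  qed
qed

text \<open>Compatibility of two bisections says that domain and codomain are injective on their union, so
  compatible sets of bisections have their union as join.\<close>

lemma complete_section_monoid: "complete_rmonoid SM"
proof -
  interpret rep: representation "nat_order SM" "Arr C" "\<lambda>A. A" by (rule representation_sections)
  interpret full: full_representation "proj_order SM" "Ob C" units_in by (rule full_representation_units)
  have "\<exists>x. is_lub (nat_order SM) x X" if X: "X \<subseteq> bisections C" and c: "compatible SM X" for X
  proof -
    have inj: "a = b" if A: "A \<in> X" "B \<in> X" and ab: "a \<in> A" "b \<in> B" "dm C a = dm C b \<or> cd C a = cd C b" for a b A B
    proof -
      have AB: "A \<in> bisections C" "B \<in> bisections C" using A X by auto
      have "smult A (un C ` dm C ` B) = smult B (un C ` dm C ` A)"
        and "smult (un C ` cd C ` B) A = smult (un C ` cd C ` A) B"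
        using c A unfolding compatible_def section_monoid_simps by blast+
      then have 1: "{a \<in> A. dm C a \<in> dm C ` B} = {b \<in> B. dm C b \<in> dm C ` A}"
        and 2: "{a \<in> A. cd C a \<in> cd C ` B} = {b \<in> B. cd C b \<in> cd C ` A}"
        unfolding smult_lam[OF AB] smult_lam[OF AB(2,1)] by auto
      from ab(3) show ?thesis
      proof
        assume eq: "dm C a = dm C b"
        then have "a \<in> {a \<in> A. dm C a \<in> dm C ` B}" using ab by auto
        then have "a \<in> B" unfolding 1 by simp
        then show ?thesis using bisection_dm[OF AB(2)] ab eq by blast
      next
        assume eq: "cd C a = cd C b"
        then have "a \<in> {a \<in> A. cd C a \<in> cd C ` B}" using ab by auto
        then have "a \<in> B" unfolding 2 by simp
        then show ?thesis using bisection_cd[OF AB(2)] ab eq by blast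
      qed
    qed
    have "openin (Arr C) (\<Union>X)" using X bisection_open by blast
    moreover have "inj_on (dm C) (\<Union>X)" "inj_on (cd C) (\<Union>X)" using inj unfolding inj_on_def by blast+
    ultimately have "\<Union>X \<in> bisections C" by (simp add: bisections_def)
    then have "is_lub (nat_order SM) (\<Union>X) X" using rep.is_lub_iff_Union[of X "\<Union>X"] X by simp
    then show ?thesis by blast
  qed
  then show ?thesis unfolding complete_rmonoid_def using restriction_section_monoid full.frame_rep by simp
qed

end

sublocale etale \<subseteq> SM: complete_rmon SM
  by (rule complete_rmonI) (rule complete_section_monoid)

context etale
begin

lemma rmonoid_ob_section_monoid:
  assumes "etale_ob v C"
  shows "rmonoid_ob v SM"
proof -
  interpret pr: full_representation "proj_order SM" "Ob C" units_in by (rule full_representation_units)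
  interpret ci: full_representation "closed_ideals SM" "Arr C" "\<lambda>A. \<Union>((\<lambda>A. A) ` A)"
    by (rule SM.representation_closed_ideals) (rule representation_sections)
  show ?thesis
    using assms complete_section_monoid pr.spatial_frame_rep ci.spatial_frame_rep
      pr.coherent_frame_iff_spectral ci.coherent_frame_iff_spectral
    by (cases v) (auto simp: spatial_rmonoid_def coherent_rmonoid_def strongly_coherent_rmonoid_def spectral_space_def)
qed

lemma sup_proj_section_monoid:
  assumes "M \<subseteq> open_units"
  shows "\<Squnion>\<^bsub>proj_order SM\<^esub>M = \<Union>M"
proof (rule SM.pord.sup_eqI)
  interpret pr: full_representation "proj_order SM" "Ob C" units_in by (rule full_representation_units)
  have "\<Union>M \<in> open_units" using assms by (auto simp: open_units_def)
  moreover have "units_in (\<Union>M) = \<Union>(units_in ` M)" by (auto simp: units_in_def)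
  ultimately show "is_lub (proj_order SM) (\<Union>M) M" using pr.is_lub_iff_Union[of M "\<Union>M"] assms by simp
qed

lemma meet_proj_section_monoid:
  assumes "F \<in> open_units" "G \<in> open_units"
  shows "F \<sqinter>\<^bsub>proj_order SM\<^esub> G = F \<inter> G"
proof (rule SM.pord.meet_eqI)
  interpret pr: full_representation "proj_order SM" "Ob C" units_in by (rule full_representation_units)
  have "F \<inter> G \<in> open_units" using assms by (auto simp: open_units_def)
  moreover have "units_in (F \<inter> G) = units_in F \<inter> units_in G" by (auto simp: units_in_def)
  ultimately show "is_glb (proj_order SM) (F \<inter> G) {F, G}"
    using pr.is_glb_iff_Int[of F G "F \<inter> G"] assms by simp
qed

lemma top_proj_section_monoid: "\<top>\<^bsub>proj_order SM\<^esub> = un C ` obs"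
  using one_open_units nat_le_section_monoid open_units_bisection
  by (intro SM.pord.top_eqI) (auto simp: open_units_def)

end

section \<open>Relational covering morphisms induce homomorphisms\<close>

locale covering = C: etale C + D: etale D for C :: "('a, 'o) topcat" and D :: "('b, 'p) topcat" +
  fixes f :: "('a, 'o, 'b, 'p) relmap"
  assumes cov: "rel_covering C D f"
begin

lemma on_arr_in: "a \<in> C.arrs \<Longrightarrow> s \<in> on_arr f a \<Longrightarrow> s \<in> D.arrs"
  and on_ob_in [simp, intro]: "x \<in> C.obs \<Longrightarrow> on_ob f x \<in> D.obs"
  and on_arr_dm: "a \<in> C.arrs \<Longrightarrow> s \<in> on_arr f a \<Longrightarrow> dm D s = on_ob f (dm C a)"
  and on_arr_cd: "a \<in> C.arrs \<Longrightarrow> s \<in> on_arr f a \<Longrightarrow> cd D s = on_ob f (cd C a)"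
  and on_arr_inj: "a \<in> C.arrs \<Longrightarrow> b \<in> C.arrs \<Longrightarrow> dm C a = dm C b \<or> cd C a = cd C b \<Longrightarrow>
    s \<in> on_arr f a \<Longrightarrow> s \<in> on_arr f b \<Longrightarrow> a = b"
  and lift_arr_dm: "q \<in> C.obs \<Longrightarrow> s \<in> D.arrs \<Longrightarrow> dm D s = on_ob f q \<Longrightarrow>
    \<exists>t\<in>C.arrs. dm C t = q \<and> s \<in> on_arr f t"
  and lift_arr_cd: "q \<in> C.obs \<Longrightarrow> s \<in> D.arrs \<Longrightarrow> cd D s = on_ob f q \<Longrightarrow>
    \<exists>t\<in>C.arrs. cd C t = q \<and> s \<in> on_arr f t"
  and preimage_open: "openin (Arr D) A \<Longrightarrow> openin (Arr C) {x \<in> C.arrs. on_arr f x \<inter> A \<noteq> {}}"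
  and on_arr_unit: "x \<in> C.obs \<Longrightarrow> un D (on_ob f x) \<in> on_arr f (un C x)"
proof -
  note r1 = cov[unfolded rel_covering_def]
  note c1 = conjunct1[OF r1] and r2 = conjunct2[OF r1]
  note r3 = conjunct2[OF r2]
  note c3 = conjunct1[OF r3] and r4 = conjunct2[OF r3]
  note c4 = conjunct1[OF r4] and r5 = conjunct2[OF r4]
  note r6 = conjunct2[OF r5]
  note c6 = conjunct1[OF r6] and r7 = conjunct2[OF r6]
  note c7 = conjunct1[OF r7] and r8 = conjunct2[OF r7]
  note c8 = conjunct1[OF r8] and c9 = conjunct2[OF r8]
  show "a \<in> C.arrs \<Longrightarrow> s \<in> on_arr f a \<Longrightarrow> s \<in> D.arrs" using PiE_mem[OF c1, of a] by auto
  show "x \<in> C.obs \<Longrightarrow> on_ob f x \<in> D.obs" using c3 by (auto simp: continuous_map_def)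
  show "a \<in> C.arrs \<Longrightarrow> s \<in> on_arr f a \<Longrightarrow> dm D s = on_ob f (dm C a)"
    "a \<in> C.arrs \<Longrightarrow> s \<in> on_arr f a \<Longrightarrow> cd D s = on_ob f (cd C a)" using c4 by simp_all
  show "a \<in> C.arrs \<Longrightarrow> b \<in> C.arrs \<Longrightarrow> dm C a = dm C b \<or> cd C a = cd C b \<Longrightarrow>
    s \<in> on_arr f a \<Longrightarrow> s \<in> on_arr f b \<Longrightarrow> a = b" using c6[rule_format, of a b] by blast
  show "q \<in> C.obs \<Longrightarrow> s \<in> D.arrs \<Longrightarrow> dm D s = on_ob f q \<Longrightarrow> \<exists>t\<in>C.arrs. dm C t = q \<and> s \<in> on_arr f t"
    "q \<in> C.obs \<Longrightarrow> s \<in> D.arrs \<Longrightarrow> cd D s = on_ob f q \<Longrightarrow> \<exists>t\<in>C.arrs. cd C t = q \<and> s \<in> on_arr f t"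
    using c7 by simp_all
  show "openin (Arr D) A \<Longrightarrow> openin (Arr C) {x \<in> C.arrs. on_arr f x \<inter> A \<noteq> {}}" using c8 by simp
  show "x \<in> C.obs \<Longrightarrow> un D (on_ob f x) \<in> on_arr f (un C x)" using c9 by simp
qed

lemma on_arr_mult:
  assumes "a \<in> C.arrs" "b \<in> C.arrs" "dm C a = cd C b" "s \<in> on_arr f a" "t \<in> on_arr f b"
  shows "cmp D s t \<in> on_arr f (cmp C a b)"
proof -
  have "\<forall>(a, b)\<in>topspace (composable C). \<forall>(s, t)\<in>topspace (composable D).
        s \<in> on_arr f a \<and> t \<in> on_arr f b \<longrightarrow> cmp D s t \<in> on_arr f (cmp C a b)"
    using cov unfolding rel_covering_def by (elim conjE)
  moreover have "(a, b) \<in> topspace (composable C)" using assms by (simp add: topspace_composable)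
  moreover have "(s, t) \<in> topspace (composable D)"
    using assms on_arr_in on_arr_dm[of a s] on_arr_cd[of b t] by (simp add: topspace_composable)
  ultimately show ?thesis using assms(4,5) by (auto dest!: bspec)
qed

definition pull :: "'b set \<Rightarrow> 'a set" where
  "pull A = {c \<in> C.arrs. on_arr f c \<inter> A \<noteq> {}}"

lemma section_pullback_eq: "A \<in> bisections D \<Longrightarrow> section_pullback C D f A = pull A"
  by (simp add: section_pullback_def pull_def)

lemma mem_pull: "c \<in> pull A \<longleftrightarrow> c \<in> C.arrs \<and> (\<exists>s\<in>A. s \<in> on_arr f c)"
  by (auto simp: pull_def)

lemma pull_bisection:
  assumes A: "A \<in> bisections D"
  shows "pull A \<in> bisections C"
proof -
  have "c = c'" if c: "c \<in> pull A" "c' \<in> pull A" and eq: "dm C c = dm C c' \<or> cd C c = cd C c'" for c c'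
  proof -
    obtain s s' where s: "s \<in> A" "s \<in> on_arr f c" "s' \<in> A" "s' \<in> on_arr f c'" "c \<in> C.arrs" "c' \<in> C.arrs"
      using c mem_pull by auto
    then have "dm D s = dm D s' \<or> cd D s = cd D s'" using eq on_arr_dm on_arr_cd by metis
    then have "s = s'" using D.bisection_dm[OF A] D.bisection_cd[OF A] s by blast
    then show ?thesis using on_arr_inj s eq by blast
  qed
  then show ?thesis
    using preimage_open[OF D.bisection_open[OF A]] unfolding bisections_def inj_on_def pull_def by blast
qed

text \<open>An arrow related to a unit is a unit, as it shares its domain with the unit at its domain.\<close>

lemma on_arr_reflects_unit:
  assumes c: "c \<in> C.arrs" and y: "y \<in> D.obs" "un D y \<in> on_arr f c"
  shows "c = un C (dm C c)" "on_ob f (dm C c) = y"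
proof -
  show 1: "on_ob f (dm C c) = y" using on_arr_dm[OF c y(2)] y(1) by simp
  then have "un D y \<in> on_arr f (un C (dm C c))" using on_arr_unit[of "dm C c"] c by simp
  then show "c = un C (dm C c)" using on_arr_inj[OF c _ _ y(2)] c by simp
qed

lemma pull_unit_iff:
  assumes F: "F \<in> D.open_units" and x: "x \<in> C.obs"
  shows "un C x \<in> pull F \<longleftrightarrow> un D (on_ob f x) \<in> F"
proof
  assume "un C x \<in> pull F"
  then obtain s where s: "s \<in> F" "s \<in> on_arr f (un C x)" using mem_pull by blast
  then obtain y where "y \<in> D.obs" "s = un D y" using D.open_units_mem[OF F] by blast
  then show "un D (on_ob f x) \<in> F" using on_arr_reflects_unit(2)[of "un C x" y] s x by simp
qed (use on_arr_unit x mem_pull in blast)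

lemma pull_open_units:
  assumes F: "F \<in> D.open_units"
  shows "pull F \<in> C.open_units"
proof -
  have "c \<in> un C ` C.obs" if "c \<in> pull F" for c
  proof -
    obtain s where s: "c \<in> C.arrs" "s \<in> F" "s \<in> on_arr f c" using \<open>c \<in> pull F\<close> mem_pull by blast
    then obtain y where "y \<in> D.obs" "s = un D y" using D.open_units_mem[OF F] by blast
    then have "c = un C (dm C c)" using on_arr_reflects_unit(1)[OF s(1)] s(3) by simp
    then show ?thesis using C.dm_in[OF s(1)] by blast
  qed
  then show ?thesis using C.bisection_open[OF pull_bisection[OF D.open_units_bisection[OF F]]] by (auto simp: C.open_units_def)
qed

text \<open>Let \<open>ab\<close> be related to \<open>c\<close>. Lift \<open>b\<close> to an arrow \<open>t\<close> with the domain of \<open>c\<close>, and then \<open>a\<close> to an arrow \<open>s\<close>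
  composable with \<open>t\<close>. The arrows \<open>st\<close> and \<open>c\<close> have the same domain and are both related to \<open>ab\<close>, hence
  are equal.\<close>

lemma pull_mult:
  assumes A: "A \<in> bisections D" and B: "B \<in> bisections D"
  shows "pull (D.smult A B) = C.smult (pull A) (pull B)"
proof
  show "pull (D.smult A B) \<subseteq> C.smult (pull A) (pull B)"
  proof
    fix c assume "c \<in> pull (D.smult A B)"
    then obtain s where s: "c \<in> C.arrs" "s \<in> D.smult A B" "s \<in> on_arr f c" using mem_pull by blast
    then obtain a b where "a \<in> A" "b \<in> B" "dm D a = cd D b" "s = cmp D a b" using D.mem_smult by blast
    then have c: "c \<in> C.arrs" "a \<in> A" "b \<in> B" "dm D a = cd D b" "cmp D a b \<in> on_arr f c" using s by auto
    have arr: "a \<in> D.arrs" "b \<in> D.arrs" using c A B D.bisection_arrs by auto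
    have "dm D b = on_ob f (dm C c)" using on_arr_dm[OF c(1,5)] D.dm_cmp arr c by simp
    then obtain t where t: "t \<in> C.arrs" "dm C t = dm C c" "b \<in> on_arr f t" using lift_arr_dm c arr by blast
    have "dm D a = on_ob f (cd C t)" using on_arr_cd[OF t(1,3)] c by simp
    then obtain s where s: "s \<in> C.arrs" "dm C s = cd C t" "a \<in> on_arr f s" using lift_arr_dm t arr by blast
    have "cmp D a b \<in> on_arr f (cmp C s t)" using on_arr_mult s t by blast
    moreover have "cmp C s t \<in> C.arrs" "dm C (cmp C s t) = dm C c" using C.cmp_in C.dm_cmp s t by auto
    ultimately have "c = cmp C s t" using on_arr_inj c by metis
    moreover have "s \<in> pull A" "t \<in> pull B" using s t c mem_pull by blast+
    ultimately show "c \<in> C.smult (pull A) (pull B)" using s C.mem_smult by blast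
  qed
  show "C.smult (pull A) (pull B) \<subseteq> pull (D.smult A B)"
  proof
    fix c assume "c \<in> C.smult (pull A) (pull B)"
    then obtain s t where st: "s \<in> pull A" "t \<in> pull B" "dm C s = cd C t" "c = cmp C s t" unfolding C.mem_smult by blast
    then obtain a b where ab: "s \<in> C.arrs" "a \<in> A" "a \<in> on_arr f s" "t \<in> C.arrs" "b \<in> B" "b \<in> on_arr f t"
      unfolding mem_pull by blast
    then have "cmp D a b \<in> on_arr f c" "c \<in> C.arrs" using on_arr_mult C.cmp_in st by auto
    moreover have "cmp D a b \<in> D.smult A B"
    proof -
      have "dm D a = cd D b" using st(3) on_arr_dm[OF ab(1,3)] on_arr_cd[OF ab(4,6)] by simp
      then show ?thesis using D.mem_smult ab(2,5) by blast
    qed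
    ultimately show "c \<in> pull (D.smult A B)" unfolding mem_pull by blast
  qed
qed

text \<open>An arrow related to the unit at the domain of \<open>a\<close> is itself a unit, and lifting \<open>a\<close> along its
  object exhibits it as the domain of an arrow related to \<open>a\<close>. The codomain is treated in the same way.\<close>

lemma pull_lam:
  assumes A: "A \<in> bisections D"
  shows "pull (un D ` dm D ` A) = un C ` dm C ` pull A" "pull (un D ` cd D ` A) = un C ` cd C ` pull A"
proof -
  have 1: "c \<in> pull (un D ` dm D ` A) \<longleftrightarrow> c \<in> un C ` dm C ` pull A" for c
  proof
    assume "c \<in> pull (un D ` dm D ` A)"
    then obtain a where a: "c \<in> C.arrs" "a \<in> A" "un D (dm D a) \<in> on_arr f c" unfolding mem_pull by blast
    then have "a \<in> D.arrs" using D.bisection_arrs A by blast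
    then have c: "c = un C (dm C c)" "on_ob f (dm C c) = dm D a"
      using on_arr_reflects_unit[OF a(1) _ a(3)] by auto
    then obtain t where "t \<in> C.arrs" "dm C t = dm C c" "a \<in> on_arr f t"
      using lift_arr_dm[of "dm C c" a] a \<open>a \<in> D.arrs\<close> by auto
    then have "t \<in> pull A" "c = un C (dm C t)" using a c mem_pull by auto
    then show "c \<in> un C ` dm C ` pull A" by blast
  next
    assume "c \<in> un C ` dm C ` pull A"
    then obtain t where "c = un C (dm C t)" "t \<in> pull A" by blast
    then obtain a where t: "c = un C (dm C t)" "t \<in> C.arrs" "a \<in> A" "a \<in> on_arr f t" using mem_pull by blast
    then have "un D (dm D a) \<in> on_arr f c" using on_arr_unit[of "dm C t"] on_arr_dm[OF t(2,4)] by simp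
    then show "c \<in> pull (un D ` dm D ` A)" unfolding mem_pull using t by auto
  qed
  have 2: "c \<in> pull (un D ` cd D ` A) \<longleftrightarrow> c \<in> un C ` cd C ` pull A" for c
  proof
    assume "c \<in> pull (un D ` cd D ` A)"
    then obtain a where a: "c \<in> C.arrs" "a \<in> A" "un D (cd D a) \<in> on_arr f c" unfolding mem_pull by blast
    then have "a \<in> D.arrs" using D.bisection_arrs A by blast
    then have c: "c = un C (dm C c)" "on_ob f (dm C c) = cd D a"
      using on_arr_reflects_unit[OF a(1) _ a(3)] by auto
    then obtain t where "t \<in> C.arrs" "cd C t = dm C c" "a \<in> on_arr f t"
      using lift_arr_cd[of "dm C c" a] a \<open>a \<in> D.arrs\<close> by auto
    then have "t \<in> pull A" "c = un C (cd C t)" using a c mem_pull by auto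
    then show "c \<in> un C ` cd C ` pull A" by blast
  next
    assume "c \<in> un C ` cd C ` pull A"
    then obtain t where "c = un C (cd C t)" "t \<in> pull A" by blast
    then obtain a where t: "c = un C (cd C t)" "t \<in> C.arrs" "a \<in> A" "a \<in> on_arr f t" using mem_pull by blast
    then have "un D (cd D a) \<in> on_arr f c" using on_arr_unit[of "cd C t"] on_arr_cd[OF t(2,4)] by simp
    then show "c \<in> pull (un D ` cd D ` A)" unfolding mem_pull using t by auto
  qed
  show "pull (un D ` dm D ` A) = un C ` dm C ` pull A" using 1 by (rule Set.set_eqI)
  show "pull (un D ` cd D ` A) = un C ` cd C ` pull A" using 2 by (rule Set.set_eqI)
qed

lemma units_in_pull:
  assumes "F \<in> D.open_units"
  shows "C.units_in (pull F) = {x \<in> C.obs. on_ob f x \<in> D.units_in F}"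
  using pull_unit_iff[OF assms] by (auto simp: C.units_in_def D.units_in_def)

lemma pull_top: "pull (un D ` D.obs) = un C ` C.obs"
proof -
  have "C.units_in (pull (un D ` D.obs)) = C.obs"
    unfolding units_in_pull[OF D.one_open_units] by (auto simp: D.units_in_def)
  then show ?thesis using C.un_units_in[OF pull_open_units[OF D.one_open_units]] by simp
qed

lemma rmonoid_hom_pullback: "rmonoid_hom D.SM C.SM (section_pullback C D f)"
  unfolding rmonoid_hom_def
proof (intro conjI)
  let ?h = "section_pullback C D f"
  have pp: "?h F = pull F" if "F \<in> D.open_units" for F using section_pullback_eq D.open_units_bisection that by blast
  show "?h \<in> hom D.SM C.SM"
    by (auto simp: hom_def section_pullback_eq pull_bisection D.smult_bisection pull_mult)
  show "?h \<in> extensional (carrier D.SM)" by (simp add: section_pullback_def)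
  show "\<forall>a\<in>carrier D.SM. ?h (lam D.SM a) = lam C.SM (?h a) \<and> ?h (rho D.SM a) = rho C.SM (?h a)"
    using D.lam_open_units D.rho_open_units by (simp add: section_pullback_eq pp pull_lam)
  show "frame_hom (proj_order D.SM) (proj_order C.SM) ?h"
    unfolding frame_hom_def
  proof (intro conjI ballI allI impI)
    show "?h \<in> carrier (proj_order D.SM) \<rightarrow> carrier (proj_order C.SM)" using pull_open_units by (simp add: pp)
    show "?h \<top>\<^bsub>proj_order D.SM\<^esub> = \<top>\<^bsub>proj_order C.SM\<^esub>"
      by (simp add: D.top_proj_section_monoid C.top_proj_section_monoid pp D.one_open_units pull_top)
  next
    fix F G assume "F \<in> carrier (proj_order D.SM)" "G \<in> carrier (proj_order D.SM)"
    then have FG: "F \<in> D.open_units" "G \<in> D.open_units" by auto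
    have FG': "F \<inter> G \<in> D.open_units" using FG by (auto simp: D.open_units_def)
    have "C.units_in (pull (F \<inter> G)) = C.units_in (pull F \<inter> pull G)"
      unfolding units_in_pull[OF FG'] using pull_unit_iff FG by (auto simp: C.units_in_def D.units_in_def)
    moreover have "pull F \<inter> pull G \<in> C.open_units" using pull_open_units FG by (auto simp: C.open_units_def)
    ultimately have "pull (F \<inter> G) = pull F \<inter> pull G" using C.un_units_in pull_open_units[OF FG'] by metis
    then show "?h (F \<sqinter>\<^bsub>proj_order D.SM\<^esub> G) = ?h F \<sqinter>\<^bsub>proj_order C.SM\<^esub> ?h G"
      using FG FG' pull_open_units by (simp add: D.meet_proj_section_monoid C.meet_proj_section_monoid pp)
  next
    fix M assume "M \<subseteq> carrier (proj_order D.SM)"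
    then have M: "M \<subseteq> D.open_units" by simp
    then have M': "\<Union>M \<in> D.open_units" by (auto simp: D.open_units_def)
    have hM: "?h ` M = pull ` M" using pp M by (intro image_cong) auto
    have "pull ` M \<subseteq> C.open_units" using pull_open_units M by blast
    moreover have "pull (\<Union>M) = \<Union>(pull ` M)" by (auto simp: pull_def)
    ultimately show "?h (\<Squnion>\<^bsub>proj_order D.SM\<^esub>M) = \<Squnion>\<^bsub>proj_order C.SM\<^esub>(?h ` M)"
      unfolding hM D.sup_proj_section_monoid[OF M] pp[OF M'] by (simp add: C.sup_proj_section_monoid)
  qed
qed

lemma proper_hom_pullback:
  assumes ne: "\<forall>c\<in>C.arrs. on_arr f c \<noteq> {}"
  shows "proper_hom D.SM C.SM (section_pullback C D f)"
  unfolding proper_hom_def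
proof
  interpret rep: representation "nat_order C.SM" "Arr C" "\<lambda>A. A" by (rule C.representation_sections)
  fix B assume "B \<in> carrier C.SM"
  then have B: "B \<in> bisections C" by simp
  \<comment> \<open>every arrow of \<open>B\<close> lies in a preimage, because it is related to some arrow\<close>
  define X where "X = {A \<in> bisections C. A \<subseteq> B \<and> (\<exists>E\<in>bisections D. A \<subseteq> pull E)}"
  have "B = \<Union>X"
  proof
    show "B \<subseteq> \<Union>X"
    proof
      fix c assume c: "c \<in> B"
      then have "c \<in> C.arrs" using C.bisection_arrs[OF B] by blast
      then obtain s where s: "s \<in> on_arr f c" using ne by blast
      obtain E where E: "E \<in> bisections D" "s \<in> E"
        using D.ex_bisection[OF openin_topspace on_arr_in[OF \<open>c \<in> C.arrs\<close> s]] by blast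
      have "c \<in> B \<inter> pull E" using c s E \<open>c \<in> C.arrs\<close> mem_pull by blast
      moreover have "B \<inter> pull E \<in> bisections C"
        using C.bisection_subset[OF B] C.bisection_open[OF B] C.bisection_open[OF pull_bisection[OF E(1)]] by blast
      ultimately show "c \<in> \<Union>X" using E by (auto simp: X_def)
    qed
  qed (auto simp: X_def)
  moreover have XC: "X \<subseteq> bisections C" by (auto simp: X_def)
  ultimately have "is_lub (nat_order C.SM) B X" using rep.is_lub_iff_Union[of X B] B by simp
  moreover have "\<exists>E\<in>carrier D.SM. nat_le C.SM A (section_pullback C D f E)" if A: "A \<in> X" for A
  proof -
    obtain E where "E \<in> bisections D" "A \<subseteq> pull E" "A \<in> bisections C" using A unfolding X_def by blast
    then show ?thesis
      using pull_bisection by (intro bexI[of _ E]) (auto simp: C.nat_le_section_monoid section_pullback_eq)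
  qed
  ultimately show "\<exists>X\<subseteq>carrier C.SM. is_lub (nat_order C.SM) B X \<and>
      (\<forall>A\<in>X. \<exists>E\<in>carrier D.SM. nat_le C.SM A (section_pullback C D f E))" using XC by auto
qed

lemma meet_hom_pullback:
  assumes one: "\<forall>c\<in>C.arrs. \<forall>s\<in>on_arr f c. \<forall>t\<in>on_arr f c. s = t"
  shows "meet_hom D.SM C.SM (section_pullback C D f)"
  unfolding meet_hom_def
proof (intro ballI allI impI)
  interpret rC: representation "nat_order C.SM" "Arr C" "\<lambda>A. A" by (rule C.representation_sections)
  interpret rD: representation "nat_order D.SM" "Arr D" "\<lambda>A. A" by (rule D.representation_sections)
  fix A B E assume "A \<in> carrier D.SM" "B \<in> carrier D.SM" and glb: "is_glb (nat_order D.SM) E {A, B}"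
  then have A: "A \<in> bisections D" and B: "B \<in> bisections D" by auto
  have E: "E \<in> bisections D" using greatest_closed[OF glb] by simp
  have "E = A \<inter> B" using rD.is_glb_iff_Int[of A B E] A B E glb by simp
  moreover have "pull (A \<inter> B) = pull A \<inter> pull B"
    using one unfolding pull_def by (intro Set.set_eqI) (auto, metis IntI empty_iff)
  ultimately show "is_glb (nat_order C.SM) (section_pullback C D f E) {section_pullback C D f A, section_pullback C D f B}"
    using rC.is_glb_iff_Int[of "pull A" "pull B" "pull E"] pull_bisection[OF A] pull_bisection[OF B] pull_bisection[OF E]
      section_pullback_eq[OF A] section_pullback_eq[OF B] section_pullback_eq[OF E] by simp
qed

lemma coherent_hom_pullback:
  assumes coh: "coherent_relmap C D f"
  shows "coherent_hom D.SM C.SM (section_pullback C D f)"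
  unfolding coherent_hom_def
proof (intro allI impI)
  interpret pC: full_representation "proj_order C.SM" "Ob C" C.units_in by (rule C.full_representation_units)
  interpret pD: full_representation "proj_order D.SM" "Ob D" D.units_in by (rule D.full_representation_units)
  fix F assume F: "finite_elem (proj_order D.SM) F"
  then have Fp: "F \<in> D.open_units" and co: "compact_open (Ob D) (D.units_in F)" using pD.finite_elem_iff by auto
  then have "compact_open (Ob C) (C.units_in (pull F))"
    using coh units_in_pull[OF Fp] unfolding coherent_relmap_def by simp
  then show "finite_elem (proj_order C.SM) (section_pullback C D f F)"
    using pC.finite_elem_iff pull_open_units[OF Fp] section_pullback_eq[OF D.open_units_bisection[OF Fp]] by simp
qed

lemma rmonoid_mor_pullback:
  assumes "etale_mor v k C D f"
  shows "rmonoid_mor v k D.SM C.SM (section_pullback C D f)"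
proof -
  have "proper_hom D.SM C.SM (section_pullback C D f)" if "k = 2 \<or> k = 4"
    using assms that unfolding etale_mor_def by (intro proper_hom_pullback) (metis empty_iff)
  moreover have "meet_hom D.SM C.SM (section_pullback C D f)" if "k = 3 \<or> k = 4"
    using assms that unfolding etale_mor_def by (intro meet_hom_pullback) blast
  moreover have "coherent_hom D.SM C.SM (section_pullback C D f)" if "v \<noteq> Sober_Spatial"
    using assms that unfolding etale_mor_def by (intro coherent_hom_pullback) blast
  ultimately show ?thesis using rmonoid_hom_pullback unfolding rmonoid_mor_def by blast
qed

end

lemma section_pullback_id: "section_pullback C C (rel_id C) = rmonoid_id (section_monoid C)"
proof
  fix A
  have "{c \<in> topspace (Arr C). on_arr (rel_id C) c \<inter> A \<noteq> {}} = A" if "A \<in> bisections C"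
    using that openin_subset by (fastforce simp: rel_id_def bisections_def)
  then show "section_pullback C C (rel_id C) A = rmonoid_id (section_monoid C) A"
    by (simp add: section_pullback_def section_monoid_def)
qed

lemma section_pullback_comp:
  assumes "covering C D f" "covering D B g"
  shows "section_pullback C B (rel_comp C g f) =
    rmonoid_comp (section_monoid B) (section_pullback C D f) (section_pullback D B g)"
proof
  interpret f: covering C D f by fact
  interpret g: covering D B g by fact
  fix A
  show "section_pullback C B (rel_comp C g f) A =
    rmonoid_comp (section_monoid B) (section_pullback C D f) (section_pullback D B g) A"
  proof (cases "A \<in> bisections B")
    case True
    have "{c \<in> topspace (Arr C). on_arr (rel_comp C g f) c \<inter> A \<noteq> {}} = f.pull (g.pull A)"
      using f.on_arr_in unfolding f.pull_def g.pull_def rel_comp_def by auto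
    then have "section_pullback C B (rel_comp C g f) A = f.pull (g.pull A)"
      using True by (simp add: section_pullback_def)
    also have "\<dots> = section_pullback C D f (section_pullback D B g A)"
      using f.section_pullback_eq g.section_pullback_eq True g.pull_bisection by simp
    finally show ?thesis using True by (simp add: compose_def)
  next
    case False
    then show ?thesis by (simp add: section_pullback_def compose_def)
  qed
qed

section \<open>The filter functor\<close>

lemma etale_ob_etale: "etale_ob v C \<Longrightarrow> etale_category C"
  by (cases v) auto

lemma etaleI: "etale_ob v C \<Longrightarrow> etale C"
  by (simp add: etale_def etale_ob_etale)

lemma coveringI: "etale_ob v C \<Longrightarrow> etale_ob v D \<Longrightarrow> etale_mor v k C D f \<Longrightarrow> covering C D f"
  by (simp add: covering_def covering_axioms_def etaleI etale_mor_def)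

lemma complete_rmon_of_ob: "rmonoid_ob v S \<Longrightarrow> complete_rmon S"
  by (rule complete_rmonI) (rule rmonoid_ob_enough_points(1))

lemma restriction_hom_of_mor: "rmonoid_ob v S \<Longrightarrow> rmonoid_ob v T \<Longrightarrow> rmonoid_mor v k S T h \<Longrightarrow> restriction_hom S T h"
  by (rule restriction_homI) (auto simp: rmonoid_mor_def intro: rmonoid_ob_enough_points(1))

lemma etale_ob_filter_category:
  assumes ob: "rmonoid_ob v S"
  shows "etale_ob v (filter_category S)"
proof -
  interpret complete_rmon S using ob by (rule complete_rmon_of_ob)
  note ep = rmonoid_ob_enough_points(2)[OF ob]
  interpret pr: full_representation "proj_order S" "point_space (proj_order S)" "pts (proj_order S)"
    by (rule full_representation_proj_order[OF ep])
  interpret ci: full_representation "closed_ideals S" "point_space (nat_order S)" "\<lambda>A. \<Union>(pts (nat_order S) ` A)"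
    by (rule representation_closed_ideals[OF representation_nat_order[OF ep]])
  show ?thesis
    using ob etale_filter_category sober_point_space[of "nat_order S"] sober_point_space[of "proj_order S"]
      pr.coherent_frame_iff_spectral ci.coherent_frame_iff_spectral
    by (cases v) (auto simp: coherent_rmonoid_def strongly_coherent_rmonoid_def)
qed

lemma etale_mor_filter_map:
  assumes S: "rmonoid_ob v S" and T: "rmonoid_ob v T" and h: "rmonoid_mor v k S T h"
  shows "etale_mor v k (filter_category T) (filter_category S) (filter_map S T h)"
proof -
  interpret restriction_hom S T h using S T h by (rule restriction_hom_of_mor)
  interpret pS: full_representation "proj_order S" "point_space (proj_order S)" "pts (proj_order S)"
    by (rule S.full_representation_proj_order[OF rmonoid_ob_enough_points(2)[OF S]])
  interpret pT: full_representation "proj_order T" "point_space (proj_order T)" "pts (proj_order T)"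
    by (rule T.full_representation_proj_order[OF rmonoid_ob_enough_points(2)[OF T]])
  let ?f = "filter_map S T h"
  have ne: "on_arr ?f P \<noteq> {}" if "k = 2 \<or> k = 4" "nat_filter T P" for P
    using that h filter_map_proper unfolding rmonoid_mor_def by blast
  have one: "Q = Q'" if "k = 3 \<or> k = 4" "nat_filter T P" "Q \<in> on_arr ?f P" "Q' \<in> on_arr ?f P" for P Q Q'
    using that h filter_map_meet unfolding rmonoid_mor_def by blast
  have coh: "coherent_relmap (filter_category T) (filter_category S) ?f" if "v \<noteq> Sober_Spatial"
    unfolding coherent_relmap_def filter_category_simps
  proof (intro allI impI)
    fix K assume K: "compact_open (point_space (proj_order S)) K"
    then obtain f where f: "f \<in> proj S" "pts (proj_order S) f = K"
      using pS.full[of K] by (auto simp: compact_open_def)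
    then have "finite_elem (proj_order S) f" using pS.finite_elem_iff K by simp
    then have "finite_elem (proj_order T) (h f)"
      using that h unfolding rmonoid_mor_def coherent_hom_def by blast
    moreover have "on_ob ?f p \<in> K \<longleftrightarrow> h f \<in> p" if p: "proj_filter T p" for p
    proof -
      have "on_ob ?f p \<in> K \<longleftrightarrow> f \<in> proj_pre S h p"
        unfolding f(2)[symmetric] using proj_filter_pre[OF p] by (simp add: on_ob_filter_map[OF p] pts_def)
      then show ?thesis using f(1) by (simp add: proj_pre_def)
    qed
    then have "{p \<in> topspace (point_space (proj_order T)). on_ob ?f p \<in> K} = pts (proj_order T) (h f)"
      by (auto simp: topspace_point_space pts_def)
    ultimately show "compact_open (point_space (proj_order T)) {p \<in> topspace (point_space (proj_order T)). on_ob ?f p \<in> K}"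
      using pT.finite_elem_iff by simp
  qed
  show ?thesis
    unfolding etale_mor_def filter_category_simps topspace_point_space
  proof (intro conjI impI)
    show "rel_covering (filter_category T) (filter_category S) ?f" by (rule rel_covering_filter_map)
    show "\<forall>P\<in>{P. nat_filter T P}. on_arr ?f P \<noteq> {}" if "k = 2" using ne that by blast
    show "\<forall>P\<in>{P. nat_filter T P}. \<forall>s\<in>on_arr ?f P. \<forall>t\<in>on_arr ?f P. s = t" if "k = 3" using one that by blast
    show "\<forall>P\<in>{P. nat_filter T P}. \<exists>!s. s \<in> on_arr ?f P" if "k = 4"
    proof
      fix P assume "P \<in> {P. nat_filter T P}"
      then have P: "nat_filter T P" by simp
      then obtain Q where "Q \<in> on_arr ?f P" using ne \<open>k = 4\<close> by blast
      then show "\<exists>!s. s \<in> on_arr ?f P" using one[OF _ P] \<open>k = 4\<close> by blast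
    qed
  qed (rule coh)
qed

section \<open>Categories of relational covering morphisms\<close>

definition fun_relmap :: "('a, 'o) topcat \<Rightarrow> ('a \<Rightarrow> 'b) \<Rightarrow> ('o \<Rightarrow> 'p) \<Rightarrow> ('a, 'o, 'b, 'p) relmap" where
  "fun_relmap C F G = \<lparr>on_arr = (\<lambda>a\<in>topspace (Arr C). {F a}), on_ob = (\<lambda>x\<in>topspace (Ob C). G x)\<rparr>"

locale cat_homeo = C: etale C + D: etale D for C :: "('a, 'o) topcat" and D :: "('b, 'p) topcat" +
  fixes F :: "'a \<Rightarrow> 'b" and G :: "'o \<Rightarrow> 'p"
  assumes homeo_arr: "homeomorphic_map (Arr C) (Arr D) F"
    and homeo_ob: "homeomorphic_map (Ob C) (Ob D) G"
    and F_dm: "a \<in> C.arrs \<Longrightarrow> dm D (F a) = G (dm C a)"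
    and F_cd: "a \<in> C.arrs \<Longrightarrow> cd D (F a) = G (cd C a)"
    and F_un: "x \<in> C.obs \<Longrightarrow> F (un C x) = un D (G x)"
    and F_cmp: "a \<in> C.arrs \<Longrightarrow> b \<in> C.arrs \<Longrightarrow> dm C a = cd C b \<Longrightarrow> F (cmp C a b) = cmp D (F a) (F b)"
begin

lemma F_bij: "F ` C.arrs = D.arrs" "inj_on F C.arrs"
  and G_bij: "G ` C.obs = D.obs" "inj_on G C.obs"
  using homeo_arr homeo_ob homeomorphic_imp_surjective_map homeomorphic_imp_injective_map by blast+

lemma F_in: "a \<in> C.arrs \<Longrightarrow> F a \<in> D.arrs" and G_in: "x \<in> C.obs \<Longrightarrow> G x \<in> D.obs"
  using F_bij G_bij by blast+

lemma on_fun_relmap [simp]: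
  "a \<in> C.arrs \<Longrightarrow> on_arr (fun_relmap C F G) a = {F a}"
  "x \<in> C.obs \<Longrightarrow> on_ob (fun_relmap C F G) x = G x"
  by (simp_all add: fun_relmap_def)

text \<open>An isomorphism of topological categories, as a relational morphism with singleton values,
  satisfies the conditions of all four types at once.\<close>

lemma etale_mor_fun_relmap: "etale_mor v k C D (fun_relmap C F G)"
proof -
  have cG: "continuous_map (Ob C) (Ob D) G" and cF: "continuous_map (Arr C) (Arr D) F"
    using homeo_ob homeo_arr by (auto intro: homeomorphic_imp_continuous_map)
  have ex: "\<exists>t\<in>C.arrs. F t = s" if "s \<in> D.arrs" for s
    using that unfolding F_bij(1)[symmetric] by blast
  have "rel_covering C D (fun_relmap C F G)"
    unfolding rel_covering_def
  proof (intro conjI)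
    show "on_arr (fun_relmap C F G) \<in> C.arrs \<rightarrow>\<^sub>E Pow D.arrs" using F_in by (auto simp: fun_relmap_def)
    show "on_ob (fun_relmap C F G) \<in> extensional C.obs" by (simp add: fun_relmap_def)
    show "continuous_map (Ob C) (Ob D) (on_ob (fun_relmap C F G))"
      using continuous_map_eq[OF cG] on_fun_relmap(2) by metis
    show "\<forall>a\<in>C.arrs. \<forall>b\<in>on_arr (fun_relmap C F G) a.
        dm D b = on_ob (fun_relmap C F G) (dm C a) \<and> cd D b = on_ob (fun_relmap C F G) (cd C a)"
      by (simp add: F_dm F_cd)
    show "\<forall>(a, b)\<in>topspace (composable C). \<forall>(s, t)\<in>topspace (composable D).
        s \<in> on_arr (fun_relmap C F G) a \<and> t \<in> on_arr (fun_relmap C F G) b \<longrightarrow>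
        cmp D s t \<in> on_arr (fun_relmap C F G) (cmp C a b)"
      by (auto simp: topspace_composable C.cmp_in F_cmp)
    show "\<forall>a\<in>C.arrs. \<forall>b\<in>C.arrs. (dm C a = dm C b \<or> cd C a = cd C b) \<and>
        on_arr (fun_relmap C F G) a \<inter> on_arr (fun_relmap C F G) b \<noteq> {} \<longrightarrow> a = b"
      using F_bij(2) by (auto simp: inj_on_def)
    show "\<forall>q\<in>C.obs. \<forall>s\<in>D.arrs.
        (dm D s = on_ob (fun_relmap C F G) q \<longrightarrow> (\<exists>t\<in>C.arrs. dm C t = q \<and> s \<in> on_arr (fun_relmap C F G) t)) \<and>
        (cd D s = on_ob (fun_relmap C F G) q \<longrightarrow> (\<exists>t\<in>C.arrs. cd C t = q \<and> s \<in> on_arr (fun_relmap C F G) t))"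
    proof (intro ballI)
      fix q s assume q: "q \<in> C.obs" and s: "s \<in> D.arrs"
      obtain t where t: "t \<in> C.arrs" "F t = s" using ex[OF s] by blast
      have "dm C t = q" if "dm D s = G q" using that F_dm[OF t(1)] t G_bij(2) q C.dm_in by (metis inj_onD)
      moreover have "cd C t = q" if "cd D s = G q" using that F_cd[OF t(1)] t G_bij(2) q C.cd_in by (metis inj_onD)
      ultimately show "(dm D s = on_ob (fun_relmap C F G) q \<longrightarrow> (\<exists>t\<in>C.arrs. dm C t = q \<and> s \<in> on_arr (fun_relmap C F G) t)) \<and>
        (cd D s = on_ob (fun_relmap C F G) q \<longrightarrow> (\<exists>t\<in>C.arrs. cd C t = q \<and> s \<in> on_arr (fun_relmap C F G) t))"
        using q t by auto
    qed
    show "\<forall>A. openin (Arr D) A \<longrightarrow> openin (Arr C) {x \<in> C.arrs. on_arr (fun_relmap C F G) x \<inter> A \<noteq> {}}"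
    proof (intro allI impI)
      fix A assume A: "openin (Arr D) A"
      have "{x \<in> C.arrs. on_arr (fun_relmap C F G) x \<inter> A \<noteq> {}} = {x \<in> C.arrs. F x \<in> A}" by auto
      then show "openin (Arr C) {x \<in> C.arrs. on_arr (fun_relmap C F G) x \<inter> A \<noteq> {}}"
        using openin_continuous_map_preimage[OF cF A] by simp
    qed
    show "\<forall>t\<in>C.obs. un D (on_ob (fun_relmap C F G) t) \<in> on_arr (fun_relmap C F G) (un C t)"
      by (simp add: F_un)
  qed
  moreover have "coherent_relmap C D (fun_relmap C F G)"
    unfolding coherent_relmap_def
  proof (intro allI impI)
    fix K assume K: "compact_open (Ob D) K"
    let ?V = "{x \<in> C.obs. G x \<in> K}"
    have "K \<subseteq> G ` C.obs"
      using K openin_subset[of "Ob D" K] unfolding G_bij(1) compact_open_def by simp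
    then have V: "?V \<subseteq> C.obs" "G ` ?V = K" by blast+
    have "openin (Ob C) ?V" using openin_continuous_map_preimage[OF cG] K unfolding compact_open_def by blast
    moreover have "compactin (Ob C) ?V"
      using homeomorphic_map_compactness[OF homeo_ob V(1)] V(2) K unfolding compact_open_def by simp
    moreover have "{x \<in> C.obs. on_ob (fun_relmap C F G) x \<in> K} = ?V" by auto
    ultimately show "compact_open (Ob C) {x \<in> C.obs. on_ob (fun_relmap C F G) x \<in> K}"
      unfolding compact_open_def by simp
  qed
  ultimately show ?thesis unfolding etale_mor_def by simp
qed

lemma ex_inverse: "\<exists>F' G'. cat_homeo D C F' G' \<and>
    (\<forall>a\<in>C.arrs. F' (F a) = a) \<and> (\<forall>b\<in>D.arrs. F (F' b) = b) \<and>
    (\<forall>x\<in>C.obs. G' (G x) = x) \<and> (\<forall>y\<in>D.obs. G (G' y) = y)"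
proof -
  obtain F' where F': "homeomorphic_maps (Arr C) (Arr D) F F'" using homeo_arr homeomorphic_map_maps by blast
  obtain G' where G': "homeomorphic_maps (Ob C) (Ob D) G G'" using homeo_ob homeomorphic_map_maps by blast
  have inv: "\<forall>a\<in>C.arrs. F' (F a) = a" "\<forall>b\<in>D.arrs. F (F' b) = b"
      "\<forall>x\<in>C.obs. G' (G x) = x" "\<forall>y\<in>D.obs. G (G' y) = y"
    using F' G' unfolding homeomorphic_maps_def by blast+
  have h: "homeomorphic_map (Arr D) (Arr C) F'" "homeomorphic_map (Ob D) (Ob C) G'"
    using F' G' homeomorphic_maps_sym homeomorphic_maps_map by blast+
  have F'_in: "F' b \<in> C.arrs" if "b \<in> D.arrs" for b
    using homeomorphic_imp_surjective_map[OF h(1)] that by blast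
  have G'_in: "G' y \<in> C.obs" if "y \<in> D.obs" for y
    using homeomorphic_imp_surjective_map[OF h(2)] that by blast
  have d: "dm C (F' b) = G' (dm D b)" "cd C (F' b) = G' (cd D b)" if b: "b \<in> D.arrs" for b
    using F_dm[OF F'_in[OF b]] F_cd[OF F'_in[OF b]] inv(2,3) b F'_in[OF b] C.dm_in C.cd_in by metis+
  have "cat_homeo D C F' G'"
  proof
    show "F' (un D y) = un C (G' y)" if y: "y \<in> D.obs" for y
      using F_un[OF G'_in[OF y]] inv(1,4) y G'_in[OF y] C.un_in by metis
    show "F' (cmp D a b) = cmp C (F' a) (F' b)" if ab: "a \<in> D.arrs" "b \<in> D.arrs" "dm D a = cd D b" for a b
    proof -
      have c: "dm C (F' a) = cd C (F' b)" using d ab by simp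
      have "F (cmp C (F' a) (F' b)) = cmp D a b" using F_cmp[OF F'_in F'_in c] ab inv(2) by simp
      then show ?thesis using inv(1) C.cmp_in[OF F'_in F'_in c] ab by metis
    qed
  qed (use h d in auto)
  then show ?thesis using inv by blast
qed

lemma rel_comp_fun_relmap:
  "rel_comp C (fun_relmap D F' G') (fun_relmap C F G) = fun_relmap C (\<lambda>a. F' (F a)) (\<lambda>x. G' (G x))"
  using F_in G_in unfolding rel_comp_def fun_relmap_def compose_def by (simp add: fun_eq_iff)

end

lemma fun_relmap_id:
  assumes "\<And>a. a \<in> topspace (Arr C) \<Longrightarrow> F a = a" "\<And>x. x \<in> topspace (Ob C) \<Longrightarrow> G x = x"
  shows "fun_relmap C F G = rel_id C"
  using assms unfolding fun_relmap_def rel_id_def by (simp add: fun_eq_iff restrict_def)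

lemma (in cat_homeo) etale_iso_fun_relmap: "etale_iso v k C D (fun_relmap C F G)"
proof -
  obtain F' G' where inv: "cat_homeo D C F' G'" "\<forall>a\<in>C.arrs. F' (F a) = a" "\<forall>b\<in>D.arrs. F (F' b) = b"
      "\<forall>x\<in>C.obs. G' (G x) = x" "\<forall>y\<in>D.obs. G (G' y) = y" using ex_inverse by blast
  interpret i: cat_homeo D C F' G' by fact
  have "rel_comp C (fun_relmap D F' G') (fun_relmap C F G) = rel_id C"
    unfolding rel_comp_fun_relmap using inv by (intro fun_relmap_id) auto
  moreover have "rel_comp D (fun_relmap C F G) (fun_relmap D F' G') = rel_id D"
    unfolding i.rel_comp_fun_relmap using inv by (intro fun_relmap_id) auto
  ultimately show ?thesis unfolding etale_iso_def using etale_mor_fun_relmap i.etale_mor_fun_relmap by blast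
qed

lemma etale_mor_rel_id:
  assumes "etale_ob v C"
  shows "etale_mor v k C C (rel_id C)"
proof -
  interpret etale C using assms by (rule etaleI)
  interpret cat_homeo C C "\<lambda>x. x" "\<lambda>x. x"
    by unfold_locales (auto simp flip: id_def)
  show ?thesis using etale_mor_fun_relmap fun_relmap_id[of C "\<lambda>x. x" "\<lambda>x. x"] by simp
qed

lemma on_rel_comp:
  "a \<in> topspace (Arr C) \<Longrightarrow> on_arr (rel_comp C g f) a = (\<Union>b\<in>on_arr f a. on_arr g b)"
  "x \<in> topspace (Ob C) \<Longrightarrow> on_ob (rel_comp C g f) x = on_ob g (on_ob f x)"
  by (simp_all add: rel_comp_def compose_def)

lemma rel_covering_comp:
  assumes "covering C D f" "covering D B g"
  shows "rel_covering C B (rel_comp C g f)"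
proof -
  interpret f: covering C D f by fact
  interpret g: covering D B g by fact
  let ?h = "rel_comp C g f"
  have mem: "z \<in> on_arr ?h a \<longleftrightarrow> (\<exists>b\<in>on_arr f a. b \<in> f.D.arrs \<and> z \<in> on_arr g b)" if "a \<in> f.C.arrs" for a z
    unfolding on_rel_comp(1)[OF that] using f.on_arr_in[OF that] by blast
  show ?thesis
    unfolding rel_covering_def
  proof (intro conjI)
    show "on_arr ?h \<in> f.C.arrs \<rightarrow>\<^sub>E Pow g.D.arrs"
    proof (rule PiE_I)
      fix a assume a: "a \<in> f.C.arrs"
      show "on_arr ?h a \<in> Pow g.D.arrs" using mem[OF a] g.on_arr_in by blast
    qed (simp add: rel_comp_def)
    show "on_ob ?h \<in> extensional f.C.obs" by (simp add: rel_comp_def)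
    have "continuous_map (Ob C) (Ob D) (on_ob f)" using f.cov unfolding rel_covering_def by (elim conjE)
    moreover have "continuous_map (Ob D) (Ob B) (on_ob g)" using g.cov unfolding rel_covering_def by (elim conjE)
    ultimately have "continuous_map (Ob C) (Ob B) (on_ob g \<circ> on_ob f)" by (rule continuous_map_compose)
    then show "continuous_map (Ob C) (Ob B) (on_ob ?h)"
      by (rule continuous_map_eq) (simp add: on_rel_comp)
    show "\<forall>a\<in>f.C.arrs. \<forall>z\<in>on_arr ?h a. dm B z = on_ob ?h (dm C a) \<and> cd B z = on_ob ?h (cd C a)"
    proof (intro ballI)
      fix a z assume a: "a \<in> f.C.arrs" and "z \<in> on_arr ?h a"
      then obtain b where b: "b \<in> on_arr f a" "b \<in> f.D.arrs" "z \<in> on_arr g b" using mem by blast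
      show "dm B z = on_ob ?h (dm C a) \<and> cd B z = on_ob ?h (cd C a)"
        using g.on_arr_dm[OF b(2,3)] g.on_arr_cd[OF b(2,3)] f.on_arr_dm[OF a b(1)] f.on_arr_cd[OF a b(1)] a
        by (simp add: on_rel_comp)
    qed
    show "\<forall>(a, b)\<in>topspace (composable C). \<forall>(s, t)\<in>topspace (composable B).
        s \<in> on_arr ?h a \<and> t \<in> on_arr ?h b \<longrightarrow> cmp B s t \<in> on_arr ?h (cmp C a b)"
    proof (clarify)
      fix a b s t
      assume "(a, b) \<in> topspace (composable C)" and s: "s \<in> on_arr ?h a" and t: "t \<in> on_arr ?h b"
      then have ab: "a \<in> f.C.arrs" "b \<in> f.C.arrs" "dm C a = cd C b" by (auto simp: topspace_composable)
      obtain s' where s': "s' \<in> on_arr f a" "s' \<in> f.D.arrs" "s \<in> on_arr g s'" using mem[OF ab(1)] s by blast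
      obtain t' where t': "t' \<in> on_arr f b" "t' \<in> f.D.arrs" "t \<in> on_arr g t'" using mem[OF ab(2)] t by blast
      have c: "dm D s' = cd D t'" using f.on_arr_dm[OF ab(1) s'(1)] f.on_arr_cd[OF ab(2) t'(1)] ab(3) by simp
      have "cmp D s' t' \<in> on_arr f (cmp C a b)" by (rule f.on_arr_mult[OF ab s'(1) t'(1)])
      moreover have "cmp B s t \<in> on_arr g (cmp D s' t')" by (rule g.on_arr_mult[OF s'(2) t'(2) c s'(3) t'(3)])
      ultimately show "cmp B s t \<in> on_arr ?h (cmp C a b)"
        unfolding on_rel_comp(1)[OF f.C.cmp_in[OF ab]] by (rule UN_I)
    qed
    show "\<forall>a\<in>f.C.arrs. \<forall>b\<in>f.C.arrs. (dm C a = dm C b \<or> cd C a = cd C b) \<and>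
        on_arr ?h a \<inter> on_arr ?h b \<noteq> {} \<longrightarrow> a = b"
    proof (intro ballI impI, elim conjE)
      fix a b assume ab: "a \<in> f.C.arrs" "b \<in> f.C.arrs" and eq: "dm C a = dm C b \<or> cd C a = cd C b"
        and "on_arr ?h a \<inter> on_arr ?h b \<noteq> {}"
      then obtain z where z: "z \<in> on_arr ?h a" "z \<in> on_arr ?h b" by blast
      obtain s where s: "s \<in> on_arr f a" "s \<in> f.D.arrs" "z \<in> on_arr g s" using mem[OF ab(1)] z by blast
      obtain t where t: "t \<in> on_arr f b" "t \<in> f.D.arrs" "z \<in> on_arr g t" using mem[OF ab(2)] z by blast
      have "dm D s = dm D t \<or> cd D s = cd D t"
        using eq f.on_arr_dm[OF ab(1) s(1)] f.on_arr_cd[OF ab(1) s(1)]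
          f.on_arr_dm[OF ab(2) t(1)] f.on_arr_cd[OF ab(2) t(1)] by auto
      then have "s = t" using g.on_arr_inj[OF s(2) t(2) _ s(3) t(3)] by blast
      then show "a = b" using f.on_arr_inj[OF ab eq s(1)] t(1) by simp
    qed
    show "\<forall>q\<in>f.C.obs. \<forall>s\<in>g.D.arrs.
        (dm B s = on_ob ?h q \<longrightarrow> (\<exists>t\<in>f.C.arrs. dm C t = q \<and> s \<in> on_arr ?h t)) \<and>
        (cd B s = on_ob ?h q \<longrightarrow> (\<exists>t\<in>f.C.arrs. cd C t = q \<and> s \<in> on_arr ?h t))"
    proof (intro ballI conjI impI)
      fix q s assume q: "q \<in> f.C.obs" and s: "s \<in> g.D.arrs"
      {
        assume "dm B s = on_ob ?h q"
        then obtain b where b: "b \<in> f.D.arrs" "dm D b = on_ob f q" "s \<in> on_arr g b"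
          using g.lift_arr_dm[of "on_ob f q" s] q s by (auto simp: on_rel_comp)
        then obtain t where "t \<in> f.C.arrs" "dm C t = q" "b \<in> on_arr f t" using f.lift_arr_dm[OF q b(1,2)] by blast
        then show "\<exists>t\<in>f.C.arrs. dm C t = q \<and> s \<in> on_arr ?h t" using mem b by blast
      }
      {
        assume "cd B s = on_ob ?h q"
        then obtain b where b: "b \<in> f.D.arrs" "cd D b = on_ob f q" "s \<in> on_arr g b"
          using g.lift_arr_cd[of "on_ob f q" s] q s by (auto simp: on_rel_comp)
        then obtain t where "t \<in> f.C.arrs" "cd C t = q" "b \<in> on_arr f t" using f.lift_arr_cd[OF q b(1,2)] by blast
        then show "\<exists>t\<in>f.C.arrs. cd C t = q \<and> s \<in> on_arr ?h t" using mem b by blast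
      }
    qed
    show "\<forall>A. openin (Arr B) A \<longrightarrow> openin (Arr C) {x \<in> f.C.arrs. on_arr ?h x \<inter> A \<noteq> {}}"
    proof (intro allI impI)
      fix A assume A: "openin (Arr B) A"
      have "x \<in> {x \<in> f.C.arrs. on_arr ?h x \<inter> A \<noteq> {}} \<longleftrightarrow>
          x \<in> {x \<in> f.C.arrs. on_arr f x \<inter> {y \<in> f.D.arrs. on_arr g y \<inter> A \<noteq> {}} \<noteq> {}}" for x
        using mem[of x] by blast
      then have "{x \<in> f.C.arrs. on_arr ?h x \<inter> A \<noteq> {}} =
          {x \<in> f.C.arrs. on_arr f x \<inter> {y \<in> f.D.arrs. on_arr g y \<inter> A \<noteq> {}} \<noteq> {}}"
        by (rule Set.set_eqI)
      then show "openin (Arr C) {x \<in> f.C.arrs. on_arr ?h x \<inter> A \<noteq> {}}"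
        using f.preimage_open[OF g.preimage_open[OF A]] by simp
    qed
    show "\<forall>t\<in>f.C.obs. un B (on_ob ?h t) \<in> on_arr ?h (un C t)"
    proof
      fix x assume x: "x \<in> f.C.obs"
      have "un D (on_ob f x) \<in> on_arr f (un C x)" by (rule f.on_arr_unit[OF x])
      moreover have "un B (on_ob g (on_ob f x)) \<in> on_arr g (un D (on_ob f x))"
        by (rule g.on_arr_unit[OF f.on_ob_in[OF x]])
      ultimately show "un B (on_ob ?h x) \<in> on_arr ?h (un C x)"
        using on_rel_comp(1)[OF f.C.un_in[OF x], of g f] on_rel_comp(2)[OF x, of g f] by auto
    qed
  qed
qed

lemma etale_mor_nonempty:
  assumes "etale_mor v k C D f" "k = 2 \<or> k = 4" "c \<in> topspace (Arr C)"
  shows "\<exists>s. s \<in> on_arr f c"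
  using assms(2)
proof
  assume "k = 2"
  then have "\<forall>c\<in>topspace (Arr C). on_arr f c \<noteq> {}" using assms(1) by (simp add: etale_mor_def)
  then show ?thesis using assms(3) by blast
next
  assume "k = 4"
  then have "\<forall>c\<in>topspace (Arr C). \<exists>!s. s \<in> on_arr f c" using assms(1) by (simp add: etale_mor_def)
  then show ?thesis using assms(3) by blast
qed

lemma etale_mor_unique:
  assumes "etale_mor v k C D f" "k = 3 \<or> k = 4" "c \<in> topspace (Arr C)" "s \<in> on_arr f c" "t \<in> on_arr f c"
  shows "s = t"
  using assms(2)
proof
  assume "k = 3"
  then have "\<forall>c\<in>topspace (Arr C). \<forall>s\<in>on_arr f c. \<forall>t\<in>on_arr f c. s = t" using assms(1) by (simp add: etale_mor_def)
  then show ?thesis using assms(3-5) by blast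
next
  assume "k = 4"
  then have "\<forall>c\<in>topspace (Arr C). \<exists>!s. s \<in> on_arr f c" using assms(1) by (simp add: etale_mor_def)
  then show ?thesis using assms(3-5) by blast
qed

lemma etale_mor_comp:
  assumes ob: "etale_ob v C" "etale_ob v D" "etale_ob v B"
    and f: "etale_mor v k C D f" and g: "etale_mor v k D B g"
  shows "etale_mor v k C B (rel_comp C g f)"
proof -
  have fc: "covering C D f" and gc: "covering D B g" using coveringI ob f g by blast+
  interpret f: covering C D f by fact
  interpret g: covering D B g by fact
  let ?h = "rel_comp C g f"
  have ne: "on_arr ?h c \<noteq> {}" if k: "k = 2 \<or> k = 4" and c: "c \<in> f.C.arrs" for c
  proof -
    obtain d where d: "d \<in> on_arr f c" using etale_mor_nonempty[OF f k c] by blast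
    obtain e where "e \<in> on_arr g d" using etale_mor_nonempty[OF g k f.on_arr_in[OF c d]] by blast
    then show ?thesis using d on_rel_comp(1)[OF c, of g f] by blast
  qed
  have one: "s = t" if k: "k = 3 \<or> k = 4" and c: "c \<in> f.C.arrs"
    and s: "s \<in> on_arr ?h c" "t \<in> on_arr ?h c" for c s t
  proof -
    obtain s' t' where st: "s' \<in> on_arr f c" "s \<in> on_arr g s'" "t' \<in> on_arr f c" "t \<in> on_arr g t'"
      using s on_rel_comp(1)[OF c, of g f] by auto
    have "s' = t'" by (rule etale_mor_unique[OF f k c st(1,3)])
    then show ?thesis using etale_mor_unique[OF g k f.on_arr_in[OF c st(1)] st(2)] st(4) by simp
  qed
  have coh: "coherent_relmap C B ?h" if "v \<noteq> Sober_Spatial"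
    unfolding coherent_relmap_def
  proof (intro allI impI)
    fix K assume K: "compact_open (Ob B) K"
    have "coherent_relmap C D f" "coherent_relmap D B g" using f g that unfolding etale_mor_def by auto
    then have "compact_open (Ob C) {x \<in> f.C.obs. on_ob f x \<in> {y \<in> f.D.obs. on_ob g y \<in> K}}"
      using K unfolding coherent_relmap_def by blast
    moreover have "{x \<in> f.C.obs. on_ob f x \<in> {y \<in> f.D.obs. on_ob g y \<in> K}} = {x \<in> f.C.obs. on_ob ?h x \<in> K}"
      by (auto simp: on_rel_comp)
    ultimately show "compact_open (Ob C) {x \<in> f.C.obs. on_ob ?h x \<in> K}" by simp
  qed
  show ?thesis
    unfolding etale_mor_def
  proof (intro conjI impI)
    show "rel_covering C B ?h" by (rule rel_covering_comp[OF fc gc])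
    show "\<forall>c\<in>f.C.arrs. on_arr ?h c \<noteq> {}" if "k = 2" using ne that by blast
    show "\<forall>c\<in>f.C.arrs. \<forall>s\<in>on_arr ?h c. \<forall>t\<in>on_arr ?h c. s = t" if "k = 3" using one that by blast
    show "\<forall>c\<in>f.C.arrs. \<exists>!s. s \<in> on_arr ?h c" if "k = 4"
    proof
      fix c assume c: "c \<in> f.C.arrs"
      then obtain s where "s \<in> on_arr ?h c" using ne[of c] \<open>k = 4\<close> by blast
      then show "\<exists>!s. s \<in> on_arr ?h c" using one[OF _ c] \<open>k = 4\<close> by blast
    qed
  qed (rule coh)
qed

lemma rel_comp_ext:
  "on_arr (rel_comp C g f) \<in> extensional (topspace (Arr C))"
  "on_ob (rel_comp C g f) \<in> extensional (topspace (Ob C))"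
  by (simp_all add: rel_comp_def)

lemma (in covering) on_ext:
  "on_arr f \<in> extensional C.arrs" "on_ob f \<in> extensional C.obs"
  using cov unfolding rel_covering_def by (auto simp: PiE_def)

lemma (in covering) rel_comp_id: "rel_comp C f (rel_id C) = f" "rel_comp C (rel_id D) f = f"
proof -
  show "rel_comp C f (rel_id C) = f"
    by (rule relmap_eqI[OF rel_comp_ext(1) on_ext(1) _ rel_comp_ext(2) on_ext(2)])
      (simp_all add: on_rel_comp rel_id_def)
  show "rel_comp C (rel_id D) f = f"
  proof (rule relmap_eqI[OF rel_comp_ext(1) on_ext(1) _ rel_comp_ext(2) on_ext(2)])
    fix a assume a: "a \<in> C.arrs"
    have "(\<Union>b\<in>on_arr f a. on_arr (rel_id D) b) = (\<Union>b\<in>on_arr f a. {b})"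
      using on_arr_in[OF a] by (intro SUP_cong) (auto simp: rel_id_def)
    then show "on_arr (rel_comp C (rel_id D) f) a = on_arr f a" by (simp add: on_rel_comp a)
  next
    fix x assume "x \<in> C.obs"
    then show "on_ob (rel_comp C (rel_id D) f) x = on_ob f x" by (simp add: on_rel_comp rel_id_def)
  qed
qed

lemma rel_comp_assoc:
  assumes "covering C D f"
  shows "rel_comp C h (rel_comp C g f) = rel_comp C (rel_comp D h g) f"
proof (rule relmap_eqI[OF rel_comp_ext(1) rel_comp_ext(1) _ rel_comp_ext(2) rel_comp_ext(2)])
  interpret covering C D f by fact
  fix a assume a: "a \<in> topspace (Arr C)"
  have "(\<Union>b\<in>on_arr f a. on_arr (rel_comp D h g) b) = (\<Union>b\<in>on_arr f a. \<Union>c\<in>on_arr g b. on_arr h c)"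
    using on_arr_in[OF a] by (intro SUP_cong) (auto simp: on_rel_comp)
  then show "on_arr (rel_comp C h (rel_comp C g f)) a = on_arr (rel_comp C (rel_comp D h g) f) a"
    by (simp add: on_rel_comp a)
next
  interpret covering C D f by fact
  fix x assume "x \<in> topspace (Ob C)"
  then show "on_ob (rel_comp C h (rel_comp C g f)) x = on_ob (rel_comp C (rel_comp D h g) f) x"
    by (simp add: on_rel_comp)
qed

section \<open>Categories of complete restriction monoids\<close>

locale order_iso = L: partial_order L + M: partial_order M
  for L :: "('a, 'm) gorder_scheme" and M :: "('b, 'n) gorder_scheme" +
  fixes h :: "'a \<Rightarrow> 'b"
  assumes bij: "bij_betw h (carrier L) (carrier M)"
    and le_iff: "x \<in> carrier L \<Longrightarrow> y \<in> carrier L \<Longrightarrow> h x \<sqsubseteq>\<^bsub>M\<^esub> h y \<longleftrightarrow> x \<sqsubseteq>\<^bsub>L\<^esub> y"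
begin

lemma h_in: "x \<in> carrier L \<Longrightarrow> h x \<in> carrier M"
  using bij bij_betwE by blast

lemma h_onto: "y \<in> carrier M \<Longrightarrow> \<exists>x\<in>carrier L. h x = y"
  using bij by (metis bij_betw_imp_surj_on imageE)

lemma all_carrier: "(\<forall>y\<in>carrier M. P y) \<longleftrightarrow> (\<forall>x\<in>carrier L. P (h x))"
  using h_in h_onto by metis

lemma is_lub_iff_image:
  assumes X: "X \<subseteq> carrier L" and x: "x \<in> carrier L"
  shows "is_lub M (h x) (h ` X) \<longleftrightarrow> is_lub L x X"
proof -
  have hX: "h ` X \<subseteq> carrier M" using X h_in by blast
  have le: "(\<forall>y\<in>h ` X. y \<sqsubseteq>\<^bsub>M\<^esub> h z) \<longleftrightarrow> (\<forall>y\<in>X. y \<sqsubseteq>\<^bsub>L\<^esub> z)" if "z \<in> carrier L" for z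
  proof -
    have "h y \<sqsubseteq>\<^bsub>M\<^esub> h z \<longleftrightarrow> y \<sqsubseteq>\<^bsub>L\<^esub> z" if "y \<in> X" for y
      using le_iff[OF _ \<open>z \<in> carrier L\<close>] X that by blast
    then show ?thesis by simp
  qed
  show ?thesis
    unfolding is_lub_iff[OF X] is_lub_iff[OF hX] all_carrier using le x h_in le_iff[OF x] by simp
qed

lemma is_glb_iff_image:
  assumes "a \<in> carrier L" "b \<in> carrier L" "c \<in> carrier L"
  shows "is_glb M (h c) {h a, h b} \<longleftrightarrow> is_glb L c {a, b}"
  unfolding is_glb_iff[OF assms(1,2)] is_glb_iff[OF h_in[OF assms(1)] h_in[OF assms(2)]] all_carrier
  using assms h_in le_iff by simp

lemma sup_image:
  assumes X: "X \<subseteq> carrier L" and ex: "is_lub L x X"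
  shows "h (\<Squnion>\<^bsub>L\<^esub>X) = \<Squnion>\<^bsub>M\<^esub>(h ` X)"
proof -
  have "x \<in> carrier L" using ex is_lub_iff[OF X] by blast
  then have "is_lub M (h x) (h ` X)" using is_lub_iff_image[OF X] ex by simp
  then show ?thesis using M.sup_eqI L.sup_eqI[OF ex] by simp
qed

end

locale rmon_iso = S: complete_rmon S + T: complete_rmon T for S :: "'s rmonoid" and T :: "'t rmonoid" +
  fixes h :: "'s \<Rightarrow> 't"
  assumes bij: "bij_betw h (carrier S) (carrier T)"
    and ext: "h \<in> extensional (carrier S)"
    and mult: "a \<in> carrier S \<Longrightarrow> b \<in> carrier S \<Longrightarrow> h (a \<otimes>\<^bsub>S\<^esub> b) = h a \<otimes>\<^bsub>T\<^esub> h b"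
    and h_lam: "a \<in> carrier S \<Longrightarrow> h (lam S a) = lam T (h a)"
    and h_rho: "a \<in> carrier S \<Longrightarrow> h (rho S a) = rho T (h a)"
begin

lemma h_in [simp, intro]: "a \<in> carrier S \<Longrightarrow> h a \<in> carrier T"
  using bij bij_betwE by blast

lemma h_inj: "a \<in> carrier S \<Longrightarrow> b \<in> carrier S \<Longrightarrow> h a = h b \<Longrightarrow> a = b"
  using bij unfolding bij_betw_def inj_on_def by blast

lemma h_onto: "t \<in> carrier T \<Longrightarrow> \<exists>s\<in>carrier S. h s = t"
  using bij by (metis bij_betw_imp_surj_on imageE)

lemma h_nat_le: "a \<in> carrier S \<Longrightarrow> b \<in> carrier S \<Longrightarrow> nat_le T (h a) (h b) \<longleftrightarrow> nat_le S a b"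
  using h_inj[of "b \<otimes>\<^bsub>S\<^esub> lam S a" a] mult[of b "lam S a"] h_lam[of a]
  by (auto simp: S.nat_le_iff_lam T.nat_le_iff_lam)

lemma h_proj_iff: "a \<in> carrier S \<Longrightarrow> h a \<in> proj T \<longleftrightarrow> a \<in> proj S"
proof
  assume a: "a \<in> carrier S" and "h a \<in> proj T"
  then have "h (lam S a) = h a" using h_lam by simp
  then have "lam S a = a" using h_inj[of "lam S a" a] a by simp
  then show "a \<in> proj S" using S.lam_in_proj[OF a] by simp
next
  assume a: "a \<in> carrier S" and "a \<in> proj S"
  then have "lam T (h a) = h a" using h_lam[OF a] by simp
  then show "h a \<in> proj T" using T.lam_in_proj[OF h_in[OF a]] by simp
qed

lemma h_bij_proj: "bij_betw h (proj S) (proj T)"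
  unfolding bij_betw_def
proof
  show "inj_on h (proj S)" using h_inj by (auto simp: inj_on_def)
  show "h ` proj S = proj T"
  proof
    show "h ` proj S \<subseteq> proj T" using h_proj_iff by auto
    show "proj T \<subseteq> h ` proj S"
    proof
      fix t assume t: "t \<in> proj T"
      then obtain s where "s \<in> carrier S" "h s = t" using h_onto by blast
      then show "t \<in> h ` proj S" using h_proj_iff t by blast
    qed
  qed
qed

sublocale nord: order_iso "nat_order S" "nat_order T" h
  by unfold_locales (simp_all add: bij h_nat_le)

sublocale pord: order_iso "proj_order S" "proj_order T" h
  by unfold_locales (simp_all add: h_bij_proj h_nat_le)

text \<open>A bijective homomorphism that preserves \<open>\<lambda>\<close> and \<open>\<rho>\<close> is an isomorphism of the natural orders, so it
  preserves all joins, meets and finite elements.\<close>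

lemma rmonoid_mor_iso: "rmonoid_mor v k S T h"
proof -
  have meet: "meet_hom S T h"
    unfolding meet_hom_def
  proof (intro ballI allI impI)
    fix a b c assume ab: "a \<in> carrier S" "b \<in> carrier S" and c: "is_glb (nat_order S) c {a, b}"
    then have "c \<in> carrier S" using greatest_closed[OF c] by simp
    then show "is_glb (nat_order T) (h c) {h a, h b}" using nord.is_glb_iff_image[of a b c] ab c by simp
  qed
  have proper: "proper_hom S T h"
    unfolding proper_hom_def
  proof
    fix t assume t: "t \<in> carrier T"
    then obtain s where s: "s \<in> carrier S" "h s = t" using h_onto by blast
    have "is_lub (nat_order T) t {t}" using t by (subst T.nat_lub_iff) auto
    then show "\<exists>X\<subseteq>carrier T. is_lub (nat_order T) t X \<and> (\<forall>x\<in>X. \<exists>s\<in>carrier S. nat_le T x (h s))"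
      using t s by (intro exI[of _ "{t}"] conjI ballI bexI[of _ s]) auto
  qed
  have ex: "\<exists>x. is_lub (proj_order S) x X" if "X \<subseteq> proj S" for X using S.pord.sup_exists[of X] that by simp
  have sup: "h (\<Squnion>\<^bsub>proj_order S\<^esub>X) = \<Squnion>\<^bsub>proj_order T\<^esub>(h ` X)" if "X \<subseteq> proj S" for X
    using ex[OF that] pord.sup_image[of X] that by auto
  have coh: "coherent_hom S T h"
    unfolding coherent_hom_def
  proof (intro allI impI)
    fix f assume f: "finite_elem (proj_order S) f"
    then have fp: "f \<in> proj S" by (simp add: finite_elem_def)
    show "finite_elem (proj_order T) (h f)"
      unfolding finite_elem_def
    proof (intro conjI allI impI)
      show "h f \<in> carrier (proj_order T)" using fp h_proj_iff by simp
      fix Y assume Y: "Y \<subseteq> carrier (proj_order T)" "h f = \<Squnion>\<^bsub>proj_order T\<^esub>Y"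
      then obtain X where X: "X \<subseteq> proj S" "Y = h ` X"
        using h_bij_proj unfolding bij_betw_def by (metis proj_order_simps(1) subset_imageE)
      have "h f = h (\<Squnion>\<^bsub>proj_order S\<^esub>X)" using Y X sup by simp
      moreover have "\<Squnion>\<^bsub>proj_order S\<^esub>X \<in> proj S" using S.pord.sup_closed[of X] X by simp
      ultimately have "f = \<Squnion>\<^bsub>proj_order S\<^esub>X" using h_inj fp by blast
      then have "\<exists>F\<subseteq>X. finite F \<and> f = \<Squnion>\<^bsub>proj_order S\<^esub>F" using f X unfolding finite_elem_def by simp
      then obtain F where F: "F \<subseteq> X" "finite F" "f = \<Squnion>\<^bsub>proj_order S\<^esub>F" by blast
      then have "h f = \<Squnion>\<^bsub>proj_order T\<^esub>(h ` F)" using sup[of F] X by simp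
      then show "\<exists>F\<subseteq>Y. finite F \<and> h f = \<Squnion>\<^bsub>proj_order T\<^esub>F" using F X by (intro exI[of _ "h ` F"]) auto
    qed
  qed
  have "rmonoid_hom S T h"
    unfolding rmonoid_hom_def frame_hom_def
  proof (intro conjI ballI allI impI)
    show "h \<in> hom S T" by (auto simp: hom_def mult)
    show "h \<in> carrier (proj_order S) \<rightarrow> carrier (proj_order T)" using h_proj_iff by auto
    have top: "\<top>\<^bsub>proj_order S\<^esub> \<in> proj S" "\<And>f. f \<in> proj S \<Longrightarrow> nat_le S f \<top>\<^bsub>proj_order S\<^esub>"
      using S.pord.top_closed S.pord.top_higher by auto
    have "nat_le T t (h \<top>\<^bsub>proj_order S\<^esub>)" if t: "t \<in> proj T" for t
    proof -
      have "t \<in> h ` proj S" using t h_bij_proj by (simp add: bij_betw_def)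
      then obtain f where "f \<in> proj S" "h f = t" by blast
      then show ?thesis using top h_nat_le[of f "\<top>\<^bsub>proj_order S\<^esub>"] by auto
    qed
    then show "h \<top>\<^bsub>proj_order S\<^esub> = \<top>\<^bsub>proj_order T\<^esub>"
      using top(1) h_proj_iff by (intro T.pord.top_eqI[symmetric]) auto
  next
    fix f g assume "f \<in> carrier (proj_order S)" "g \<in> carrier (proj_order S)"
    then show "h (f \<sqinter>\<^bsub>proj_order S\<^esub> g) = h f \<sqinter>\<^bsub>proj_order T\<^esub> h g"
      using h_proj_iff mult by (simp add: S.proj_meet T.proj_meet)
  qed (use ext h_lam h_rho sup in auto)
  then show ?thesis using meet proper coh unfolding rmonoid_mor_def by blast
qed

definition h_inv :: "'t \<Rightarrow> 's" where
  "h_inv = (\<lambda>t\<in>carrier T. inv_into (carrier S) h t)"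

lemma h_inv: "t \<in> carrier T \<Longrightarrow> h_inv t \<in> carrier S" "t \<in> carrier T \<Longrightarrow> h (h_inv t) = t"
    "s \<in> carrier S \<Longrightarrow> h_inv (h s) = s"
proof -
  show 1: "t \<in> carrier T \<Longrightarrow> h_inv t \<in> carrier S" "t \<in> carrier T \<Longrightarrow> h (h_inv t) = t" for t
    using bij unfolding h_inv_def bij_betw_def by (auto simp: inv_into_into f_inv_into_f)
  show "s \<in> carrier S \<Longrightarrow> h_inv (h s) = s" using 1 h_inj h_in by metis
qed

lemma rmon_iso_inv: "rmon_iso T S h_inv"
proof
  show "bij_betw h_inv (carrier T) (carrier S)"
    by (rule bij_betw_byWitness[of _ h]) (use h_inv in auto)
  show "h_inv \<in> extensional (carrier T)" by (simp add: h_inv_def)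
  show "h_inv (a \<otimes>\<^bsub>T\<^esub> b) = h_inv a \<otimes>\<^bsub>S\<^esub> h_inv b" if "a \<in> carrier T" "b \<in> carrier T" for a b
    using mult[of "h_inv a" "h_inv b"] h_inv that by (metis S.m_closed)
  show "h_inv (lam T a) = lam S (h_inv a)" if "a \<in> carrier T" for a
    using h_lam[of "h_inv a"] h_inv that by (metis S.lam_in_proj S.proj_carrier)
  show "h_inv (rho T a) = rho S (h_inv a)" if "a \<in> carrier T" for a
    using h_rho[of "h_inv a"] h_inv that by (metis S.rho_in_proj S.proj_carrier)
qed

lemma rmonoid_iso: "rmonoid_iso v k S T h"
proof -
  have "rmonoid_mor v k T S h_inv" by (rule rmon_iso.rmonoid_mor_iso[OF rmon_iso_inv])
  moreover have "rmonoid_comp S h_inv h = rmonoid_id S" "rmonoid_comp T h h_inv = rmonoid_id T"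
    using h_inv by (auto simp: compose_def fun_eq_iff)
  ultimately show ?thesis unfolding rmonoid_iso_def using rmonoid_mor_iso by blast
qed

end

lemma rmonoid_mor_id:
  assumes "rmonoid_ob v S"
  shows "rmonoid_mor v k S S (rmonoid_id S)"
proof -
  interpret complete_rmon S using assms by (rule complete_rmon_of_ob)
  interpret rmon_iso S S "rmonoid_id S"
    by unfold_locales (auto simp: bij_betw_def inj_on_def)
  show ?thesis by (rule rmonoid_mor_iso)
qed

lemma rmonoid_hom_comp:
  assumes f: "restriction_hom S T f" and g: "restriction_hom T U g"
  shows "restriction_hom S U (rmonoid_comp S g f)"
proof -
  interpret f: restriction_hom S T f by fact
  interpret g: restriction_hom T U g by fact
  let ?h = "rmonoid_comp S g f"
  have h: "?h a = g (f a)" if "a \<in> carrier S" for a using that by (simp add: compose_def)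
  have fr: "frame_hom (proj_order S) (proj_order T) f" "frame_hom (proj_order T) (proj_order U) g"
    using f.hom g.hom unfolding rmonoid_hom_def by auto
  have "frame_hom (proj_order S) (proj_order U) ?h"
    unfolding frame_hom_def
  proof (intro conjI ballI allI impI)
    show "?h \<in> carrier (proj_order S) \<rightarrow> carrier (proj_order U)" using h by auto
    have "\<top>\<^bsub>proj_order S\<^esub> \<in> proj S" using f.S.pord.top_closed by simp
    then show "?h \<top>\<^bsub>proj_order S\<^esub> = \<top>\<^bsub>proj_order U\<^esub>" using fr h by (simp add: frame_hom_def)
  next
    fix x y assume "x \<in> carrier (proj_order S)" "y \<in> carrier (proj_order S)"
    then have xy: "x \<in> proj S" "y \<in> proj S" by auto
    then show "?h (x \<sqinter>\<^bsub>proj_order S\<^esub> y) = ?h x \<sqinter>\<^bsub>proj_order U\<^esub> ?h y"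
      by (simp add: f.S.proj_meet g.T.proj_meet h f.h_mult g.h_mult)
  next
    fix A assume "A \<subseteq> carrier (proj_order S)"
    then have A: "A \<subseteq> proj S" by simp
    have "\<Squnion>\<^bsub>proj_order S\<^esub>A \<in> proj S" using f.S.pord.sup_closed[of A] A by simp
    then have "?h (\<Squnion>\<^bsub>proj_order S\<^esub>A) = g (f (\<Squnion>\<^bsub>proj_order S\<^esub>A))" using h by auto
    also have "\<dots> = g (\<Squnion>\<^bsub>proj_order T\<^esub>(f ` A))" using fr(1) A by (simp add: frame_hom_def)
    also have "\<dots> = \<Squnion>\<^bsub>proj_order U\<^esub>(g ` f ` A)"
    proof -
      have "f ` A \<subseteq> proj T" using A by auto
      then show ?thesis using fr(2) by (simp add: frame_hom_def)
    qed
    also have "g ` f ` A = ?h ` A" unfolding image_image using h A by (intro image_cong) auto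
    finally show "?h (\<Squnion>\<^bsub>proj_order S\<^esub>A) = \<Squnion>\<^bsub>proj_order U\<^esub>(?h ` A)" .
  qed
  then have "rmonoid_hom S U ?h"
    unfolding rmonoid_hom_def
    by (auto simp: hom_def h f.h_mult g.h_mult f.h_lam g.h_lam f.h_rho g.h_rho)
  then show ?thesis using f.S.complete g.T.complete by (intro restriction_homI)
qed

lemma (in restriction_hom) proper_hom_meets:
  assumes "proper_hom S T h" "nat_filter T P"
  shows "\<exists>s\<in>carrier S. h s \<in> P"
proof -
  obtain Q where Q: "Q \<in> map_filter P" using filter_map_proper[OF assms] on_arr_filter_map[OF assms(2)] by blast
  then have "nat_filter S Q" "h ` Q \<subseteq> P" by (auto simp: map_filter_def)
  then show ?thesis using S.nat_filter_nonempty by blast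
qed

text \<open>With enough points joins are unions of basic open sets, so \<open>t\<close> is the join of the elements below
  both \<open>t\<close> and the image as soon as every filter through \<open>t\<close> meets the image.\<close>

lemma (in restriction_hom) proper_homI:
  assumes ep: "enough_points (proj_order T)" and meets: "\<And>P. nat_filter T P \<Longrightarrow> \<exists>s\<in>carrier S. h s \<in> P"
  shows "proper_hom S T h"
  unfolding proper_hom_def
proof
  interpret rep: representation "nat_order T" "point_space (nat_order T)" "pts (nat_order T)"
    by (rule T.representation_nat_order[OF ep])
  fix t assume t: "t \<in> carrier T"
  define X where "X = {x \<in> carrier T. nat_le T x t \<and> (\<exists>s\<in>carrier S. nat_le T x (h s))}"
  have X: "X \<subseteq> carrier T" by (auto simp: X_def)
  have "pts (nat_order T) t = \<Union>(pts (nat_order T) ` X)"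
  proof
    show "pts (nat_order T) t \<subseteq> \<Union>(pts (nat_order T) ` X)"
    proof
      fix P assume "P \<in> pts (nat_order T) t"
      then have P: "nat_filter T P" "t \<in> P" by (auto simp: pts_def)
      then obtain s where s: "s \<in> carrier S" "h s \<in> P" using meets by blast
      obtain x where "x \<in> P" "x \<in> carrier T" "nat_le T x t" "nat_le T x (h s)"
        using T.nat_filter_down[OF P s(2)] by blast
      then have "x \<in> X" "P \<in> pts (nat_order T) x" using s P by (auto simp: X_def pts_def)
      then show "P \<in> \<Union>(pts (nat_order T) ` X)" by blast
    qed
    show "\<Union>(pts (nat_order T) ` X) \<subseteq> pts (nat_order T) t"
      using T.nat_filter_up t by (auto simp: X_def pts_def)
  qed
  then have "is_lub (nat_order T) t X" using rep.is_lub_iff_Union[of X t] X t by simp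
  then show "\<exists>X\<subseteq>carrier T. is_lub (nat_order T) t X \<and> (\<forall>x\<in>X. \<exists>s\<in>carrier S. nat_le T x (h s))"
    using X by (intro exI[of _ X]) (auto simp: X_def)
qed

lemma rmonoid_mor_comp:
  assumes ob: "rmonoid_ob v S" "rmonoid_ob v T" "rmonoid_ob v U"
    and f: "rmonoid_mor v k S T f" and g: "rmonoid_mor v k T U g"
  shows "rmonoid_mor v k S U (rmonoid_comp S g f)"
proof -
  have fh: "restriction_hom S T f" and gh: "restriction_hom T U g" using restriction_hom_of_mor ob f g by blast+
  interpret f: restriction_hom S T f by fact
  interpret g: restriction_hom T U g by fact
  interpret gf: restriction_hom S U "rmonoid_comp S g f" by (rule rmonoid_hom_comp[OF fh gh])
  let ?h = "rmonoid_comp S g f"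
  have h: "?h a = g (f a)" if "a \<in> carrier S" for a using that by (simp add: compose_def)
  have proper: "proper_hom S U ?h" if pf: "proper_hom S T f" "proper_hom T U g"
  proof (rule gf.proper_homI[OF rmonoid_ob_enough_points(2)[OF ob(3)]])
    fix P assume P: "nat_filter U P"
    obtain t where t: "t \<in> carrier T" "g t \<in> P" using g.proper_hom_meets[OF pf(2) P] by blast
    then obtain Q where Q: "Q \<in> g.map_filter P" using g.ex_map_filter[OF P] by blast
    then have Qf: "nat_filter T Q" "g ` Q \<subseteq> P" by (auto simp: g.map_filter_def)
    obtain s where "s \<in> carrier S" "f s \<in> Q" using f.proper_hom_meets[OF pf(1) Qf(1)] by blast
    then show "\<exists>s\<in>carrier S. ?h s \<in> P" using Qf(2) h by (intro bexI[of _ s]) auto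
  qed
  have meet: "meet_hom S U ?h" if m: "meet_hom S T f" "meet_hom T U g"
    unfolding meet_hom_def
  proof (intro ballI allI impI)
    fix a b c assume ab: "a \<in> carrier S" "b \<in> carrier S" and c: "is_glb (nat_order S) c {a, b}"
    have "c \<in> carrier S" using greatest_closed[OF c] by simp
    moreover have "is_glb (nat_order T) (f c) {f a, f b}" using m(1) ab c unfolding meet_hom_def by blast
    then have "is_glb (nat_order U) (g (f c)) {g (f a), g (f b)}"
      using m(2) f.h_closed[OF ab(1)] f.h_closed[OF ab(2)] unfolding meet_hom_def by blast
    ultimately show "is_glb (nat_order U) (?h c) {?h a, ?h b}" using ab h by simp
  qed
  have coh: "coherent_hom S U ?h" if c: "coherent_hom S T f" "coherent_hom T U g"
    unfolding coherent_hom_def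
  proof (intro allI impI)
    fix x assume x: "finite_elem (proj_order S) x"
    then have "x \<in> carrier S" by (auto simp: finite_elem_def)
    then show "finite_elem (proj_order U) (?h x)" using c x h unfolding coherent_hom_def by simp
  qed
  show ?thesis using f g gf.hom proper meet coh unfolding rmonoid_mor_def by auto
qed

lemma (in restriction_hom) comp_id: "rmonoid_comp S h (rmonoid_id S) = h" "rmonoid_comp S (rmonoid_id T) h = h"
proof -
  have ext: "h \<in> extensional (carrier S)" using hom by (simp add: rmonoid_hom_def)
  show "rmonoid_comp S h (rmonoid_id S) = h"
    by (rule extensionalityI[OF _ ext]) (auto simp: compose_def)
  show "rmonoid_comp S (rmonoid_id T) h = h"
    by (rule extensionalityI[OF _ ext]) (auto simp: compose_def)
qed

section \<open>The unit of an etale category\<close>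

context etale
begin

definition nhds_arr :: "'a \<Rightarrow> 'a set set" where
  "nhds_arr c = {A \<in> bisections C. c \<in> A}"

definition nhds_ob :: "'o \<Rightarrow> 'a set set" where
  "nhds_ob x = {F \<in> open_units. un C x \<in> F}"

lemma etale_unit_eq: "etale_unit C = fun_relmap C nhds_arr nhds_ob"
  by (simp add: etale_unit_def fun_relmap_def nhds_arr_def nhds_ob_def)

lemma nhds_ob_eq: "x \<in> obs \<Longrightarrow> nhds_ob x = {F \<in> carrier (proj_order SM). x \<in> units_in F}"
  by (auto simp: nhds_ob_def units_in_def)

lemma nat_filter_nhds: "c \<in> arrs \<Longrightarrow> nat_filter SM (nhds_arr c)"
  using representation.cp_filter_nhds[OF representation_sections] by (simp add: nhds_arr_def)

lemma proj_filter_nhds: "x \<in> obs \<Longrightarrow> proj_filter SM (nhds_ob x)"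
  using representation.cp_filter_nhds[OF full_representation.axioms(1)[OF full_representation_units]]
    nhds_ob_eq by simp

lemma ex_nhds_arr: "c \<in> arrs \<Longrightarrow> \<exists>A\<in>bisections C. c \<in> A"
  using ex_bisection[OF openin_topspace] by blast

lemma fdom_nhds_arr: "c \<in> arrs \<Longrightarrow> fdom SM (nhds_arr c) = nhds_ob (dm C c)"
  and fcod_nhds_arr: "c \<in> arrs \<Longrightarrow> fcod SM (nhds_arr c) = nhds_ob (cd C c)"
proof -
  assume c: "c \<in> arrs"
  note nf = nat_filter_nhds[OF c]
  obtain A where A: "A \<in> bisections C" "c \<in> A" using ex_nhds_arr[OF c] by blast
  then have An: "A \<in> nhds_arr c" by (simp add: nhds_arr_def)
  have sub: "smult A F \<in> nhds_arr c \<longleftrightarrow> un C (dm C c) \<in> F" "smult F A \<in> nhds_arr c \<longleftrightarrow> un C (cd C c) \<in> F"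
    if F: "F \<in> open_units" for F
    using smult_bisection[OF A(1) open_units_bisection[OF F]] smult_bisection[OF open_units_bisection[OF F] A(1)]
      smult_open_units[OF A(1) F] A(2) by (auto simp: nhds_arr_def)
  have "F \<in> fdom SM (nhds_arr c) \<longleftrightarrow> F \<in> nhds_ob (dm C c)" for F
    using SM.mult_proj_mem_iff[OF nf An, of F] sub(1)[of F] SM.mem_fdom[of F "nhds_arr c"]
    by (auto simp: nhds_ob_def)
  then show "fdom SM (nhds_arr c) = nhds_ob (dm C c)" by (rule Set.set_eqI)
  have "F \<in> fcod SM (nhds_arr c) \<longleftrightarrow> F \<in> nhds_ob (cd C c)" for F
    using SM.proj_mult_mem_iff[OF nf An, of F] sub(2)[of F] SM.mem_fcod[of F "nhds_arr c"]
    by (auto simp: nhds_ob_def)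
  then show "fcod SM (nhds_arr c) = nhds_ob (cd C c)" by (rule Set.set_eqI)
qed

lemma nhds_arr_un:
  assumes x: "x \<in> obs"
  shows "nhds_arr (un C x) = up_closure (nat_order SM) (nhds_ob x)"
proof (rule SM.filter_eqI[where s = "un C ` obs"])
  note p = proj_filter_nhds[OF x]
  show "nat_filter SM (nhds_arr (un C x))" using nat_filter_nhds x by blast
  show "nat_filter SM (up_closure (nat_order SM) (nhds_ob x))" by (rule SM.unit_filter(1)[OF p])
  show "fdom SM (nhds_arr (un C x)) = fdom SM (up_closure (nat_order SM) (nhds_ob x))"
    using fdom_nhds_arr[of "un C x"] SM.unit_filter(2)[OF p] x by simp
  show "un C ` obs \<in> nhds_arr (un C x)" using units_bisection x by (simp add: nhds_arr_def)
  have "un C ` obs \<in> nhds_ob x" using one_open_units x by (simp add: nhds_ob_def)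
  then show "un C ` obs \<in> up_closure (nat_order SM) (nhds_ob x)" using SM.unit_filter(3)[OF p] by blast
qed

lemma nhds_arr_cmp:
  assumes ab: "a \<in> arrs" "b \<in> arrs" "dm C a = cd C b"
  shows "nhds_arr (cmp C a b) = fmult SM (nhds_arr a) (nhds_arr b)"
proof -
  obtain A B where A: "A \<in> bisections C" "a \<in> A" and B: "B \<in> bisections C" "b \<in> B"
    using ex_nhds_arr ab by meson
  have c: "fdom SM (nhds_arr a) = fcod SM (nhds_arr b)"
    using fdom_nhds_arr fcod_nhds_arr ab by simp
  note m = SM.fmult_filter[OF nat_filter_nhds[OF ab(1)] nat_filter_nhds[OF ab(2)] c]
  show ?thesis
  proof (rule SM.filter_eqI[where s = "smult A B"])
    show "nat_filter SM (nhds_arr (cmp C a b))" by (rule nat_filter_nhds[OF cmp_in[OF ab]])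
    show "nat_filter SM (fmult SM (nhds_arr a) (nhds_arr b))" by (rule m(1))
    show "fdom SM (nhds_arr (cmp C a b)) = fdom SM (fmult SM (nhds_arr a) (nhds_arr b))"
      unfolding m(2) fdom_nhds_arr[OF cmp_in[OF ab]] fdom_nhds_arr[OF ab(2)] dm_cmp[OF ab] ..
    show "smult A B \<in> nhds_arr (cmp C a b)"
      using smult_bisection[OF A(1) B(1)] mem_smult A B ab(3) by (auto simp: nhds_arr_def)
    show "smult A B \<in> fmult SM (nhds_arr a) (nhds_arr b)"
      using SM.mult_mem_fmult[OF nat_filter_nhds[OF ab(1)] nat_filter_nhds[OF ab(2)], of A B] A B
      by (simp add: nhds_arr_def)
  qed
qed

text \<open>When the objects or the arrows form a sober space, points of the frame of projections are
  objects: in the second case a point is first turned into a filter of the monoid.\<close>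

lemma proj_filter_is_nhds:
  assumes ob: "etale_ob v C" and p: "proj_filter SM p"
  shows "\<exists>!x. x \<in> obs \<and> p = nhds_ob x"
proof -
  have from_ob: ?thesis if "sober_space (Ob C)"
  proof -
    interpret pr: full_representation "proj_order SM" "Ob C" units_in by (rule full_representation_units)
    have "\<exists>!x. x \<in> obs \<and> p = {F \<in> carrier (proj_order SM). x \<in> units_in F}"
      by (rule pr.cp_filter_is_nhds[OF that p])
    moreover have "x \<in> obs \<and> p = nhds_ob x \<longleftrightarrow>
        x \<in> obs \<and> p = {F \<in> carrier (proj_order SM). x \<in> units_in F}" for x
      using nhds_ob_eq[of x] by auto
    ultimately show ?thesis by simp
  qed
  show ?thesis
  proof (cases v)
    case Strongly_Spectral_Coherent
    then have sob: "sober_space (Arr C)" using ob by (simp add: spectral_space_def)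
    interpret rep: representation "nat_order SM" "Arr C" "\<lambda>A. A" by (rule representation_sections)
    have arr: "\<exists>!c. c \<in> arrs \<and> P = nhds_arr c" if "nat_filter SM P" for P
      using rep.cp_filter_is_nhds[OF sob that] by (simp add: nhds_arr_def)
    obtain c where c: "c \<in> arrs" "up_closure (nat_order SM) p = nhds_arr c"
      using arr[OF SM.unit_filter(1)[OF p]] by blast
    have "p = nhds_ob (dm C c)" using SM.unit_filter(2)[OF p] fdom_nhds_arr[OF c(1)] c(2) by simp
    moreover have "x = y" if x: "x \<in> obs" and y: "y \<in> obs" and eq: "p = nhds_ob x" "p = nhds_ob y" for x y
    proof -
      have "nhds_arr (un C x) = nhds_arr (un C y)" using nhds_arr_un x y eq by simp
      then have "un C x = un C y" using arr[OF nat_filter_nhds[OF un_in[OF x]]] x y un_in by metis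
      then show ?thesis using un_inj x y by blast
    qed
    ultimately show ?thesis using dm_in[OF c(1)] by blast
  next
    case Sober_Spatial
    then show ?thesis using from_ob ob by simp
  next
    case Spectral_Coherent
    then show ?thesis using from_ob ob by (simp add: spectral_space_def)
  qed
qed

text \<open>The domain of \<open>P\<close> is the neighbourhood filter of an object \<open>x\<close>, and a bisection in \<open>P\<close> contains
  exactly one arrow with domain \<open>x\<close>. Its neighbourhood filter has the domain of \<open>P\<close> and a common
  member with \<open>P\<close>.\<close>

lemma nat_filter_is_nhds:
  assumes ob: "etale_ob v C" and P: "nat_filter SM P"
  shows "\<exists>!c. c \<in> arrs \<and> P = nhds_arr c"
proof -
  obtain A where A: "A \<in> bisections C" "A \<in> P" using SM.nat_filter_nonempty[OF P] by auto
  obtain x where x: "x \<in> obs" "fdom SM P = nhds_ob x"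
    using proj_filter_is_nhds[OF ob SM.proj_filter_fdom[OF P]] by blast
  have "un C ` dm C ` A \<in> nhds_ob x" using SM.lam_mem_fdom[OF P A(2)] x(2) by simp
  then have "x \<in> dm C ` A" using un_dm_mem[OF A(1) x(1)] by (simp add: nhds_ob_def)
  then obtain c where c: "c \<in> A" "dm C c = x" by blast
  have ca: "c \<in> arrs" using bisection_arrs[OF A(1) c(1)] .
  have An: "A \<in> nhds_arr c" using A c by (simp add: nhds_arr_def)
  have "P = nhds_arr c"
    using SM.filter_eqI[OF P nat_filter_nhds[OF ca] _ A(2) An] fdom_nhds_arr[OF ca] x(2) c(2) by simp
  moreover have "c' = c" if c': "c' \<in> arrs" "P = nhds_arr c'" for c'
  proof -
    have "nhds_ob (dm C c') = nhds_ob x" using fdom_nhds_arr[OF c'(1)] c'(2) x(2) by simp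
    then have "dm C c' = x" using proj_filter_is_nhds[OF ob SM.proj_filter_fdom[OF P]] x dm_in[OF c'(1)] by metis
    moreover have "c' \<in> A" using A(2) c'(2) by (simp add: nhds_arr_def)
    ultimately show ?thesis using bisection_dm[OF A(1)] c by blast
  qed
  ultimately show ?thesis using ca by blast
qed

lemma cat_homeo_unit:
  assumes ob: "etale_ob v C"
  shows "cat_homeo C (filter_category SM) nhds_arr nhds_ob"
proof -
  interpret rep: representation "nat_order SM" "Arr C" "\<lambda>A. A" by (rule representation_sections)
  interpret pr: full_representation "proj_order SM" "Ob C" units_in by (rule full_representation_units)
  interpret FC: etale "filter_category SM" by unfold_locales (rule SM.etale_filter_category)
  have "\<exists>!c. c \<in> arrs \<and> P = {A \<in> carrier (nat_order SM). c \<in> A}" if "nat_filter SM P" for P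
    using nat_filter_is_nhds[OF ob that] by (simp add: nhds_arr_def)
  then have h1: "homeomorphic_map (Arr C) (point_space (nat_order SM)) nhds_arr"
    using rep.homeomorphic_point_space by (simp add: nhds_arr_def[abs_def])
  have eq: "x \<in> obs \<and> p = nhds_ob x \<longleftrightarrow> x \<in> obs \<and> p = {F \<in> carrier (proj_order SM). x \<in> units_in F}" for p x
    using nhds_ob_eq[of x] by auto
  have "\<exists>!x. x \<in> obs \<and> p = {F \<in> carrier (proj_order SM). x \<in> units_in F}" if "proj_filter SM p" for p
    using proj_filter_is_nhds[OF ob that] unfolding eq .
  then have "homeomorphic_map (Ob C) (point_space (proj_order SM)) (\<lambda>x. {F \<in> carrier (proj_order SM). x \<in> units_in F})"
    by (rule pr.homeomorphic_point_space)
  then have h2: "homeomorphic_map (Ob C) (point_space (proj_order SM)) nhds_ob"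
    by (rule homeomorphic_map_eq) (rule nhds_ob_eq[symmetric])
  show ?thesis
    by unfold_locales
      (simp_all add: h1 h2 fdom_nhds_arr fcod_nhds_arr nhds_arr_un nhds_arr_cmp)
qed

end

lemma etale_iso_unit:
  assumes "etale_ob v C"
  shows "etale_iso v k C (filter_category (section_monoid C)) (etale_unit C)"
proof -
  interpret etale C using assms by (rule etaleI)
  show ?thesis unfolding etale_unit_eq by (rule cat_homeo.etale_iso_fun_relmap[OF cat_homeo_unit[OF assms]])
qed

text \<open>Every filter of bisections of \<open>D\<close> is the neighbourhood filter of an arrow \<open>s\<close>. If it is related to
  that of \<open>c\<close>, then \<open>s\<close> starts over the domain of \<open>c\<close> and lifts to an arrow \<open>t\<close> with this domain; the
  preimage of a bisection around \<open>s\<close> contains both \<open>t\<close> and \<open>c\<close>, so \<open>t = c\<close>.\<close>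

lemma etale_unit_natural:
  assumes C: "etale_ob v C" and D: "etale_ob v D" and f: "etale_mor v k C D f"
  shows "rel_comp C (filter_map (section_monoid D) (section_monoid C) (section_pullback C D f)) (etale_unit C) =
    rel_comp C (etale_unit D) f"
proof (rule relmap_eqI[OF rel_comp_ext(1) rel_comp_ext(1) _ rel_comp_ext(2) rel_comp_ext(2)])
  interpret covering C D f using C D f by (rule coveringI)
  interpret h: restriction_hom D.SM C.SM "section_pullback C D f"
    by (rule restriction_homI) (rule D.complete_section_monoid C.complete_section_monoid rmonoid_hom_pullback)+
  let ?h = "section_pullback C D f"
  have pre: "proj_pre D.SM ?h (C.nhds_ob x) = D.nhds_ob (on_ob f x)" if x: "x \<in> C.obs" for x
    using pull_unit_iff[OF _ x] pull_open_units section_pullback_eq[OF D.open_units_bisection]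
    by (auto simp: proj_pre_def C.nhds_ob_def D.nhds_ob_def)
  {
    fix c assume c: "c \<in> C.arrs"
    have "Q \<in> h.map_filter (C.nhds_arr c) \<longleftrightarrow> (\<exists>s\<in>on_arr f c. Q = D.nhds_arr s)" for Q
    proof
      assume "Q \<in> h.map_filter (C.nhds_arr c)"
      then have Q: "nat_filter D.SM Q" "?h ` Q \<subseteq> C.nhds_arr c" "fdom D.SM Q = D.nhds_ob (on_ob f (dm C c))"
        using pre[of "dm C c"] c C.fdom_nhds_arr[OF c] by (auto simp: h.map_filter_def)
      then obtain s where s: "s \<in> D.arrs" "Q = D.nhds_arr s" using D.nat_filter_is_nhds[OF D] by blast
      have "D.nhds_ob (dm D s) = D.nhds_ob (on_ob f (dm C c))" using D.fdom_nhds_arr[OF s(1)] s(2) Q(3) by simp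
      then have "dm D s = on_ob f (dm C c)"
        using D.proj_filter_is_nhds[OF D D.proj_filter_nhds[OF D.dm_in[OF s(1)]]] D.dm_in[OF s(1)]
          on_ob_in[OF C.dm_in[OF c]] by metis
      then obtain t where t: "t \<in> C.arrs" "dm C t = dm C c" "s \<in> on_arr f t"
        using lift_arr_dm[OF C.dm_in[OF c] s(1)] by blast
      obtain A where A: "A \<in> bisections D" "s \<in> A" using D.ex_nhds_arr[OF s(1)] by blast
      then have "A \<in> Q" using s(2) by (simp add: D.nhds_arr_def)
      then have "c \<in> pull A" using Q(2) section_pullback_eq[OF A(1)] by (auto simp: C.nhds_arr_def)
      moreover have "t \<in> pull A" using mem_pull t A by blast
      ultimately have "t = c" using C.bisection_dm[OF pull_bisection[OF A(1)]] t(2) by blast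
      then show "\<exists>s\<in>on_arr f c. Q = D.nhds_arr s" using t(3) s(2) by blast
    next
      assume "\<exists>s\<in>on_arr f c. Q = D.nhds_arr s"
      then obtain s where s: "s \<in> on_arr f c" "Q = D.nhds_arr s" by blast
      have sa: "s \<in> D.arrs" using on_arr_in[OF c s(1)] .
      have "?h A \<in> C.nhds_arr c" if "A \<in> Q" for A
      proof -
        have A: "A \<in> bisections D" "s \<in> A" using that s(2) by (auto simp: D.nhds_arr_def)
        then show ?thesis
          using section_pullback_eq[OF A(1)] pull_bisection[OF A(1)] mem_pull c s(1) by (auto simp: C.nhds_arr_def)
      qed
      then show "Q \<in> h.map_filter (C.nhds_arr c)"
        using D.nat_filter_nhds[OF sa] s(2) D.fdom_nhds_arr[OF sa] D.fcod_nhds_arr[OF sa]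
          C.fdom_nhds_arr[OF c] C.fcod_nhds_arr[OF c] pre[of "dm C c"] pre[of "cd C c"] c
          on_arr_dm[OF c s(1)] on_arr_cd[OF c s(1)]
        by (auto simp: h.map_filter_def)
    qed
    then have "h.map_filter (C.nhds_arr c) = (\<Union>s\<in>on_arr f c. {D.nhds_arr s})" by auto
    moreover have "(\<Union>s\<in>on_arr f c. on_arr (etale_unit D) s) = (\<Union>s\<in>on_arr f c. {D.nhds_arr s})"
      using on_arr_in[OF c] by (intro SUP_cong) (auto simp: D.etale_unit_eq fun_relmap_def)
    ultimately show "on_arr (rel_comp C (filter_map D.SM C.SM ?h) (etale_unit C)) c =
        on_arr (rel_comp C (etale_unit D) f) c"
      using c h.on_arr_filter_map[OF C.nat_filter_nhds[OF c]]
      by (simp add: on_rel_comp C.etale_unit_eq fun_relmap_def)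
  }
  {
    fix x assume x: "x \<in> C.obs"
    show "on_ob (rel_comp C (filter_map D.SM C.SM ?h) (etale_unit C)) x = on_ob (rel_comp C (etale_unit D) f) x"
      using x pre[OF x] h.on_ob_filter_map[OF C.proj_filter_nhds[OF x]]
      by (simp add: on_rel_comp C.etale_unit_eq D.etale_unit_eq fun_relmap_def)
  }
qed

section \<open>The unit of a complete restriction monoid\<close>

lemma rmonoid_unit_eq: "s \<in> carrier S \<Longrightarrow> rmonoid_unit S s = pts (nat_order S) s"
  by (simp add: rmonoid_unit_def pts_def)

context complete_rmon
begin

interpretation FC: etale "filter_category S"
  by unfold_locales (rule etale_filter_category)

lemma pts_bisection: "pts (nat_order S) s \<in> bisections (filter_category S)"
proof -
  have "inj_on (fdom S) (pts (nat_order S) s)" using filter_eqI by (auto simp: inj_on_def pts_def)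
  moreover have "inj_on (fcod S) (pts (nat_order S) s)" using filter_eqI_cod by (auto simp: inj_on_def pts_def)
  ultimately show ?thesis by (simp add: bisections_def openin_pts)
qed

lemma pts_mult:
  assumes ab: "a \<in> carrier S" "b \<in> carrier S"
  shows "pts (nat_order S) (a \<otimes> b) = FC.smult (pts (nat_order S) a) (pts (nat_order S) b)"
proof
  show "pts (nat_order S) (a \<otimes> b) \<subseteq> FC.smult (pts (nat_order S) a) (pts (nat_order S) b)"
  proof
    fix R assume "R \<in> pts (nat_order S) (a \<otimes> b)"
    then have R: "nat_filter S R" "a \<otimes> b \<in> R" by (auto simp: pts_def)
    obtain P Q where "P \<in> pts (nat_order S) a" "Q \<in> pts (nat_order S) b" "fdom S P = fcod S Q" "R = fmult S P Q"
      using fmult_factor[OF R ab] unfolding pts_def by blast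
    then have "\<exists>P\<in>pts (nat_order S) a. \<exists>Q\<in>pts (nat_order S) b. fdom S P = fcod S Q \<and> R = fmult S P Q"
      by blast
    then show "R \<in> FC.smult (pts (nat_order S) a) (pts (nat_order S) b)" by (simp add: FC.mem_smult)
  qed
  show "FC.smult (pts (nat_order S) a) (pts (nat_order S) b) \<subseteq> pts (nat_order S) (a \<otimes> b)"
    using fmult_filter(1) mult_mem_fmult by (auto simp: FC.smult_def pts_def)
qed

lemma pts_lam:
  assumes s: "s \<in> carrier S"
  shows "pts (nat_order S) (lam S s) = up_closure (nat_order S) ` fdom S ` pts (nat_order S) s"
    and "pts (nat_order S) (rho S s) = up_closure (nat_order S) ` fcod S ` pts (nat_order S) s"
  using image_fdom_pts[OF s] complete_rmon.image_fdom_pts[OF complete_rmon_opp, of s] unit_image_pts[of "lam S s"]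
    unit_image_pts[of "rho S s"] s by simp_all

text \<open>A bisection of the filter category is the join of the basic open sets that it contains;
  these are compatible because they are restrictions of the same bisection.\<close>

lemma rmon_iso_unit:
  assumes ep: "enough_points (proj_order S)"
  shows "rmon_iso S (section_monoid (filter_category S)) (rmonoid_unit S)"
proof
  interpret rep: representation "nat_order S" "point_space (nat_order S)" "pts (nat_order S)"
    by (rule representation_nat_order[OF ep])
  let ?X = "pts (nat_order S)"
  have inj: "a = b" if "a \<in> carrier S" "b \<in> carrier S" "?X a = ?X b" for a b
    using rep.rep_inj[of a b] that by simp
  have onto: "\<exists>s\<in>carrier S. ?X s = A" if A: "A \<in> bisections (filter_category S)" for A
  proof -
    define M where "M = {s \<in> carrier S. ?X s \<subseteq> A}"
    have M: "M \<subseteq> carrier S" by (auto simp: M_def)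
    have "compatible S M"
      unfolding compatible_def
    proof (intro ballI)
      fix a b assume "a \<in> M" "b \<in> M"
      then have ab: "a \<in> carrier S" "b \<in> carrier S" "?X a \<subseteq> A" "?X b \<subseteq> A" by (auto simp: M_def)
      note bis = pts_bisection[of a] pts_bisection[of b]
      have d: "{P \<in> ?X s. fdom S P \<in> fdom S ` ?X t} = ?X s \<inter> ?X t"
        and c: "{P \<in> ?X s. fcod S P \<in> fcod S ` ?X t} = ?X s \<inter> ?X t"
        if "?X s \<subseteq> A" "?X t \<subseteq> A" for s t
      proof -
        have "P \<in> ?X t" if P: "P \<in> ?X s" "fdom S P \<in> fdom S ` ?X t \<or> fcod S P \<in> fcod S ` ?X t" for P
        proof -
          obtain Q where Q: "Q \<in> ?X t" "fdom S P = fdom S Q \<or> fcod S P = fcod S Q" using P(2) by blast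
          then have "P = Q" using FC.bisection_dm[OF A, of P Q] FC.bisection_cd[OF A, of P Q] P(1)
            \<open>?X s \<subseteq> A\<close> \<open>?X t \<subseteq> A\<close> by auto
          then show ?thesis using Q by simp
        qed
        then show "{P \<in> ?X s. fdom S P \<in> fdom S ` ?X t} = ?X s \<inter> ?X t"
          and "{P \<in> ?X s. fcod S P \<in> fcod S ` ?X t} = ?X s \<inter> ?X t" by blast+
      qed
      have "?X (a \<otimes> lam S b) = ?X (b \<otimes> lam S a)"
        using FC.smult_lam(1)[OF bis] FC.smult_lam(1)[OF bis(2,1)] d[OF ab(3,4)] d[OF ab(4,3)] ab(1,2)
        by (simp add: pts_mult pts_lam Int_commute)
      then have 1: "a \<otimes> lam S b = b \<otimes> lam S a" using inj ab(1,2) by simp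
      have "?X (rho S b \<otimes> a) = ?X (rho S a \<otimes> b)"
        using FC.smult_lam(4)[OF bis] FC.smult_lam(4)[OF bis(2,1)] c[OF ab(3,4)] c[OF ab(4,3)] ab(1,2)
        by (simp add: pts_mult pts_lam Int_commute)
      then have 2: "rho S b \<otimes> a = rho S a \<otimes> b" using inj ab(1,2) by simp
      show "a \<otimes> lam S b = b \<otimes> lam S a \<and> rho S b \<otimes> a = rho S a \<otimes> b" using 1 2 by blast
    qed
    then obtain x where x: "is_lub (nat_order S) x M" using ex_lub[OF M] by blast
    then have xc: "x \<in> carrier S" using nat_lub_iff[OF M] by blast
    have "?X x = \<Union>(?X ` M)" using rep.is_lub_iff_Union[of M x] M x xc by simp
    also have "\<dots> = A"
    proof
      show "A \<subseteq> \<Union>(?X ` M)"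
      proof
        fix P assume "P \<in> A"
        then obtain a where "a \<in> carrier S" "P \<in> ?X a" "?X a \<subseteq> A"
          using rep.basis[of A P] FC.bisection_open[OF A] by auto
        then show "P \<in> \<Union>(?X ` M)" by (auto simp: M_def)
      qed
    qed (auto simp: M_def)
    finally show ?thesis using xc by blast
  qed
  show "bij_betw (rmonoid_unit S) (carrier S) (carrier FC.SM)"
    unfolding bij_betw_def
  proof
    show "inj_on (rmonoid_unit S) (carrier S)" using inj by (auto simp: inj_on_def rmonoid_unit_eq)
    show "rmonoid_unit S ` carrier S = carrier FC.SM"
    proof
      show "rmonoid_unit S ` carrier S \<subseteq> carrier FC.SM" using pts_bisection by (auto simp: rmonoid_unit_eq)
      show "carrier FC.SM \<subseteq> rmonoid_unit S ` carrier S"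
      proof
        fix A assume "A \<in> carrier FC.SM"
        then obtain s where "s \<in> carrier S" "?X s = A" using onto by auto
        then show "A \<in> rmonoid_unit S ` carrier S" using rmonoid_unit_eq by (metis imageI)
      qed
    qed
  qed
  show "rmonoid_unit S \<in> extensional (carrier S)" by (simp add: rmonoid_unit_def)
  show "rmonoid_unit S (a \<otimes> b) = rmonoid_unit S a \<otimes>\<^bsub>FC.SM\<^esub> rmonoid_unit S b"
    if "a \<in> carrier S" "b \<in> carrier S" for a b using that by (simp add: rmonoid_unit_eq pts_mult)
  show "rmonoid_unit S (lam S a) = lam FC.SM (rmonoid_unit S a)" if "a \<in> carrier S" for a
    using that by (simp add: rmonoid_unit_eq pts_lam)
  show "rmonoid_unit S (rho S a) = rho FC.SM (rmonoid_unit S a)" if "a \<in> carrier S" for a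
    using that by (simp add: rmonoid_unit_eq pts_lam)
qed

end

lemma rmonoid_iso_unit:
  assumes "rmonoid_ob v S"
  shows "rmonoid_iso v k S (section_monoid (filter_category S)) (rmonoid_unit S)"
  by (rule rmon_iso.rmonoid_iso[OF complete_rmon.rmon_iso_unit[OF complete_rmon_of_ob[OF assms] rmonoid_ob_enough_points(2)[OF assms]]])

lemma (in restriction_hom) rmonoid_unit_natural:
  "rmonoid_comp S (section_pullback (filter_category T) (filter_category S) (filter_map S T h)) (rmonoid_unit S) =
    rmonoid_comp S (rmonoid_unit T) h"
proof (rule extensionalityI[of _ "carrier S"])
  fix s assume s: "s \<in> carrier S"
  have "section_pullback (filter_category T) (filter_category S) (filter_map S T h) (pts (nat_order S) s) =
      pts (nat_order T) (h s)"
    using S.pts_bisection[of s] filter_map_preimage[OF s] by (simp add: section_pullback_def topspace_point_space)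
  then show "rmonoid_comp S (section_pullback (filter_category T) (filter_category S) (filter_map S T h)) (rmonoid_unit S) s =
      rmonoid_comp S (rmonoid_unit T) h s"
    using s by (simp add: compose_def rmonoid_unit_eq)
qed (auto simp: compose_def)

section \<open>The duality\<close>

theorem theorem1p6:
  fixes k :: nat and v :: flavour
  assumes "k \<in> {1, 2, 3, 4}"
  shows
    \<comment> \<open>etale categories and their morphisms form a category\<close>
   "(\<forall>C :: ('a1, 'o1) topcat. etale_ob v C \<longrightarrow> etale_mor v k C C (rel_id C)) \<and>
    (\<forall>(C :: ('a1, 'o1) topcat) (D :: ('a2, 'o2) topcat) (B :: ('a3, 'o3) topcat) f g.
       etale_ob v C \<and> etale_ob v D \<and> etale_ob v B \<and> etale_mor v k C D f \<and> etale_mor v k D B g \<longrightarrow>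
       etale_mor v k C B (rel_comp C g f)) \<and>
    (\<forall>(C :: ('a1, 'o1) topcat) (D :: ('a2, 'o2) topcat) f.
       etale_ob v C \<and> etale_ob v D \<and> etale_mor v k C D f \<longrightarrow>
       rel_comp C f (rel_id C) = f \<and> rel_comp C (rel_id D) f = f) \<and>
    (\<forall>(C :: ('a1, 'o1) topcat) (D :: ('a2, 'o2) topcat) (B :: ('a3, 'o3) topcat)
        (A :: ('a4, 'o4) topcat) f g h.
       etale_ob v C \<and> etale_ob v D \<and> etale_ob v B \<and> etale_ob v A \<and>
       etale_mor v k C D f \<and> etale_mor v k D B g \<and> etale_mor v k B A h \<longrightarrow>
       rel_comp C h (rel_comp C g f) = rel_comp C (rel_comp D h g) f) \<and>
    \<comment> \<open>complete restriction monoids and their morphisms form a category\<close>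
    (\<forall>S :: 's1 rmonoid. rmonoid_ob v S \<longrightarrow> rmonoid_mor v k S S (rmonoid_id S)) \<and>
    (\<forall>(S :: 's1 rmonoid) (T :: 's2 rmonoid) (U :: 's3 rmonoid) f g.
       rmonoid_ob v S \<and> rmonoid_ob v T \<and> rmonoid_ob v U \<and>
       rmonoid_mor v k S T f \<and> rmonoid_mor v k T U g \<longrightarrow>
       rmonoid_mor v k S U (rmonoid_comp S g f)) \<and>
    (\<forall>(S :: 's1 rmonoid) (T :: 's2 rmonoid) f.
       rmonoid_ob v S \<and> rmonoid_ob v T \<and> rmonoid_mor v k S T f \<longrightarrow>
       rmonoid_comp S f (rmonoid_id S) = f \<and> rmonoid_comp S (rmonoid_id T) f = f) \<and>
    (\<forall>(S :: 's1 rmonoid) (T :: 's2 rmonoid) (U :: 's3 rmonoid) (V :: 's4 rmonoid) f g h.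
       rmonoid_ob v S \<and> rmonoid_ob v T \<and> rmonoid_ob v U \<and> rmonoid_ob v V \<and>
       rmonoid_mor v k S T f \<and> rmonoid_mor v k T U g \<and> rmonoid_mor v k U V h \<longrightarrow>
       rmonoid_comp S h (rmonoid_comp S g f) = rmonoid_comp S (rmonoid_comp T h g) f) \<and>
    \<comment> \<open>a contravariant functor from etale categories to monoids\<close>
    (\<forall>C :: ('a1, 'o1) topcat. etale_ob v C \<longrightarrow> rmonoid_ob v (section_monoid C)) \<and>
    (\<forall>(C :: ('a1, 'o1) topcat) (D :: ('a2, 'o2) topcat) f.
       etale_ob v C \<and> etale_ob v D \<and> etale_mor v k C D f \<longrightarrow>
       rmonoid_mor v k (section_monoid D) (section_monoid C) (section_pullback C D f)) \<and>
    (\<forall>C :: ('a1, 'o1) topcat. etale_ob v C \<longrightarrow>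
       section_pullback C C (rel_id C) = rmonoid_id (section_monoid C)) \<and>
    (\<forall>(C :: ('a1, 'o1) topcat) (D :: ('a2, 'o2) topcat) (B :: ('a3, 'o3) topcat) f g.
       etale_ob v C \<and> etale_ob v D \<and> etale_ob v B \<and> etale_mor v k C D f \<and> etale_mor v k D B g \<longrightarrow>
       section_pullback C B (rel_comp C g f) =
         rmonoid_comp (section_monoid B) (section_pullback C D f) (section_pullback D B g)) \<and>
    \<comment> \<open>a contravariant functor from monoids to etale categories\<close>
    (\<forall>S :: 's1 rmonoid. rmonoid_ob v S \<longrightarrow> etale_ob v (filter_category S)) \<and>
    (\<forall>(S :: 's1 rmonoid) (T :: 's2 rmonoid) f.
       rmonoid_ob v S \<and> rmonoid_ob v T \<and> rmonoid_mor v k S T f \<longrightarrow>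
       etale_mor v k (filter_category T) (filter_category S) (filter_map S T f)) \<and>
    (\<forall>S :: 's1 rmonoid. rmonoid_ob v S \<longrightarrow>
       filter_map S S (rmonoid_id S) = rel_id (filter_category S)) \<and>
    (\<forall>(S :: 's1 rmonoid) (T :: 's2 rmonoid) (U :: 's3 rmonoid) f g.
       rmonoid_ob v S \<and> rmonoid_ob v T \<and> rmonoid_ob v U \<and>
       rmonoid_mor v k S T f \<and> rmonoid_mor v k T U g \<longrightarrow>
       filter_map S U (rmonoid_comp S g f) =
         rel_comp (filter_category U) (filter_map S T f) (filter_map T U g)) \<and>
    \<comment> \<open>a natural isomorphism from the identity of etale categories to the composite\<close>
    (\<forall>C :: ('a1, 'o1) topcat. etale_ob v C \<longrightarrow>
       etale_iso v k C (filter_category (section_monoid C)) (etale_unit C)) \<and>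
    (\<forall>(C :: ('a1, 'o1) topcat) (D :: ('a2, 'o2) topcat) f.
       etale_ob v C \<and> etale_ob v D \<and> etale_mor v k C D f \<longrightarrow>
       rel_comp C (filter_map (section_monoid D) (section_monoid C) (section_pullback C D f))
         (etale_unit C) = rel_comp C (etale_unit D) f) \<and>
    \<comment> \<open>a natural isomorphism from the identity of monoids to the composite\<close>
    (\<forall>S :: 's1 rmonoid. rmonoid_ob v S \<longrightarrow>
       rmonoid_iso v k S (section_monoid (filter_category S)) (rmonoid_unit S)) \<and>
    (\<forall>(S :: 's1 rmonoid) (T :: 's2 rmonoid) f.
       rmonoid_ob v S \<and> rmonoid_ob v T \<and> rmonoid_mor v k S T f \<longrightarrow>
       rmonoid_comp S (section_pullback (filter_category T) (filter_category S) (filter_map S T f))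
         (rmonoid_unit S) = rmonoid_comp S (rmonoid_unit T) f)"
proof (intro conjI allI impI; (elim conjE)?)
  note cov = coveringI and hom = restriction_hom_of_mor
  fix C :: "('a1, 'o1) topcat"
  assume C: "etale_ob v C"
  show "etale_mor v k C C (rel_id C)" by (rule etale_mor_rel_id[OF C])
  show "rmonoid_ob v (section_monoid C)" by (rule etale.rmonoid_ob_section_monoid[OF etaleI[OF C] C])
  show "section_pullback C C (rel_id C) = rmonoid_id (section_monoid C)" by (rule section_pullback_id)
  show "etale_iso v k C (filter_category (section_monoid C)) (etale_unit C)" by (rule etale_iso_unit[OF C])
next
  fix C :: "('a1, 'o1) topcat" and D :: "('a2, 'o2) topcat" and f
  assume CD: "etale_ob v C" "etale_ob v D" "etale_mor v k C D f"
  interpret covering C D f by (rule coveringI[OF CD])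
  show "rel_comp C f (rel_id C) = f" "rel_comp C (rel_id D) f = f" by (rule rel_comp_id)+
  show "rmonoid_mor v k (section_monoid D) (section_monoid C) (section_pullback C D f)"
    by (rule rmonoid_mor_pullback[OF CD(3)])
  show "rel_comp C (filter_map (section_monoid D) (section_monoid C) (section_pullback C D f)) (etale_unit C) =
    rel_comp C (etale_unit D) f" by (rule etale_unit_natural[OF CD])
next
  fix C :: "('a1, 'o1) topcat" and D :: "('a2, 'o2) topcat" and B :: "('a3, 'o3) topcat" and f g
  assume ob: "etale_ob v C" "etale_ob v D" "etale_ob v B"
    and mor: "etale_mor v k C D f" "etale_mor v k D B g"
  show "etale_mor v k C B (rel_comp C g f)" by (rule etale_mor_comp[OF ob mor])
  show "section_pullback C B (rel_comp C g f) =
      rmonoid_comp (section_monoid B) (section_pullback C D f) (section_pullback D B g)"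
    by (rule section_pullback_comp[OF coveringI[OF ob(1,2) mor(1)] coveringI[OF ob(2,3) mor(2)]])
next
  fix C :: "('a1, 'o1) topcat" and D :: "('a2, 'o2) topcat" and B :: "('a3, 'o3) topcat"
    and A :: "('a4, 'o4) topcat" and f g h
  assume "etale_ob v C" "etale_ob v D" "etale_mor v k C D f"
  then show "rel_comp C h (rel_comp C g f) = rel_comp C (rel_comp D h g) f"
    by (intro rel_comp_assoc coveringI)
next
  fix S :: "'s1 rmonoid"
  assume S: "rmonoid_ob v S"
  interpret complete_rmon S by (rule complete_rmon_of_ob[OF S])
  show id: "rmonoid_mor v k S S (rmonoid_id S)" by (rule rmonoid_mor_id[OF S])
  show "etale_ob v (filter_category S)" by (rule etale_ob_filter_category[OF S])
  show "filter_map S S (rmonoid_id S) = rel_id (filter_category S)"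
    using id by (intro filter_map_id) (simp add: rmonoid_mor_def)
  show "rmonoid_iso v k S (section_monoid (filter_category S)) (rmonoid_unit S)"
    by (rule rmonoid_iso_unit[OF S])
next
  fix S :: "'s1 rmonoid" and T :: "'s2 rmonoid" and f
  assume ST: "rmonoid_ob v S" "rmonoid_ob v T" "rmonoid_mor v k S T f"
  interpret restriction_hom S T f by (rule restriction_hom_of_mor[OF ST])
  show "rmonoid_comp S f (rmonoid_id S) = f" "rmonoid_comp S (rmonoid_id T) f = f" by (rule comp_id)+
  show "etale_mor v k (filter_category T) (filter_category S) (filter_map S T f)"
    by (rule etale_mor_filter_map[OF ST])
  show "rmonoid_comp S (section_pullback (filter_category T) (filter_category S) (filter_map S T f))
      (rmonoid_unit S) = rmonoid_comp S (rmonoid_unit T) f"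
    by (rule rmonoid_unit_natural)
next
  fix S :: "'s1 rmonoid" and T :: "'s2 rmonoid" and U :: "'s3 rmonoid" and f g
  assume ob: "rmonoid_ob v S" "rmonoid_ob v T" "rmonoid_ob v U"
    and mor: "rmonoid_mor v k S T f" "rmonoid_mor v k T U g"
  have fg: "restriction_hom S T f" "restriction_hom T U g" using restriction_hom_of_mor ob mor by blast+
  show "rmonoid_mor v k S U (rmonoid_comp S g f)" by (rule rmonoid_mor_comp[OF ob mor])
  show "filter_map S U (rmonoid_comp S g f) =
      rel_comp (filter_category U) (filter_map S T f) (filter_map T U g)"
    by (rule filter_map_comp[OF fg rmonoid_hom_comp[OF fg]])
next
  fix S :: "'s1 rmonoid" and T :: "'s2 rmonoid" and U :: "'s3 rmonoid" and V :: "'s4 rmonoid" and f g h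
  assume "rmonoid_ob v S" "rmonoid_ob v T" "rmonoid_mor v k S T f"
  then interpret restriction_hom S T f by (rule restriction_hom_of_mor)
  show "rmonoid_comp S h (rmonoid_comp S g f) = rmonoid_comp S (rmonoid_comp T h g) f"
    by (auto simp: compose_def fun_eq_iff)
qed

end
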